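(* Let $\tau\geq1$ and let $T=(t_0,t_1,\ldots,t_\tau)$ be a list of steps with $0\le t_0<t_1<\dots<t_\tau=N$, and set $\widetilde T=T_1=(t_1,\ldots,t_\tau)$. Let $D\subseteq\mathbb{R}_{0,t_0}\times\mathbb{R}^\tau$ be as in the context and assume $\Omega_D$ is a domain. Assume $t_1-t_0$ is an odd natural number $2n_1+1$. Then for every strongly $T$-regular function $f\in\mathcal{SR}_T(\Omega_D,A)$, the function $\Delta_{\widetilde T}^{n_1}f$ (called the first Fueter transform of $f$) is strongly $\widetilde T$-regular and is still a $T$-function; in symbols, $\Delta_{\widetilde T}^{n_1}f\in\mathcal{SR}_{\widetilde T}(\Omega_D,A)\cap\mathcal{S}_T^\omega(\Omega_D,A)$.
   Context: Setting. $A$ is a finite-dimensional associative real algebra with unit $1$ and a $*$-involution $x\mapsto x^c$ (an involutive real-linear antiautomorphism). Let $\mathbb S_A=\{x\in A: x+x^c=0,\ xx^c=1\}$, assumed nonempty. $V\subseteq A$ is a real subspace with a hypercomplex basis $\mathcal B=(v_0,\dots,v_N)$, $N\ge1$: $v_0=1$, $v_s\in\mathbb S_A$ for $s\geq1$, $v_sv_t=-v_tv_s$ for distinct $s,t\ge1$, and $V\subseteq\bigcup_{J\in\mathbb S_A}(\mathbb R+J\mathbb R)$. Complete $\mathcal B$ to a real basis of $A$ and give $A$ the Euclidean norm $\|\cdot\|$ making that basis orthonormal; write $x=\sum_{s=0}^Nx_sv_s$ for $x\in V$. For $0\le\ell<m\le N$, $\mathbb R_{\ell,m}=\mathrm{Span}_{\mathbb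 R}(v_\ell,\dots,v_m)$ and $\mathbb S_{\ell,m}$ is its unit sphere. A list of steps $T=(t_0,\dots,t_\tau)$ ($\tau\in\mathbb N$, $0\le t_0<\dots<t_\tau=N$) has torus $\mathbb T=\mathbb S_{t_0+1,t_1}\times\cdots\times\mathbb S_{t_{\tau-1}+1,t_\tau}$. Each $x\in V$ decomposes uniquely as $x=x^0+\dots+x^\tau$ with $x^h=\sum_{s=t_{h-1}+1}^{t_h}x_sv_s$ ($t_{-1}=-1$). For $J=(J_1,\dots,J_\tau)\in\mathbb T$ and $\beta\in\mathbb R^\tau$, $\beta J=\sum_h\beta_hJ_h$; $\mathscr P(\tau)$ is the power set of $\{1,\dots,\tau\}$; $J_\emptyset=1$, $J_K=J_{k_1}\cdots J_{k_p}$ for $K=\{k_1<\dots<k_p\}$; $\overline\beta^h$ is $\beta$ with $\beta_h$ replaced by $-\beta_h$. $T$-functions. $D\subseteq\mathbb R_{0,t_0}\times\mathbb R^\tau$ is open and invariant under $(\alpha,\beta)\mapsto(\alpha,\overline\beta^h)$ for each $h$, and $\Omega_D=\{\alpha+\beta J:(\alpha,\beta)\in D,J\in\mathbb T\}$ is open in $V$. A $T$-stem function is $F=\sum_{K\in\mathscr P(\tau)}E_KF_K:D\to A\otimes\mathbb R^{2^\tau}$ ($E_K$ the canonical basis of $\mathbb R^{2^\tau}$, $F_K:D\to A$) with $F_K(\alpha,\overline\beta^h)=F_K(\alpha,\beta)$ if $h\notin K$ and $=-F_K(\alpha,\beta)$ if $h\in K$. It induces $\mathcal I(F):\Omega_D\to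 A$, $\mathcal I(F)(\alpha+\beta J)=\sum_KJ_KF_K(\alpha,\beta)$; $\mathcal I$ is a well-defined injective right $A$-linear map onto the class $\mathcal S_T(\Omega_D,A)$ of $T$-functions. For $p\in\mathbb N\cup\{\infty,\omega\}$ ($\omega$ = real analytic), $\mathcal S^p_T(\Omega_D,A)$ is the set of $\mathcal I(F)$ with all $F_K\in C^p(D,A)$. Regularity. For $J\in\mathbb T$ let $\mathbb R_J=\mathrm{Span}(v_0,\dots,v_{t_0},J_1,\dots,J_\tau)$; for $\phi$ of class $C^1$ on an open subset of $\mathbb R_J$, $\partial_s\phi$ ($0\le s\le t_0$), $\partial_{t_0+u}\phi$ ($1\le u\le\tau$) are the directional derivatives along $v_s$, $J_u$, and $\overline\partial_J\phi=\sum_{s=0}^{t_0}v_s\partial_s\phi+\sum_{u=1}^\tau J_u\partial_{t_0+u}\phi$. A function $f$ on a domain $\Omega\subseteq V$ is $T$-regular if $\overline\partial_J(f|_{\Omega\cap\mathbb R_J})\equiv0$ for all $J\in\mathbb T$. If $\Omega_D$ is a domain, $\mathcal{SR}_T(\Omega_D,A)$ (strongly $T$-regular functions) is the set of $T$-functions on $\Omega_D$ that are $T$-regular; these are real analytic. Laplacian. Writing $\alpha=\sum_{s=0}^{t_0}x_sv_s$, let $\partial_{\alpha_s}$, $\partial_{\beta_h}$ denote partial derivatives of functions on $D$ with respect to $x_s$, $\beta_h$. For a $T$-stem function $F$ of class $C^2$, $\Delta_TF$ is the $T$-stem function with $(\Delta_TF)_K=\sum_{s=0}^{t_0}\partial_{\alpha_s}^2F_K+\sum_{h=1}^\tau\partial_{\beta_h}^2F_K$,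 and $\Delta_T\mathcal I(F):=\mathcal I(\Delta_TF)$. The same definitions apply to any list of steps $T'$ in place of $T$. Sub-lists. $\widetilde T=(t_1,\dots,t_\tau)$ is a list of steps (torus $\mathbb S_{t_1+1,t_2}\times\cdots$, mirror $\mathbb R_{0,t_1}$), and $\Omega_D=\Omega_{\widetilde D}$ for $\widetilde T$, with $\widetilde D=\{(\alpha+x^1,\beta_2,\dots,\beta_\tau):x^1\in\mathbb R_{t_0+1,t_1},(\alpha,\|x^1\|,\beta_2,\dots,\beta_\tau)\in D\}$. Every element of $\mathcal S^p_T(\Omega_D,A)$, $p\in\{\infty,\omega\}$, is also an element of $\mathcal S^p_{\widetilde T}(\Omega_D,A)$, and $\Delta_{\widetilde T}$ is applied to it in that sense. *)

theory Defs
  imports "HOL-Analysis.Analysis"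
begin

text \<open>Points of the coordinate space R^n are represented as functions nat => real
vanishing from index n on; topology = (restricted) product topology, which on
this finite-dimensional subspace is the Euclidean one.\<close>

definition Ecoord :: "nat \<Rightarrow> (nat \<Rightarrow> real) set" where
  "Ecoord n = {y. \<forall>i\<ge>n. y i = 0}"

definition pderiv_c :: "nat \<Rightarrow> ((nat \<Rightarrow> real) \<Rightarrow> 'a::real_normed_vector) \<Rightarrow> (nat \<Rightarrow> real) \<Rightarrow> 'a" where
  "pderiv_c i F y = vector_derivative (\<lambda>s. F (y(i := y i + s))) (at 0)"

fun Ck :: "nat \<Rightarrow> nat \<Rightarrow> (nat \<Rightarrow> real) set \<Rightarrow> ((nat \<Rightarrow> real) \<Rightarrow> 'a::real_normed_vector) \<Rightarrow> bool" where
  "Ck 0 n D F = continuous_on D F"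
| "Ck (Suc k) n D F =
     (continuous_on D F \<and>
      (\<forall>y\<in>D. \<forall>i<n. (\<lambda>s. F (y(i := y i + s))) differentiable (at 0)) \<and>
      (\<forall>i<n. Ck k n D (pderiv_c i F)))"

definition Cinf :: "nat \<Rightarrow> (nat \<Rightarrow> real) set \<Rightarrow> ((nat \<Rightarrow> real) \<Rightarrow> 'a::real_normed_vector) \<Rightarrow> bool" where
  "Cinf n D F = (\<forall>k. Ck k n D F)"

definition real_analytic_c :: "nat \<Rightarrow> (nat \<Rightarrow> real) set \<Rightarrow> ((nat \<Rightarrow> real) \<Rightarrow> 'a::{real_normed_vector,topological_comm_monoid_add}) \<Rightarrow> bool" where
  "real_analytic_c n D F =
     (\<forall>y\<in>D. \<exists>r>0. \<exists>c :: (nat \<Rightarrow> nat) \<Rightarrow> 'a.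
        \<forall>z\<in>Ecoord n. (\<forall>i<n. \<bar>z i - y i\<bar> < r) \<longrightarrow>
          z \<in> D \<and>
          ((\<lambda>m. (\<Prod>i<n. (z i - y i) ^ m i) *\<^sub>R c m) has_sum F z) {m. \<forall>i\<ge>n. m i = 0})"

definition SA :: "('a::real_algebra_1 \<Rightarrow> 'a) \<Rightarrow> 'a set" where
  "SA cj = {x. x + cj x = 0 \<and> x * cj x = 1}"

text \<open>Unit sphere of R_{l,m} = Span(v_l,...,v_m) (coordinates w.r.t. the orthonormal v's).\<close>
definition usph :: "(nat \<Rightarrow> 'a::real_vector) \<Rightarrow> nat \<Rightarrow> nat \<Rightarrow> 'a set" where
  "usph v l m = {(\<Sum>s=l..m. c s *\<^sub>R v s) | c. (\<Sum>s=l..m. (c s)^2) = 1}"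

text \<open>A list of steps (t_0,...,t_tau) is encoded as t :: nat => nat together with tau.\<close>
definition steps :: "(nat \<Rightarrow> nat) \<Rightarrow> nat \<Rightarrow> nat \<Rightarrow> bool" where
  "steps t \<tau> N = (strict_mono_on {0..\<tau>} t \<and> t \<tau> = N)"

definition tshift :: "(nat \<Rightarrow> nat) \<Rightarrow> nat \<Rightarrow> nat" where
  "tshift t = (\<lambda>i. t (Suc i))"

definition torus :: "(nat \<Rightarrow> 'a::real_vector) \<Rightarrow> (nat \<Rightarrow> nat) \<Rightarrow> nat \<Rightarrow> (nat \<Rightarrow> 'a) set" where
  "torus v t \<tau> = {J. (\<forall>h\<in>{1..\<tau>}. J h \<in> usph v (t (h - 1) + 1) (t h)) \<and> (\<forall>h. h \<notin> {1..\<tau>} \<longrightarrow> J h = 0)}"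

text \<open>A point (alpha,beta) of D is encoded by coordinates y: alpha = sum_{s<=t_0} y_s v_s,
beta_h = y (t_0 + h).  pt gives alpha + beta J.\<close>
definition pt :: "(nat \<Rightarrow> 'a::real_vector) \<Rightarrow> (nat \<Rightarrow> nat) \<Rightarrow> nat \<Rightarrow> (nat \<Rightarrow> 'a) \<Rightarrow> (nat \<Rightarrow> real) \<Rightarrow> 'a" where
  "pt v t \<tau> J y = (\<Sum>s\<le>t 0. y s *\<^sub>R v s) + (\<Sum>h=1..\<tau>. y (t 0 + h) *\<^sub>R J h)"

definition Omega :: "(nat \<Rightarrow> 'a::real_vector) \<Rightarrow> (nat \<Rightarrow> nat) \<Rightarrow> nat \<Rightarrow> (nat \<Rightarrow> real) set \<Rightarrow> 'a set" where
  "Omega v t \<tau> D = {pt v t \<tau> J y | J y. y \<in> D \<and> J \<in> torus v t \<tau>}"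

definition Jprod :: "(nat \<Rightarrow> 'a::monoid_mult) \<Rightarrow> nat set \<Rightarrow> 'a" where
  "Jprod J K = foldr (\<lambda>k a. J k * a) (sorted_list_of_set K) 1"

definition flip :: "(nat \<Rightarrow> nat) \<Rightarrow> nat \<Rightarrow> (nat \<Rightarrow> real) \<Rightarrow> (nat \<Rightarrow> real)" where
  "flip t h y = y(t 0 + h := - y (t 0 + h))"

text \<open>T-stem function F = sum_K E_K F_K, encoded as F K y = F_K(alpha,beta).\<close>
definition stem :: "(nat \<Rightarrow> nat) \<Rightarrow> nat \<Rightarrow> (nat \<Rightarrow> real) set \<Rightarrow> (nat set \<Rightarrow> (nat \<Rightarrow> real) \<Rightarrow> 'a::ab_group_add) \<Rightarrow> bool" where
  "stem t \<tau> D F =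
     (\<forall>K. K \<subseteq> {1..\<tau>} \<longrightarrow> (\<forall>h\<in>{1..\<tau>}. \<forall>y\<in>D.
        F K (flip t h y) = (if h \<in> K then - F K y else F K y)))"

definition represents :: "(nat \<Rightarrow> 'a::real_algebra_1) \<Rightarrow> (nat \<Rightarrow> nat) \<Rightarrow> nat \<Rightarrow> (nat \<Rightarrow> real) set
     \<Rightarrow> ('a \<Rightarrow> 'a) \<Rightarrow> (nat set \<Rightarrow> (nat \<Rightarrow> real) \<Rightarrow> 'a) \<Rightarrow> bool" where
  "represents v t \<tau> D f F =
     (\<forall>y\<in>D. \<forall>J\<in>torus v t \<tau>. f (pt v t \<tau> J y) = (\<Sum>K\<in>Pow {1..\<tau>}. Jprod J K * F K y))"

definition Tfun :: "(nat \<Rightarrow> 'a::real_algebra_1) \<Rightarrow> (nat \<Rightarrow> nat) \<Rightarrow> nat \<Rightarrow> (nat \<Rightarrow> real) set \<Rightarrow> ('a \<Rightarrow> 'a) \<Rightarrow> bool" where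
  "Tfun v t \<tau> D f = (\<exists>F. stem t \<tau> D F \<and> represents v t \<tau> D f F)"

definition Tfun_inf :: "(nat \<Rightarrow> 'a::{real_algebra_1,real_normed_vector}) \<Rightarrow> (nat \<Rightarrow> nat) \<Rightarrow> nat \<Rightarrow> (nat \<Rightarrow> real) set \<Rightarrow> ('a \<Rightarrow> 'a) \<Rightarrow> bool" where
  "Tfun_inf v t \<tau> D f = (\<exists>F. stem t \<tau> D F \<and> represents v t \<tau> D f F \<and>
      (\<forall>K. K \<subseteq> {1..\<tau>} \<longrightarrow> Cinf (t 0 + 1 + \<tau>) D (F K)))"

definition Tfun_omega :: "(nat \<Rightarrow> 'a::{real_algebra_1,real_normed_vector}) \<Rightarrow> (nat \<Rightarrow> nat) \<Rightarrow> nat \<Rightarrow> (nat \<Rightarrow> real) set \<Rightarrow> ('a \<Rightarrow> 'a) \<Rightarrow> bool" where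
  "Tfun_omega v t \<tau> D f = (\<exists>F. stem t \<tau> D F \<and> represents v t \<tau> D f F \<and>
      (\<forall>K. K \<subseteq> {1..\<tau>} \<longrightarrow> real_analytic_c (t 0 + 1 + \<tau>) D (F K)))"

text \<open>T-regularity on Omega: for each J, the restriction to Omega cap R_J (parametrised
linearly by pt v t tau J) is C^1 and annihilated by the Cauchy-Riemann-Fueter operator.\<close>
definition Tregular :: "(nat \<Rightarrow> 'a::{real_algebra_1,real_normed_vector}) \<Rightarrow> (nat \<Rightarrow> nat) \<Rightarrow> nat \<Rightarrow> 'a set \<Rightarrow> ('a \<Rightarrow> 'a) \<Rightarrow> bool" where
  "Tregular v t \<tau> \<Omega> f =
     (\<forall>J\<in>torus v t \<tau>.
        Ck 1 (t 0 + 1 + \<tau>) {c \<in> Ecoord (t 0 + 1 + \<tau>). pt v t \<tau> J c \<in> \<Omega>} (f \<circ> pt v t \<tau> J) \<and>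
        (\<forall>c \<in> {c \<in> Ecoord (t 0 + 1 + \<tau>). pt v t \<tau> J c \<in> \<Omega>}.
           (\<Sum>s\<le>t 0. v s * pderiv_c s (f \<circ> pt v t \<tau> J) c)
         + (\<Sum>u=1..\<tau>. J u * pderiv_c (t 0 + u) (f \<circ> pt v t \<tau> J) c) = 0))"

definition SR :: "(nat \<Rightarrow> 'a::{real_algebra_1,real_normed_vector}) \<Rightarrow> (nat \<Rightarrow> nat) \<Rightarrow> nat \<Rightarrow> (nat \<Rightarrow> real) set \<Rightarrow> ('a \<Rightarrow> 'a) \<Rightarrow> bool" where
  "SR v t \<tau> D f = (Tfun v t \<tau> D f \<and> Tregular v t \<tau> (Omega v t \<tau> D) f)"

definition lap_stem :: "nat \<Rightarrow> (nat set \<Rightarrow> (nat \<Rightarrow> real) \<Rightarrow> 'a::real_normed_vector) \<Rightarrow> nat set \<Rightarrow> (nat \<Rightarrow> real) \<Rightarrow> 'a" where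
  "lap_stem n G K y = (\<Sum>i<n. pderiv_c i (pderiv_c i (G K)) y)"

text \<open>Delta_T f := I(Delta_T G) where f = I(G), G a C^infinity T-stem function
(well defined by injectivity of I); values off Omega_D are set to 0.\<close>
definition lapT :: "(nat \<Rightarrow> 'a::{real_algebra_1,real_normed_vector}) \<Rightarrow> (nat \<Rightarrow> nat) \<Rightarrow> nat \<Rightarrow> (nat \<Rightarrow> real) set \<Rightarrow> ('a \<Rightarrow> 'a) \<Rightarrow> ('a \<Rightarrow> 'a)" where
  "lapT v t \<tau> D f =
     (THE g. (\<forall>x. x \<notin> Omega v t \<tau> D \<longrightarrow> g x = 0) \<and>
        (\<exists>G. stem t \<tau> D G \<and> (\<forall>K. K \<subseteq> {1..\<tau>} \<longrightarrow> Cinf (t 0 + 1 + \<tau>) D (G K)) \<and>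
             represents v t \<tau> D f G \<and>
             represents v t \<tau> D g (lap_stem (t 0 + 1 + \<tau>) G)))"

text \<open>The domain D~ for the sub-list T~ = (t_1,...,t_tau), in coordinates:
y' s (s <= t_1) are the coordinates of alpha + x^1, y' (t_1 + k) = beta_{k+1}.\<close>
definition Dtilde :: "(nat \<Rightarrow> nat) \<Rightarrow> nat \<Rightarrow> (nat \<Rightarrow> real) set \<Rightarrow> (nat \<Rightarrow> real) set" where
  "Dtilde t \<tau> D = {y'. y' \<in> Ecoord (t 1 + \<tau>) \<and>
      (\<lambda>i. if i \<le> t 0 then y' i
           else if i = t 0 + 1 then sqrt (\<Sum>s=t 0 + 1..t 1. (y' s)^2)
           else if i \<le> t 0 + \<tau> then y' (t 1 + (i - t 0 - 1))
           else 0) \<in> D}"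

end

theory Submission
  imports Defs
begin

text \<open>
  Restricted to a slice, a \<open>T\<close>-regular function is annihilated by a Dirac operator of a Clifford system, so a
  weighted mean value formula over balls makes it real analytic and harmonic; inverting the representation formula,
  so are the stem components \<open>F\<^sub>K\<close>.  Write \<open>r\<close> for the variable \<open>\<beta>\<^sub>1\<close>, with \<open>A\<close> for the components even in \<open>r\<close>
  and \<open>r B\<close> for the odd ones.  In terms of the shifted list of steps the function has the stem components
  \<open>A(|x\<^sup>1|) \<plusminus> x\<^sup>1 B(|x\<^sup>1|)\<close>, where \<open>x\<^sup>1\<close> runs over a space of odd dimension \<open>m = 2 n\<^sub>1 + 1\<close>.  With the operator
  \<open>L = r\<^sup>-\<^sup>1 \<partial>\<^sub>r\<close>, harmonicity of \<open>A\<close> and \<open>r B\<close> in one radial dimension shows that the Laplacian in \<open>m\<close> radial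
  dimensions sends the pair \<open>(L\<^sup>k A, L\<^sup>k B)\<close> to \<open>(m - 1 - 2 k)\<close> times \<open>(L\<^sup>k\<^sup>+\<^sup>1 A, L\<^sup>k\<^sup>+\<^sup>1 B)\<close>.  The first-order system
  satisfied by \<open>(L\<^sup>k A, L\<^sup>k B)\<close> is that of a regular function in \<open>2 k + 1\<close> radial dimensions, so it expresses
  regularity for the shifted list exactly when \<open>k = n\<^sub>1\<close>.
\<close>

section \<open>Clifford-regular functions are real analytic\<close>

text \<open>Regularity supplies only first derivatives, so the conjugate operator cannot be applied
  to the equation to get harmonicity. The mean value formula gets around this: its derivative in the
  radius is the trace of the matrix of moments of the gradient, and that matrix is symmetric, as a
  Hessian would be, because the weight has a radial gradient; the Clifford relations then kill the
  trace. The formula expresses the gradient through the function itself, and everything up to the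
  Taylor series follows. The number of variables is a term, not a type. Clifford elements are
  linearly independent, so the algebra itself can serve as the Euclidean space of integration. An
  identity between iterates of \<open>L\<close> is checked for \<open>k = 0\<close> and passes to
  all \<open>k\<close>, divisions by \<open>r\<close> being settled by continuity. Analyticity of
  the iterates is not attacked directly: the transform is regular for the shifted list, hence has
  analytic components there, and those for the original list are recovered by restricting
  \<open>x\<^sup>1\<close> to a line.\<close>

lemma has_vector_derivative_translate:
  fixes f :: "real \<Rightarrow> 'a::real_normed_vector"
  assumes "((\<lambda>s. f (s0 + s)) has_vector_derivative d) (at 0)"
  shows "(f has_vector_derivative d) (at s0)"
proof -
  have "((\<lambda>s. f (s0 + s)) \<circ> (\<lambda>s. s - s0) has_vector_derivative 1 *\<^sub>R d) (at s0)"
    by (rule vector_diff_chain_at) (use assms in \<open>auto intro!: derivative_eq_intros\<close>)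
  then show ?thesis by (simp add: o_def)
qed

lemma has_vector_derivative_line:
  fixes f :: "'b::real_normed_vector \<Rightarrow> 'a::real_normed_vector"
  assumes "((\<lambda>s. f ((x + s0 *\<^sub>R b) + s *\<^sub>R b)) has_vector_derivative d) (at 0)"
  shows "((\<lambda>s. f (x + s *\<^sub>R b)) has_vector_derivative d) (at s0)"
  by (rule has_vector_derivative_translate) (use assms in \<open>simp add: algebra_simps\<close>)

text \<open>The partial derivatives are an explicit argument \<open>g\<close>, because the later
  formulas are about the gradient, which is itself integrated and differentiated.\<close>

definition C1_on :: "'b::euclidean_space set \<Rightarrow> ('b \<Rightarrow> 'c::real_normed_vector) \<Rightarrow> ('b \<Rightarrow> 'b \<Rightarrow> 'c) \<Rightarrow> bool" where
  "C1_on U f g \<longleftrightarrow> (\<forall>b\<in>Basis. continuous_on U (g b) \<and>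
     (\<forall>x\<in>U. ((\<lambda>s. f (x + s *\<^sub>R b)) has_vector_derivative g b x) (at 0)))"

text \<open>The coordinates are changed one at a time: on each segment the mean value inequality
  applies to \<open>f\<close> minus its linear part, and the errors add up.\<close>

lemma C1_on_increment_bound:
  fixes f :: "'b::euclidean_space \<Rightarrow> 'c::real_normed_vector"
  assumes C1: "C1_on U f g" and ball: "ball x \<delta> \<subseteq> U"
    and close: "\<And>z b. z \<in> ball x \<delta> \<Longrightarrow> b \<in> Basis \<Longrightarrow> norm (g b z - g b x) \<le> \<epsilon>"
    and h: "(\<Sum>b\<in>Basis. \<bar>h \<bullet> b\<bar>) < \<delta>" and B: "B \<subseteq> Basis"
  shows "norm (f (x + (\<Sum>b\<in>B. (h \<bullet> b) *\<^sub>R b)) - f x - (\<Sum>b\<in>B. (h \<bullet> b) *\<^sub>R g b x)) \<le> \<epsilon> * (\<Sum>b\<in>B. \<bar>h \<bullet> b\<bar>)"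
proof -
  have "finite B" using B finite_Basis finite_subset by blast
  then show ?thesis using B
  proof (induction B rule: finite_induct)
    case empty
    then show ?case by simp
  next
    case (insert c B)
    define z0 where "z0 = x + (\<Sum>b\<in>B. (h \<bullet> b) *\<^sub>R b)"
    define S where "S = closed_segment 0 (h \<bullet> c)"
    have cB: "c \<in> Basis" "B \<subseteq> Basis" using insert.prems by auto
    have inball: "z0 + s *\<^sub>R c \<in> ball x \<delta>" if "s \<in> S" for s
    proof -
      have s: "\<bar>s\<bar> \<le> \<bar>h \<bullet> c\<bar>" using that unfolding S_def
        by (auto simp: closed_segment_eq_real_ivl split: if_splits)
      have "dist x (z0 + s *\<^sub>R c) = norm ((\<Sum>b\<in>B. (h \<bullet> b) *\<^sub>R b) + s *\<^sub>R c)"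
        using norm_minus_cancel[of "(\<Sum>b\<in>B. (h \<bullet> b) *\<^sub>R b) + s *\<^sub>R c"]
        by (simp add: z0_def dist_norm)
      also have "\<dots> \<le> norm (\<Sum>b\<in>B. (h \<bullet> b) *\<^sub>R b) + norm (s *\<^sub>R c)" by (rule norm_triangle_ineq)
      also have "norm (\<Sum>b\<in>B. (h \<bullet> b) *\<^sub>R b) \<le> (\<Sum>b\<in>B. \<bar>h \<bullet> b\<bar>)"
      proof (rule sum_norm_le)
        fix b assume "b \<in> B"
        then have "norm b = 1" using cB by auto
        then show "norm ((h \<bullet> b) *\<^sub>R b) \<le> \<bar>h \<bullet> b\<bar>" by simp
      qed
      also have "norm (s *\<^sub>R c) \<le> \<bar>h \<bullet> c\<bar>" using s cB by simp
      also have "(\<Sum>b\<in>B. \<bar>h \<bullet> b\<bar>) + \<bar>h \<bullet> c\<bar> = (\<Sum>b\<in>insert c B. \<bar>h \<bullet> b\<bar>)"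
        using insert.hyps by simp
      also have "\<dots> \<le> (\<Sum>b\<in>Basis. \<bar>h \<bullet> b\<bar>)" by (rule sum_mono2) (use insert.prems in auto)
      finally show ?thesis using h by simp
    qed
    have der: "((\<lambda>s. f (z0 + s *\<^sub>R c)) has_vector_derivative g c (z0 + s *\<^sub>R c)) (at s within S)" if "s \<in> S" for s
      by (rule has_vector_derivative_at_within, rule has_vector_derivative_line)
        (use C1 inball[OF that] ball cB in \<open>auto simp: C1_on_def\<close>)
    have "norm ((\<lambda>s. f (z0 + s *\<^sub>R c) - s *\<^sub>R g c x) (h \<bullet> c) - (\<lambda>s. f (z0 + s *\<^sub>R c) - s *\<^sub>R g c x) 0)
        \<le> \<epsilon> * norm (h \<bullet> c - 0)"
    proof (rule differentiable_bound[of S _ "\<lambda>s k. k *\<^sub>R (g c (z0 + s *\<^sub>R c) - g c x)"])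
      show "convex S" unfolding S_def by simp
      fix s assume s: "s \<in> S"
      show "((\<lambda>s. f (z0 + s *\<^sub>R c) - s *\<^sub>R g c x) has_derivative (\<lambda>k. k *\<^sub>R (g c (z0 + s *\<^sub>R c) - g c x))) (at s within S)"
        using der[OF s] unfolding has_vector_derivative_def
        by (auto intro!: derivative_eq_intros simp: scaleR_diff_right)
      show "onorm (\<lambda>k. k *\<^sub>R (g c (z0 + s *\<^sub>R c) - g c x)) \<le> \<epsilon>"
        by (rule onorm_le) (use close[OF inball[OF s] cB(1)] in \<open>simp add: mult.commute[of \<epsilon>] mult_left_mono\<close>)
    qed (auto simp: S_def)
    then have step: "norm (f (z0 + (h \<bullet> c) *\<^sub>R c) - f z0 - (h \<bullet> c) *\<^sub>R g c x) \<le> \<epsilon> * \<bar>h \<bullet> c\<bar>"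
      by (simp add: algebra_simps)
    have split: "f (x + (\<Sum>b\<in>insert c B. (h \<bullet> b) *\<^sub>R b)) - f x - (\<Sum>b\<in>insert c B. (h \<bullet> b) *\<^sub>R g b x)
       = (f z0 - f x - (\<Sum>b\<in>B. (h \<bullet> b) *\<^sub>R g b x)) + (f (z0 + (h \<bullet> c) *\<^sub>R c) - f z0 - (h \<bullet> c) *\<^sub>R g c x)"
      using insert.hyps by (simp add: z0_def algebra_simps)
    show ?case unfolding split
      using norm_triangle_le[OF add_mono[OF insert.IH[OF cB(2)] step]] insert.hyps
      by (simp add: z0_def algebra_simps)
  qed
qed

lemma C1_on_has_derivative:
  fixes f :: "'b::euclidean_space \<Rightarrow> 'c::real_normed_vector"
  assumes C1: "C1_on U f g" and U: "open U" "x \<in> U"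
  shows "(f has_derivative (\<lambda>h. \<Sum>b\<in>Basis. (h \<bullet> b) *\<^sub>R g b x)) (at x)"
  unfolding has_derivative_at_alt
proof (intro conjI allI impI)
  show "bounded_linear (\<lambda>h. \<Sum>b\<in>Basis. (h \<bullet> b) *\<^sub>R g b x)"
    by (intro bounded_linear_sum bounded_linear_scaleR_const bounded_linear_inner_left)
  fix e :: real assume e: "0 < e"
  define \<epsilon> where "\<epsilon> = e / DIM('b)"
  have \<epsilon>: "\<epsilon> > 0" using e by (simp add: \<epsilon>_def)
  have "\<forall>\<^sub>F z in at x. \<forall>b\<in>Basis. dist (g b z) (g b x) < \<epsilon>"
  proof (rule eventually_ball_finite, simp, intro ballI)
    fix b :: 'b assume "b \<in> Basis"
    then have "isCont (g b) x" using C1 U by (auto simp: C1_on_def continuous_on_eq_continuous_at)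
    then show "\<forall>\<^sub>F z in at x. dist (g b z) (g b x) < \<epsilon>"
      using \<epsilon> by (simp add: isCont_def tendsto_iff)
  qed
  then obtain d1 where d1: "d1 > 0" "\<And>z b. z \<noteq> x \<Longrightarrow> dist z x < d1 \<Longrightarrow> b \<in> Basis \<Longrightarrow> dist (g b z) (g b x) < \<epsilon>"
    by (auto simp: eventually_at)
  obtain d2 where d2: "d2 > 0" "ball x d2 \<subseteq> U" using U openE by blast
  define \<delta> where "\<delta> = min d1 d2"
  have \<delta>: "\<delta> > 0" "ball x \<delta> \<subseteq> U" using d1 d2 by (auto simp: \<delta>_def)
  have close: "norm (g b z - g b x) \<le> \<epsilon>" if "z \<in> ball x \<delta>" "b \<in> Basis" for z b
    using d1(2)[of z b] that \<epsilon> by (cases "z = x") (auto simp: \<delta>_def dist_norm norm_minus_commute)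
  show "\<exists>d>0. \<forall>y. norm (y - x) < d \<longrightarrow>
      norm (f y - f x - (\<Sum>b\<in>Basis. ((y - x) \<bullet> b) *\<^sub>R g b x)) \<le> e * norm (y - x)"
  proof (intro exI conjI allI impI)
    \<comment> \<open>The coordinatewise estimate is in the l1 norm, which is at most
      \<open>DIM('b)\<close> times the Euclidean norm; hence this division and the one in
      \<open>\<epsilon>\<close>.\<close>
    show "\<delta> / DIM('b) > 0" using \<delta> by simp
    fix y assume y: "norm (y - x) < \<delta> / DIM('b)"
    have l1: "(\<Sum>b\<in>Basis. \<bar>(y - x) \<bullet> b\<bar>) \<le> DIM('b) * norm (y - x)"
      by (rule order_trans[OF sum_bounded_above[of _ _ "norm (y - x)"]]) (auto intro: Basis_le_norm)
    also have "\<dots> < \<delta>" using y by (simp add: field_simps)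
    finally have "norm (f (x + (\<Sum>b\<in>Basis. ((y - x) \<bullet> b) *\<^sub>R b)) - f x - (\<Sum>b\<in>Basis. ((y - x) \<bullet> b) *\<^sub>R g b x))
      \<le> \<epsilon> * (\<Sum>b\<in>Basis. \<bar>(y - x) \<bullet> b\<bar>)"
      by (intro C1_on_increment_bound[OF C1 \<delta>(2)] close) auto
    also have "\<dots> \<le> \<epsilon> * (DIM('b) * norm (y - x))" using l1 \<epsilon> by (intro mult_left_mono) auto
    finally show "norm (f y - f x - (\<Sum>b\<in>Basis. ((y - x) \<bullet> b) *\<^sub>R g b x)) \<le> e * norm (y - x)"
      by (simp add: euclidean_representation \<epsilon>_def)
  qed
qed

lemma C1_on_continuous_on:
  assumes "C1_on U f g" "open U" shows "continuous_on U f"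
  using C1_on_has_derivative[OF assms] by (meson continuous_at_imp_continuous_on has_derivative_continuous)

lemma C1_on_has_vector_derivative_along:
  fixes f :: "'b::euclidean_space \<Rightarrow> 'c::real_normed_vector"
  assumes C1: "C1_on U f g" and U: "open U" "x + s *\<^sub>R y \<in> U"
  shows "((\<lambda>s. f (x + s *\<^sub>R y)) has_vector_derivative (\<Sum>b\<in>Basis. (y \<bullet> b) *\<^sub>R g b (x + s *\<^sub>R y))) (at s)"
proof -
  have "((\<lambda>s. x + s *\<^sub>R y) has_derivative (\<lambda>h. h *\<^sub>R y)) (at s)" by (auto intro!: derivative_eq_intros)
  from has_derivative_compose[OF this C1_on_has_derivative[OF C1 U]]
  show ?thesis by (simp add: has_vector_derivative_def scaleR_sum_right)
qed

section \<open>A compactly supported radial weight and integration by parts\<close>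

lemma max_square_has_derivative: "((\<lambda>q::real. (max 0 q)^2) has_real_derivative 2 * max 0 q) (at q)"
proof -
  consider "q > 0" | "q < 0" | "q = 0" by linarith
  then show ?thesis
  proof cases
    case 1
    have "((\<lambda>q::real. q^2) has_real_derivative 2 * max 0 q) (at q)"
      using 1 by (auto intro!: derivative_eq_intros)
    then show ?thesis
      by (rule DERIV_cong_ev[THEN iffD1, rotated -1])
         (use 1 eventually_nhds_in_open[of "{0<..}" q] in \<open>auto elim!: eventually_mono\<close>)
  next
    case 2
    have "((\<lambda>q::real. 0) has_real_derivative 2 * max 0 q) (at q)"
      using 2 by (auto intro!: derivative_eq_intros)
    then show ?thesis
      by (rule DERIV_cong_ev[THEN iffD1, rotated -1])
         (use 2 eventually_nhds_in_open[of "{..<0}" q] in \<open>auto elim!: eventually_mono\<close>)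
  next
    case 3
    have "(\<lambda>h::real. (max 0 h)^2 / h) \<midarrow>0\<rightarrow> 0"
    proof (rule Lim_null_comparison[of _ "\<lambda>h. \<bar>h\<bar>"])
      show "\<forall>\<^sub>F h::real in at 0. norm ((max 0 h)^2 / h) \<le> \<bar>h\<bar>"
        by (rule always_eventually) (auto simp: max_def power2_eq_square)
      show "((\<lambda>h::real. \<bar>h\<bar>) \<longlongrightarrow> 0) (at 0)" by (rule tendsto_eq_intros) auto
    qed
    then show ?thesis using 3 by (simp add: DERIV_def)
  qed
qed

text \<open>The square makes the weight continuously differentiable across the unit sphere. Its
  gradient is a scalar multiple of \<open>y\<close>, so \<open>(y \<bullet> a) * dbump b y\<close>
  is symmetric in \<open>a\<close> and \<open>b\<close>; \<open>moment_symmetric\<close> rests on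
  this.\<close>

definition bump :: "'b::euclidean_space \<Rightarrow> real" where "bump y = (max 0 (1 - (norm y)^2))^2"
definition dbump :: "'b::euclidean_space \<Rightarrow> 'b \<Rightarrow> real" where
  "dbump b y = - 4 * (y \<bullet> b) * max 0 (1 - (norm y)^2)"

lemma bump_has_derivative:
  assumes "b \<in> Basis"
  shows "((\<lambda>s. bump (y + s *\<^sub>R b)) has_vector_derivative dbump b y) (at 0)"
proof -
  have eq: "(norm (y + s *\<^sub>R b))^2 = (norm y)^2 + 2 * s * (y \<bullet> b) + s^2" for s
    using assms by (simp add: power2_norm_eq_inner inner_simps) (simp add: inner_commute power2_eq_square algebra_simps)
  have "((\<lambda>s. (max 0 (1 - ((norm y)^2 + 2 * s * (y \<bullet> b) + s^2)))^2) has_real_derivative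
      2 * max 0 (1 - ((norm y)^2 + 2 * 0 * (y \<bullet> b) + 0^2)) * (- 2 * (y \<bullet> b))) (at 0)"
    by (rule DERIV_chain2[OF max_square_has_derivative]) (auto intro!: derivative_eq_intros)
  then show ?thesis
    by (simp add: bump_def dbump_def eq has_real_derivative_iff_has_vector_derivative algebra_simps)
qed

lemma bump_outside:
  assumes "norm y \<ge> 1" shows "bump y = 0" "dbump b y = 0"
proof -
  have "max 0 (1 - (norm y)^2) = 0" using one_le_power[OF assms, of 2] by simp
  then show "bump y = 0" "dbump b y = 0" by (simp_all add: bump_def dbump_def)
qed

lemma continuous_on_bump: "continuous_on S bump" "continuous_on S (dbump b)"
  unfolding bump_def[abs_def] dbump_def[abs_def] by (intro continuous_intros)+

text \<open>The box leaves a margin around the unit ball, so that its translates by at most one unit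
  along an axis still contain the support; \<open>integral_directional_derivative_0\<close> uses
  this.\<close>

abbreviation bigbox :: "'b::euclidean_space set" where
  "bigbox \<equiv> cbox (- 2 *\<^sub>R One) (2 *\<^sub>R One)"

lemma integral_bump_pos: "integral bigbox (bump :: 'b::euclidean_space \<Rightarrow> real) > 0"
proof -
  have nn: "bump y \<ge> 0" for y :: 'b by (simp add: bump_def)
  have int: "bump integrable_on (bigbox::'b set)" by (intro integrable_continuous continuous_on_bump)
  have "integral bigbox (bump::'b\<Rightarrow>real) \<noteq> 0"
  proof
    assume 0: "integral bigbox (bump::'b\<Rightarrow>real) = 0"
    have "\<forall>x\<in>bigbox. bump (x::'b) = 0"
      using 0 nn by (subst (asm) integral_cbox_eq_0_iff) (auto intro: continuous_on_bump simp: box_eq_empty)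
    moreover have "(0::'b) \<in> bigbox" by (auto simp: mem_box)
    ultimately show False by (force simp: bump_def)
  qed
  with integral_nonneg[OF int] nn show ?thesis by fastforce
qed

text \<open>By translation invariance the integral of \<open>\<psi> (y + s *\<^sub>R b)\<close> does
  not depend on \<open>s\<close>; differentiating under the integral at \<open>s = 0\<close> gives
  the claim.\<close>

lemma integral_directional_derivative_0:
  fixes \<psi> :: "'b::euclidean_space \<Rightarrow> 'c::banach"
  assumes b: "b \<in> Basis" and supp: "\<And>y. norm y > 1 \<Longrightarrow> \<psi> y = 0"
    and cont: "continuous_on UNIV \<psi>" "continuous_on UNIV \<psi>'"
    and der: "\<And>y. ((\<lambda>s. \<psi> (y + s *\<^sub>R b)) has_vector_derivative \<psi>' y) (at 0)"
  shows "integral bigbox \<psi>' = 0"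
proof -
  define \<phi> where "\<phi> s = integral bigbox (\<lambda>y. \<psi> (y + s *\<^sub>R b))" for s
  have "((\<lambda>s. integral bigbox (\<lambda>y. \<psi> (y + s *\<^sub>R b))) has_vector_derivative
      integral bigbox (\<lambda>y. \<psi>' (y + 0 *\<^sub>R b))) (at 0 within {-1..1})"
  proof (rule leibniz_rule_vector_derivative[where f = "\<lambda>s y. \<psi> (y + s *\<^sub>R b)" and fx = "\<lambda>s y. \<psi>' (y + s *\<^sub>R b)"])
    show "((\<lambda>s. \<psi> (y + s *\<^sub>R b)) has_vector_derivative \<psi>' (y + s *\<^sub>R b)) (at s within {-1..1})" for s y
      by (rule has_vector_derivative_at_within, rule has_vector_derivative_line, rule der)
    show "(\<lambda>y. \<psi> (y + s *\<^sub>R b)) integrable_on bigbox" for s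
      by (intro integrable_continuous continuous_on_compose2[OF cont(1)] continuous_intros) auto
    show "continuous_on ({-1..1} \<times> bigbox) (\<lambda>(s, y). \<psi>' (y + s *\<^sub>R b))"
      unfolding split_beta by (intro continuous_on_compose2[OF cont(2)] continuous_intros) auto
  qed auto
  then have d: "(\<phi> has_vector_derivative integral bigbox \<psi>') (at 0 within {-1..1})"
    by (simp add: \<phi>_def[abs_def])
  have const: "\<phi> s = integral UNIV \<psi>" if "s \<in> {-1..1}" for s
  proof -
    have "\<phi> s = integral bigbox (\<psi> \<circ> (+) (s *\<^sub>R b))" by (simp add: \<phi>_def o_def add.commute)
    also have "\<dots> = integral (cbox (- 2 *\<^sub>R One + s *\<^sub>R b) (2 *\<^sub>R One + s *\<^sub>R b)) \<psi>" (is "_ = integral ?C \<psi>")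
      by (rule integral_shift_cbox_plus)
    also have "\<dots> = integral UNIV \<psi>"
    proof -
      have "\<psi> y = 0" if "y \<notin> ?C" for y
      proof (rule supp, rule ccontr)
        assume "\<not> 1 < norm y"
        have "y \<in> ?C" unfolding mem_box
        proof (intro ballI)
          fix i :: 'b assume i: "i \<in> Basis"
          have "\<bar>y \<bullet> i\<bar> \<le> 1" using Basis_le_norm[OF i, of y] \<open>\<not> 1 < norm y\<close> by linarith
          moreover have "\<bar>(s *\<^sub>R b) \<bullet> i\<bar> \<le> 1"
            using b i \<open>s \<in> {-1..1}\<close> by (auto simp: inner_Basis)
          ultimately show "(- 2 *\<^sub>R One + s *\<^sub>R b) \<bullet> i \<le> y \<bullet> i \<and> y \<bullet> i \<le> (2 *\<^sub>R One + s *\<^sub>R b) \<bullet> i"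
            using i by (auto simp: inner_simps abs_le_iff)
        qed
        with that show False ..
      qed
      then have "(\<lambda>x. if x \<in> ?C then \<psi> x else 0) = \<psi>" by auto
      then show ?thesis using integral_restrict_UNIV[of ?C \<psi>] by simp
    qed
    finally show ?thesis .
  qed
  have "(\<phi> has_vector_derivative 0) (at 0 within {-1..1})"
    by (rule has_vector_derivative_transform[of _ _ _ "\<lambda>_. integral UNIV \<psi>"]) (auto simp: const)
  with d show ?thesis
    using vector_derivative_unique_within_closed_interval[of "-1" 1 0 \<phi>] by auto
qed

text \<open>\<open>\<phi>\<close> is controlled only on \<open>U\<close>, yet the integrals run over
  a whole box. Where \<open>Z p\<close> leaves \<open>U\<close>, the norm of \<open>Y p\<close>
  exceeds one strictly, so the weight vanishes in a neighbourhood and the values of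
  \<open>\<phi>\<close> there do not matter.\<close>

lemma continuous_on_cutoff:
  fixes \<phi> :: "'b::real_normed_vector \<Rightarrow> 'c::real_normed_vector" and w :: "'d::real_normed_vector \<Rightarrow> real"
  assumes w: "continuous_on UNIV w" "\<And>y. norm y \<ge> 1 \<Longrightarrow> w y = 0"
    and \<phi>: "continuous_on U \<phi>" "open U"
    and Y: "continuous_on P Y" and Z: "continuous_on P Z"
    and YZ: "\<And>p. p \<in> P \<Longrightarrow> norm (Y p) \<le> 1 \<Longrightarrow> Z p \<in> U"
  shows "continuous_on P (\<lambda>p. w (Y p) *\<^sub>R \<phi> (Z p))"
  unfolding continuous_on_def
proof
  fix p assume p: "p \<in> P"
  have tY: "(Y \<longlongrightarrow> Y p) (at p within P)" and tZ: "(Z \<longlongrightarrow> Z p) (at p within P)"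
    using Y Z p by (auto simp: continuous_on_def)
  have tw: "((\<lambda>q. w (Y q)) \<longlongrightarrow> w (Y p)) (at p within P)"
    by (rule isCont_tendsto_compose[OF _ tY]) (use w(1) in \<open>simp add: continuous_on_eq_continuous_at\<close>)
  show "((\<lambda>q. w (Y q) *\<^sub>R \<phi> (Z q)) \<longlongrightarrow> w (Y p) *\<^sub>R \<phi> (Z p)) (at p within P)"
  proof (cases "Z p \<in> U")
    case True
    then have "((\<lambda>q. \<phi> (Z q)) \<longlongrightarrow> \<phi> (Z p)) (at p within P)"
      by (intro isCont_tendsto_compose[OF _ tZ]) (use \<phi> in \<open>simp add: continuous_on_eq_continuous_at\<close>)
    with tw show ?thesis by (rule tendsto_scaleR)
  next
    case False
    then have 1: "norm (Y p) > 1" using YZ[OF p] by force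
    have "\<forall>\<^sub>F q in at p within P. norm (Y q) > 1"
      using order_tendstoD(1)[OF tendsto_norm[OF tY] 1] .
    then have "\<forall>\<^sub>F q in at p within P. 0 = w (Y q) *\<^sub>R \<phi> (Z q)"
      by eventually_elim (simp add: w(2))
    then have "((\<lambda>q. w (Y q) *\<^sub>R \<phi> (Z q)) \<longlongrightarrow> 0) (at p within P)"
      by (rule Lim_transform_eventually[OF tendsto_const])
    then show ?thesis using 1 by (simp add: w(2))
  qed
qed

lemma scaled_point_in_cball:
  fixes x y :: "'b::real_normed_vector"
  assumes "norm y \<le> 1" "0 \<le> r" "r \<le> R" shows "x + r *\<^sub>R y \<in> cball x R"
proof -
  have "r * norm y \<le> R * 1" using assms by (intro mult_mono) auto
  then show ?thesis using assms by (simp add: dist_norm)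
qed

lemma cutoff_has_directional_derivative:
  fixes f :: "'b::euclidean_space \<Rightarrow> 'c::real_normed_vector"
  assumes C1: "C1_on U f g" and b: "b \<in> Basis" and r: "0 \<le> r" "cball x r \<subseteq> U"
    and w: "((\<lambda>s. w (y + s *\<^sub>R b)) has_vector_derivative w' y) (at 0)"
    and out: "\<And>y. norm y \<ge> 1 \<Longrightarrow> w y = (0::real)" "\<And>y. norm y \<ge> 1 \<Longrightarrow> w' y = 0"
  shows "((\<lambda>s. w (y + s *\<^sub>R b) *\<^sub>R f (x + r *\<^sub>R (y + s *\<^sub>R b))) has_vector_derivative
     (w' y *\<^sub>R f (x + r *\<^sub>R y) + (r * w y) *\<^sub>R g b (x + r *\<^sub>R y))) (at 0)"
proof (cases "x + r *\<^sub>R y \<in> U")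
  case True
  have "((\<lambda>s. f ((x + r *\<^sub>R y) + s *\<^sub>R b)) has_vector_derivative g b (x + r *\<^sub>R y)) (at 0)"
    using C1 True b by (auto simp: C1_on_def)
  then have "((\<lambda>s. f ((x + r *\<^sub>R y) + s *\<^sub>R b)) \<circ> (\<lambda>s. r * s) has_vector_derivative r *\<^sub>R g b (x + r *\<^sub>R y)) (at 0)"
    by (intro vector_diff_chain_at) (auto intro!: derivative_eq_intros)
  then have "((\<lambda>s. f (x + r *\<^sub>R (y + s *\<^sub>R b))) has_vector_derivative r *\<^sub>R g b (x + r *\<^sub>R y)) (at 0)"
    by (simp add: o_def algebra_simps)
  from has_vector_derivative_scaleR[OF w[unfolded has_real_derivative_iff_has_vector_derivative[symmetric]] this]
  show ?thesis by (simp add: algebra_simps)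
next
  case False
  then have 1: "norm y > 1"
    using scaled_point_in_cball[of y r r x] r by force
  have "((\<lambda>s. 0) has_vector_derivative (0::'c)) (at (0::real))" by simp
  then have "((\<lambda>s. w (y + s *\<^sub>R b) *\<^sub>R f (x + r *\<^sub>R (y + s *\<^sub>R b))) has_vector_derivative 0) (at 0)"
  proof (rule has_vector_derivative_transform_within_open[where S = "{s. norm (y + s *\<^sub>R b) > 1}"])
    show "open {s. norm (y + s *\<^sub>R b) > 1}" by (intro open_Collect_less continuous_intros)
  qed (use 1 in \<open>auto simp: out\<close>)
  then show ?thesis using 1 by (simp add: out)
qed

lemma cutoff_integration_by_parts:
  fixes f :: "'b::euclidean_space \<Rightarrow> 'c::banach"
  assumes C1: "C1_on U f g" and U: "open U" and b: "b \<in> Basis" and r: "0 \<le> r" "cball x r \<subseteq> U"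
    and w: "\<And>y. ((\<lambda>s. w (y + s *\<^sub>R b)) has_vector_derivative w' y) (at 0)"
    and out: "\<And>y. norm y \<ge> 1 \<Longrightarrow> w y = (0::real)" "\<And>y. norm y \<ge> 1 \<Longrightarrow> w' y = 0"
    and cont: "continuous_on UNIV w" "continuous_on UNIV w'"
  shows "integral bigbox (\<lambda>y. w' y *\<^sub>R f (x + r *\<^sub>R y)) + r *\<^sub>R integral bigbox (\<lambda>y. w y *\<^sub>R g b (x + r *\<^sub>R y)) = 0"
proof -
  have cf: "continuous_on U f" "continuous_on U (g b)"
    using C1_on_continuous_on[OF C1 U] C1 b by (auto simp: C1_on_def)
  have YZ: "x + r *\<^sub>R y \<in> U" if "norm y \<le> 1" for y
    using scaled_point_in_cball[OF that r(1) order_refl, of x] r by auto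
  have c: "continuous_on UNIV (\<lambda>y. w y *\<^sub>R f (x + r *\<^sub>R y))" "continuous_on UNIV (\<lambda>y. w' y *\<^sub>R f (x + r *\<^sub>R y))"
     "continuous_on UNIV (\<lambda>y. w y *\<^sub>R g b (x + r *\<^sub>R y))"
    by (rule continuous_on_cutoff[where U = U]; use cf cont out U YZ in \<open>auto intro!: continuous_intros\<close>)+
  have "integral bigbox (\<lambda>y. w' y *\<^sub>R f (x + r *\<^sub>R y) + (r * w y) *\<^sub>R g b (x + r *\<^sub>R y)) = 0"
  proof (rule integral_directional_derivative_0[OF b])
    show "((\<lambda>s. w (y + s *\<^sub>R b) *\<^sub>R f (x + r *\<^sub>R (y + s *\<^sub>R b))) has_vector_derivative
     (w' y *\<^sub>R f (x + r *\<^sub>R y) + (r * w y) *\<^sub>R g b (x + r *\<^sub>R y))) (at 0)" for y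
      by (rule cutoff_has_directional_derivative[OF C1 b r w out])
    show "continuous_on UNIV (\<lambda>y. w' y *\<^sub>R f (x + r *\<^sub>R y) + (r * w y) *\<^sub>R g b (x + r *\<^sub>R y))"
      using continuous_on_add[OF c(2) continuous_on_scaleR[OF continuous_on_const[of _ r] c(3)]] by simp
  qed (use c(1) out in auto)
  also have "(\<lambda>y. w' y *\<^sub>R f (x + r *\<^sub>R y) + (r * w y) *\<^sub>R g b (x + r *\<^sub>R y)) =
      (\<lambda>y. w' y *\<^sub>R f (x + r *\<^sub>R y) + r *\<^sub>R (w y *\<^sub>R g b (x + r *\<^sub>R y)))" by simp
  finally have 0: "integral bigbox (\<lambda>y. w' y *\<^sub>R f (x + r *\<^sub>R y) + r *\<^sub>R (w y *\<^sub>R g b (x + r *\<^sub>R y))) = 0" .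
  have i: "(\<lambda>y. w' y *\<^sub>R f (x + r *\<^sub>R y)) integrable_on bigbox" "(\<lambda>y. w y *\<^sub>R g b (x + r *\<^sub>R y)) integrable_on bigbox"
    using c(2,3) by (auto intro!: integrable_continuous elim: continuous_on_subset)
  show ?thesis
    using 0 integral_add[OF i(1) integrable_cmul[OF i(2), of r]] integral_cmul[of bigbox r "\<lambda>y. w y *\<^sub>R g b (x + r *\<^sub>R y)"]
    by (simp only:)
qed

section \<open>Clifford relations and the mean value formula\<close>

lemma bounded_linear_mult_left_fin:
  fixes a :: "'a::{real_algebra,euclidean_space}"
  shows "bounded_linear (\<lambda>x. a * x)"
  by (rule linear_conv_bounded_linear[THEN iffD1], unfold_locales) (auto simp: algebra_simps)

text \<open>Pairing \<open>(a, b)\<close> with \<open>(b, a)\<close> leaves twice the diagonal,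
  since the off-diagonal products cancel. With a Hessian as \<open>M\<close> this is the
  factorisation of the Laplacian; with a matrix of moments it gives the mean value formula; with
  entries \<open>c a * c b\<close> it yields squares of linear combinations and linear
  independence.\<close>

lemma clifford_trace:
  fixes e eb :: "'i \<Rightarrow> 'a::real_algebra_1"
  assumes finite_I: "finite I" and ebe: "\<And>b. b \<in> I \<Longrightarrow> eb b * e b = 1"
    and ebe_anti: "\<And>a b. a \<in> I \<Longrightarrow> b \<in> I \<Longrightarrow> a \<noteq> b \<Longrightarrow> eb a * e b + eb b * e a = 0"
    and sym: "\<And>a b. a \<in> I \<Longrightarrow> b \<in> I \<Longrightarrow> M a b = M b a"
  shows "(\<Sum>a\<in>I. eb a * (\<Sum>b\<in>I. e b * M a b)) = (\<Sum>a\<in>I. M a a)"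
proof -
  define X where "X a b = eb a * (e b * M a b)" for a b
  have X: "X a b + X b a = (if a = b then 2 *\<^sub>R M a a else 0)" if "a \<in> I" "b \<in> I" for a b
  proof (cases "a = b")
    case True
    have "X a a = M a a" using that by (simp add: X_def mult.assoc[symmetric] ebe)
    then show ?thesis using True by (simp add: scaleR_2)
  next
    case False
    have "X a b + X b a = (eb a * e b + eb b * e a) * M a b"
      using sym[OF that] by (simp add: X_def algebra_simps)
    then show ?thesis using ebe_anti[OF that False] False by simp
  qed
  have "2 *\<^sub>R (\<Sum>a\<in>I. \<Sum>b\<in>I. X a b) = (\<Sum>a\<in>I. \<Sum>b\<in>I. X a b) + (\<Sum>b\<in>I. \<Sum>a\<in>I. X a b)"
    by (subst (3) sum.swap) (simp add: scaleR_2)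
  also have "\<dots> = (\<Sum>a\<in>I. \<Sum>b\<in>I. if a = b then 2 *\<^sub>R M a a else 0)"
    by (simp add: sum.distrib[symmetric] X cong: sum.cong)
  also have "\<dots> = 2 *\<^sub>R (\<Sum>a\<in>I. M a a)"
    using finite_I by (simp add: sum.delta' scaleR_sum_right)
  finally show ?thesis by (simp add: X_def sum_distrib_left)
qed

text \<open>The ambient space may have more directions than there are variables. \<open>I\<close>
  holds those that carry a variable; \<open>regular\<close> makes the gradient vanish along the
  others.\<close>

locale clifford_family =
  fixes I :: "'b::euclidean_space set" and e eb :: "'b \<Rightarrow> 'a::{real_algebra_1,euclidean_space}"
  assumes I: "I \<subseteq> Basis" and ebe: "\<And>b. b \<in> I \<Longrightarrow> eb b * e b = 1"
    and ebe_anti: "\<And>a b. a \<in> I \<Longrightarrow> b \<in> I \<Longrightarrow> a \<noteq> b \<Longrightarrow> eb a * e b + eb b * e a = 0"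
begin

lemma finite_I: "finite I" using I finite_Basis finite_subset by blast

definition regular :: "'b set \<Rightarrow> ('b \<Rightarrow> 'a) \<Rightarrow> ('b \<Rightarrow> 'b \<Rightarrow> 'a) \<Rightarrow> bool" where
  "regular U f g \<longleftrightarrow> C1_on U f g \<and>
     (\<forall>x\<in>U. (\<Sum>b\<in>I. e b * g b x) = 0 \<and> (\<forall>b\<in>Basis - I. g b x = 0))"

text \<open>Integration by parts turns both sides into \<open>- 1 / r\<close> times an integral of
  \<open>f\<close> against \<open>(y \<bullet> a) * dbump b y\<close>, which is symmetric in
  \<open>a\<close> and \<open>b\<close>. For \<open>a \<noteq> b\<close> the factor
  \<open>y \<bullet> a\<close> is constant along \<open>b\<close>, so only the weight is
  differentiated.\<close>

lemma moment_symmetric: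
  fixes f :: "'b \<Rightarrow> 'a"
  assumes C1: "C1_on U f g" and U: "open U" and r: "0 < r" "cball x r \<subseteq> U"
    and ab: "a \<in> Basis" "b \<in> Basis"
  shows "integral bigbox (\<lambda>y. ((y \<bullet> a) * bump y) *\<^sub>R g b (x + r *\<^sub>R y)) =
         integral bigbox (\<lambda>y. ((y \<bullet> b) * bump y) *\<^sub>R g a (x + r *\<^sub>R y))"
proof (cases "a = b")
  case False
  have parts: "integral bigbox (\<lambda>y. ((y \<bullet> a) * dbump b y) *\<^sub>R f (x + r *\<^sub>R y))
     + r *\<^sub>R integral bigbox (\<lambda>y. ((y \<bullet> a) * bump y) *\<^sub>R g b (x + r *\<^sub>R y)) = 0"
    if "a \<in> Basis" "b \<in> Basis" "a \<noteq> b" for a b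
  proof (rule cutoff_integration_by_parts[OF C1 U])
    show "((\<lambda>s. (y + s *\<^sub>R b) \<bullet> a * bump (y + s *\<^sub>R b)) has_vector_derivative y \<bullet> a * dbump b y) (at 0)" for y
    proof -
      have "(y + s *\<^sub>R b) \<bullet> a = y \<bullet> a" for s using that by (simp add: inner_simps inner_Basis)
      then show ?thesis
        using has_vector_derivative_mult_right[OF bump_has_derivative[OF that(2), of y], of "y \<bullet> a"] by simp
    qed
    show "continuous_on UNIV (\<lambda>y. y \<bullet> a * bump y)" "continuous_on UNIV (\<lambda>y. y \<bullet> a * dbump b y)"
      by (intro continuous_intros continuous_on_bump)+
  qed (use that r in \<open>auto simp: bump_outside\<close>)
  have "(y \<bullet> a) * dbump b y = (y \<bullet> b) * dbump a y" for y :: 'b by (simp add: dbump_def)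
  then have "r *\<^sub>R integral bigbox (\<lambda>y. ((y \<bullet> a) * bump y) *\<^sub>R g b (x + r *\<^sub>R y)) =
         r *\<^sub>R integral bigbox (\<lambda>y. ((y \<bullet> b) * bump y) *\<^sub>R g a (x + r *\<^sub>R y))"
    using parts[OF ab False] parts[OF ab(2,1)] False by (auto simp: eq_neg_iff_add_eq_0[symmetric] add_eq_0_iff)
  then show ?thesis using r by simp
qed simp

text \<open>The integral is the trace of the matrix of moments. As the matrix is symmetric,
  \<open>clifford_trace\<close> rewrites its trace through the sums
  \<open>\<Sum>b\<in>I. e b * M a b\<close>, and each of these vanishes because the equation holds
  under the integral.\<close>

lemma moments_trace_0:
  assumes reg: "regular U f g" and U: "open U" and r: "0 < r" "cball x r \<subseteq> U"
  shows "integral bigbox (\<lambda>y. bump y *\<^sub>R (\<Sum>b\<in>Basis. (y \<bullet> b) *\<^sub>R g b (x + r *\<^sub>R y))) = 0"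
proof -
  have C1: "C1_on U f g" using reg by (simp add: regular_def)
  define M where "M a b = integral bigbox (\<lambda>y. ((y \<bullet> a) * bump y) *\<^sub>R g b (x + r *\<^sub>R y))" for a b
  have YZ: "x + r *\<^sub>R y \<in> U" if "norm y \<le> 1" for y
    using scaled_point_in_cball[OF that _ order_refl, of r x] r by auto
  have int: "(\<lambda>y. ((y \<bullet> a) * bump y) *\<^sub>R g b (x + r *\<^sub>R y)) integrable_on bigbox" if "b \<in> Basis" for a b
    by (intro integrable_continuous continuous_on_cutoff[where U = U])
       (use C1 that U YZ in \<open>auto simp: C1_on_def bump_outside intro!: continuous_intros continuous_on_bump\<close>)
  have gout: "bump y *\<^sub>R g b (x + r *\<^sub>R y) = 0" if "b \<in> Basis - I" for b y
    using YZ[of y] reg that by (cases "norm y \<le> 1") (auto simp: regular_def bump_outside)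
  have "integral bigbox (\<lambda>y. bump y *\<^sub>R (\<Sum>b\<in>Basis. (y \<bullet> b) *\<^sub>R g b (x + r *\<^sub>R y)))
      = integral bigbox (\<lambda>y. \<Sum>b\<in>I. ((y \<bullet> b) * bump y) *\<^sub>R g b (x + r *\<^sub>R y))"
  proof (rule integral_cong)
    fix y :: 'b
    have "bump y *\<^sub>R (\<Sum>b\<in>Basis. (y \<bullet> b) *\<^sub>R g b (x + r *\<^sub>R y)) = (\<Sum>b\<in>Basis. (y \<bullet> b) *\<^sub>R (bump y *\<^sub>R g b (x + r *\<^sub>R y)))"
      by (simp add: scaleR_sum_right mult.commute)
    also have "\<dots> = (\<Sum>b\<in>I. (y \<bullet> b) *\<^sub>R (bump y *\<^sub>R g b (x + r *\<^sub>R y)))"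
      by (rule sum.mono_neutral_right) (use I gout in auto)
    finally show "bump y *\<^sub>R (\<Sum>b\<in>Basis. (y \<bullet> b) *\<^sub>R g b (x + r *\<^sub>R y)) = (\<Sum>b\<in>I. ((y \<bullet> b) * bump y) *\<^sub>R g b (x + r *\<^sub>R y))"
      by simp
  qed
  also have "\<dots> = (\<Sum>b\<in>I. M b b)"
    unfolding M_def by (rule integral_sum) (use finite_I int I in auto)
  also have "\<dots> = (\<Sum>a\<in>I. eb a * (\<Sum>b\<in>I. e b * M a b))"
    proof (rule clifford_trace[symmetric])
    show "M a b = M b a" if "a \<in> I" "b \<in> I" for a b
      unfolding M_def by (rule moment_symmetric[OF C1 U r]) (use that I in auto)
  qed (use finite_I ebe ebe_anti in auto)
  also have "\<dots> = 0"
  proof (rule sum.neutral, rule ballI)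
    fix a assume "a \<in> I"
    have "(\<Sum>b\<in>I. e b * M a b) = (\<Sum>b\<in>I. integral bigbox (\<lambda>y. e b * (((y \<bullet> a) * bump y) *\<^sub>R g b (x + r *\<^sub>R y))))"
      unfolding M_def
      by (intro sum.cong refl integral_linear[OF int bounded_linear_mult_left_fin, unfolded o_def, symmetric]) (use I in auto)
    also have "\<dots> = integral bigbox (\<lambda>y. \<Sum>b\<in>I. e b * (((y \<bullet> a) * bump y) *\<^sub>R g b (x + r *\<^sub>R y)))"
      by (rule integral_sum[symmetric])
         (use finite_I integrable_linear[OF int bounded_linear_mult_left_fin, unfolded o_def] I in auto)
    also have "\<dots> = integral bigbox (\<lambda>y::'b. 0::'a)"
    proof (rule integral_cong)
      fix y :: 'b
      have "(\<Sum>b\<in>I. e b * (((y \<bullet> a) * bump y) *\<^sub>R g b (x + r *\<^sub>R y))) = ((y \<bullet> a) * bump y) *\<^sub>R (\<Sum>b\<in>I. e b * g b (x + r *\<^sub>R y))"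
        by (simp add: scaleR_sum_right)
      also have "\<dots> = 0" using YZ[of y] reg by (cases "norm y \<le> 1") (auto simp: regular_def bump_outside)
      finally show "(\<Sum>b\<in>I. e b * (((y \<bullet> a) * bump y) *\<^sub>R g b (x + r *\<^sub>R y))) = 0" .
    qed
    finally show "eb a * (\<Sum>b\<in>I. e b * M a b) = 0" by simp
  qed
  finally show ?thesis .
qed

text \<open>As a function of \<open>r\<close> the left side has derivative zero by
  \<open>moments_trace_0\<close>, and at \<open>r = 0\<close> it equals the right side.\<close>

lemma regular_mean_value:
  assumes reg: "regular U f g" and U: "open U" and r: "0 \<le> r" "cball x r \<subseteq> U"
  shows "integral bigbox (\<lambda>y. bump y *\<^sub>R f (x + r *\<^sub>R y)) = integral bigbox (bump :: 'b \<Rightarrow> real) *\<^sub>R f x"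
proof -
  have C1: "C1_on U f g" using reg by (simp add: regular_def)
  have YZ: "x + s *\<^sub>R y \<in> U" if "norm y \<le> 1" "s \<in> {0..r}" for y s
    using scaled_point_in_cball[of y s r x] r that by auto
  define \<phi> where "\<phi> s = integral bigbox (\<lambda>y. bump y *\<^sub>R f (x + s *\<^sub>R y))" for s
  have d: "(\<phi> has_vector_derivative
      integral bigbox (\<lambda>y. bump y *\<^sub>R (\<Sum>b\<in>Basis. (y \<bullet> b) *\<^sub>R g b (x + s *\<^sub>R y)))) (at s within {0..r})"
    if s: "s \<in> {0..r}" for s
    unfolding \<phi>_def
  proof (rule leibniz_rule_vector_derivative[where f = "\<lambda>s y. bump y *\<^sub>R f (x + s *\<^sub>R y)"
         and fx = "\<lambda>s y. bump y *\<^sub>R (\<Sum>b\<in>Basis. (y \<bullet> b) *\<^sub>R g b (x + s *\<^sub>R y))"])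
    fix s :: real and y :: 'b assume s: "s \<in> {0..r}"
    show "((\<lambda>s. bump y *\<^sub>R f (x + s *\<^sub>R y)) has_vector_derivative
        bump y *\<^sub>R (\<Sum>b\<in>Basis. (y \<bullet> b) *\<^sub>R g b (x + s *\<^sub>R y))) (at s within {0..r})"
    proof (cases "norm y \<le> 1")
      case True
      have "((\<lambda>s. f (x + s *\<^sub>R y)) has_vector_derivative (\<Sum>b\<in>Basis. (y \<bullet> b) *\<^sub>R g b (x + s *\<^sub>R y))) (at s)"
        by (rule C1_on_has_vector_derivative_along[OF C1 U YZ[OF True s]])
      then have "((\<lambda>s. bump y *\<^sub>R f (x + s *\<^sub>R y)) has_vector_derivative
          bump y *\<^sub>R (\<Sum>b\<in>Basis. (y \<bullet> b) *\<^sub>R g b (x + s *\<^sub>R y))) (at s)"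
        by (intro bounded_linear.has_vector_derivative[OF bounded_linear_scaleR_right])
      then show ?thesis by (rule has_vector_derivative_at_within)
    qed (simp add: bump_outside)
  next
    fix s :: real assume s: "s \<in> {0..r}"
    show "(\<lambda>y. bump y *\<^sub>R f (x + s *\<^sub>R y)) integrable_on bigbox"
      by (intro integrable_continuous continuous_on_cutoff[where U = U])
         (use C1_on_continuous_on[OF C1 U] U YZ s in \<open>auto simp: bump_outside intro!: continuous_intros continuous_on_bump\<close>)
  next
    have eq: "(\<lambda>(s, y). bump y *\<^sub>R (\<Sum>b\<in>Basis. (y \<bullet> b) *\<^sub>R g b (x + s *\<^sub>R y)))
       = (\<lambda>p. \<Sum>b\<in>Basis. (snd p \<bullet> b) *\<^sub>R (bump (snd p) *\<^sub>R g b (x + fst p *\<^sub>R snd p)))"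
      by (auto simp: fun_eq_iff scaleR_sum_right mult.commute)
    show "continuous_on ({0..r} \<times> bigbox) (\<lambda>(s, y). bump y *\<^sub>R (\<Sum>b\<in>Basis. (y \<bullet> b) *\<^sub>R g b (x + s *\<^sub>R y)))"
      unfolding eq
      by (intro continuous_on_sum continuous_on_scaleR continuous_on_cutoff[where U = U])
         (use C1 U YZ in \<open>auto simp: C1_on_def bump_outside intro!: continuous_intros continuous_on_bump\<close>)
  qed (use s in auto)
  have "\<phi> r = \<phi> 0"
  proof (rule has_derivative_zero_unique_strong_interval[of "{0}" 0 r])
    show "continuous_on {0..r} \<phi>"
      using d by (meson continuous_on_eq_continuous_within has_vector_derivative_continuous)
    fix s assume s: "s \<in> {0..r} - {0}"
    have "cball x s \<subseteq> U" using s r by (meson DiffD1 atLeastAtMost_iff order_trans subset_cball)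
    then show "(\<phi> has_derivative (\<lambda>h. 0)) (at s within {0..r})"
      using d[of s] s moments_trace_0[OF reg U, of s x] by (auto simp: has_vector_derivative_def)
  qed (use r in auto)
  also have "\<phi> 0 = integral bigbox (bump :: 'b \<Rightarrow> real) *\<^sub>R f x"
    unfolding \<phi>_def
    using integral_linear[OF integrable_continuous[OF continuous_on_bump(1)] bounded_linear_scaleR_left[of "f x"], where a1 = "- 2 *\<^sub>R One :: 'b" and b1 = "2 *\<^sub>R One"]
    by (simp add: o_def)
  finally show ?thesis by (simp add: \<phi>_def)
qed

end

lemma has_vector_derivative_parametric_integral:
  fixes f :: "'b::euclidean_space \<Rightarrow> 'c::banach"
  assumes C1: "C1_on U f g" and U: "open U" and b: "b \<in> Basis"
    and r: "0 \<le> r" and x0: "cball x0 (\<delta> + r) \<subseteq> U" and x: "x \<in> ball x0 \<delta>"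
    and w: "continuous_on UNIV w" "\<And>y. norm y \<ge> 1 \<Longrightarrow> w y = (0::real)"
  shows "((\<lambda>s. integral bigbox (\<lambda>y. w y *\<^sub>R f (x + s *\<^sub>R b + r *\<^sub>R y))) has_vector_derivative
      integral bigbox (\<lambda>y. w y *\<^sub>R g b (x + r *\<^sub>R y))) (at 0)"
proof -
  define \<eta> where "\<eta> = \<delta> - dist x0 x"
  have \<eta>: "\<eta> > 0" using x by (simp add: \<eta>_def)
  have YZ: "x + s *\<^sub>R b + r *\<^sub>R y \<in> U" if "norm y \<le> 1" "s \<in> {-\<eta><..<\<eta>}" for y s
  proof -
    have "dist x0 (x + s *\<^sub>R b + r *\<^sub>R y) \<le> dist x0 x + dist x (x + s *\<^sub>R b) + dist (x + s *\<^sub>R b) (x + s *\<^sub>R b + r *\<^sub>R y)"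
      by (smt (verit) dist_triangle)
    also have "dist x (x + s *\<^sub>R b) \<le> \<eta>" using that b by (auto simp: dist_norm)
    also have "dist (x + s *\<^sub>R b) (x + s *\<^sub>R b + r *\<^sub>R y) \<le> r"
      using scaled_point_in_cball[OF that(1) r order_refl, of "x + s *\<^sub>R b"] by simp
    finally have "dist x0 (x + s *\<^sub>R b + r *\<^sub>R y) \<le> \<delta> + r" by (simp add: \<eta>_def)
    then show ?thesis using x0 by auto
  qed
  have "((\<lambda>s. integral bigbox (\<lambda>y. w y *\<^sub>R f (x + s *\<^sub>R b + r *\<^sub>R y))) has_vector_derivative
      integral bigbox (\<lambda>y. w y *\<^sub>R g b (x + 0 *\<^sub>R b + r *\<^sub>R y))) (at 0 within {-\<eta><..<\<eta>})"
  proof (rule leibniz_rule_vector_derivative[where f = "\<lambda>s y. w y *\<^sub>R f (x + s *\<^sub>R b + r *\<^sub>R y)"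
         and fx = "\<lambda>s y. w y *\<^sub>R g b (x + s *\<^sub>R b + r *\<^sub>R y)"])
    fix s :: real and y :: 'b assume s: "s \<in> {-\<eta><..<\<eta>}"
    show "((\<lambda>s. w y *\<^sub>R f (x + s *\<^sub>R b + r *\<^sub>R y)) has_vector_derivative
        w y *\<^sub>R g b (x + s *\<^sub>R b + r *\<^sub>R y)) (at s within {-\<eta><..<\<eta>})"
    proof (cases "norm y \<le> 1")
      case True
      have ac: "x + s *\<^sub>R b + r *\<^sub>R y = (x + r *\<^sub>R y) + s *\<^sub>R b" for s by simp
      have "((\<lambda>s. f (x + s *\<^sub>R b + r *\<^sub>R y)) has_vector_derivative g b (x + s *\<^sub>R b + r *\<^sub>R y)) (at s)"
        unfolding ac by (rule has_vector_derivative_line) (use C1 YZ[OF True s] b in \<open>simp add: C1_on_def ac\<close>)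
      then have "((\<lambda>s. w y *\<^sub>R f (x + s *\<^sub>R b + r *\<^sub>R y)) has_vector_derivative
          w y *\<^sub>R g b (x + s *\<^sub>R b + r *\<^sub>R y)) (at s)"
        by (intro bounded_linear.has_vector_derivative[OF bounded_linear_scaleR_right])
      then show ?thesis by (rule has_vector_derivative_at_within)
    qed (simp add: w)
  next
    fix s :: real assume s: "s \<in> {-\<eta><..<\<eta>}"
    show "(\<lambda>y. w y *\<^sub>R f (x + s *\<^sub>R b + r *\<^sub>R y)) integrable_on bigbox"
      by (intro integrable_continuous continuous_on_cutoff[where U = U])
         (use C1_on_continuous_on[OF C1 U] U YZ s w in \<open>auto intro!: continuous_intros\<close>)
  next
    show "continuous_on ({-\<eta><..<\<eta>} \<times> bigbox) (\<lambda>(s, y). w y *\<^sub>R g b (x + s *\<^sub>R b + r *\<^sub>R y))"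
      unfolding split_beta
      by (intro continuous_on_cutoff[where U = U])
         (use C1 U YZ w b in \<open>auto simp: C1_on_def intro!: continuous_intros\<close>)
  qed (use \<eta> in auto)
  then show ?thesis using \<eta> at_within_open[of 0 "{-\<eta><..<\<eta>}"] by simp
qed

lemma continuous_on_parametric_integral:
  fixes h :: "'b::euclidean_space \<Rightarrow> 'c::banach"
  assumes h: "continuous_on U h" and U: "open U" 
    and r: "0 \<le> r" and x0: "cball x0 (\<delta> + r) \<subseteq> U"
    and w: "continuous_on UNIV w" "\<And>y. norm y \<ge> 1 \<Longrightarrow> w y = (0::real)"
  shows "continuous_on (ball x0 \<delta>) (\<lambda>x. integral bigbox (\<lambda>y. w y *\<^sub>R h (x + r *\<^sub>R y)))"
proof (rule integral_continuous_on_param)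
  have YZ: "x + r *\<^sub>R y \<in> U" if "norm y \<le> 1" "x \<in> ball x0 \<delta>" for x y
  proof -
    have "dist x0 (x + r *\<^sub>R y) \<le> dist x0 x + dist x (x + r *\<^sub>R y)" by (rule dist_triangle)
    also have "dist x (x + r *\<^sub>R y) \<le> r"
      using scaled_point_in_cball[OF that(1) r order_refl, of x] by simp
    finally show ?thesis using x0 that by auto
  qed
  show "continuous_on (ball x0 \<delta> \<times> bigbox) (\<lambda>(x, y). w y *\<^sub>R h (x + r *\<^sub>R y))"
    unfolding split_beta
    by (intro continuous_on_cutoff[where U = U])
       (use h U YZ w in \<open>auto intro!: continuous_intros\<close>)
qed

context clifford_family begin

text \<open>Differentiating the mean value formula along \<open>b\<close> puts \<open>g b\<close>
  under the integral; integrating by parts moves the derivative onto the weight. The gradient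
  becomes an integral of \<open>f\<close> alone and can therefore be differentiated once
  more.\<close>

lemma regular_gradient_formula:
  assumes reg: "regular U f g" and U: "open U" and b: "b \<in> Basis"
    and r: "0 < r" and \<delta>: "0 < \<delta>" and x0: "cball x0 (\<delta> + r) \<subseteq> U" and x: "x \<in> ball x0 \<delta>"
  shows "g b x = (- 1 / (r * integral bigbox (bump :: 'b \<Rightarrow> real))) *\<^sub>R
      integral bigbox (\<lambda>y. dbump b y *\<^sub>R f (x + r *\<^sub>R y))"
proof -
  let ?c = "integral bigbox (bump :: 'b \<Rightarrow> real)"
  have C1: "C1_on U f g" using reg by (simp add: regular_def)
  have cb: "cball x' r \<subseteq> U" if "x' \<in> ball x0 \<delta>" for x'
  proof
    fix z assume "z \<in> cball x' r"
    then have "dist x0 z \<le> \<delta> + r" using that dist_triangle[of x0 z x'] by simp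
    then show "z \<in> U" using x0 by auto
  qed
  have "((\<lambda>s. integral bigbox (\<lambda>y. bump y *\<^sub>R f (x + s *\<^sub>R b + r *\<^sub>R y))) has_vector_derivative
      integral bigbox (\<lambda>y. bump y *\<^sub>R g b (x + r *\<^sub>R y))) (at 0)"
    by (rule has_vector_derivative_parametric_integral[OF C1 U b _ x0 x])
       (use r in \<open>auto intro: continuous_on_bump simp: bump_outside\<close>)
  moreover have "((\<lambda>s. integral bigbox (\<lambda>y. bump y *\<^sub>R f (x + s *\<^sub>R b + r *\<^sub>R y))) has_vector_derivative ?c *\<^sub>R g b x) (at 0)"
  proof (rule has_vector_derivative_transform_within_open[where S = "{s. x + s *\<^sub>R b \<in> ball x0 \<delta>}"])
    have "x \<in> U" using cb[OF x] r by (auto simp: subset_eq)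
    then show "((\<lambda>s. ?c *\<^sub>R f (x + s *\<^sub>R b)) has_vector_derivative ?c *\<^sub>R g b x) (at 0)"
      using C1 b by (intro bounded_linear.has_vector_derivative[OF bounded_linear_scaleR_right]) (auto simp: C1_on_def)
    show "open {s. x + s *\<^sub>R b \<in> ball x0 \<delta>}"
      unfolding mem_ball by (intro open_Collect_less continuous_intros)
    show "?c *\<^sub>R f (x + s *\<^sub>R b) = integral bigbox (\<lambda>y. bump y *\<^sub>R f (x + s *\<^sub>R b + r *\<^sub>R y))"
      if "s \<in> {s. x + s *\<^sub>R b \<in> ball x0 \<delta>}" for s
      using regular_mean_value[OF reg U _ cb, of "x + s *\<^sub>R b"] that r by simp
  qed (use x in auto)
  ultimately have "?c *\<^sub>R g b x = integral bigbox (\<lambda>y. bump y *\<^sub>R g b (x + r *\<^sub>R y))"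
    using vector_derivative_unique_at by blast
  moreover have "integral bigbox (\<lambda>y. dbump b y *\<^sub>R f (x + r *\<^sub>R y))
      + r *\<^sub>R integral bigbox (\<lambda>y. bump y *\<^sub>R g b (x + r *\<^sub>R y)) = 0"
    by (rule cutoff_integration_by_parts[OF C1 U b _ cb[OF x] bump_has_derivative[OF b]])
       (use r in \<open>auto intro: continuous_on_bump simp: bump_outside\<close>)
  ultimately have "r *\<^sub>R ?c *\<^sub>R g b x = - integral bigbox (\<lambda>y. dbump b y *\<^sub>R f (x + r *\<^sub>R y))"
    by (simp add: add_eq_0_iff)
  then have "(1 / (r * ?c)) *\<^sub>R (r *\<^sub>R ?c *\<^sub>R g b x) = (- 1 / (r * ?c)) *\<^sub>R integral bigbox (\<lambda>y. dbump b y *\<^sub>R f (x + r *\<^sub>R y))"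
    by simp
  then show ?thesis using integral_bump_pos[where 'b = 'b] r by simp
qed

text \<open>The gradient formula makes \<open>g b\<close> continuously differentiable, with
  derivatives that are integrals of \<open>g b'\<close> against the fixed weight
  \<open>dbump b\<close>; the linear equations satisfied by \<open>g\<close> pass through the
  integral.\<close>

lemma regular_derivative:
  assumes reg: "regular U f g" and U: "open U" and b: "b \<in> Basis"
  shows "regular U (g b) (\<lambda>b' x. vector_derivative (\<lambda>s. g b (x + s *\<^sub>R b')) (at 0))"
proof -
  have C1: "C1_on U f g" using reg by (simp add: regular_def)
  let ?c = "integral bigbox (bump :: 'b \<Rightarrow> real)"
  let ?g2 = "\<lambda>b' x. vector_derivative (\<lambda>s. g b (x + s *\<^sub>R b')) (at 0)"
  \<comment> \<open>The derivative along \<open>b'\<close> of the right side of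
    \<open>regular_gradient_formula\<close>: it falls on \<open>f\<close> and produces
    \<open>g b'\<close>.\<close>
  define G where "G r b' x = (- 1 / (r * ?c)) *\<^sub>R integral bigbox (\<lambda>y. dbump b y *\<^sub>R g b' (x + r *\<^sub>R y))" for r b' x
  have loc: "\<exists>r>0. \<exists>\<delta>>0. cball x0 (\<delta> + r) \<subseteq> U \<and> (\<forall>x\<in>ball x0 \<delta>. \<forall>b'\<in>Basis.
      ((\<lambda>s. g b (x + s *\<^sub>R b')) has_vector_derivative G r b' x) (at 0)) \<and>
      (\<forall>b'\<in>Basis. continuous_on (ball x0 \<delta>) (G r b'))" if x0U: "x0 \<in> U" for x0
  proof -
    obtain \<rho> where \<rho>: "\<rho> > 0" "cball x0 \<rho> \<subseteq> U" using U x0U unfolding open_contains_cball by blast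
    define r where "r = \<rho> / 2"
    have r: "r > 0" "cball x0 (r + r) \<subseteq> U" using \<rho> by (auto simp: r_def)
    have der: "((\<lambda>s. g b (x + s *\<^sub>R b')) has_vector_derivative G r b' x) (at 0)"
      if x: "x \<in> ball x0 r" and b': "b' \<in> Basis" for x b'
    proof (rule has_vector_derivative_transform_within_open[where S = "{s. x + s *\<^sub>R b' \<in> ball x0 r}"])
      show "((\<lambda>s. (- 1 / (r * ?c)) *\<^sub>R integral bigbox (\<lambda>y. dbump b y *\<^sub>R f (x + s *\<^sub>R b' + r *\<^sub>R y)))
          has_vector_derivative G r b' x) (at 0)"
        unfolding G_def
        by (intro bounded_linear.has_vector_derivative[OF bounded_linear_scaleR_right]
            has_vector_derivative_parametric_integral[OF C1 U b' _ r(2) x])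
           (use r in \<open>auto intro: continuous_on_bump simp: bump_outside\<close>)
      show "open {s. x + s *\<^sub>R b' \<in> ball x0 r}"
        unfolding mem_ball by (intro open_Collect_less continuous_intros)
      show "(- 1 / (r * ?c)) *\<^sub>R integral bigbox (\<lambda>y. dbump b y *\<^sub>R f (x + s *\<^sub>R b' + r *\<^sub>R y)) = g b (x + s *\<^sub>R b')"
        if "s \<in> {s. x + s *\<^sub>R b' \<in> ball x0 r}" for s
        using regular_gradient_formula[OF reg U b r(1) r(1) r(2), of "x + s *\<^sub>R b'"] that by simp
    qed (use x in auto)
    have "continuous_on (ball x0 r) (G r b')" if "b' \<in> Basis" for b'
      unfolding G_def
      by (intro continuous_on_scaleR continuous_on_const continuous_on_parametric_integral[OF _ U _ r(2)])
         (use C1 that r in \<open>auto simp: C1_on_def bump_outside intro: continuous_on_bump\<close>)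
    with der r show ?thesis by blast
  qed
  have 1: "C1_on U (g b) ?g2"
    unfolding C1_on_def
  proof (intro ballI conjI)
    fix b' :: 'b assume b': "b' \<in> Basis"
    show "((\<lambda>s. g b (x + s *\<^sub>R b')) has_vector_derivative ?g2 b' x) (at 0)" if "x \<in> U" for x
      using loc[OF that] b' by (metis centre_in_ball vector_derivative_at)
    show "continuous_on U (?g2 b')"
      unfolding continuous_on_eq_continuous_at[OF U]
    proof
      fix x assume "x \<in> U"
      then obtain r \<delta> where r: "\<delta> > 0" "\<forall>z\<in>ball x \<delta>. ((\<lambda>s. g b (z + s *\<^sub>R b')) has_vector_derivative G r b' z) (at 0)"
        "continuous_on (ball x \<delta>) (G r b')" using loc b' by metis
      have "continuous_on (ball x \<delta>) (?g2 b')"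
        by (rule continuous_on_eq[OF r(3)]) (use r(2) vector_derivative_at in fastforce)
      then show "isCont (?g2 b') x" using r(1) by (simp add: continuous_on_eq_continuous_at)
    qed
  qed
  have 2: "(\<Sum>b'\<in>I. e b' * ?g2 b' x) = 0 \<and> (\<forall>b'\<in>Basis - I. ?g2 b' x = 0)" if x: "x \<in> U" for x
  proof -
    from loc[OF x] obtain r \<delta> where r: "r > 0" "\<delta> > 0" "cball x (\<delta> + r) \<subseteq> U"
      and der: "\<And>b'. b' \<in> Basis \<Longrightarrow> ((\<lambda>s. g b (x + s *\<^sub>R b')) has_vector_derivative G r b' x) (at 0)"
      by (meson centre_in_ball)
    have g2: "?g2 b' x = G r b' x" if "b' \<in> Basis" for b' using der[OF that] vector_derivative_at by blast
    have YZ: "x + r *\<^sub>R y \<in> U" if "norm y \<le> 1" for y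
      using scaled_point_in_cball[OF that _ order_refl, of r x] r by (auto simp: subset_eq)
    have int: "(\<lambda>y. dbump b y *\<^sub>R g b' (x + r *\<^sub>R y)) integrable_on bigbox" if "b' \<in> Basis" for b'
      by (intro integrable_continuous continuous_on_cutoff[where U = U])
         (use C1 that U YZ in \<open>auto simp: C1_on_def bump_outside intro!: continuous_intros continuous_on_bump\<close>)
    have "(\<Sum>b'\<in>I. e b' * integral bigbox (\<lambda>y. dbump b y *\<^sub>R g b' (x + r *\<^sub>R y)))
        = (\<Sum>b'\<in>I. integral bigbox (\<lambda>y. e b' * (dbump b y *\<^sub>R g b' (x + r *\<^sub>R y))))"
      by (intro sum.cong refl integral_linear[OF int bounded_linear_mult_left_fin, unfolded o_def, symmetric]) (use I in auto)
    also have "\<dots> = integral bigbox (\<lambda>y. \<Sum>b'\<in>I. e b' * (dbump b y *\<^sub>R g b' (x + r *\<^sub>R y)))"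
      by (rule integral_sum[symmetric])
         (use finite_I integrable_linear[OF int bounded_linear_mult_left_fin, unfolded o_def] I in auto)
    also have "\<dots> = integral bigbox (\<lambda>y::'b. 0::'a)"
    proof (rule integral_cong)
      fix y :: 'b
      have "(\<Sum>b'\<in>I. e b' * (dbump b y *\<^sub>R g b' (x + r *\<^sub>R y))) = dbump b y *\<^sub>R (\<Sum>b'\<in>I. e b' * g b' (x + r *\<^sub>R y))"
        by (simp add: scaleR_sum_right)
      also have "\<dots> = 0" using YZ[of y] reg by (cases "norm y \<le> 1") (auto simp: regular_def bump_outside)
      finally show "(\<Sum>b'\<in>I. e b' * (dbump b y *\<^sub>R g b' (x + r *\<^sub>R y))) = 0" .
    qed
    finally have "(\<Sum>b'\<in>I. e b' * integral bigbox (\<lambda>y. dbump b y *\<^sub>R g b' (x + r *\<^sub>R y))) = 0" by simp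
    moreover have "(\<Sum>b'\<in>I. e b' * ?g2 b' x) =
       (- 1 / (r * ?c)) *\<^sub>R (\<Sum>b'\<in>I. e b' * integral bigbox (\<lambda>y. dbump b y *\<^sub>R g b' (x + r *\<^sub>R y)))"
      by (rule trans[OF _ scaleR_sum_right[symmetric]], intro sum.cong refl) (use I in \<open>auto simp: g2 G_def subset_iff\<close>)
    moreover have "?g2 b' x = 0" if "b' \<in> Basis - I" for b'
    proof -
      have "(\<lambda>y. dbump b y *\<^sub>R g b' (x + r *\<^sub>R y)) = (\<lambda>y. 0)"
      proof
        fix y show "dbump b y *\<^sub>R g b' (x + r *\<^sub>R y) = 0"
          using YZ[of y] reg that by (cases "norm y \<le> 1") (auto simp: regular_def bump_outside)
      qed
      then show ?thesis using that by (simp add: g2 G_def)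
    qed
    ultimately show ?thesis by simp
  qed
  show ?thesis unfolding regular_def using 1 2 by blast
qed

lemma abs_dbump_le:
  fixes y :: "'d::euclidean_space" assumes "b \<in> Basis" shows "\<bar>dbump b y\<bar> \<le> 4"
proof (cases "norm y \<ge> 1")
  case False
  have "\<bar>y \<bullet> b\<bar> \<le> 1" using Basis_le_norm[OF assms, of y] False by linarith
  moreover have "\<bar>max 0 (1 - (norm y)^2)\<bar> \<le> 1" by auto
  ultimately have "\<bar>y \<bullet> b\<bar> * \<bar>max 0 (1 - (norm y)^2)\<bar> \<le> 1" by (intro mult_le_one) auto
  then show ?thesis by (simp add: dbump_def abs_mult)
qed (simp add: bump_outside)

text \<open>A Cauchy estimate. The constant is fixed before the domain, the function and the radius,
  so that the estimate can be iterated in \<open>dword_bound\<close>.\<close>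

lemma regular_gradient_bound:
  obtains C where "C > 0" "\<And>U f g b x r M. regular U f g \<Longrightarrow> open U \<Longrightarrow> b \<in> Basis \<Longrightarrow> r > 0 \<Longrightarrow> cball x r \<subseteq> U \<Longrightarrow>
      (\<And>z. z \<in> cball x r \<Longrightarrow> norm (f z) \<le> M) \<Longrightarrow> norm (g b x) \<le> C / r * M"
proof -
  let ?c = "integral bigbox (bump :: 'b \<Rightarrow> real)" and ?v = "measure lborel (bigbox :: 'b set)"
  have c: "?c > 0" by (rule integral_bump_pos)
  have v: "?v \<ge> 0" by (rule measure_nonneg)
  \<comment> \<open>\<open>4\<close> bounds \<open>dbump\<close>, a further \<open>2\<close> comes
    from the radius \<open>s = r / 2\<close>, and the summand \<open>1\<close> makes the constant
    positive without computing a volume.\<close>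
  define C where "C = 8 * ?v / ?c + 1"
  show ?thesis
  proof (rule that[of C])
    show "C > 0" using c v by (simp add: C_def add_nonneg_pos)
    fix U :: "'b set" and f g r M and b x :: 'b
    assume reg: "regular U f g" and U: "open U" and b: "b \<in> Basis" and r: "r > 0" and x: "cball x r \<subseteq> U"
      and M: "\<And>z. z \<in> cball x r \<Longrightarrow> norm (f z) \<le> M"
    have C1: "C1_on U f g" using reg by (simp add: regular_def)
    have M0: "M \<ge> 0" using order_trans[OF norm_ge_zero M[of x]] r by simp
    define s where "s = r / 2"
    have s: "s > 0" "cball x (s + s) \<subseteq> U" "cball x s \<subseteq> cball x r" using r x by (auto simp: s_def)
    have YZ: "x + s *\<^sub>R y \<in> cball x r" if "norm y \<le> 1" for y
      using scaled_point_in_cball[OF that _ order_refl, of s x] s by (meson less_imp_le subsetD)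
    have bnd: "norm (dbump b y *\<^sub>R f (x + s *\<^sub>R y)) \<le> 4 * M" for y
    proof (cases "norm y \<le> 1")
      case True
      then show ?thesis using abs_dbump_le[OF b, of y] M[OF YZ[OF True]] by (auto intro!: mult_mono)
    next
      case False then show ?thesis using M0 by (simp add: bump_outside)
    qed
    have int: "(\<lambda>y. dbump b y *\<^sub>R f (x + s *\<^sub>R y)) integrable_on bigbox"
      by (intro integrable_continuous continuous_on_cutoff[where U = U])
         (use C1_on_continuous_on[OF C1 U] U YZ x in \<open>auto simp: bump_outside intro!: continuous_intros continuous_on_bump\<close>)
    have "norm (integral bigbox (\<lambda>y. dbump b y *\<^sub>R f (x + s *\<^sub>R y))) \<le> (4 * M) * ?v"
      by (rule has_integral_bound[OF _ integrable_integral[OF int]]) (use M0 bnd in auto)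
    then have "norm (g b x) \<le> (1 / (s * ?c)) * ((4 * M) * ?v)"
      unfolding regular_gradient_formula[OF reg U b s(1) s(1) s(2) centre_in_ball[THEN iffD2, OF s(1)]]
      using s c by (simp add: mult_left_mono field_simps)
    also have "\<dots> = (8 * ?v / ?c) / r * M" using r c by (simp add: s_def field_simps)
    also have "\<dots> \<le> C / r * M" using r M0 by (intro mult_right_mono divide_right_mono) (auto simp: C_def)
    finally show "norm (g b x) \<le> C / r * M" .
  qed
qed

end

section \<open>Coordinate sequences and points of a Euclidean space\<close>

locale coordinate_chart =
  fixes n :: nat and b :: "nat \<Rightarrow> 'b::euclidean_space"
  assumes inj: "inj_on b {..<n}" and bB: "b ` {..<n} \<subseteq> Basis"
begin

definition coord :: "'b \<Rightarrow> nat \<Rightarrow> real" where "coord x = (\<lambda>i. if i < n then x \<bullet> b i else 0)"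
definition point :: "(nat \<Rightarrow> real) \<Rightarrow> 'b" where "point y = (\<Sum>i<n. y i *\<^sub>R b i)"

lemma b_Basis: "i < n \<Longrightarrow> b i \<in> Basis" using bB by auto

lemma b_inner: "i < n \<Longrightarrow> j < n \<Longrightarrow> b i \<bullet> b j = (if i = j then 1 else 0)"
  using inj by (auto simp: inner_Basis b_Basis inj_on_def)

lemma point_inner: assumes "j < n" shows "point y \<bullet> b j = y j"
proof -
  have "point y \<bullet> b j = (\<Sum>i<n. y i * (b i \<bullet> b j))" by (simp add: point_def inner_sum_left)
  also have "\<dots> = (\<Sum>i<n. if i = j then y i else 0)" using assms by (intro sum.cong) (auto simp: b_inner)
  also have "\<dots> = y j" using assms by (simp add: sum.delta)
  finally show ?thesis .
qed

lemma point_inner_other: assumes "c \<in> Basis" "c \<notin> b ` {..<n}" shows "point y \<bullet> c = 0"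
  unfolding point_def inner_sum_left
  by (rule sum.neutral) (use assms b_Basis in \<open>auto simp: inner_Basis image_iff\<close>)

lemma coord_in_Ecoord: "coord x \<in> Ecoord n" by (auto simp: coord_def Ecoord_def)

lemma coord_point: "y \<in> Ecoord n \<Longrightarrow> coord (point y) = y"
  by (auto simp: coord_def Ecoord_def point_inner fun_eq_iff)

lemma coord_step: "i < n \<Longrightarrow> coord (x + s *\<^sub>R b i) = (coord x)(i := coord x i + s)"
  by (auto simp: coord_def fun_eq_iff inner_simps b_inner)

lemma coord_step_other: "c \<in> Basis \<Longrightarrow> c \<notin> b ` {..<n} \<Longrightarrow> coord (x + s *\<^sub>R c) = coord x"
  using b_Basis by (auto simp: coord_def fun_eq_iff inner_simps inner_Basis image_iff)

lemma coord_add: "coord (x + s *\<^sub>R z) = (\<lambda>i. coord x i + s * coord z i)"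
  by (auto simp: coord_def fun_eq_iff inner_simps)

lemma continuous_on_coord: "continuous_on S coord"
  unfolding coord_def
proof (rule continuous_on_coordinatewise_then_product)
  show "continuous_on S (\<lambda>x. if i < n then x \<bullet> b i else 0)" for i
    by (cases "i < n") (auto intro!: continuous_intros)
qed

lemma continuous_on_point: "continuous_on S point"
  unfolding point_def
  by (intro continuous_intros continuous_on_subset[OF continuous_on_product_coordinates]) auto

lemma open_coord_vimage:
  assumes "openin (top_of_set (Ecoord n)) D" shows "open (coord -` D)"
proof -
  obtain T where T: "open T" "D = Ecoord n \<inter> T" using assms by (auto simp: openin_open)
  have "coord -` D = coord -` T" using T coord_in_Ecoord by auto
  then show ?thesis using T continuous_on_coord[of UNIV] by (simp add: continuous_on_open_vimage)
qed

lemma Ck1_imp_C1_on: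
  fixes F :: "(nat \<Rightarrow> real) \<Rightarrow> 'c::real_normed_vector"
  assumes F: "Ck 1 n D F"
  shows "C1_on (coord -` D) (F \<circ> coord)
     (\<lambda>c x. if c \<in> b ` {..<n} then pderiv_c (the_inv_into {..<n} b c) F (coord x) else 0)"
  unfolding C1_on_def
proof (intro ballI conjI)
  fix c :: 'b assume c: "c \<in> Basis"
  show "continuous_on (coord -` D) (\<lambda>x. if c \<in> b ` {..<n} then pderiv_c (the_inv_into {..<n} b c) F (coord x) else 0)"
  proof (cases "c \<in> b ` {..<n}")
    case True
    then have "the_inv_into {..<n} b c < n" using the_inv_into_into[OF inj True order_refl] by simp
    then have "continuous_on D (pderiv_c (the_inv_into {..<n} b c) F)" using F by simp
    then show ?thesis using True by (simp add: continuous_on_compose2[OF _ continuous_on_coord])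
  qed simp
  fix x assume x: "x \<in> coord -` D"
  show "((\<lambda>s. (F \<circ> coord) (x + s *\<^sub>R c)) has_vector_derivative
      (if c \<in> b ` {..<n} then pderiv_c (the_inv_into {..<n} b c) F (coord x) else 0)) (at 0)"
  proof (cases "c \<in> b ` {..<n}")
    case True
    then obtain i where i: "i < n" "c = b i" by auto
    then have inv: "the_inv_into {..<n} b c = i" using the_inv_into_f_f[OF inj] by simp
    have "(\<lambda>s. F ((coord x)(i := coord x i + s))) differentiable (at 0)" using F x i by simp
    then show ?thesis using True i inv by (simp add: coord_step pderiv_c_def vector_derivative_works)
  qed (use c in \<open>simp add: coord_step_other\<close>)
qed

text \<open>The path is carried to a line in the Euclidean space, where continuous partial
  derivatives are already known to give a total derivative.\<close>

lemma Ck1_has_vector_derivative_along: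
  fixes F :: "(nat \<Rightarrow> real) \<Rightarrow> 'c::real_normed_vector"
  assumes F: "Ck 1 n D F" and D: "openin (top_of_set (Ecoord n)) D"
    and y: "y \<in> Ecoord n" "h \<in> Ecoord n" "(\<lambda>i. y i + s * h i) \<in> D"
  shows "((\<lambda>s. F (\<lambda>i. y i + s * h i)) has_vector_derivative
      (\<Sum>i<n. h i *\<^sub>R pderiv_c i F (\<lambda>i. y i + s * h i))) (at s)"
proof -
  have eq: "coord (point y + s *\<^sub>R point h) = (\<lambda>i. y i + s * h i)" for s
    using y by (simp add: coord_add coord_point)
  let ?g = "\<lambda>c x. if c \<in> b ` {..<n} then pderiv_c (the_inv_into {..<n} b c) F (coord x) else 0"
  have "((\<lambda>s. (F \<circ> coord) (point y + s *\<^sub>R point h)) has_vector_derivative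
     (\<Sum>c\<in>Basis. (point h \<bullet> c) *\<^sub>R ?g c (point y + s *\<^sub>R point h))) (at s)"
    by (rule C1_on_has_vector_derivative_along[OF Ck1_imp_C1_on[OF F] open_coord_vimage[OF D]]) (use y eq in simp)
  also have "(\<Sum>c\<in>Basis. (point h \<bullet> c) *\<^sub>R ?g c (point y + s *\<^sub>R point h))
     = (\<Sum>c\<in>b ` {..<n}. (point h \<bullet> c) *\<^sub>R ?g c (point y + s *\<^sub>R point h))"
    by (rule sum.mono_neutral_right) (use bB in auto)
  also have "\<dots> = (\<Sum>i<n. h i *\<^sub>R pderiv_c i F (\<lambda>i. y i + s * h i))"
    by (subst sum.reindex[OF inj]) (auto intro!: sum.cong simp: eq point_inner the_inv_into_f_f[OF inj])
  finally show ?thesis by (simp add: eq)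
qed

end

definition clifford_sys :: "nat \<Rightarrow> (nat \<Rightarrow> 'a::real_algebra_1) \<Rightarrow> bool" where
  "clifford_sys n e \<longleftrightarrow> e 0 = 1 \<and> (\<forall>i\<in>{1..<n}. e i * e i = - 1) \<and>
     (\<forall>i\<in>{1..<n}. \<forall>j\<in>{1..<n}. i \<noteq> j \<longrightarrow> e i * e j = - (e j * e i))"

text \<open>Clifford conjugation: the first-order operator with coefficients
  \<open>cconj e i\<close>, composed with the one with coefficients \<open>e i\<close>, is the
  Laplacian.\<close>

definition cconj :: "(nat \<Rightarrow> 'a::real_algebra_1) \<Rightarrow> nat \<Rightarrow> 'a" where
  "cconj e i = (if i = 0 then 1 else - e i)"

lemma clifford_sysD:
  assumes "clifford_sys n e"
  shows "e 0 = 1" "\<And>i. 0 < i \<Longrightarrow> i < n \<Longrightarrow> e i * e i = - 1"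
    "\<And>i j. 0 < i \<Longrightarrow> i < n \<Longrightarrow> 0 < j \<Longrightarrow> j < n \<Longrightarrow> i \<noteq> j \<Longrightarrow> e i * e j = - (e j * e i)"
proof -
  show "e 0 = 1" using assms unfolding clifford_sys_def by blast
  show "e i * e i = - 1" if "0 < i" "i < n" for i
    using assms that unfolding clifford_sys_def by (metis One_nat_def Suc_leI atLeastLessThan_iff)
  show "e i * e j = - (e j * e i)" if "0 < i" "i < n" "0 < j" "j < n" "i \<noteq> j" for i j
    using assms that unfolding clifford_sys_def by (metis One_nat_def Suc_leI atLeastLessThan_iff)
qed

lemma cconj_mult:
  assumes "clifford_sys n e" "i < n" shows "cconj e i * e i = 1"
  using clifford_sysD(1,2)[OF assms(1)] assms(2) by (cases "i = 0") (simp_all add: cconj_def)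

lemma cconj_anti:
  assumes e: "clifford_sys n e" "i < n" "j < n" "i \<noteq> j" shows "cconj e i * e j + cconj e j * e i = 0"
proof -
  consider "i = 0" "j > 0" | "j = 0" "i > 0" | "i > 0" "j > 0" using e by blast
  then show ?thesis
  proof cases
    case 3
    then show ?thesis using clifford_sysD(3)[OF e(1), of i j] e by (simp add: cconj_def)
  qed (simp_all add: cconj_def clifford_sysD(1)[OF e(1)])
qed

text \<open>If a combination of the \<open>e i\<close> with coefficients \<open>c i\<close>
  vanishes, then \<open>clifford_trace\<close> with entries \<open>c a * c b\<close> shows that the
  sum of the squares of the \<open>c i\<close> vanishes. So the \<open>e i\<close> are independent,
  and \<open>'a\<close> has room for \<open>n\<close> orthonormal coordinates: it can itself be the
  space over which one integrates.\<close>

lemma clifford_sys_le_DIM: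
  fixes e :: "nat \<Rightarrow> 'a::{real_algebra_1,euclidean_space}"
  assumes e: "clifford_sys n e" shows "n \<le> DIM('a)"
proof -
  have zero: "c i = 0" if "(\<Sum>i<n. c i *\<^sub>R e i) = 0" "i < n" for c :: "nat \<Rightarrow> real" and i
  proof -
    have "(\<Sum>a<n. cconj e a * (\<Sum>j<n. e j * (c a * c j) *\<^sub>R 1)) = (\<Sum>a<n. (c a * c a) *\<^sub>R 1)"
      by (rule clifford_trace) (use e in \<open>auto simp: cconj_mult cconj_anti mult.commute\<close>)
    moreover have "(\<Sum>j<n. e j * (c a * c j) *\<^sub>R 1) = c a *\<^sub>R (\<Sum>j<n. c j *\<^sub>R e j)" for a
      by (simp add: scaleR_sum_right)
    ultimately have "(\<Sum>a<n. (c a * c a) *\<^sub>R (1::'a)) = 0" using that by simp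
    then have "(\<Sum>a<n. c a * c a) *\<^sub>R (1::'a) = 0" by (simp add: scaleR_sum_left)
    then have "(\<Sum>a<n. c a * c a) = 0" by simp
    then show ?thesis using that by (subst (asm) sum_nonneg_eq_0_iff) auto
  qed
  have inj: "inj_on e {..<n}"
  proof (rule inj_onI, rule ccontr)
    fix i j assume ij: "i \<in> {..<n}" "j \<in> {..<n}" "e i = e j" "i \<noteq> j"
    define c where "c k = (if k = i then 1 else 0) - (if k = j then 1 else (0::real))" for k
    have "(\<Sum>k<n. c k *\<^sub>R e k) = 0"
      using ij by (simp add: c_def scaleR_diff_left sum_subtractf if_distrib[of "\<lambda>u. u *\<^sub>R _"] sum.delta cong: if_cong)
    from zero[OF this, of i] ij show False by (simp add: c_def)
  qed
  have "independent (e ` {..<n})"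
  proof
    assume "dependent (e ` {..<n})"
    then obtain u i where "i < n" "u (e i) \<noteq> 0" "(\<Sum>v\<in>e ` {..<n}. u v *\<^sub>R v) = 0"
      by (auto simp: dependent_finite)
    then show False using zero[of "\<lambda>i. u (e i)" i] by (simp add: sum.reindex[OF inj])
  qed
  then show ?thesis using independent_bound[of "e ` {..<n}"] card_image[OF inj] by simp
qed

lemma ex_coordinate_chart:
  assumes "n \<le> DIM('b::euclidean_space)"
  obtains b :: "nat \<Rightarrow> 'b::euclidean_space" where "coordinate_chart n b"
proof -
  obtain h :: "nat \<Rightarrow> 'b" where h: "bij_betw h {0..<DIM('b)} Basis"
    using ex_bij_betw_nat_finite[OF finite_Basis] by blast
  have "coordinate_chart n h"
    using h assms by unfold_locales (auto simp: bij_betw_def elim: inj_on_subset)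
  then show thesis by (rule that)
qed

definition cregular :: "nat \<Rightarrow> (nat \<Rightarrow> 'a::{real_algebra_1,euclidean_space}) \<Rightarrow> (nat \<Rightarrow> real) set \<Rightarrow> ((nat \<Rightarrow> real) \<Rightarrow> 'a) \<Rightarrow> bool" where
  "cregular n e D F \<longleftrightarrow> Ck 1 n D F \<and> (\<forall>y\<in>D. (\<Sum>i<n. e i * pderiv_c i F y) = 0)"

locale clifford_chart = coordinate_chart n b for n and b :: "nat \<Rightarrow> 'a::{real_algebra_1,euclidean_space}" +
  fixes e :: "nat \<Rightarrow> 'a"
  assumes e: "clifford_sys n e"
begin

abbreviation "ix \<equiv> the_inv_into {..<n} b"

lemma ix: "i < n \<Longrightarrow> ix (b i) = i" using the_inv_into_f_f[OF inj] by simp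

sublocale clifford_family "b ` {..<n}" "\<lambda>c. e (ix c)" "\<lambda>c. cconj e (ix c)"
proof unfold_locales
  show "cconj e (ix c) * e (ix c) = 1" if "c \<in> b ` {..<n}" for c
    using that e by (auto simp: ix cconj_mult)
  show "cconj e (ix c) * e (ix d) + cconj e (ix d) * e (ix c) = 0"
    if cd: "c \<in> b ` {..<n}" "d \<in> b ` {..<n}" "c \<noteq> d" for c d
  proof -
    obtain i j where ij: "i < n" "c = b i" "j < n" "d = b j" using cd by auto
    moreover have "i \<noteq> j" using ij cd by auto
    ultimately show ?thesis using cconj_anti[OF e, of i j] by (simp add: ix)
  qed
qed (rule bB)

abbreviation "gr F \<equiv> \<lambda>c x. if c \<in> b ` {..<n} then pderiv_c (ix c) F (coord x) else 0"

lemma cregular_imp_regular: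
  assumes F: "cregular n e D F" shows "regular (coord -` D) (F \<circ> coord) (gr F)"
  unfolding regular_def
proof (intro conjI ballI)
  show "C1_on (coord -` D) (F \<circ> coord) (gr F)" by (rule Ck1_imp_C1_on) (use F in \<open>simp add: cregular_def\<close>)
  fix x assume x: "x \<in> coord -` D"
  have "(\<Sum>c\<in>b ` {..<n}. e (ix c) * gr F c x) = (\<Sum>i<n. e i * pderiv_c i F (coord x))"
    by (subst sum.reindex[OF inj]) (auto intro!: sum.cong simp: ix)
  also have "\<dots> = 0" using F x by (simp add: cregular_def)
  finally show "(\<Sum>c\<in>b ` {..<n}. e (ix c) * gr F c x) = 0" .
qed auto

text \<open>\<open>regular_derivative\<close> in coordinates: differentiation preserves the
  solutions of one and the same equation, so all orders of smoothness follow by induction.\<close>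

lemma cregular_pderiv:
  assumes F: "cregular n e D F" and D: "openin (top_of_set (Ecoord n)) D" and i: "i < n"
  shows "cregular n e D (pderiv_c i F)"
proof -
  let ?U = "coord -` D" and ?F = "pderiv_c i F"
  have DE: "D \<subseteq> Ecoord n" using D openin_imp_subset by blast
  have "regular ?U (gr F (b i)) (\<lambda>c x. vector_derivative (\<lambda>s. gr F (b i) (x + s *\<^sub>R c)) (at 0))"
    by (rule regular_derivative[OF cregular_imp_regular[OF F] open_coord_vimage[OF D] b_Basis[OF i]])
  then have reg: "regular ?U (?F \<circ> coord) (\<lambda>c x. vector_derivative (\<lambda>s. (?F \<circ> coord) (x + s *\<^sub>R c)) (at 0))"
    using i by (simp add: ix o_def)
  have vd: "vector_derivative (\<lambda>s. (?F \<circ> coord) (x + s *\<^sub>R b j)) (at 0) = pderiv_c j ?F (coord x)" if "j < n" for j x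
    using that by (simp add: coord_step pderiv_c_def[of j])
  have inU: "point y \<in> ?U" if "y \<in> D" for y using that DE by (auto simp: coord_point)
  have hvd: "((\<lambda>s. ?F (y(j := y j + s))) has_vector_derivative pderiv_c j ?F y) (at 0)" if "y \<in> D" "j < n" for y j
  proof -
    have "((\<lambda>s. (?F \<circ> coord) (point y + s *\<^sub>R b j)) has_vector_derivative
       vector_derivative (\<lambda>s. (?F \<circ> coord) (point y + s *\<^sub>R b j)) (at 0)) (at 0)"
      using reg inU[OF that(1)] b_Basis[OF that(2)] by (auto simp: regular_def C1_on_def)
    then show ?thesis unfolding vd[OF that(2)] using that DE by (simp add: coord_step coord_point subset_iff)
  qed
  have cont: "continuous_on D (pderiv_c j ?F)" if "j < n" for j
  proof -
    have "continuous_on ?U (\<lambda>x. vector_derivative (\<lambda>s. (?F \<circ> coord) (x + s *\<^sub>R b j)) (at 0))"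
      using reg b_Basis[OF that] unfolding regular_def C1_on_def by blast
    then have "continuous_on ?U (\<lambda>x. pderiv_c j ?F (coord x))" unfolding vd[OF that] .
    then have "continuous_on D (\<lambda>y. pderiv_c j ?F (coord (point y)))"
      by (rule continuous_on_compose2[OF _ continuous_on_point]) (use inU in auto)
    then show ?thesis by (rule continuous_on_eq) (use DE in \<open>auto simp: coord_point\<close>)
  qed
  have "(\<Sum>j<n. e j * pderiv_c j ?F y) = 0" if "y \<in> D" for y
  proof -
    have "(\<Sum>c\<in>b ` {..<n}. e (ix c) * vector_derivative (\<lambda>s. (?F \<circ> coord) (point y + s *\<^sub>R c)) (at 0)) = 0"
      using reg inU[OF that] unfolding regular_def by blast
    then show ?thesis
      using that DE by (simp add: sum.reindex[OF inj] ix vd[unfolded o_def] coord_point subset_iff)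
  qed
  moreover have "continuous_on D ?F" using F i by (simp add: cregular_def)
  ultimately show ?thesis using hvd cont by (auto simp: cregular_def intro: differentiableI_vector)
qed

lemma cregular_Ck:
  assumes D: "openin (top_of_set (Ecoord n)) D" and F: "cregular n e D F"
  shows "Ck k n D F"
  using F
proof (induction k arbitrary: F)
  case 0
  then show ?case by (simp add: cregular_def)
next
  case (Suc k)
  then show ?case using cregular_pderiv[OF _ D] by (simp add: cregular_def)
qed

text \<open>Cubes rather than balls, because \<open>real_analytic_c\<close> measures distances
  coordinate by coordinate.\<close>

definition cube :: "(nat \<Rightarrow> real) \<Rightarrow> real \<Rightarrow> (nat \<Rightarrow> real) set" where
  "cube y r = {z \<in> Ecoord n. \<forall>j<n. \<bar>z j - y j\<bar> \<le> r}"

lemma cregular_pderiv_bound: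
  obtains C where "C > 0" "\<And>D F i y r M. cregular n e D F \<Longrightarrow> openin (top_of_set (Ecoord n)) D \<Longrightarrow> i < n \<Longrightarrow>
     r > 0 \<Longrightarrow> y \<in> D \<Longrightarrow> cube y r \<subseteq> D \<Longrightarrow> (\<And>z. z \<in> cube y r \<Longrightarrow> norm (F z) \<le> M) \<Longrightarrow> norm (pderiv_c i F y) \<le> C / r * M"
proof -
  obtain C where C: "C > 0" "\<And>U f g b' x r M. regular U f g \<Longrightarrow> open U \<Longrightarrow> b' \<in> Basis \<Longrightarrow> r > 0 \<Longrightarrow> cball x r \<subseteq> U \<Longrightarrow>
      (\<And>z. z \<in> cball x r \<Longrightarrow> norm (f z) \<le> M) \<Longrightarrow> norm (g b' x) \<le> C / r * M"
    using regular_gradient_bound by blast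
  show thesis
  proof (rule that[OF C(1)])
    fix D F i y r M
    assume F: "cregular n e D F" and D: "openin (top_of_set (Ecoord n)) D" and i: "i < n" and r: "r > 0"
      and y: "y \<in> D" "cube y r \<subseteq> D" and M: "\<And>z. z \<in> cube y r \<Longrightarrow> norm (F z) \<le> M"
    have yE: "y \<in> Ecoord n" using D y openin_imp_subset by blast
    have cb: "coord z \<in> cube y r" if z: "z \<in> cball (point y) r" for z
    proof -
      have "\<bar>coord z j - y j\<bar> \<le> r" if j: "j < n" for j
      proof -
        have "\<bar>coord z j - y j\<bar> = \<bar>(z - point y) \<bullet> b j\<bar>" using j by (simp add: coord_def inner_diff_left point_inner)
        also have "\<dots> \<le> norm (z - point y)" by (rule Basis_le_norm[OF b_Basis[OF j]])
        also have "\<dots> \<le> r" using z by (simp add: dist_norm norm_minus_commute)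
        finally show ?thesis .
      qed
      then show ?thesis by (simp add: cube_def coord_in_Ecoord)
    qed
    have "norm (gr F (b i) (point y)) \<le> C / r * M"
      by (rule C(2)[OF cregular_imp_regular[OF F] open_coord_vimage[OF D] b_Basis[OF i] r])
         (use subsetD[OF y(2) cb] M[OF cb] in auto)
    then show "norm (pderiv_c i F y) \<le> C / r * M" using i yE by (simp add: ix coord_point)
  qed
qed

end

section \<open>Iterated derivatives and Taylor series\<close>

fun dword :: "nat list \<Rightarrow> ((nat \<Rightarrow> real) \<Rightarrow> 'a::real_normed_vector) \<Rightarrow> (nat \<Rightarrow> real) \<Rightarrow> 'a" where
  "dword [] F = F"
| "dword (i # w) F = dword w (pderiv_c i F)"

lemma dword_snoc: "dword (w @ [i]) F = pderiv_c i (dword w F)"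
  by (induction w arbitrary: F) auto

text \<open>Derivatives are indexed by words, so the Taylor terms arise without rearranging partial
  derivatives; words with equal letter counts are collected only at the end, in
  \<open>has_sum_words_by_multiindex\<close>.\<close>

definition words :: "nat \<Rightarrow> nat \<Rightarrow> nat list set" where
  "words n k = {w. set w \<subseteq> {..<n} \<and> length w = k}"

lemma finite_words: "finite (words n k)" and card_words: "card (words n k) = n ^ k"
  using finite_lists_length_eq[of "{..<n}" k] card_lists_length_eq[of "{..<n}" k] by (simp_all add: words_def)

lemma words_Suc: "words n (Suc k) = (\<lambda>(w, i). w @ [i]) ` (words n k \<times> {..<n})"
proof
  show "words n (Suc k) \<subseteq> (\<lambda>(w, i). w @ [i]) ` (words n k \<times> {..<n})"
  proof
    fix w assume w: "w \<in> words n (Suc k)"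
    then have "w \<noteq> []" by (auto simp: words_def)
    then obtain u i where u: "w = u @ [i]" by (metis append_butlast_last_id)
    then have "(u, i) \<in> words n k \<times> {..<n}" using w by (auto simp: words_def)
    then show "w \<in> (\<lambda>(w, i). w @ [i]) ` (words n k \<times> {..<n})" using u by force
  qed
qed (auto simp: words_def)

lemma sum_words_Suc: "(\<Sum>w\<in>words n (Suc k). g w) = (\<Sum>w\<in>words n k. \<Sum>i<n. g (w @ [i]))"
  unfolding words_Suc sum.cartesian_product
  by (subst sum.reindex) (auto simp: inj_on_def intro!: sum.cong)

lemma prod_list_map_power:
  fixes h :: "nat \<Rightarrow> real"
  assumes "set w \<subseteq> {..<n}" shows "prod_list (map h w) = (\<Prod>i<n. h i ^ count_list w i)"
  using assms
proof (induction w)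
  case (Cons a w)
  have "(\<Prod>i<n. h i ^ count_list (a # w) i) = (\<Prod>i<n. (if i = a then h i else 1) * h i ^ count_list w i)"
    by (intro prod.cong) auto
  also have "\<dots> = h a * (\<Prod>i<n. h i ^ count_list w i)"
    using Cons.prems by (simp add: prod.distrib prod.delta)
  finally show ?case using Cons by simp
qed simp

lemma abs_prod_list_le:
  fixes h :: "nat \<Rightarrow> real"
  assumes "\<And>i. i \<in> set w \<Longrightarrow> \<bar>h i\<bar> \<le> r" "r \<ge> 0" shows "\<bar>prod_list (map h w)\<bar> \<le> r ^ length w"
  using assms by (induction w) (auto simp: abs_mult intro!: mult_mono)

text \<open>A single term of the exponential series. It turns the factor \<open>k ^ k\<close> left
  by \<open>k\<close> successive Cauchy estimates into a factorial times a geometric factor.\<close>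

lemma power_self_le_exp_fact: "real k ^ k \<le> exp (real k) * fact k"
proof -
  have s: "(\<lambda>n. real k ^ n /\<^sub>R fact n) sums exp (real k)" by (rule exp_converges)
  have "(\<Sum>n\<in>{k}. real k ^ n /\<^sub>R fact n) \<le> (\<Sum>n. real k ^ n /\<^sub>R fact n)"
    by (rule sum_le_suminf) (use s in \<open>auto simp: sums_iff\<close>)
  then have "real k ^ k / fact k \<le> exp (real k)" using s by (simp add: sums_iff field_simps)
  then show ?thesis by (simp add: field_simps)
qed

context clifford_chart begin

lemma cregular_dword:
  assumes D: "openin (top_of_set (Ecoord n)) D" and F: "cregular n e D F" and w: "set w \<subseteq> {..<n}"
  shows "cregular n e D (dword w F)"
  using F w by (induction w arbitrary: F) (auto intro: cregular_pderiv[OF _ D])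

lemma cube_mono: "z \<in> cube y s \<Longrightarrow> cube z r \<subseteq> cube y (s + r)"
  unfolding cube_def by (auto, smt (verit))

text \<open>A derivative of order \<open>k\<close> is bounded by \<open>k\<close> Cauchy estimates,
  each spending the radius \<open>\<delta> / k\<close>. This gives
  \<open>(C * k / \<delta>) ^ k * M\<close>, and \<open>power_self_le_exp_fact\<close> leaves the
  growth that a convergent Taylor series tolerates.\<close>

lemma dword_bound:
  obtains A where "A > 0" "\<And>D F y \<delta> M w. cregular n e D F \<Longrightarrow> openin (top_of_set (Ecoord n)) D \<Longrightarrow> \<delta> > 0 \<Longrightarrow>
     y \<in> D \<Longrightarrow> cube y \<delta> \<subseteq> D \<Longrightarrow> (\<And>z. z \<in> cube y \<delta> \<Longrightarrow> norm (F z) \<le> M) \<Longrightarrow> set w \<subseteq> {..<n} \<Longrightarrow>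
     norm (dword w F y) \<le> M * (A / \<delta>) ^ length w * fact (length w)"
proof -
  obtain C where C: "C > 0" "\<And>D F i y r M. cregular n e D F \<Longrightarrow> openin (top_of_set (Ecoord n)) D \<Longrightarrow> i < n \<Longrightarrow>
     r > 0 \<Longrightarrow> y \<in> D \<Longrightarrow> cube y r \<subseteq> D \<Longrightarrow> (\<And>z. z \<in> cube y r \<Longrightarrow> norm (F z) \<le> M) \<Longrightarrow> norm (pderiv_c i F y) \<le> C / r * M"
    using cregular_pderiv_bound by blast
  have step: "norm (dword w F y) \<le> (C / h) ^ length w * M"
    if D: "openin (top_of_set (Ecoord n)) D" and h: "h > 0" and F: "cregular n e D F" and w: "set w \<subseteq> {..<n}"
      and y: "y \<in> D" "cube y (length w * h) \<subseteq> D" and M: "\<And>z. z \<in> cube y (length w * h) \<Longrightarrow> norm (F z) \<le> M"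
    for D F w y M and h :: real
    using F w y M
  proof (induction w arbitrary: F M)
    case Nil
    then show ?case using openin_imp_subset[OF D] by (auto simp: cube_def)
  next
    case (Cons i w)
    have yE: "y \<in> Ecoord n" using openin_imp_subset[OF D] Cons.prems by auto
    have sub: "cube z h \<subseteq> cube y (length (i # w) * h)" if "z \<in> cube y (length w * h)" for z
      using cube_mono[OF that, of h] by (simp add: algebra_simps)
    have sub': "cube y (length w * h) \<subseteq> cube y (length (i # w) * h)"
      using h unfolding cube_def by (auto simp: algebra_simps intro: order_trans)
    have "norm (dword w (pderiv_c i F) y) \<le> (C / h) ^ length w * (C / h * M)"
    proof (rule Cons.IH)
      show "cregular n e D (pderiv_c i F)" using Cons.prems by (intro cregular_pderiv[OF _ D]) auto
      show "norm (pderiv_c i F z) \<le> C / h * M" if "z \<in> cube y (length w * h)" for z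
        by (rule C(2)[OF Cons.prems(1) D _ h]) (use that sub[OF that] sub' Cons.prems in auto)
    qed (use Cons.prems sub' in auto)
    then show ?case by (simp add: mult_ac)
  qed
  show thesis
  proof (rule that[of "C * exp 1"])
    show "C * exp 1 > 0" using C by simp
    fix D F y \<delta> M w
    assume F: "cregular n e D F" and D: "openin (top_of_set (Ecoord n)) D" and \<delta>: "\<delta> > 0" and y: "y \<in> D" "cube y \<delta> \<subseteq> D"
      and M: "\<And>z. z \<in> cube y \<delta> \<Longrightarrow> norm (F z) \<le> M" and w: "set w \<subseteq> {..<n}"
    have "y \<in> cube y \<delta>" using openin_imp_subset[OF D] y \<delta> by (auto simp: cube_def)
    then have M0: "M \<ge> 0" using order_trans[OF norm_ge_zero M] by blast
    show "norm (dword w F y) \<le> M * (C * exp 1 / \<delta>) ^ length w * fact (length w)"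
    proof (cases "w = []")
      case True
      then show ?thesis using M \<open>y \<in> cube y \<delta>\<close> by simp
    next
      case False
      define k where "k = length w"
      have k: "k > 0" using False by (simp add: k_def)
      have "norm (dword w F y) \<le> (C / (\<delta> / k)) ^ length w * M"
        by (rule step[OF D _ F w y(1)]) (use k \<delta> y M in \<open>auto simp: k_def\<close>)
      also have "\<dots> = (C / \<delta>) ^ k * M * real k ^ k" by (simp add: k_def power_mult_distrib power_divide field_simps)
      also have "\<dots> \<le> (C / \<delta>) ^ k * M * (exp (real k) * fact k)"
        using power_self_le_exp_fact M0 C(1) \<delta> by (intro mult_left_mono) auto
      also have "exp (real k) = exp 1 ^ k" by (simp add: exp_of_nat_mult[symmetric])
      also have "(C / \<delta>) ^ k * M * (exp 1 ^ k * fact k) = M * (C * exp 1 / \<delta>) ^ k * fact k"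
        by (simp add: power_mult_distrib power_divide)
      finally show ?thesis by (simp add: k_def)
    qed
  qed
qed

lemma open_imp_cube:
  assumes D: "openin (top_of_set (Ecoord n)) D" and y: "y \<in> D"
  obtains \<delta> where "\<delta> > 0" "cube y \<delta> \<subseteq> D"
proof -
  have yE: "y \<in> Ecoord n" using openin_imp_subset[OF D] y by auto
  have "point y \<in> coord -` D" using y yE by (simp add: coord_point)
  then obtain \<rho> where \<rho>: "\<rho> > 0" "ball (point y) \<rho> \<subseteq> coord -` D" using open_coord_vimage[OF D] openE by blast
  \<comment> \<open>A cube of half side \<open>\<delta>\<close> lies in the Euclidean ball of radius
    \<open>n * \<delta>\<close>; the summand \<open>1\<close> keeps the denominator positive when
    \<open>n = 0\<close>.\<close>
  define \<delta> where "\<delta> = \<rho> / (2 * (real n + 1))"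
  have \<delta>: "\<delta> > 0" using \<rho> by (simp add: \<delta>_def)
  have "cube y \<delta> \<subseteq> D"
  proof
    fix z assume z: "z \<in> cube y \<delta>"
    have "point z - point y = (\<Sum>i<n. (z i - y i) *\<^sub>R b i)" by (simp add: point_def sum_subtractf scaleR_diff_left)
    then have "norm (point z - point y) \<le> (\<Sum>i<n. norm ((z i - y i) *\<^sub>R b i))" using norm_sum by metis
    also have "\<dots> \<le> (\<Sum>i<n. \<delta>)" using z b_Basis by (intro sum_mono) (auto simp: cube_def)
    also have "\<dots> = n * \<delta>" by simp
    also have "\<dots> < (real n + 1) * \<delta>" using \<delta> by simp
    also have "\<dots> \<le> \<rho>" using \<rho> by (simp add: \<delta>_def field_simps)
    finally have "point z \<in> ball (point y) \<rho>" by (simp add: dist_norm norm_minus_commute)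
    then have "coord (point z) \<in> D" using \<rho> by auto
    then show "z \<in> D" using z by (simp add: coord_point cube_def)
  qed
  with \<delta> show thesis by (rule that)
qed

lemma bounded_on_cube:
  fixes F :: "(nat \<Rightarrow> real) \<Rightarrow> 'd::real_normed_vector"
  assumes F: "continuous_on D F" and y: "cube y r \<subseteq> D"
  obtains M where "\<And>z. z \<in> cube y r \<Longrightarrow> norm (F z) \<le> M"
proof -
  define K where "K = {x. (\<forall>j<n. \<bar>coord x j - y j\<bar> \<le> r) \<and> (\<forall>c\<in>Basis - b ` {..<n}. x \<bullet> c = 0)}"
  have "closed K"
  proof -
    have "K = (\<Inter>j<n. {x. \<bar>x \<bullet> b j - y j\<bar> \<le> r}) \<inter> (\<Inter>c\<in>Basis - b ` {..<n}. {x. x \<bullet> c = 0})"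
      by (auto simp: K_def coord_def)
    also have "closed \<dots>"
      by (intro closed_Int closed_INT ballI closed_Collect_le closed_Collect_eq continuous_intros)
    finally show ?thesis .
  qed
  moreover have "bounded K"
  proof (rule boundedI)
    fix x assume x: "x \<in> K"
    have "norm x \<le> (\<Sum>c\<in>Basis. \<bar>x \<bullet> c\<bar>)" by (rule norm_le_l1)
    also have "\<dots> = (\<Sum>c\<in>b ` {..<n}. \<bar>x \<bullet> c\<bar>)"
      by (rule sum.mono_neutral_right) (use bB x in \<open>auto simp: K_def\<close>)
    also have "\<dots> = (\<Sum>j<n. \<bar>x \<bullet> b j\<bar>)" by (simp add: sum.reindex[OF inj])
    also have "\<dots> \<le> (\<Sum>j<n. \<bar>y j\<bar> + r)"
    proof (rule sum_mono)
      fix j assume "j \<in> {..<n}"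
      then have "\<bar>x \<bullet> b j - y j\<bar> \<le> r" using x by (auto simp: K_def coord_def)
      then show "\<bar>x \<bullet> b j\<bar> \<le> \<bar>y j\<bar> + r" by linarith
    qed
    finally show "norm x \<le> (\<Sum>j<n. \<bar>y j\<bar> + r)" .
  qed
  ultimately have "compact K" by (simp add: compact_eq_bounded_closed)
  moreover have "coord ` K \<subseteq> cube y r" by (auto simp: K_def cube_def coord_in_Ecoord)
  ultimately have "compact ((\<lambda>x. F (coord x)) ` K)"
    by (intro compact_continuous_image continuous_on_compose2[OF F continuous_on_coord]) (use y in auto)
  then obtain M where M: "\<And>x. x \<in> K \<Longrightarrow> norm (F (coord x)) \<le> M"
    using compact_imp_bounded bounded_iff by (metis (no_types, lifting) imageI)
  show thesis
  proof (rule that[of M])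
    fix z assume z: "z \<in> cube y r"
    then have "point z \<in> K" by (auto simp: K_def cube_def coord_point point_inner_other)
    then show "norm (F z) \<le> M" using M z by (force simp: cube_def coord_point)
  qed
qed

end

text \<open>The geometric bound makes the family over all words absolutely summable, so it may be
  regrouped: by length, which gives \<open>S\<close>, or by the multi-index
  \<open>count_list w\<close>.\<close>

lemma has_sum_words_by_multiindex:
  fixes a :: "nat list \<Rightarrow> 'a::banach"
  assumes summ: "\<And>k. (\<Sum>w\<in>words n k. norm (a w)) \<le> M / 2 ^ k"
    and lim: "(\<lambda>k. \<Sum>w\<in>words n k. a w) sums S"
  shows "((\<lambda>m. \<Sum>w | set w \<subseteq> {..<n} \<and> count_list w = m. a w) has_sum S) {m. \<forall>i\<ge>n. m i = 0}"
proof -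
  let ?P = "SIGMA k:UNIV. words n k" and ?a = "\<lambda>(k::nat, w). a w"
  have "(\<lambda>x. norm (?a x)) summable_on ?P"
  proof (rule Infinite_Sum.abs_summable_on_Sigma_iff[THEN iffD2], intro conjI ballI)
    show "(\<lambda>w. norm (?a (k, w))) summable_on words n k" for k by (rule summable_on_finite[OF finite_words])
    have geo: "summable (\<lambda>k. M / 2 ^ k)"
      using summable_mult[OF summable_geometric[of "1/2::real"], of M] by (simp add: power_divide)
    have "summable (\<lambda>k. \<Sum>w\<in>words n k. norm (a w))"
      by (rule summable_comparison_test[OF _ geo]) (use summ in \<open>auto intro!: exI[of _ 0] simp: abs_of_nonneg[OF sum_nonneg]\<close>)
    then have "(\<lambda>k. \<Sum>w\<in>words n k. norm (a w)) summable_on UNIV"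
      by (rule summable_nonneg_imp_summable_on) (simp add: sum_nonneg)
    then show "(\<lambda>k. norm (\<Sum>\<^sub>\<infinity>w\<in>words n k. norm (?a (k, w)))) summable_on UNIV"
      by (simp add: infsum_finite[OF finite_words] abs_of_nonneg[OF sum_nonneg])
  qed
  then obtain S' where S': "(?a has_sum S') ?P" using abs_summable_summable summable_on_def by blast
  have "((\<lambda>k. \<Sum>w\<in>words n k. a w) has_sum S') UNIV"
    by (rule has_sum_SigmaD[OF S']) (simp add: has_sum_finite[OF finite_words])
  then have "S' = S" using has_sum_imp_sums lim sums_unique2 by blast
  let ?Q = "SIGMA m:{m. \<forall>i\<ge>n. m i = (0::nat)}. {w. set w \<subseteq> {..<n} \<and> count_list w = m}"
  have "((\<lambda>(m::nat \<Rightarrow> nat, w). a w) has_sum S) ?Q \<longleftrightarrow> (?a has_sum S') ?P"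
  proof (rule has_sum_reindex_bij_witness[where i = "\<lambda>(k, w). (count_list w, w)" and j = "\<lambda>(m, w). (length w, w)"])
    show "(\<lambda>(k::nat, w). (count_list w, w)) p \<in> ?Q" if "p \<in> ?P" for p
      using that by (auto simp: words_def count_list_0_iff)
  qed (auto simp: words_def \<open>S' = S\<close>)
  then have Q: "((\<lambda>(m::nat \<Rightarrow> nat, w). a w) has_sum S) ?Q" using S' by blast
  show ?thesis
  proof (rule has_sum_SigmaD[OF Q])
    fix m :: "nat \<Rightarrow> nat"
    let ?W = "{w. set w \<subseteq> {..<n} \<and> count_list w = m}"
    have "finite ?W"
    proof (rule finite_subset[OF _ finite_words[of n "\<Sum>i<n. m i"]])
      have "length w = (\<Sum>i<n. count_list w i)" if "set w \<subseteq> {..<n}" for w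
      proof -
        have "(\<Sum>i<n. count_list w i) = (\<Sum>i\<in>set w. count_list w i)"
          by (rule sum.mono_neutral_right) (use that in \<open>auto simp: count_list_0_iff\<close>)
        then show ?thesis by (simp add: sum_count_set[symmetric, OF order_refl])
      qed
      then show "?W \<subseteq> words n (\<Sum>i<n. m i)" by (auto simp: words_def)
    qed
    then show "((\<lambda>w. (case (m, w) of (m, w) \<Rightarrow> a w)) has_sum (\<Sum>w\<in>?W. a w)) ?W" by (simp add: has_sum_finite)
  qed
qed

context clifford_chart begin

text \<open>Taylor's formula with integral remainder along the segment from \<open>y\<close> to
  \<open>y + h\<close>. The derivative bound makes the remainder after \<open>p\<close> terms at
  most \<open>M * p / 2 ^ p\<close>, where the factor \<open>p\<close> is
  \<open>fact p / fact (p - 1)\<close>.\<close>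

lemma taylor_words:
  fixes r A M :: real
  assumes D: "openin (top_of_set (Ecoord n)) D" and F: "cregular n e D F" 
    and y: "y \<in> Ecoord n" and h: "h \<in> Ecoord n" "\<And>i. i < n \<Longrightarrow> \<bar>h i\<bar> \<le> r"
    and seg: "\<And>s. s \<in> {0..1} \<Longrightarrow> (\<lambda>i. y i + s * h i) \<in> D"
    and bound: "\<And>w s. s \<in> {0..1} \<Longrightarrow> set w \<subseteq> {..<n} \<Longrightarrow> norm (dword w F (\<lambda>i. y i + s * h i)) \<le> M * A ^ length w * fact (length w)"
    and r: "0 \<le> r" "0 \<le> A" "0 \<le> M" "n * r * A \<le> 1 / 2"
  shows "(\<lambda>k. \<Sum>w\<in>words n k. (prod_list (map h w) / fact k) *\<^sub>R dword w F y) sums F (\<lambda>i. y i + h i)"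
proof -
  define \<gamma> where "\<gamma> s = (\<lambda>i. y i + s * h i)" for s
  define Df where "Df k s = (\<Sum>w\<in>words n k. prod_list (map h w) *\<^sub>R dword w F (\<gamma> s))" for k s
  have Df: "(Df m has_vector_derivative Df (Suc m) s) (at s within {0..1})" if s: "0 \<le> s" "s \<le> 1" for m s
  proof -
    have "(Df m has_vector_derivative
      (\<Sum>w\<in>words n m. prod_list (map h w) *\<^sub>R (\<Sum>i<n. h i *\<^sub>R pderiv_c i (dword w F) (\<gamma> s)))) (at s)"
      unfolding Df_def
    proof (intro has_vector_derivative_sum bounded_linear.has_vector_derivative[OF bounded_linear_scaleR_right])
      fix w assume "w \<in> words n m"
      then have "cregular n e D (dword w F)" by (intro cregular_dword[OF D F]) (auto simp: words_def)
      then show "((\<lambda>s. dword w F (\<gamma> s)) has_vector_derivative (\<Sum>i<n. h i *\<^sub>R pderiv_c i (dword w F) (\<gamma> s))) (at s)"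
        unfolding \<gamma>_def by (intro Ck1_has_vector_derivative_along[OF _ D]) (use seg s y h in \<open>auto simp: cregular_def\<close>)
    qed
    also have "(\<Sum>w\<in>words n m. prod_list (map h w) *\<^sub>R (\<Sum>i<n. h i *\<^sub>R pderiv_c i (dword w F) (\<gamma> s))) = Df (Suc m) s"
      by (simp add: Df_def sum_words_Suc dword_snoc scaleR_sum_right)
    finally show ?thesis by (rule has_vector_derivative_at_within)
  qed
  have Dfb: "norm (Df k s) \<le> (n * r * A) ^ k * M * fact k" if "s \<in> {0..1}" for k s
  proof -
    have "norm (Df k s) \<le> (\<Sum>w\<in>words n k. r ^ k * (M * A ^ k * fact k))"
      unfolding Df_def
    proof (rule sum_norm_le)
      fix w assume w: "w \<in> words n k"
      have "\<bar>prod_list (map h w)\<bar> \<le> r ^ length w"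
        by (rule abs_prod_list_le) (use w h r in \<open>auto simp: words_def\<close>)
      moreover have "norm (dword w F (\<gamma> s)) \<le> M * A ^ k * fact k"
        unfolding \<gamma>_def using bound[of s w] that w by (auto simp: words_def)
      ultimately show "norm (prod_list (map h w) *\<^sub>R dword w F (\<gamma> s)) \<le> r ^ k * (M * A ^ k * fact k)"
        using w r by (auto simp: words_def intro!: mult_mono)
    qed
    also have "\<dots> = (n * r * A) ^ k * M * fact k" by (simp add: card_words power_mult_distrib)
    finally show ?thesis .
  qed
  have F1: "F (\<gamma> 1) = F (\<lambda>i. y i + h i)" by (simp add: \<gamma>_def)
  have rem: "norm ((\<Sum>k<p. Df k 0 /\<^sub>R fact k) - F (\<gamma> 1)) \<le> M * (of_nat p * (1/2) ^ p)" if p: "p > 0" for p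
  proof -
    let ?i = "\<lambda>x. ((1 - x) ^ (p - 1) / fact (p - 1)) *\<^sub>R Df p x"
    have "(?i has_integral F (\<gamma> 1) - (\<Sum>i<p. ((1 - 0) ^ i / fact i) *\<^sub>R Df i 0)) {0..1}"
    proof (rule Taylor_has_integral[OF p])
      show "Df 0 = (\<lambda>s. F (\<gamma> s))" by (auto simp: Df_def words_def fun_eq_iff cong: conj_cong)
    qed (use Df in auto)
    then have i: "(?i has_integral F (\<gamma> 1) - (\<Sum>i<p. Df i 0 /\<^sub>R fact i)) (cbox 0 1)"
      by (simp add: divide_inverse)
    have "norm (F (\<gamma> 1) - (\<Sum>i<p. Df i 0 /\<^sub>R fact i)) \<le> (1 / fact (p - 1) * ((1/2) ^ p * M * fact p)) * measure lborel (cbox 0 (1::real))"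
    proof (rule has_integral_bound[OF _ i])
      fix s :: real assume s: "s \<in> cbox 0 1"
      have "norm (Df p s) \<le> (n * r * A) ^ p * M * fact p" using Dfb s by simp
      also have "\<dots> \<le> (1/2) ^ p * M * fact p" using r by (intro mult_right_mono power_mono) auto
      finally have 1: "norm (Df p s) \<le> (1/2) ^ p * M * fact p" .
      have 2: "\<bar>(1 - s) ^ (p - 1) / fact (p - 1)\<bar> \<le> 1 / fact (p - 1)"
        using s by (auto simp: abs_of_nonneg intro!: divide_right_mono power_le_one)
      show "norm (?i s) \<le> 1 / fact (p - 1) * ((1/2) ^ p * M * fact p)"
        unfolding norm_scaleR using 1 2 by (intro mult_mono) auto
    qed (use r in auto)
    also have "\<dots> = M * (of_nat p * (1/2) ^ p)"
      using p fact_reduce[of p, where 'a = real] by (simp add: field_simps)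
    finally show ?thesis by (simp add: norm_minus_commute)
  qed
  have ev: "\<forall>\<^sub>F p in sequentially. norm ((\<Sum>k<p. Df k 0 /\<^sub>R fact k) - F (\<gamma> 1)) \<le> M * (of_nat p * (1/2) ^ p)"
    using eventually_gt_at_top[of 0] by eventually_elim (rule rem)
  have "(\<lambda>p. M * (of_nat p * (1/2::real) ^ p)) \<longlonglongrightarrow> M * 0"
    by (intro tendsto_mult_left powser_times_n_limit_0) auto
  from this[unfolded mult_zero_right] have "(\<lambda>p. (\<Sum>k<p. Df k 0 /\<^sub>R fact k) - F (\<gamma> 1)) \<longlonglongrightarrow> 0"
    by (rule Lim_null_comparison[OF ev])
  then have "(\<lambda>k. Df k 0 /\<^sub>R fact k) sums F (\<gamma> 1)"
    by (simp add: sums_def LIM_zero_iff)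
  moreover have "Df k 0 /\<^sub>R fact k = (\<Sum>w\<in>words n k. (prod_list (map h w) / fact k) *\<^sub>R dword w F y)" for k
    by (simp add: Df_def \<gamma>_def scaleR_sum_right divide_inverse mult.commute)
  ultimately show ?thesis unfolding F1 by simp
qed

lemma cregular_real_analytic:
  assumes D: "openin (top_of_set (Ecoord n)) D" and F: "cregular n e D F"
  shows "real_analytic_c n D F"
  unfolding real_analytic_c_def
proof
  fix y assume y: "y \<in> D"
  have yE: "y \<in> Ecoord n" using openin_imp_subset[OF D] y by auto
  obtain \<delta>0 where \<delta>0: "\<delta>0 > 0" "cube y \<delta>0 \<subseteq> D" using open_imp_cube[OF D y] .
  \<comment> \<open>The derivatives must be bounded uniformly on the cube of radius
    \<open>\<delta>\<close>, and the bound at each of its points uses another cube of radius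
    \<open>\<delta>\<close>.\<close>
  define \<delta> where "\<delta> = \<delta>0 / 2"
  have \<delta>: "\<delta> > 0" "cube y (\<delta> + \<delta>) \<subseteq> D" using \<delta>0 by (simp_all add: \<delta>_def)
  have "continuous_on D F" using F by (simp add: cregular_def)
  then obtain M where M: "\<And>z. z \<in> cube y (\<delta> + \<delta>) \<Longrightarrow> norm (F z) \<le> M" using bounded_on_cube[OF _ \<delta>(2)] by blast
  have yc: "y \<in> cube y \<delta>" using yE \<delta> by (simp add: cube_def)
  have M0: "M \<ge> 0" using order_trans[OF norm_ge_zero M[of y]] yE \<delta> by (simp add: cube_def)
  obtain A where A: "A > 0" "\<And>D F y \<delta> M w. cregular n e D F \<Longrightarrow> openin (top_of_set (Ecoord n)) D \<Longrightarrow> \<delta> > 0 \<Longrightarrow>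
     y \<in> D \<Longrightarrow> cube y \<delta> \<subseteq> D \<Longrightarrow> (\<And>z. z \<in> cube y \<delta> \<Longrightarrow> norm (F z) \<le> M) \<Longrightarrow> set w \<subseteq> {..<n} \<Longrightarrow>
     norm (dword w F y) \<le> M * (A / \<delta>) ^ length w * fact (length w)"
    using dword_bound by blast
  have bnd: "norm (dword w F z) \<le> M * (A / \<delta>) ^ length w * fact (length w)" if z: "z \<in> cube y \<delta>" and w: "set w \<subseteq> {..<n}" for z w
  proof (rule A(2)[OF F D \<delta>(1) _ _ _ w])
    have "z \<in> cube z \<delta>" using z \<delta> by (simp add: cube_def)
    then show "z \<in> D" "cube z \<delta> \<subseteq> D" using cube_mono[OF z, of \<delta>] \<delta> by auto
    show "norm (F z') \<le> M" if "z' \<in> cube z \<delta>" for z' using cube_mono[OF z, of \<delta>] that M by auto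
  qed
  \<comment> \<open>The second entry makes \<open>n * r * (A / \<delta>)\<close>, the ratio of the
    geometric series, at most \<open>1 / 2\<close>; \<open>real n + 1\<close> keeps the denominator
    positive when \<open>n = 0\<close>.\<close>
  define r where "r = min \<delta> (\<delta> / (2 * (real n + 1) * A))"
  have r: "r > 0" "r \<le> \<delta>" using \<delta> A by (auto simp: r_def)
  have nrA: "n * r * (A / \<delta>) \<le> 1 / 2"
  proof -
    have "r \<le> \<delta> / (2 * (real n + 1) * A)" by (simp add: r_def)
    then have "r * (2 * (real n + 1) * A) \<le> \<delta>" using A(1) by (subst (asm) pos_le_divide_eq) auto
    moreover have "0 \<le> r * A" using r A by simp
    ultimately have "2 * n * r * A \<le> \<delta>" by (simp add: algebra_simps)
    then show ?thesis using \<delta> by (simp add: field_simps)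
  qed
  \<comment> \<open>All words with the same letter counts share one monomial, so their Taylor
    coefficients are added.\<close>
  define c where "c m = (\<Sum>w | set w \<subseteq> {..<n} \<and> count_list w = m. dword w F y /\<^sub>R fact (length w))" for m
  have "z \<in> D \<and> ((\<lambda>m. (\<Prod>i<n. (z i - y i) ^ m i) *\<^sub>R c m) has_sum F z) {m. \<forall>i\<ge>n. m i = 0}"
    if z: "z \<in> Ecoord n" "\<forall>i<n. \<bar>z i - y i\<bar> < r" for z
  proof
    define h where "h i = z i - y i" for i
    have h: "h \<in> Ecoord n" "\<And>i. i < n \<Longrightarrow> \<bar>h i\<bar> \<le> r" using z yE by (auto simp: h_def Ecoord_def less_imp_le)
    have seg: "(\<lambda>i. y i + s * h i) \<in> cube y \<delta>" if s: "s \<in> {0..1}" for s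
    proof -
      have "\<bar>s * h i\<bar> \<le> \<delta>" if "i < n" for i
      proof -
        have "\<bar>s * h i\<bar> \<le> 1 * r" unfolding abs_mult using s h(2)[OF that] by (intro mult_mono) auto
        then show ?thesis using r by simp
      qed
      then show ?thesis using yE h by (auto simp: cube_def Ecoord_def)
    qed
    have cD: "cube y \<delta> \<subseteq> D" using \<delta> by (auto simp: cube_def subset_iff) (smt (verit))
    have F1: "F (\<lambda>i. y i + h i) = F z" by (simp add: h_def)
    show "z \<in> D" using seg[of 1] cD by (auto simp: h_def)
    let ?a = "\<lambda>w. (prod_list (map h w) / fact (length w)) *\<^sub>R dword w F y"
    have "(\<lambda>k. \<Sum>w\<in>words n k. (prod_list (map h w) / fact k) *\<^sub>R dword w F y) sums F z"
      unfolding F1[symmetric]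
      by (rule taylor_words[OF D F yE h, where M = M and A = "A / \<delta>"])
         (use seg cD bnd r A \<delta> M0 nrA in auto)
    then have 1: "(\<lambda>k. \<Sum>w\<in>words n k. ?a w) sums F z" by (simp add: words_def)
    have 2: "(\<Sum>w\<in>words n k. norm (?a w)) \<le> M / 2 ^ k" for k
    proof -
      have "(\<Sum>w\<in>words n k. norm (?a w)) \<le> (\<Sum>w\<in>words n k. r ^ k * (M * (A / \<delta>) ^ k))"
      proof (rule sum_mono)
        fix w assume w: "w \<in> words n k"
        have "\<bar>prod_list (map h w)\<bar> \<le> r ^ length w"
          by (rule abs_prod_list_le) (use w h r in \<open>auto simp: words_def\<close>)
        moreover have "norm (dword w F y) \<le> M * (A / \<delta>) ^ k * fact k" using bnd[OF yc, of w] w by (auto simp: words_def)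
        ultimately have "\<bar>prod_list (map h w)\<bar> * norm (dword w F y) \<le> r ^ k * (M * (A / \<delta>) ^ k * fact k)"
          using w r by (auto simp: words_def intro!: mult_mono)
        then show "norm (?a w) \<le> r ^ k * (M * (A / \<delta>) ^ k)"
          using w by (simp add: words_def field_simps)
      qed
      also have "\<dots> = (n * r * (A / \<delta>)) ^ k * M"
        by (simp add: card_words power_mult_distrib del: times_divide_eq_right)
      also have "\<dots> \<le> (1 / 2) ^ k * M" using nrA r A \<delta> M0 by (intro mult_right_mono power_mono) auto
      finally show ?thesis by (simp add: power_divide)
    qed
    have "((\<lambda>m. \<Sum>w | set w \<subseteq> {..<n} \<and> count_list w = m. ?a w) has_sum F z) {m. \<forall>i\<ge>n. m i = 0}"
      by (rule has_sum_words_by_multiindex[OF 2 1])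
    moreover have "(\<Sum>w | set w \<subseteq> {..<n} \<and> count_list w = m. ?a w) = (\<Prod>i<n. (z i - y i) ^ m i) *\<^sub>R c m" for m
      unfolding c_def scaleR_sum_right
      by (intro sum.cong refl) (auto simp: prod_list_map_power h_def divide_inverse)
    ultimately show "((\<lambda>m. (\<Prod>i<n. (z i - y i) ^ m i) *\<^sub>R c m) has_sum F z) {m. \<forall>i\<ge>n. m i = 0}" by simp
  qed
  then show "\<exists>r>0. \<exists>c. \<forall>z\<in>Ecoord n. (\<forall>i<n. \<bar>z i - y i\<bar> < r) \<longrightarrow> z \<in> D \<and>
     ((\<lambda>m. (\<Prod>i<n. (z i - y i) ^ m i) *\<^sub>R c m) has_sum F z) {m. \<forall>i\<ge>n. m i = 0}"
    using r(1) by blast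
qed

end

theorem cregular_imp_analytic:
  fixes e :: "nat \<Rightarrow> 'a::{real_algebra_1,euclidean_space}"
  assumes "clifford_sys n e" "openin (top_of_set (Ecoord n)) D" "cregular n e D F"
  shows "Cinf n D F" "real_analytic_c n D F"
proof -
  obtain b :: "nat \<Rightarrow> 'a" where "coordinate_chart n b" using ex_coordinate_chart[OF clifford_sys_le_DIM[OF assms(1)]] .
  then interpret clifford_chart n b e using assms by (simp add: clifford_chart_def clifford_chart_axioms_def)
  show "Cinf n D F" using cregular_Ck[OF assms(2,3)] by (simp add: Cinf_def)
  show "real_analytic_c n D F" by (rule cregular_real_analytic[OF assms(2,3)])
qed

section \<open>Smooth functions of finitely many coordinates\<close>

abbreviation opn :: "nat \<Rightarrow> (nat \<Rightarrow> real) set \<Rightarrow> bool" where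
  "opn n D \<equiv> openin (top_of_set (Ecoord n)) D"

text \<open>A relation beside the function \<open>pderiv_c\<close>: \<open>vector_derivative\<close>
  returns a value even where no derivative exists, so existence has to be carried along.\<close>

definition has_pd :: "nat \<Rightarrow> ((nat \<Rightarrow> real) \<Rightarrow> 'a::real_normed_vector) \<Rightarrow> 'a \<Rightarrow> (nat \<Rightarrow> real) \<Rightarrow> bool" where
  "has_pd i F d y \<longleftrightarrow> ((\<lambda>s. F (y(i := y i + s))) has_vector_derivative d) (at 0)"

lemma has_pd_imp_pderiv: "has_pd i F d y \<Longrightarrow> pderiv_c i F y = d"
  by (simp add: has_pd_def pderiv_c_def vector_derivative_at)

lemma continuous_on_fun_upd:
  fixes f :: "'b::topological_space \<Rightarrow> nat \<Rightarrow> real"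
  assumes "continuous_on S f" "continuous_on S g"
  shows "continuous_on S (\<lambda>x. (f x)(i := g x))"
proof (rule continuous_on_coordinatewise_then_product)
  show "continuous_on S (\<lambda>x. ((f x)(i := g x)) j)" for j
    using assms continuous_on_product_then_coordinatewise[of S f] by (cases "j = i") auto
qed

lemma open_line:
  assumes D: "opn n D" and y: "y \<in> D" and i: "i < n"
  shows "open {s. y(i := y i + s) \<in> D}"
proof -
  obtain T where T: "open T" "D = Ecoord n \<inter> T" using D by (auto simp: openin_open)
  have "{s. y(i := y i + s) \<in> D} = (\<lambda>s. y(i := y i + s)) -` T"
    using T y i by (auto simp: Ecoord_def)
  moreover have "continuous_on UNIV (\<lambda>s. y(i := y i + s))"
    by (intro continuous_on_fun_upd continuous_intros)
  ultimately show ?thesis using T by (simp add: continuous_on_open_vimage)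
qed

lemma has_pd_cong:
  assumes D: "opn n D" and y: "y \<in> D" and i: "i < n" and eq: "\<And>z. z \<in> D \<Longrightarrow> F z = G z"
    and F: "has_pd i F d y"
  shows "has_pd i G d y"
  unfolding has_pd_def
  by (rule has_vector_derivative_transform_within_open[OF F[unfolded has_pd_def] open_line[OF D y i]])
     (use y eq in auto)

lemma pderiv_c_cong:
  assumes D: "opn n D" and y: "y \<in> D" and i: "i < n" and eq: "\<And>z. z \<in> D \<Longrightarrow> F z = G z"
  shows "pderiv_c i F y = pderiv_c i G y"
proof -
  have "((\<lambda>s. F (y(i := y i + s))) has_vector_derivative d) (at 0) \<longleftrightarrow> ((\<lambda>s. G (y(i := y i + s))) has_vector_derivative d) (at 0)" for d
    using has_pd_cong[OF D y i, of F G d] has_pd_cong[OF D y i, of G F d] eq by (auto simp: has_pd_def)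
  then show ?thesis by (simp add: pderiv_c_def vector_derivative_def)
qed

lemma Ck_cong:
  assumes D: "opn n D" and eq: "\<And>z. z \<in> D \<Longrightarrow> F z = G z" and F: "Ck k n D F"
  shows "Ck k n D G"
  using eq F
proof (induction k arbitrary: F G)
  case 0
  then show ?case using continuous_on_eq by fastforce
next
  case (Suc k)
  have "(\<lambda>s. G (y(i := y i + s))) differentiable (at 0)" if "y \<in> D" "i < n" for y i
  proof -
    have "has_pd i F (pderiv_c i F y) y" using Suc.prems(2) that by (simp add: has_pd_def pderiv_c_def vector_derivative_works)
    from has_pd_cong[OF D that Suc.prems(1) this] show ?thesis by (auto simp: has_pd_def intro: differentiableI_vector)
  qed
  moreover have "Ck k n D (pderiv_c i G)" if "i < n" for i
    by (rule Suc.IH[of "pderiv_c i F"]) (use pderiv_c_cong[OF D _ that] Suc.prems that in auto)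
  moreover have "continuous_on D G" using Suc.prems continuous_on_eq by fastforce
  ultimately show ?case by simp
qed

lemma Ck_continuous: "Ck k n D F \<Longrightarrow> continuous_on D F" by (cases k) auto

lemma Ck_SucI:
  assumes D: "opn n D" and F: "continuous_on D F" and pd: "\<And>i y. i < n \<Longrightarrow> y \<in> D \<Longrightarrow> has_pd i F (g i y) y"
    and g: "\<And>i. i < n \<Longrightarrow> Ck k n D (g i)"
  shows "Ck (Suc k) n D F"
proof -
  have "Ck k n D (pderiv_c i F)" if "i < n" for i
    by (rule Ck_cong[OF D _ g[OF that]]) (use has_pd_imp_pderiv[OF pd[OF that]] in simp)
  then show ?thesis using F pd by (auto simp: has_pd_def intro: differentiableI_vector)
qed

lemma Ck_Suc_has_pd: "Ck (Suc k) n D F \<Longrightarrow> i < n \<Longrightarrow> y \<in> D \<Longrightarrow> has_pd i F (pderiv_c i F y) y"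
  by (simp add: has_pd_def pderiv_c_def vector_derivative_works)

lemma Ck_Suc_imp_Ck: "Ck (Suc k) n D F \<Longrightarrow> Ck k n D F"
  by (induction k arbitrary: F) auto

lemma Ck_subset: "Ck k n D F \<Longrightarrow> D' \<subseteq> D \<Longrightarrow> Ck k n D' F"
  by (induction k arbitrary: F) (auto elim: continuous_on_subset)

lemma continuous_on_locally:
  fixes F :: "(nat \<Rightarrow> real) \<Rightarrow> 'a::topological_space"
  assumes loc: "\<And>y. y \<in> D \<Longrightarrow> \<exists>D'. opn n D' \<and> y \<in> D' \<and> D' \<subseteq> D \<and> continuous_on D' F"
  shows "continuous_on D F"
  unfolding continuous_on_def
proof
  fix y assume y: "y \<in> D"
  obtain D' where D': "opn n D'" "y \<in> D'" "D' \<subseteq> D" "continuous_on D' F" using loc[OF y] by blast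
  obtain T where T: "open T" "D' = Ecoord n \<inter> T" using D'(1) by (auto simp: openin_open)
  have DE: "D \<subseteq> Ecoord n" using loc openin_imp_subset by (metis subsetD subsetI)
  have "at y within D' = at y within D"
    by (rule at_within_nhd[of y T]) (use DE T D' in auto)
  moreover have "(F \<longlongrightarrow> F y) (at y within D')" using D' by (simp add: continuous_on_def)
  ultimately show "(F \<longlongrightarrow> F y) (at y within D)" by simp
qed

text \<open>Needed for the quotient \<open>Dv\<close>, whose smoothness is shown by different
  formulas near the hyperplane \<open>y p = 0\<close> and away from it.\<close>

lemma Ck_local:
  assumes "\<And>y. y \<in> D \<Longrightarrow> \<exists>D'. opn n D' \<and> y \<in> D' \<and> D' \<subseteq> D \<and> Ck k n D' F"
  shows "Ck k n D F"
  using assms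
proof (induction k arbitrary: F)
  case 0
  then show ?case using continuous_on_locally[of D n F] by simp
next
  case (Suc k)
  have "continuous_on D F"
  proof (rule continuous_on_locally)
    fix y assume "y \<in> D"
    from Suc.prems[OF this] obtain D' where "opn n D'" "y \<in> D'" "D' \<subseteq> D" "Ck (Suc k) n D' F" by blast
    then show "\<exists>D'. opn n D' \<and> y \<in> D' \<and> D' \<subseteq> D \<and> continuous_on D' F"
      by (intro exI[of _ D']) auto
  qed
  moreover have "(\<lambda>s. F (y(i := y i + s))) differentiable (at 0)" if "y \<in> D" "i < n" for y i
    using Suc.prems[OF that(1)] that(2) by auto
  moreover have "Ck k n D (pderiv_c i F)" if "i < n" for i
  proof (rule Suc.IH)
    fix y assume "y \<in> D"
    from Suc.prems[OF this] obtain D' where "opn n D'" "y \<in> D'" "D' \<subseteq> D" "Ck (Suc k) n D' F" by blast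
    then show "\<exists>D'. opn n D' \<and> y \<in> D' \<and> D' \<subseteq> D \<and> Ck k n D' (pderiv_c i F)"
      using that by (intro exI[of _ D']) auto
  qed
  ultimately show ?case by simp
qed

lemma has_pd_const: "has_pd i (\<lambda>y. c) 0 y"
  by (simp add: has_pd_def)

lemma has_pd_add: "has_pd i F a y \<Longrightarrow> has_pd i G b y \<Longrightarrow> has_pd i (\<lambda>y. F y + G y) (a + b) y"
  unfolding has_pd_def by (rule has_vector_derivative_add)

lemma has_pd_sum: "(\<And>j. j \<in> A \<Longrightarrow> has_pd i (F j) (d j) y) \<Longrightarrow> has_pd i (\<lambda>y. \<Sum>j\<in>A. F j y) (\<Sum>j\<in>A. d j) y"
  unfolding has_pd_def by (rule has_vector_derivative_sum)

lemma has_pd_linear: "bounded_linear L \<Longrightarrow> has_pd i F a y \<Longrightarrow> has_pd i (\<lambda>y. L (F y)) (L a) y"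
  unfolding has_pd_def by (rule bounded_linear.has_vector_derivative)

lemma has_pd_scaleR:
  "has_pd i \<phi> a y \<Longrightarrow> has_pd i F d y \<Longrightarrow> has_pd i (\<lambda>y. \<phi> y *\<^sub>R F y) (\<phi> y *\<^sub>R d + a *\<^sub>R F y) y"
  unfolding has_pd_def has_real_derivative_iff_has_vector_derivative[symmetric]
  using has_vector_derivative_scaleR[of "\<lambda>s. \<phi> (y(i := y i + s))" a 0 UNIV "\<lambda>s. F (y(i := y i + s))" d] by simp

lemma has_pd_coord: "has_pd i (\<lambda>y. y j) (if j = i then 1 else 0) y"
  unfolding has_pd_def by (auto intro!: derivative_eq_intros)

lemma Ck_const: "Ck k n D (\<lambda>y. c)"
proof (induction k arbitrary: c)
  case (Suc k)
  have "pderiv_c i (\<lambda>y. c) = (\<lambda>y. 0)" for i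
    by (rule ext, rule has_pd_imp_pderiv, rule has_pd_const)
  then show ?case using Suc by simp
qed simp

lemma Ck_coord: "Ck k n D (\<lambda>y. y j)"
proof (cases k)
  case 0
  then show ?thesis using continuous_on_subset[OF continuous_on_product_coordinates] by fastforce
next
  case (Suc m)
  have "pderiv_c i (\<lambda>y. y j) = (\<lambda>y. if j = i then 1 else 0)" for i
    by (rule ext, rule has_pd_imp_pderiv, rule has_pd_coord)
  moreover have "(\<lambda>s. (y(i := y i + s)) j) differentiable (at 0)" for y :: "nat \<Rightarrow> real" and i j :: nat
    using has_pd_coord[of i j y] unfolding has_pd_def by (rule differentiableI_vector)
  moreover have "continuous_on D (\<lambda>y. y j)"
    using continuous_on_subset[OF continuous_on_product_coordinates] by fastforce
  ultimately show ?thesis unfolding Suc by (simp add: Ck_const)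
qed

lemma Ck_add:
  assumes D: "opn n D" shows "Ck k n D F \<Longrightarrow> Ck k n D G \<Longrightarrow> Ck k n D (\<lambda>y. F y + G y)"
proof (induction k arbitrary: F G)
  case (Suc k)
  show ?case
    by (rule Ck_SucI[OF D _ has_pd_add[OF Ck_Suc_has_pd[OF Suc.prems(1)] Ck_Suc_has_pd[OF Suc.prems(2)]]])
       (use Suc in \<open>auto intro: continuous_on_add\<close>)
qed (auto intro: continuous_on_add)

lemma Ck_linear:
  assumes D: "opn n D" and L: "bounded_linear L" shows "Ck k n D F \<Longrightarrow> Ck k n D (\<lambda>y. L (F y))"
proof (induction k arbitrary: F)
  case 0
  then show ?case using bounded_linear.continuous_on[OF L] by simp
next
  case (Suc k)
  show ?case
    by (rule Ck_SucI[OF D _ has_pd_linear[OF L Ck_Suc_has_pd[OF Suc.prems]]])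
       (use Suc bounded_linear.continuous_on[OF L] in auto)
qed

lemma Ck_sum:
  assumes D: "opn n D" shows "(\<And>j. j \<in> A \<Longrightarrow> Ck k n D (F j)) \<Longrightarrow> Ck k n D (\<lambda>y. \<Sum>j\<in>A. F j y)"
  by (induction A rule: infinite_finite_induct) (auto simp: Ck_const intro!: Ck_add[OF D])

lemma Ck_scaleR:
  fixes F :: "(nat \<Rightarrow> real) \<Rightarrow> 'a::real_normed_vector"
  assumes D: "opn n D" shows "Ck k n D \<phi> \<Longrightarrow> Ck k n D F \<Longrightarrow> Ck k n D (\<lambda>y. \<phi> y *\<^sub>R F y)"
proof (induction k arbitrary: \<phi> F)
  case (Suc k)
  show ?case
  proof (rule Ck_SucI[OF D _ has_pd_scaleR[OF Ck_Suc_has_pd[OF Suc.prems(1)] Ck_Suc_has_pd[OF Suc.prems(2)]]])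
    show "continuous_on D (\<lambda>y. \<phi> y *\<^sub>R F y)" using Suc.prems by (auto intro: continuous_on_scaleR)
    fix i assume "i < n"
    then show "Ck k n D (\<lambda>y. \<phi> y *\<^sub>R pderiv_c i F y + pderiv_c i \<phi> y *\<^sub>R F y)"
      using Suc.prems Ck_Suc_imp_Ck[OF Suc.prems(1)] Ck_Suc_imp_Ck[OF Suc.prems(2)]
      by (intro Ck_add[OF D] Suc.IH) auto
  qed
qed (auto intro: continuous_on_scaleR)

lemma Ck_inverse_coord:
  assumes D: "opn n D" and nz: "\<And>y. y \<in> D \<Longrightarrow> y p \<noteq> (0::real)"
  shows "Ck k n D (\<lambda>y. inverse (y p))"
proof (induction k)
  case 0
  have "continuous_on D (\<lambda>y. y p)" using Ck_coord[of 0] by simp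
  then show ?case using nz by (auto intro!: continuous_on_inverse)
next
  case (Suc k)
  show ?case
  proof (rule Ck_SucI[OF D, where g = "\<lambda>i y. (if p = i then - 1 else 0) *\<^sub>R (inverse (y p) *\<^sub>R inverse (y p))"])
    show "continuous_on D (\<lambda>y. inverse (y p))" using Suc Ck_continuous by blast
    show "has_pd i (\<lambda>y. inverse (y p)) ((if p = i then - 1 else 0) *\<^sub>R (inverse (y p) *\<^sub>R inverse (y p))) y" if "y \<in> D" for i y
      unfolding has_pd_def has_real_derivative_iff_has_vector_derivative[symmetric]
      using nz[OF that] by (auto intro!: derivative_eq_intros simp: power2_eq_square)
    show "Ck k n D (\<lambda>y. (if p = i then - 1 else 0) *\<^sub>R (inverse (y p) *\<^sub>R inverse (y p)))" for i
      by (intro Ck_scaleR[OF D] Ck_const Suc)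
  qed
qed

lemma Cinf_has_pd: "Cinf n D F \<Longrightarrow> i < n \<Longrightarrow> y \<in> D \<Longrightarrow> has_pd i F (pderiv_c i F y) y"
  by (rule Ck_Suc_has_pd[where k = 0]) (auto simp only: Cinf_def)

lemma Cinf_pderiv: "Cinf n D F \<Longrightarrow> i < n \<Longrightarrow> Cinf n D (pderiv_c i F)"
  unfolding Cinf_def
proof
  fix k assume "\<forall>k. Ck k n D F" "i < n"
  then have "Ck (Suc k) n D F" by blast
  then show "Ck k n D (pderiv_c i F)" using \<open>i < n\<close> by simp
qed

lemma Cinf_continuous: "Cinf n D F \<Longrightarrow> continuous_on D F"
  unfolding Cinf_def using Ck_continuous by blast

lemma Cinf_cong: "opn n D \<Longrightarrow> (\<And>z. z \<in> D \<Longrightarrow> F z = G z) \<Longrightarrow> Cinf n D F \<Longrightarrow> Cinf n D G"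
  unfolding Cinf_def using Ck_cong by blast

lemma Cinf_const: "Cinf n D (\<lambda>y. c)" by (simp add: Cinf_def Ck_const)

lemma Cinf_coord: "Cinf n D (\<lambda>y. y j)" by (simp add: Cinf_def Ck_coord)

lemma Cinf_add: "opn n D \<Longrightarrow> Cinf n D F \<Longrightarrow> Cinf n D G \<Longrightarrow> Cinf n D (\<lambda>y. F y + G y)"
  by (simp add: Cinf_def Ck_add)

lemma Cinf_linear: "opn n D \<Longrightarrow> bounded_linear L \<Longrightarrow> Cinf n D F \<Longrightarrow> Cinf n D (\<lambda>y. L (F y))"
  by (simp add: Cinf_def Ck_linear)

lemma Cinf_sum: "opn n D \<Longrightarrow> (\<And>j. j \<in> A \<Longrightarrow> Cinf n D (F j)) \<Longrightarrow> Cinf n D (\<lambda>y. \<Sum>j\<in>A. F j y)"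
  by (simp add: Cinf_def Ck_sum)

lemma Cinf_scaleR: "opn n D \<Longrightarrow> Cinf n D \<phi> \<Longrightarrow> Cinf n D F \<Longrightarrow> Cinf n D (\<lambda>y. \<phi> y *\<^sub>R F y)"
  by (simp add: Cinf_def Ck_scaleR)

section \<open>Mixed derivatives and means along a coordinate\<close>

lemma has_vector_derivative_partial:
  assumes F: "Ck (Suc k) n D F" and i: "i < n" and y: "y(i := x) \<in> D"
  shows "((\<lambda>x. F (y(i := x))) has_vector_derivative pderiv_c i F (y(i := x))) (at x)"
  by (rule has_vector_derivative_translate) (use Ck_Suc_has_pd[OF F i y] in \<open>simp add: has_pd_def\<close>)

lemma open_line_interval:
  assumes "opn n D" "y \<in> D" "i < n"
  obtains \<epsilon> where "\<epsilon> > 0" "\<And>s. \<bar>s\<bar> < \<epsilon> \<Longrightarrow> y(i := y i + s) \<in> D"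
proof -
  have "0 \<in> {s. y(i := y i + s) \<in> D}" using assms by simp
  then obtain \<epsilon> where "\<epsilon> > 0" "ball 0 \<epsilon> \<subseteq> {s. y(i := y i + s) \<in> D}"
    using open_line[OF assms] openE by blast
  then show thesis by (intro that[of \<epsilon>]) (auto simp: subset_iff)
qed

definition ocube :: "nat \<Rightarrow> (nat \<Rightarrow> real) \<Rightarrow> real \<Rightarrow> (nat \<Rightarrow> real) set" where
  "ocube n y \<epsilon> = {z \<in> Ecoord n. \<forall>j<n. \<bar>z j - y j\<bar> < \<epsilon>}"

lemma continuous_on_coordinate: "continuous_on S (\<lambda>y::nat \<Rightarrow> real. y j)"
  using continuous_on_subset[OF continuous_on_product_coordinates] by fastforce

lemma opn_ocube: "opn n (ocube n y \<epsilon>)"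
proof -
  have "open (\<Inter>j<n. {z::nat \<Rightarrow> real. \<bar>z j - y j\<bar> < \<epsilon>})"
    by (intro open_INT ballI open_Collect_less continuous_intros continuous_on_coordinate) auto
  moreover have "ocube n y \<epsilon> = Ecoord n \<inter> (\<Inter>j<n. {z. \<bar>z j - y j\<bar> < \<epsilon>})"
    by (auto simp: ocube_def)
  ultimately show ?thesis by (auto simp: openin_open)
qed

lemma opn_imp_ocube:
  assumes D: "opn n D" and y: "y \<in> D"
  obtains \<epsilon> where "\<epsilon> > 0" "ocube n y \<epsilon> \<subseteq> D"
proof -
  obtain T where T: "open T" "D = Ecoord n \<inter> T" using D by (auto simp: openin_open)
  have yE: "y \<in> Ecoord n" using T y by auto
  have "openin (product_topology (\<lambda>i. euclidean) UNIV) T" using T by (simp add: open_fun_def)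
  from product_topology_open_contains_basis[OF this, of y] T y
  obtain V where V: "y \<in> (\<Pi>\<^sub>E i\<in>UNIV. V i)" "\<And>i. openin euclidean (V i)" "(\<Pi>\<^sub>E i\<in>UNIV. V i) \<subseteq> T"
    by auto
  have "\<exists>\<epsilon>>0. ball (y i) \<epsilon> \<subseteq> V i" for i
    using V(1) V(2)[of i] by (auto simp: PiE_def Pi_def intro: openE)
  then obtain \<epsilon> where \<epsilon>: "\<And>i. \<epsilon> i > 0" "\<And>i. ball (y i) (\<epsilon> i) \<subseteq> V i" by metis
  define \<delta> where "\<delta> = Min (insert 1 (\<epsilon> ` {..<n}))"
  have \<delta>: "\<delta> > 0" using \<epsilon> by (simp add: \<delta>_def)
  have "ocube n y \<delta> \<subseteq> D"
  proof
    fix z assume z: "z \<in> ocube n y \<delta>"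
    have "z i \<in> V i" for i
    proof (cases "i < n")
      case True
      then have "\<delta> \<le> \<epsilon> i" by (simp add: \<delta>_def)
      then show ?thesis using z True \<epsilon>(2)[of i] by (force simp: ocube_def dist_real_def abs_minus_commute)
    next
      case False
      then have "z i = y i" using z yE by (simp add: ocube_def Ecoord_def)
      then show ?thesis using V(1) by (auto simp: PiE_def Pi_def)
    qed
    then have "z \<in> T" using V(3) by (auto simp: PiE_def)
    then show "z \<in> D" using z T by (simp add: ocube_def)
  qed
  with \<delta> show thesis by (rule that)
qed

text \<open>The increment \<open>F (P \<sigma> s) - F (P \<sigma> 0)\<close> is an integral of the
  \<open>j\<close>-derivative. Its \<open>\<sigma>\<close>-derivative at \<open>0\<close> is an
  increment of the \<open>i\<close>-derivative and, under the integral, an integral of the mixed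
  derivative; differentiating both in the upper limit \<open>s\<close> compares the two
  orders.\<close>

lemma pderiv_c_commute:
  fixes F :: "(nat \<Rightarrow> real) \<Rightarrow> 'a::banach"
  assumes D: "opn n D" and F: "Ck (Suc (Suc 0)) n D F" and y: "y \<in> D" and ij: "i < n" "j < n"
  shows "pderiv_c i (pderiv_c j F) y = pderiv_c j (pderiv_c i F) y"
proof (cases "i = j")
  case False
  obtain \<epsilon> where \<epsilon>: "\<epsilon> > 0" "ocube n y \<epsilon> \<subseteq> D" using opn_imp_ocube[OF D y] .
  define \<delta> where "\<delta> = \<epsilon> / 2"
  have \<delta>: "\<delta> > 0" using \<epsilon> by (simp add: \<delta>_def)
  have yE: "y \<in> Ecoord n" using D y openin_imp_subset by blast
  define P where "P \<sigma> s = y(i := y i + \<sigma>, j := y j + s)" for \<sigma> s :: real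
  have P: "P \<sigma> s \<in> D" if "\<sigma> \<in> {-\<delta>..\<delta>}" "s \<in> {-\<delta>..\<delta>}" for \<sigma> s
  proof -
    have "P \<sigma> s \<in> ocube n y \<epsilon>" using that ij yE \<epsilon>(1) by (auto simp: P_def ocube_def Ecoord_def \<delta>_def)
    then show ?thesis using \<epsilon> by auto
  qed
  have P00: "P 0 0 = y" by (simp add: P_def)
  have Pj: "(P \<sigma> s)(j := P \<sigma> s j + r) = P \<sigma> (s + r)" for \<sigma> s r by (auto simp: P_def)
  have Pi: "(P \<sigma> s)(i := P \<sigma> s i + r) = P (\<sigma> + r) s" for \<sigma> s r using False by (auto simp: P_def)
  have cP: "continuous_on S (\<lambda>p. P (fst p) (snd p))" for S :: "(real \<times> real) set"
    unfolding P_def by (intro continuous_on_fun_upd continuous_intros)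
  have dj: "((\<lambda>s. G (P \<sigma> s)) has_vector_derivative pderiv_c j G (P \<sigma> s)) (at s)"
    if G: "Ck (Suc 0) n D G" and s: "\<sigma> \<in> {-\<delta>..\<delta>}" "s \<in> {-\<delta>..\<delta>}" for \<sigma> s and G :: "(nat \<Rightarrow> real) \<Rightarrow> 'a"
    by (rule has_vector_derivative_translate)
       (use Ck_Suc_has_pd[OF G ij(2) P[OF s]] in \<open>simp only: has_pd_def Pj\<close>)
  have di: "((\<lambda>\<sigma>. G (P \<sigma> s)) has_vector_derivative pderiv_c i G (P \<sigma> s)) (at \<sigma>)"
    if G: "Ck (Suc 0) n D G" and s: "\<sigma> \<in> {-\<delta>..\<delta>}" "s \<in> {-\<delta>..\<delta>}" for \<sigma> s and G :: "(nat \<Rightarrow> real) \<Rightarrow> 'a"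
    by (rule has_vector_derivative_translate)
       (use Ck_Suc_has_pd[OF G ij(1) P[OF s]] in \<open>simp only: has_pd_def Pi\<close>)
  have F1: "Ck (Suc 0) n D F" by (rule Ck_Suc_imp_Ck[OF F])
  have Fi: "Ck (Suc 0) n D (pderiv_c i F)" and Fj: "Ck (Suc 0) n D (pderiv_c j F)" using F ij by auto
  have cji: "continuous_on D (pderiv_c i (pderiv_c j F))" using Fj ij by simp
  have key: "pderiv_c i F (P 0 s) - pderiv_c i F y = integral {0..s} (\<lambda>u. pderiv_c i (pderiv_c j F) (P 0 u))"
    if s: "s \<in> {0..\<delta>}" for s
  proof -
    have ftc: "((\<lambda>u. pderiv_c j F (P \<sigma> u)) has_integral F (P \<sigma> s) - F (P \<sigma> 0)) {0..s}" if "\<sigma> \<in> {-\<delta>..\<delta>}" for \<sigma>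
    proof (rule fundamental_theorem_of_calculus)
      fix u assume u: "u \<in> {0..s}"
      show "((\<lambda>u. F (P \<sigma> u)) has_vector_derivative pderiv_c j F (P \<sigma> u)) (at u within {0..s})"
        by (rule has_vector_derivative_at_within[OF dj[OF F1]]; use s u that in auto)
    qed (use s in simp)
    have "((\<lambda>\<sigma>. integral (cbox 0 s) (\<lambda>u. pderiv_c j F (P \<sigma> u))) has_vector_derivative
        integral (cbox 0 s) (\<lambda>u. pderiv_c i (pderiv_c j F) (P 0 u))) (at 0 within {-\<delta>..\<delta>})"
    proof (rule leibniz_rule_vector_derivative[where f = "\<lambda>\<sigma> u. pderiv_c j F (P \<sigma> u)" and fx = "\<lambda>\<sigma> u. pderiv_c i (pderiv_c j F) (P \<sigma> u)"])
      show "((\<lambda>\<sigma>. pderiv_c j F (P \<sigma> u)) has_vector_derivative pderiv_c i (pderiv_c j F) (P \<sigma> u)) (at \<sigma> within {-\<delta>..\<delta>})"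
        if "\<sigma> \<in> {-\<delta>..\<delta>}" "u \<in> cbox 0 s" for \<sigma> u
        by (rule has_vector_derivative_at_within, rule di[OF Fj]) (use that s in auto)
      show "(\<lambda>u. pderiv_c j F (P \<sigma> u)) integrable_on cbox 0 s" if "\<sigma> \<in> {-\<delta>..\<delta>}" for \<sigma>
        using ftc[OF that] by auto
      show "continuous_on ({-\<delta>..\<delta>} \<times> cbox 0 s) (\<lambda>(\<sigma>, u). pderiv_c i (pderiv_c j F) (P \<sigma> u))"
        unfolding split_beta by (rule continuous_on_compose2[OF cji cP]) (use P s in auto)
    qed (use \<delta> in auto)
    moreover have "((\<lambda>\<sigma>. integral (cbox 0 s) (\<lambda>u. pderiv_c j F (P \<sigma> u))) has_vector_derivative
        pderiv_c i F (P 0 s) - pderiv_c i F (P 0 0)) (at 0 within {-\<delta>..\<delta>})"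
    proof (rule has_vector_derivative_transform[of _ _ _ "\<lambda>\<sigma>. F (P \<sigma> s) - F (P \<sigma> 0)"])
      show "((\<lambda>\<sigma>. F (P \<sigma> s) - F (P \<sigma> 0)) has_vector_derivative pderiv_c i F (P 0 s) - pderiv_c i F (P 0 0)) (at 0 within {-\<delta>..\<delta>})"
        by (rule has_vector_derivative_diff; rule has_vector_derivative_at_within[OF di[OF F1]]; use s \<delta> in auto)
    qed (use ftc \<delta> in \<open>auto simp: integral_unique\<close>)
    ultimately show ?thesis
      using vector_derivative_unique_within_closed_interval[of "-\<delta>" \<delta> 0] \<delta> by (auto simp: P00)
  qed
  have "((\<lambda>s. integral {0..s} (\<lambda>u. pderiv_c i (pderiv_c j F) (P 0 u))) has_vector_derivative pderiv_c i (pderiv_c j F) (P 0 0)) (at 0 within {0..\<delta>})"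
  proof (rule integral_has_vector_derivative)
    have "continuous_on {0..\<delta>} (\<lambda>u. P 0 u)"
      unfolding P_def by (intro continuous_on_fun_upd continuous_intros)
    then show "continuous_on {0..\<delta>} (\<lambda>u. pderiv_c i (pderiv_c j F) (P 0 u))"
      by (rule continuous_on_compose2[OF cji]) (use P \<delta> in auto)
  qed (use \<delta> in auto)
  moreover have "((\<lambda>s. integral {0..s} (\<lambda>u. pderiv_c i (pderiv_c j F) (P 0 u))) has_vector_derivative pderiv_c j (pderiv_c i F) (P 0 0) - 0) (at 0 within {0..\<delta>})"
  proof (rule has_vector_derivative_transform[of _ _ _ "\<lambda>s. pderiv_c i F (P 0 s) - pderiv_c i F y"])
    show "((\<lambda>s. pderiv_c i F (P 0 s) - pderiv_c i F y) has_vector_derivative pderiv_c j (pderiv_c i F) (P 0 0) - 0) (at 0 within {0..\<delta>})"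
      by (rule has_vector_derivative_diff[OF has_vector_derivative_at_within[OF dj[OF Fi]] has_vector_derivative_const]; use \<delta> in auto)
  qed (use key \<delta> in auto)
  ultimately show ?thesis
    using vector_derivative_unique_within_closed_interval[of 0 \<delta> 0] \<delta> by (auto simp: P00)
qed simp

lemma Cinf_pderiv_commute:
  fixes F :: "(nat \<Rightarrow> real) \<Rightarrow> 'a::banach"
  assumes "opn n D" "Cinf n D F" "y \<in> D" "i < n" "j < n"
  shows "pderiv_c i (pderiv_c j F) y = pderiv_c j (pderiv_c i F) y"
  by (rule pderiv_c_commute[OF assms(1) _ assms(3-)]) (use assms(2) in \<open>simp only: Cinf_def\<close>)

text \<open>For \<open>a = 0\<close> and \<open>k\<close> the \<open>p\<close>-derivative of an odd
  function \<open>h\<close>, this is the quotient of \<open>h\<close> by \<open>y p\<close>. Each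
  derivative along \<open>p\<close> produces another factor \<open>s\<close>, and the weight
  \<open>s ^ a\<close> makes the family closed under differentiation.\<close>

definition radial_mean :: "nat \<Rightarrow> nat \<Rightarrow> ((nat \<Rightarrow> real) \<Rightarrow> 'a::banach) \<Rightarrow> (nat \<Rightarrow> real) \<Rightarrow> 'a" where
  "radial_mean p a k y = integral {0..1} (\<lambda>s. s ^ a *\<^sub>R k (y(p := s * y p)))"

lemma Ck_radial_mean:
  fixes k :: "(nat \<Rightarrow> real) \<Rightarrow> 'a::banach"
  assumes D: "opn n D" and p: "p < n"
    and star: "\<And>y s. y \<in> D \<Longrightarrow> s \<in> {0..1} \<Longrightarrow> y(p := s * y p) \<in> D"
  shows "Ck m n D k \<Longrightarrow> Ck m n D (radial_mean p a k)"
proof (induction m arbitrary: k a)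
  have cont: "continuous_on D (radial_mean p a k)" if "continuous_on D k" for k :: "(nat \<Rightarrow> real) \<Rightarrow> 'a" and a
  proof -
    have "continuous_on D (\<lambda>y. integral (cbox 0 1) (\<lambda>s. s ^ a *\<^sub>R k (y(p := s * y p))))"
    proof (rule integral_continuous_on_param)
      have cc: "continuous_on (D \<times> cbox 0 1) (\<lambda>q. (fst q)(p := snd q * fst q p))"
        by (intro continuous_on_fun_upd continuous_intros continuous_on_compose2[OF continuous_on_coordinate[of UNIV]]) auto
      show "continuous_on (D \<times> cbox 0 1) (\<lambda>(y, s). s ^ a *\<^sub>R k (y(p := s * y p)))"
        unfolding split_beta
        by (intro continuous_on_scaleR continuous_on_power continuous_on_snd continuous_on_id continuous_on_compose2[OF that cc])
           (use star in auto)
    qed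
    then show ?thesis by (simp add: radial_mean_def[abs_def])
  qed
  {
    case 0
    then show ?case using cont by simp
  next
    case (Suc m)
    define g where "g i = radial_mean p (if i = p then Suc a else a) (pderiv_c i k)" for i
    show ?case
    proof (rule Ck_SucI[OF D, where g = g])
      show "continuous_on D (radial_mean p a k)" using Suc.prems by (intro cont) simp
      show "Ck m n D (g i)" if "i < n" for i unfolding g_def by (rule Suc.IH) (use Suc.prems that in simp)
      fix i y assume i: "i < n" and y: "y \<in> D"
      obtain \<epsilon> where \<epsilon>: "\<epsilon> > 0" "\<And>s. \<bar>s\<bar> < \<epsilon> \<Longrightarrow> y(i := y i + s) \<in> D" using open_line_interval[OF D y i] by blast
      define Y where "Y \<sigma> = y(i := y i + \<sigma>)" for \<sigma>
      have Y: "Y \<sigma> \<in> D" if "\<sigma> \<in> {-\<epsilon><..<\<epsilon>}" for \<sigma> using \<epsilon>(2)[of \<sigma>] that by (auto simp: Y_def)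
      let ?a = "if i = p then Suc a else a"
      have "((\<lambda>\<sigma>. integral (cbox 0 1) (\<lambda>s. s ^ a *\<^sub>R k ((Y \<sigma>)(p := s * Y \<sigma> p)))) has_vector_derivative
          integral (cbox 0 1) (\<lambda>s. s ^ ?a *\<^sub>R pderiv_c i k ((Y 0)(p := s * Y 0 p)))) (at 0 within {-\<epsilon><..<\<epsilon>})"
      proof (rule leibniz_rule_vector_derivative[where f = "\<lambda>\<sigma> s. s ^ a *\<^sub>R k ((Y \<sigma>)(p := s * Y \<sigma> p))"
            and fx = "\<lambda>\<sigma> s. s ^ ?a *\<^sub>R pderiv_c i k ((Y \<sigma>)(p := s * Y \<sigma> p))"])
        fix \<sigma> s :: real assume \<sigma>: "\<sigma> \<in> {-\<epsilon><..<\<epsilon>}" and s: "s \<in> cbox 0 1"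
        let ?z = "(Y \<sigma>)(p := s * Y \<sigma> p)"
        have zD: "?z \<in> D" using star[OF Y[OF \<sigma>]] s by simp
        have hp: "((\<lambda>r. k (?z(i := ?z i + r))) has_vector_derivative pderiv_c i k ?z) (at 0)"
          using Ck_Suc_has_pd[OF Suc.prems i zD] by (simp only: has_pd_def)
        have "((\<lambda>r. k ((Y (\<sigma> + r))(p := s * Y (\<sigma> + r) p))) has_vector_derivative (if i = p then s else 1) *\<^sub>R pderiv_c i k ?z) (at 0)"
        proof (cases "i = p")
          case True
          have "((\<lambda>r. k (?z(i := ?z i + r))) \<circ> (\<lambda>r. s * r) has_vector_derivative s *\<^sub>R pderiv_c i k ?z) (at 0)"
            by (rule vector_diff_chain_at) (use hp in \<open>auto intro!: derivative_eq_intros\<close>)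
          moreover have "?z(i := ?z i + s * r) = (Y (\<sigma> + r))(p := s * Y (\<sigma> + r) p)" for r
            using True by (auto simp: Y_def algebra_simps)
          ultimately show ?thesis using True by (simp add: o_def)
        next
          case False
          have "?z(i := ?z i + r) = (Y (\<sigma> + r))(p := s * Y (\<sigma> + r) p)" for r
            using False by (auto simp: Y_def algebra_simps)
          then show ?thesis using hp False by simp
        qed
        then have "((\<lambda>\<sigma>. k ((Y \<sigma>)(p := s * Y \<sigma> p))) has_vector_derivative (if i = p then s else 1) *\<^sub>R pderiv_c i k ?z) (at \<sigma>)"
          by (rule has_vector_derivative_translate)
        then have "((\<lambda>\<sigma>. s ^ a *\<^sub>R k ((Y \<sigma>)(p := s * Y \<sigma> p))) has_vector_derivative s ^ a *\<^sub>R ((if i = p then s else 1) *\<^sub>R pderiv_c i k ?z)) (at \<sigma>)"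
          by (rule bounded_linear.has_vector_derivative[OF bounded_linear_scaleR_right])
        then show "((\<lambda>\<sigma>. s ^ a *\<^sub>R k ((Y \<sigma>)(p := s * Y \<sigma> p))) has_vector_derivative s ^ ?a *\<^sub>R pderiv_c i k ?z) (at \<sigma> within {-\<epsilon><..<\<epsilon>})"
          by (rule has_vector_derivative_at_within[THEN has_vector_derivative_eq_rhs]) (simp add: mult.commute)
      next
        fix \<sigma> :: real assume \<sigma>: "\<sigma> \<in> {-\<epsilon><..<\<epsilon>}"
        show "(\<lambda>s. s ^ a *\<^sub>R k ((Y \<sigma>)(p := s * Y \<sigma> p))) integrable_on cbox 0 1"
        proof (rule integrable_continuous, rule continuous_on_scaleR)
          have cs: "continuous_on (cbox 0 1) (\<lambda>s. (Y \<sigma>)(p := s * Y \<sigma> p))"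
            by (intro continuous_on_fun_upd continuous_intros)
          have ck: "continuous_on D k" using Suc.prems by simp
          show "continuous_on (cbox 0 1) (\<lambda>s. k ((Y \<sigma>)(p := s * Y \<sigma> p)))"
            by (rule continuous_on_compose2[OF ck cs]) (use star[OF Y[OF \<sigma>]] in auto)
        qed (intro continuous_intros)
      next
        have ck: "continuous_on D (pderiv_c i k)" using Suc.prems i by (auto intro: Ck_continuous)
        have cs: "continuous_on ({-\<epsilon><..<\<epsilon>} \<times> cbox 0 1) (\<lambda>q. (Y (fst q))(p := snd q * Y (fst q) p))"
        proof -
          have cY: "continuous_on ({-\<epsilon><..<\<epsilon>} \<times> cbox 0 (1::real)) (\<lambda>q. Y (fst q))"
            unfolding Y_def by (intro continuous_on_fun_upd continuous_intros)
          show ?thesis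
            by (rule continuous_on_fun_upd[OF cY continuous_on_mult[OF continuous_on_snd[OF continuous_on_id]
                  continuous_on_product_then_coordinatewise[OF cY]]])
        qed
        show "continuous_on ({-\<epsilon><..<\<epsilon>} \<times> cbox 0 1) (\<lambda>(\<sigma>, s). s ^ ?a *\<^sub>R pderiv_c i k ((Y \<sigma>)(p := s * Y \<sigma> p)))"
          unfolding split_beta
          by (intro continuous_on_scaleR continuous_on_power continuous_on_snd continuous_on_id continuous_on_compose2[OF ck cs])
             (use star Y in auto)
      qed (use \<epsilon> in auto)
      then have "((\<lambda>\<sigma>. radial_mean p a k (Y \<sigma>)) has_vector_derivative g i (Y 0)) (at 0)"
        using \<epsilon> at_within_open[of 0 "{-\<epsilon><..<\<epsilon>}"] by (simp add: radial_mean_def g_def)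
      then show "has_pd i (radial_mean p a k) (g i y) y" by (simp add: has_pd_def Y_def)
    qed
  }
qed

section \<open>Functions even or odd in one coordinate\<close>

definition rf :: "nat \<Rightarrow> (nat \<Rightarrow> real) \<Rightarrow> nat \<Rightarrow> real" where "rf p y = y(p := - y p)"

text \<open>The value at \<open>y p = 0\<close> is the one that makes the quotient of an odd function by \<open>y p\<close> smooth.\<close>

definition Dv :: "nat \<Rightarrow> ((nat \<Rightarrow> real) \<Rightarrow> 'a::real_normed_vector) \<Rightarrow> (nat \<Rightarrow> real) \<Rightarrow> 'a" where
  "Dv p h y = (if y p = 0 then pderiv_c p h y else inverse (y p) *\<^sub>R h y)"

definition Lop :: "nat \<Rightarrow> ((nat \<Rightarrow> real) \<Rightarrow> 'a::real_normed_vector) \<Rightarrow> (nat \<Rightarrow> real) \<Rightarrow> 'a" where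
  "Lop p u = Dv p (pderiv_c p u)"

lemma opn_imp_Ecoord: "opn n D \<Longrightarrow> y \<in> D \<Longrightarrow> y \<in> Ecoord n"
  using openin_imp_subset by blast

text \<open>The factor \<open>\<sigma>\<close> treats even and odd functions together; the chain
  rule adds a sign exactly when one differentiates along the reflected coordinate.\<close>

lemma pderiv_c_reflect:
  fixes u :: "(nat \<Rightarrow> real) \<Rightarrow> 'a::real_normed_vector"
  assumes D: "opn n D" and u: "Cinf n D u" and sym: "\<And>y. y \<in> D \<Longrightarrow> u (rf p y) = \<sigma> *\<^sub>R u y"
    and y: "y \<in> D" and j: "j < n"
  shows "pderiv_c j u (rf p y) = (if j = p then - \<sigma> else \<sigma>) *\<^sub>R pderiv_c j u y"
proof (rule has_pd_imp_pderiv)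
  have d0: "((\<lambda>s. u (y(j := y j + s))) has_vector_derivative pderiv_c j u y) (at 0)"
    using Cinf_has_pd[OF u j y] by (simp add: has_pd_def)
  let ?z = "rf p y"
  show "has_pd j u ((if j = p then - \<sigma> else \<sigma>) *\<^sub>R pderiv_c j u y) ?z"
  proof (cases "j = p")
    case False
    have A: "((\<lambda>s. \<sigma> *\<^sub>R u (y(j := y j + s))) has_vector_derivative \<sigma> *\<^sub>R pderiv_c j u y) (at 0)"
      by (rule bounded_linear.has_vector_derivative[OF bounded_linear_scaleR_right d0])
    have B: "\<sigma> *\<^sub>R u (y(j := y j + s)) = u (?z(j := ?z j + s))" if "s \<in> {s. y(j := y j + s) \<in> D}" for s
    proof -
      have "?z(j := ?z j + s) = rf p (y(j := y j + s))" using False by (auto simp: rf_def)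
      then show ?thesis using sym that by simp
    qed
    have "((\<lambda>s. u (?z(j := ?z j + s))) has_vector_derivative \<sigma> *\<^sub>R pderiv_c j u y) (at 0)"
      by (rule has_vector_derivative_transform_within_open[OF A open_line[OF D y j] _ B]) (use y in simp)
    then show ?thesis using False by (simp add: has_pd_def)
  next
    case True
    have "((\<lambda>s. u (y(j := y j + s))) \<circ> (\<lambda>s. - s) has_vector_derivative (- 1) *\<^sub>R pderiv_c j u y) (at 0)"
      by (rule vector_diff_chain_at) (use d0 in \<open>auto intro!: derivative_eq_intros\<close>)
    then have A: "((\<lambda>s. \<sigma> *\<^sub>R u (y(j := y j + (- s)))) has_vector_derivative \<sigma> *\<^sub>R ((- 1) *\<^sub>R pderiv_c j u y)) (at 0)"
      by (intro bounded_linear.has_vector_derivative[OF bounded_linear_scaleR_right]) (simp add: o_def)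
    have O: "open ((\<lambda>s. - s) -` {s. y(j := y j + s) \<in> D})"
      by (intro open_vimage open_line[OF D y j] continuous_intros)
    have B: "\<sigma> *\<^sub>R u (y(j := y j + (- s))) = u (?z(j := ?z j + s))" if "s \<in> (\<lambda>s. - s) -` {s. y(j := y j + s) \<in> D}" for s
    proof -
      have "?z(j := ?z j + s) = rf p (y(j := y j + (- s)))" using True by (auto simp: rf_def)
      then show ?thesis using sym that by simp
    qed
    have "((\<lambda>s. u (?z(j := ?z j + s))) has_vector_derivative \<sigma> *\<^sub>R ((- 1) *\<^sub>R pderiv_c j u y)) (at 0)"
      by (rule has_vector_derivative_transform_within_open[OF A O _ B]) (use y in simp)
    then show ?thesis using True by (simp add: has_pd_def)
  qed
qed

text \<open>Off the hyperplane \<open>y p = 0\<close> the factor cancels; a point of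
  \<open>D\<close> on it is a limit of points of \<open>D\<close> off it, and both functions are
  continuous. Later identities are divided by \<open>y p\<close> in this way.\<close>

lemma eq_if_coord_multiples_eq:
  fixes a b :: "(nat \<Rightarrow> real) \<Rightarrow> 'a::real_normed_vector"
  assumes D: "opn n D" and p: "p < n" and cont: "continuous_on D a" "continuous_on D b"
    and eq: "\<And>y. y \<in> D \<Longrightarrow> y p *\<^sub>R a y = y p *\<^sub>R b y" and y: "y \<in> D"
  shows "a y = b y"
proof (cases "y p = 0")
  case False
  then show ?thesis using eq[OF y] by simp
next
  case True
  let ?c = "\<lambda>s. a (y(p := y p + s)) - b (y(p := y p + s))" and ?S = "{s. y(p := y p + s) \<in> D}"
  have cl: "continuous_on ?S (\<lambda>s. y(p := y p + s))" by (intro continuous_on_fun_upd continuous_intros)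
  have "continuous_on ?S ?c"
    by (rule continuous_on_diff[OF continuous_on_compose2[OF cont(1) cl] continuous_on_compose2[OF cont(2) cl]]) auto
  moreover have O: "open ?S" "0 \<in> ?S" using open_line[OF D y p] y by auto
  ultimately have "isCont ?c 0" using continuous_on_eq_continuous_at by blast
  then have 1: "(?c \<longlongrightarrow> a y - b y) (at 0)" by (simp add: isCont_def)
  have "\<forall>\<^sub>F s in at 0. s \<in> ?S \<and> s \<noteq> 0"
    using eventually_at_in_open[OF O] by eventually_elim auto
  then have "\<forall>\<^sub>F s in at 0. ?c s = 0"
  proof eventually_elim
    case (elim s)
    then show ?case using eq[of "y(p := y p + s)"] True by simp
  qed
  then have 2: "(?c \<longlongrightarrow> 0) (at 0)" by (rule tendsto_eventually)
  show ?thesis using tendsto_unique[OF _ 1 2] by simp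
qed

locale reflected =
  fixes n p :: nat and D :: "(nat \<Rightarrow> real) set"
  assumes D: "opn n D" and p: "p < n" and rfD: "\<And>y. y \<in> D \<Longrightarrow> rf p y \<in> D"
begin

definition Ev :: "((nat \<Rightarrow> real) \<Rightarrow> 'a::banach) \<Rightarrow> bool" where
  "Ev u \<longleftrightarrow> Cinf n D u \<and> (\<forall>y\<in>D. u (rf p y) = u y)"

definition Od :: "((nat \<Rightarrow> real) \<Rightarrow> 'a::banach) \<Rightarrow> bool" where
  "Od u \<longleftrightarrow> Cinf n D u \<and> (\<forall>y\<in>D. u (rf p y) = - u y)"

lemma Ev_pderiv: assumes "Ev u" "j < n" "j \<noteq> p" shows "Ev (pderiv_c j u)"
  using pderiv_c_reflect[OF D, of u p 1] Cinf_pderiv assms by (auto simp: Ev_def)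

lemma Ev_pderiv_p: assumes "Ev u" shows "Od (pderiv_c p u)"
  using pderiv_c_reflect[OF D, of u p 1] Cinf_pderiv assms p by (auto simp: Ev_def Od_def)

lemma Od_zero: assumes "Od h" "y \<in> D" "y p = 0" shows "h y = 0"
proof -
  have "rf p y = y" using assms by (auto simp: rf_def)
  then have "h y = - h y" using assms by (metis Od_def)
  then show ?thesis by (metis add.right_inverse double_zero_sym neg_equal_0_iff_equal scaleR_2 scaleR_eq_0_iff zero_neq_numeral)
qed

lemma Od_eq_Dv: assumes "Od h" "y \<in> D" shows "h y = y p *\<^sub>R Dv p h y"
  using Od_zero[OF assms] by (simp add: Dv_def)

text \<open>Away from the hyperplane the quotient is a product of smooth functions. Near it,
  \<open>h\<close> vanishes on the hyperplane, so by the fundamental theorem of calculus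
  \<open>h z\<close> is \<open>z p\<close> times the mean of the \<open>p\<close>-derivative over
  the segment from the hyperplane to \<open>z\<close>; the quotient is a \<open>radial_mean\<close>
  and involves no division.\<close>

lemma Ck_Dv:
  fixes h :: "(nat \<Rightarrow> real) \<Rightarrow> 'a::banach"
  assumes h: "Od h" shows "Ck k n D (Dv p h)"
proof (rule Ck_local)
  have hC: "Cinf n D h" using h by (simp add: Od_def)
  fix y assume y: "y \<in> D"
  show "\<exists>D'. opn n D' \<and> y \<in> D' \<and> D' \<subseteq> D \<and> Ck k n D' (Dv p h)"
  proof (cases "y p = 0")
    case False
    have "open {z::nat \<Rightarrow> real. z p \<noteq> 0}"
      by (intro open_Collect_neq continuous_intros continuous_on_coordinate)
    then have O: "opn n (D \<inter> {z. z p \<noteq> 0})" (is "opn n ?D'")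
      using D by (intro openin_Int_open)
    have "Ck k n ?D' (\<lambda>z. inverse (z p) *\<^sub>R h z)"
      by (rule Ck_scaleR[OF O Ck_inverse_coord[OF O] Ck_subset[of k n D h]])
         (use hC in \<open>auto simp only: Cinf_def\<close>)
    then have "Ck k n ?D' (Dv p h)" by (rule Ck_cong[OF O, rotated]) (auto simp: Dv_def)
    then show ?thesis using O y False by blast
  next
    case True
    obtain \<epsilon> where \<epsilon>: "\<epsilon> > 0" "ocube n y \<epsilon> \<subseteq> D" using opn_imp_ocube[OF D y] .
    let ?D' = "ocube n y \<epsilon>"
    \<comment> \<open>As \<open>y p = 0\<close>, the cube is centred on the hyperplane and contains
      the segments that join its points to the hyperplane.\<close>
    have star: "z(p := s * z p) \<in> ?D'" if z: "z \<in> ?D'" and s: "s \<in> {0..1}" for z s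
    proof -
      have "\<bar>s * z p\<bar> \<le> 1 * \<bar>z p\<bar>" unfolding abs_mult using s by (intro mult_right_mono) auto
      moreover have "\<bar>z p\<bar> < \<epsilon>" using z p True by (auto simp: ocube_def)
      ultimately show ?thesis using z p True by (auto simp: ocube_def Ecoord_def)
    qed
    have dh: "Ck k n ?D' (pderiv_c p h)"
      using Cinf_pderiv[OF hC p] Ck_subset[OF _ \<epsilon>(2)] by (auto simp: Cinf_def)
    have "Ck k n ?D' (radial_mean p 0 (pderiv_c p h))"
      by (rule Ck_radial_mean[OF opn_ocube p star dh])
    moreover have "radial_mean p 0 (pderiv_c p h) z = Dv p h z" if z: "z \<in> ?D'" for z
    proof (cases "z p = 0")
      case zp: True
      have "z(p := s * z p) = z" for s using zp by auto
      then show ?thesis using zp by (simp add: radial_mean_def Dv_def)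
    next
      case zp: False
      have "((\<lambda>s. z p *\<^sub>R pderiv_c p h (z(p := s * z p))) has_integral h (z(p := 1 * z p)) - h (z(p := 0 * z p))) {0..1}"
      proof (rule fundamental_theorem_of_calculus)
        fix s :: real assume s: "s \<in> {0..1}"
        have "((\<lambda>x. h (z(p := x))) \<circ> (\<lambda>s. s * z p) has_vector_derivative z p *\<^sub>R pderiv_c p h (z(p := s * z p))) (at s)"
          by (rule vector_diff_chain_at)
             (use has_vector_derivative_partial[of 0 n D h p z "s * z p"] hC p star[OF z s] \<epsilon>(2) in
               \<open>auto simp: Cinf_def intro!: derivative_eq_intros simp del: Ck.simps\<close>)
        then show "((\<lambda>s. h (z(p := s * z p))) has_vector_derivative z p *\<^sub>R pderiv_c p h (z(p := s * z p))) (at s within {0..1})"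
          by (simp add: o_def has_vector_derivative_at_within)
      qed simp
      moreover have "h (z(p := 0)) = 0"
        using star[OF z, of 0] \<epsilon>(2) by (intro Od_zero[OF h]) auto
      ultimately have "((\<lambda>s. z p *\<^sub>R pderiv_c p h (z(p := s * z p))) has_integral h z) {0..1}" by simp
      then have "((\<lambda>s. inverse (z p) *\<^sub>R (z p *\<^sub>R pderiv_c p h (z(p := s * z p)))) has_integral inverse (z p) *\<^sub>R h z) {0..1}"
        by (rule has_integral_cmul)
      then have "((\<lambda>s. pderiv_c p h (z(p := s * z p))) has_integral inverse (z p) *\<^sub>R h z) {0..1}" using zp by simp
      then show ?thesis using zp by (simp add: radial_mean_def Dv_def integral_unique)
    qed
    ultimately have "Ck k n ?D' (Dv p h)" using Ck_cong[OF opn_ocube] by blast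
    moreover have "y \<in> ?D'" using \<epsilon> opn_imp_Ecoord[OF D y] by (simp add: ocube_def)
    ultimately show ?thesis using opn_ocube \<epsilon>(2) by blast
  qed
qed

lemma Ev_Dv: assumes "Od h" shows "Ev (Dv p h)"
  unfolding Ev_def
proof (intro conjI ballI)
  show "Cinf n D (Dv p h)" using Ck_Dv[OF assms] by (simp add: Cinf_def)
  fix y assume y: "y \<in> D"
  show "Dv p h (rf p y) = Dv p h y"
  proof (cases "y p = 0")
    case True
    then have "rf p y = y" by (auto simp: rf_def)
    then show ?thesis by simp
  next
    case False
    then show ?thesis using assms y by (simp add: Dv_def Od_def rf_def)
  qed
qed

lemma Ev_Lop: "Ev u \<Longrightarrow> Ev (Lop p u)" unfolding Lop_def by (rule Ev_Dv[OF Ev_pderiv_p])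

lemma Ev_Lop_funpow: "Ev u \<Longrightarrow> Ev ((Lop p ^^ k) u)" by (induction k) (auto simp: Ev_Lop)

section \<open>Sequences of iterated radial derivatives\<close>

definition chain :: "(nat \<Rightarrow> (nat \<Rightarrow> real) \<Rightarrow> 'a::banach) \<Rightarrow> bool" where
  "chain u \<longleftrightarrow> (\<forall>k. Cinf n D (u k) \<and> (\<forall>y\<in>D. pderiv_c p (u k) y = y p *\<^sub>R u (Suc k) y))"

lemma chainD: "chain u \<Longrightarrow> Cinf n D (u k)" "chain u \<Longrightarrow> y \<in> D \<Longrightarrow> pderiv_c p (u k) y = y p *\<^sub>R u (Suc k) y"
  by (auto simp: chain_def)

lemma chain_has_pd: "chain u \<Longrightarrow> y \<in> D \<Longrightarrow> has_pd p (u k) (y p *\<^sub>R u (Suc k) y) y"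
  using Cinf_has_pd[OF chainD(1) p, of u y k] chainD(2)[of u y k] by simp

lemma chainI:
  assumes "\<And>k. Cinf n D (u k)" "\<And>k y. y \<in> D \<Longrightarrow> has_pd p (u k) (y p *\<^sub>R u (Suc k) y) y"
  shows "chain u"
  using assms(1) has_pd_imp_pderiv[OF assms(2)] by (simp add: chain_def)

lemma chain_Lop: assumes "Ev u" shows "chain (\<lambda>k. (Lop p ^^ k) u)"
  unfolding chain_def
proof (intro allI conjI ballI)
  fix k
  have E: "Ev ((Lop p ^^ k) u)" by (rule Ev_Lop_funpow[OF assms])
  show "Cinf n D ((Lop p ^^ k) u)" using E by (simp add: Ev_def)
  show "pderiv_c p ((Lop p ^^ k) u) y = y p *\<^sub>R (Lop p ^^ Suc k) u y" if "y \<in> D" for y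
    using Od_eq_Dv[OF Ev_pderiv_p[OF E] that] by (simp add: Lop_def)
qed

lemma chain_linear:
  assumes L: "bounded_linear L" and u: "chain u" shows "chain (\<lambda>k y. L (u k y))"
proof (rule chainI)
  show "Cinf n D (\<lambda>y. L (u k y))" for k by (rule Cinf_linear[OF D L chainD(1)[OF u]])
  show "has_pd p (\<lambda>y. L (u k y)) (y p *\<^sub>R L (u (Suc k) y)) y" if "y \<in> D" for k y
    using has_pd_linear[OF L chain_has_pd[OF u that]] L by (simp add: linear_simps)
qed

lemma chain_add: assumes "chain u" "chain v" shows "chain (\<lambda>k y. u k y + v k y)"
proof (rule chainI)
  show "Cinf n D (\<lambda>y. u k y + v k y)" for k using assms by (intro Cinf_add[OF D] chainD)
  show "has_pd p (\<lambda>y. u k y + v k y) (y p *\<^sub>R (u (Suc k) y + v (Suc k) y)) y" if "y \<in> D" for k y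
    using has_pd_add[OF chain_has_pd[OF assms(1) that] chain_has_pd[OF assms(2) that]] by (simp add: scaleR_add_right)
qed

lemma chain_sum: assumes "\<And>j. j \<in> A \<Longrightarrow> chain (u j)" shows "chain (\<lambda>k y. \<Sum>j\<in>A. u j k y)"
proof (rule chainI)
  show "Cinf n D (\<lambda>y. \<Sum>j\<in>A. u j k y)" for k using assms by (intro Cinf_sum[OF D] chainD)
  show "has_pd p (\<lambda>y. \<Sum>j\<in>A. u j k y) (y p *\<^sub>R (\<Sum>j\<in>A. u j (Suc k) y)) y" if "y \<in> D" for k y
    using has_pd_sum[of A p "\<lambda>j. u j k" "\<lambda>j. y p *\<^sub>R u j (Suc k) y" y] chain_has_pd[OF assms that] by (simp add: scaleR_sum_right)
qed

lemma chain_Suc: "chain u \<Longrightarrow> chain (\<lambda>k. u (Suc k))" by (simp add: chain_def)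

lemma chain_pderiv: assumes u: "chain u" and j: "j < n" "j \<noteq> p" shows "chain (\<lambda>k. pderiv_c j (u k))"
  unfolding chain_def
proof (intro allI conjI ballI)
  fix k
  show "Cinf n D (pderiv_c j (u k))" by (rule Cinf_pderiv[OF chainD(1)[OF u] j(1)])
  fix y assume y: "y \<in> D"
  have "pderiv_c p (pderiv_c j (u k)) y = pderiv_c j (pderiv_c p (u k)) y"
    by (rule Cinf_pderiv_commute[OF D chainD(1)[OF u] y p j(1)])
  also have "\<dots> = pderiv_c j (\<lambda>y. y p *\<^sub>R u (Suc k) y) y"
    by (rule pderiv_c_cong[OF D y j(1)]) (use chainD(2)[OF u] in auto)
  also have "\<dots> = y p *\<^sub>R pderiv_c j (u (Suc k)) y"
    by (rule has_pd_imp_pderiv)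
       (use has_pd_scaleR[OF has_pd_coord[of j p y] Cinf_has_pd[OF chainD(1)[OF u] j(1) y, of "Suc k"]] j in simp)
  finally show "pderiv_c p (pderiv_c j (u k)) y = y p *\<^sub>R pderiv_c j (u (Suc k)) y" .
qed

text \<open>\<open>L\<close> is a derivation that sends \<open>(y p)\<^sup>2\<close> to
  \<open>2\<close>, so applying it \<open>k\<close> times to
  \<open>(y p)\<^sup>2 *\<^sub>R u 1\<close>, the member for \<open>k = 0\<close>, gives this
  combination.\<close>

lemma chain_radius_square:
  assumes u: "chain u" shows "chain (\<lambda>k y. (2 * real k) *\<^sub>R u k y + (y p)\<^sup>2 *\<^sub>R u (Suc k) y)"
proof (rule chainI)
  show "Cinf n D (\<lambda>y. (2 * real k) *\<^sub>R u k y + (y p)\<^sup>2 *\<^sub>R u (Suc k) y)" for k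
  proof -
    have "Cinf n D (\<lambda>y. (2 * real k) *\<^sub>R u k y + y p *\<^sub>R (y p *\<^sub>R u (Suc k) y))"
      by (intro Cinf_add[OF D] Cinf_scaleR[OF D] Cinf_const Cinf_coord chainD[OF u])
    then show ?thesis by (simp add: power2_eq_square)
  qed
  fix k y assume y: "y \<in> D"
  have s: "has_pd p (\<lambda>y. (y p)\<^sup>2) (2 * y p) y"
    unfolding has_pd_def has_real_derivative_iff_has_vector_derivative[symmetric]
    by (auto intro!: derivative_eq_intros)
  have "has_pd p (\<lambda>y. (2 * real k) *\<^sub>R u k y + (y p)\<^sup>2 *\<^sub>R u (Suc k) y)
     ((2 * real k) *\<^sub>R (y p *\<^sub>R u (Suc k) y) + ((y p)\<^sup>2 *\<^sub>R (y p *\<^sub>R u (Suc (Suc k)) y) + (2 * y p) *\<^sub>R u (Suc k) y)) y"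
    by (intro has_pd_add has_pd_linear[OF bounded_linear_scaleR_right] chain_has_pd[OF u y] has_pd_scaleR[OF s])
  then show "has_pd p (\<lambda>y. (2 * real k) *\<^sub>R u k y + (y p)\<^sup>2 *\<^sub>R u (Suc k) y)
     (y p *\<^sub>R ((2 * real (Suc k)) *\<^sub>R u (Suc k) y + (y p)\<^sup>2 *\<^sub>R u (Suc (Suc k)) y)) y"
    by (simp add: algebra_simps)
qed

text \<open>A chain is determined by its first member, since \<open>y p *\<^sub>R u (Suc k)\<close>
  is the derivative of \<open>u k\<close> and the factor cancels by continuity. A linear identity is
  thus proved for all \<open>k\<close> by writing the difference of its sides as a chain and
  checking \<open>k = 0\<close>.\<close>

lemma chain_zero:
  assumes u: "chain u" and 0: "\<And>y. y \<in> D \<Longrightarrow> u 0 y = 0" and y: "y \<in> D" shows "u k y = 0"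
  using y
proof (induction k arbitrary: y)
  case (Suc k)
  show ?case
  proof (rule eq_if_coord_multiples_eq[OF D p Cinf_continuous[OF chainD(1)[OF u]] continuous_on_const _ Suc.prems])
    fix y assume y: "y \<in> D"
    have "y p *\<^sub>R u (Suc k) y = pderiv_c p (u k) y" using chainD(2)[OF u y] by simp
    also have "\<dots> = pderiv_c p (\<lambda>y. 0) y" by (rule pderiv_c_cong[OF D y p]) (use Suc.IH in auto)
    also have "\<dots> = 0" by (rule has_pd_imp_pderiv[OF has_pd_const])
    finally show "y p *\<^sub>R u (Suc k) y = y p *\<^sub>R 0" by simp
  qed
qed (use 0 in auto)

lemma chain_pderiv_pp:
  assumes u: "chain u" and y: "y \<in> D"
  shows "pderiv_c p (pderiv_c p (u k)) y = u (Suc k) y + (y p)\<^sup>2 *\<^sub>R u (Suc (Suc k)) y"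
proof -
  have "pderiv_c p (pderiv_c p (u k)) y = pderiv_c p (\<lambda>y. y p *\<^sub>R u (Suc k) y) y"
    by (rule pderiv_c_cong[OF D y p]) (use chainD(2)[OF u] in auto)
  also have "\<dots> = u (Suc k) y + (y p)\<^sup>2 *\<^sub>R u (Suc (Suc k)) y"
    by (rule has_pd_imp_pderiv)
       (use has_pd_scaleR[OF has_pd_coord[of p p y] chain_has_pd[OF u y, of "Suc k"]] in \<open>simp add: power2_eq_square add.commute\<close>)
  finally show ?thesis .
qed

text \<open>Below, \<open>u\<close> harmonic corresponds to \<open>c = 0\<close>; \<open>y p *\<^sub>R u\<close> harmonic to \<open>c = 2\<close>.\<close>

lemma chain_radial_equation:
  assumes u: "chain u"
    and base: "\<And>y. y \<in> D \<Longrightarrow> (\<Sum>j\<in>{..<n} - {p}. pderiv_c j (pderiv_c j (u 0)) y) + (1 + c) *\<^sub>R u 1 y + (y p)\<^sup>2 *\<^sub>R u 2 y = 0"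
    and y: "y \<in> D"
  shows "(\<Sum>j\<in>{..<n} - {p}. pderiv_c j (pderiv_c j (u k)) y) + (1 + c + 2 * real k) *\<^sub>R u (Suc k) y
     + (y p)\<^sup>2 *\<^sub>R u (Suc (Suc k)) y = 0"
proof -
  \<comment> \<open>\<open>w k\<close> is what \<open>k\<close> applications of \<open>L\<close>
    make of the left side of \<open>base\<close>; the radius term contributes the additional
    \<open>2 * real k\<close>.\<close>
  define w where "w k y = ((\<Sum>j\<in>{..<n} - {p}. pderiv_c j (pderiv_c j (u k)) y) + (1 + c) *\<^sub>R u (Suc k) y)
     + ((2 * real k) *\<^sub>R u (Suc k) y + (y p)\<^sup>2 *\<^sub>R u (Suc (Suc k)) y)" for k y
  have "chain w" unfolding w_def
    by (intro chain_add chain_sum chain_pderiv chain_linear[OF bounded_linear_scaleR_right]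
        chain_radius_square[OF chain_Suc[OF u]] chain_Suc[OF u] u) auto
  moreover have "w 0 y = 0" if "y \<in> D" for y
    using base[OF that] by (simp add: w_def numeral_2_eq_2 add.assoc)
  ultimately have "w k y = 0" by (rule chain_zero[OF _ _ y])
  then show ?thesis by (simp add: w_def algebra_simps)
qed

lemma chain_harmonic_base:
  assumes u: "chain u" and y: "y \<in> D" and h: "(\<Sum>j<n. pderiv_c j (pderiv_c j (u 0)) y) = 0"
  shows "(\<Sum>j\<in>{..<n} - {p}. pderiv_c j (pderiv_c j (u 0)) y) + (1 + 0) *\<^sub>R u 1 y + (y p)\<^sup>2 *\<^sub>R u 2 y = 0"
  using h chain_pderiv_pp[OF u y, of 0] p by (subst (asm) sum.remove[of _ p]) (auto simp: algebra_simps numeral_2_eq_2)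

text \<open>The second \<open>p\<close>-derivative of \<open>y p *\<^sub>R u 0\<close> is
  \<open>y p\<close> times \<open>3 *\<^sub>R u 1 + (y p)\<^sup>2 *\<^sub>R u 2\<close>, the radial
  Laplacian of \<open>u 0\<close> in dimension three; the common factor \<open>y p\<close> is then
  cancelled by continuity.\<close>

lemma chain_odd_harmonic_base:
  assumes u: "chain u" and F: "\<And>y. y \<in> D \<Longrightarrow> F y = y p *\<^sub>R u 0 y"
    and h: "\<And>y. y \<in> D \<Longrightarrow> (\<Sum>j<n. pderiv_c j (pderiv_c j F) y) = 0" and y: "y \<in> D"
  shows "(\<Sum>j\<in>{..<n} - {p}. pderiv_c j (pderiv_c j (u 0)) y) + (1 + 2) *\<^sub>R u 1 y + (y p)\<^sup>2 *\<^sub>R u 2 y = 0"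
    (is "?R y = 0")
proof (rule eq_if_coord_multiples_eq[OF D p _ continuous_on_const _ y])
  have "Cinf n D ?R"
  proof -
    have "Cinf n D (\<lambda>y. (\<Sum>j\<in>{..<n} - {p}. pderiv_c j (pderiv_c j (u 0)) y) + (1 + 2) *\<^sub>R u 1 y + y p *\<^sub>R (y p *\<^sub>R u 2 y))"
      by (intro Cinf_add[OF D] Cinf_sum[OF D] Cinf_scaleR[OF D] Cinf_const Cinf_coord Cinf_pderiv chainD(1)[OF u]) auto
    then show ?thesis by (simp add: power2_eq_square)
  qed
  then show "continuous_on D ?R" by (rule Cinf_continuous)
  fix y assume y: "y \<in> D"
  have dF: "pderiv_c j F z = z p *\<^sub>R pderiv_c j (u 0) z" if "z \<in> D" "j < n" "j \<noteq> p" for z j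
  proof -
    have "pderiv_c j F z = pderiv_c j (\<lambda>y. y p *\<^sub>R u 0 y) z" by (rule pderiv_c_cong[OF D that(1,2)]) (use F in auto)
    also have "\<dots> = z p *\<^sub>R pderiv_c j (u 0) z"
      by (rule has_pd_imp_pderiv)
         (use has_pd_scaleR[OF has_pd_coord[of j p z] Cinf_has_pd[OF chainD(1)[OF u] that(2,1), of 0]] that in simp)
    finally show ?thesis .
  qed
  have ddF: "pderiv_c j (pderiv_c j F) y = y p *\<^sub>R pderiv_c j (pderiv_c j (u 0)) y" if "j < n" "j \<noteq> p" for j
  proof -
    have "pderiv_c j (pderiv_c j F) y = pderiv_c j (\<lambda>y. y p *\<^sub>R pderiv_c j (u 0) y) y"
      by (rule pderiv_c_cong[OF D y that(1)]) (use dF that in auto)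
    also have "\<dots> = y p *\<^sub>R pderiv_c j (pderiv_c j (u 0)) y"
      by (rule has_pd_imp_pderiv)
         (use has_pd_scaleR[OF has_pd_coord[of j p y] Cinf_has_pd[OF Cinf_pderiv[OF chainD(1)[OF u] that(1)] that(1) y, of 0]] that in simp)
    finally show ?thesis .
  qed
  have dpF: "pderiv_c p F z = u 0 z + (z p)\<^sup>2 *\<^sub>R u 1 z" if "z \<in> D" for z
  proof -
    have "pderiv_c p F z = pderiv_c p (\<lambda>y. y p *\<^sub>R u 0 y) z" by (rule pderiv_c_cong[OF D that p]) (use F in auto)
    also have "\<dots> = u 0 z + (z p)\<^sup>2 *\<^sub>R u 1 z"
      by (rule has_pd_imp_pderiv)
         (use has_pd_scaleR[OF has_pd_coord[of p p z] chain_has_pd[OF u that, of 0]] in \<open>simp add: power2_eq_square add.commute\<close>)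
    finally show ?thesis .
  qed
  have ddpF: "pderiv_c p (pderiv_c p F) y = y p *\<^sub>R (3 *\<^sub>R u 1 y + (y p)\<^sup>2 *\<^sub>R u 2 y)"
  proof -
    have s: "has_pd p (\<lambda>y. (y p)\<^sup>2) (2 * y p) y"
      unfolding has_pd_def has_real_derivative_iff_has_vector_derivative[symmetric]
      by (auto intro!: derivative_eq_intros)
    have "pderiv_c p (pderiv_c p F) y = pderiv_c p (\<lambda>y. u 0 y + (y p)\<^sup>2 *\<^sub>R u 1 y) y"
      by (rule pderiv_c_cong[OF D y p]) (use dpF in auto)
    also have "\<dots> = y p *\<^sub>R u (Suc 0) y + ((y p)\<^sup>2 *\<^sub>R (y p *\<^sub>R u (Suc 1) y) + (2 * y p) *\<^sub>R u 1 y)"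
      by (rule has_pd_imp_pderiv) (intro has_pd_add has_pd_scaleR[OF s] chain_has_pd[OF u y])
    also have "\<dots> = y p *\<^sub>R (3 *\<^sub>R u 1 y + (y p)\<^sup>2 *\<^sub>R u 2 y)"
      by (simp add: algebra_simps numeral_2_eq_2 scaleR_add_left[symmetric])
    finally show ?thesis .
  qed
  have "0 = (\<Sum>j\<in>{..<n} - {p}. pderiv_c j (pderiv_c j F) y) + pderiv_c p (pderiv_c p F) y"
    using h[OF y] p by (subst (asm) sum.remove[of _ p]) (auto simp: add.commute)
  also have "(\<Sum>j\<in>{..<n} - {p}. pderiv_c j (pderiv_c j F) y) = y p *\<^sub>R (\<Sum>j\<in>{..<n} - {p}. pderiv_c j (pderiv_c j (u 0)) y)"
    unfolding scaleR_sum_right by (intro sum.cong) (use ddF in auto)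
  finally show "y p *\<^sub>R ?R y = y p *\<^sub>R 0"
    unfolding ddpF by (simp add: scaleR_add_right add.assoc)
qed

end

section \<open>Replacing a coordinate by the norm of a block of coordinates\<close>

text \<open>The single coordinate \<open>p\<close> is replaced by the block from \<open>p\<close> to
  \<open>t1\<close>; the \<open>\<tau> - 1\<close> coordinates behind it move from
  \<open>p + h\<close> to \<open>t1 + h\<close>.\<close>

locale pulled = reflected n p D for n p D +
  fixes t1 \<tau> n' :: nat
  assumes pt1: "p \<le> t1" and tau: "1 \<le> \<tau>" and n: "n = p + \<tau>" and n': "n' = t1 + \<tau>"
begin

abbreviation "Bl \<equiv> {p..t1}"

lemma n_iff: "i < n \<longleftrightarrow> i < p + \<tau>" "n \<le> i \<longleftrightarrow> p + \<tau> \<le> i" using n by auto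

lemma n'_iff: "i < n' \<longleftrightarrow> i < t1 + \<tau>" "n' \<le> i \<longleftrightarrow> t1 + \<tau> \<le> i" using n' by auto

definition rho :: "(nat \<Rightarrow> real) \<Rightarrow> nat \<Rightarrow> real" where
  "rho y' = (\<lambda>i. if i < p then y' i
           else if i = p then sqrt (\<Sum>s=p..t1. (y' s)^2)
           else if i < p + \<tau> then y' (t1 + (i - p))
           else 0)"

definition D' :: "(nat \<Rightarrow> real) set" where "D' = {y' \<in> Ecoord n'. rho y' \<in> D}"

definition kap :: "nat \<Rightarrow> nat" where "kap i = (if i < p then i else p + (i - t1))"

lemma kap_bij: "bij_betw kap ({..<n'} - Bl) ({..<n} - {p})"
proof (rule bij_betw_byWitness[where f' = "\<lambda>i. if i < p then i else t1 + (i - p)"])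
qed (use pt1 tau in \<open>auto simp: kap_def n_iff n'_iff\<close>)

lemma kap_range: assumes "i < n'" "i \<notin> Bl" shows "kap i < n \<and> kap i \<noteq> p"
proof -
  have "kap i \<in> {..<n} - {p}" using bij_betwE[OF kap_bij] assms by blast
  then show ?thesis by simp
qed

lemma rho_upd_other: "i < n' \<Longrightarrow> i \<notin> Bl \<Longrightarrow> rho (y(i := c)) = (rho y)(kap i := c)"
proof
  fix j assume i: "i < n'" "i \<notin> Bl"
  have s: "(\<Sum>s=p..t1. ((y(i := c)) s)^2) = (\<Sum>s=p..t1. (y s)^2)" by (rule sum.cong) (use i in auto)
  show "rho (y(i := c)) j = ((rho y)(kap i := c)) j"
    unfolding rho_def s using i pt1 by (auto simp: kap_def n'_iff)
qed

lemma rho_kap: "i < n' \<Longrightarrow> i \<notin> Bl \<Longrightarrow> rho y (kap i) = y i"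
  using pt1 by (auto simp: rho_def kap_def n'_iff)

lemma rho_p: "rho y p = sqrt (\<Sum>s\<in>Bl. (y s)^2)" by (simp add: rho_def)

lemma rho_p_nonneg: "rho y p \<ge> 0" by (simp add: rho_p sum_nonneg)

lemma rho_p_square: "(rho y p)\<^sup>2 = (\<Sum>s\<in>Bl. (y s)^2)" by (simp add: rho_p sum_nonneg)

lemma rho_upd_block:
  assumes i: "i \<in> Bl" shows "rho (y(i := y i + s)) = (rho y)(p := sqrt ((rho y p)\<^sup>2 + 2 * y i * s + s\<^sup>2))"
proof
  fix j
  have "(\<Sum>k\<in>Bl. ((y(i := y i + s)) k)^2) = (y i + s)^2 + (\<Sum>k\<in>Bl - {i}. (y k)^2)"
    using i by (subst sum.remove[of _ i]) auto
  also have "\<dots> = (\<Sum>k\<in>Bl. (y k)^2) + 2 * y i * s + s\<^sup>2"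
    using i by (subst (2) sum.remove[of _ i]) (auto simp: power2_eq_square algebra_simps)
  finally have s: "(\<Sum>k\<in>Bl. ((y(i := y i + s)) k)^2) = (\<Sum>k\<in>Bl. (y k)^2) + 2 * y i * s + s\<^sup>2" .
  show "rho (y(i := y i + s)) j = ((rho y)(p := sqrt ((rho y p)\<^sup>2 + 2 * y i * s + s\<^sup>2))) j"
    unfolding rho_p_square unfolding rho_def s using i pt1 by auto
qed

lemma rho_Ecoord: "rho y \<in> Ecoord n" using tau by (auto simp: rho_def Ecoord_def n_iff)

lemma continuous_on_rho: "continuous_on S rho"
proof (rule continuous_on_coordinatewise_then_product)
  fix i
  have "continuous_on S (\<lambda>y. if i < p then y i else if i = p then sqrt (\<Sum>s=p..t1. (y s)^2)
           else if i < p + \<tau> then y (t1 + (i - p)) else 0)"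
    by (cases "i < p"; cases "i = p"; cases "i < p + \<tau>")
       (auto intro!: continuous_on_coordinate continuous_intros)
  then show "continuous_on S (\<lambda>y. rho y i)" by (simp add: rho_def)
qed

lemma opn_D': "opn n' D'"
proof -
  obtain T where T: "open T" "D = Ecoord n \<inter> T" using D by (auto simp: openin_open)
  have "D' = Ecoord n' \<inter> rho -` T" using T(2) rho_Ecoord unfolding D'_def by blast
  moreover have "open (rho -` T)" using T continuous_on_rho[of UNIV] by (simp add: continuous_on_open_vimage)
  ultimately show ?thesis by (auto simp: openin_open)
qed

lemma rho_D: "y \<in> D' \<Longrightarrow> rho y \<in> D" by (simp add: D'_def)

lemma has_pd_pull_other:
  assumes "has_pd (kap i) u d (rho y)" "i < n'" "i \<notin> Bl" shows "has_pd i (\<lambda>y. u (rho y)) d y"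
  using assms by (simp add: has_pd_def rho_upd_other rho_kap)

text \<open>The chain rule for \<open>u\<close> composed with the norm of the block,
  \<open>w\<close> being the \<open>p\<close>-derivative divided by \<open>y p\<close>. At norm zero
  the norm is not differentiable: \<open>rho\<close> moves to the absolute value of the increment,
  which evenness of \<open>u\<close> allows to be replaced by the increment itself, and the
  \<open>p\<close>-derivative of an even function vanishes there.\<close>

lemma has_pd_pull_block:
  fixes u :: "(nat \<Rightarrow> real) \<Rightarrow> 'a::banach"
  assumes u: "Ev u" and w: "\<And>y. y \<in> D \<Longrightarrow> pderiv_c p u y = y p *\<^sub>R w y" and y: "y \<in> D'" and i: "i \<in> Bl"
  shows "has_pd i (\<lambda>y. u (rho y)) (y i *\<^sub>R w (rho y)) y"
proof -
  define z where "z = rho y"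
  have zD: "z \<in> D" using rho_D[OF y] by (simp add: z_def)
  have uC: "Cinf n D u" using u by (simp add: Ev_def)
  have F: "u (rho (y(i := y i + s))) = u (z(p := sqrt ((z p)\<^sup>2 + 2 * y i * s + s\<^sup>2)))" for s
    by (simp add: rho_upd_block[OF i] z_def)
  have "((\<lambda>s. u (z(p := sqrt ((z p)\<^sup>2 + 2 * y i * s + s\<^sup>2)))) has_vector_derivative y i *\<^sub>R w z) (at 0)"
  proof (cases "z p = 0")
    case False
    then have zp: "z p > 0" using rho_p_nonneg[of y] by (simp add: z_def)
    have q: "((\<lambda>s. sqrt ((z p)\<^sup>2 + 2 * y i * s + s\<^sup>2)) has_vector_derivative y i / z p) (at 0)"
      unfolding has_real_derivative_iff_has_vector_derivative[symmetric]
      using zp by (auto intro!: derivative_eq_intros simp: field_simps)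
    have d: "((\<lambda>x. u (z(p := x))) has_vector_derivative pderiv_c p u z) (at (sqrt ((z p)\<^sup>2 + 2 * y i * 0 + 0\<^sup>2)))"
      using has_vector_derivative_partial[of 0 n D u p z "z p"] uC zD p zp by (simp add: Cinf_def del: Ck.simps)
    have "((\<lambda>x. u (z(p := x))) \<circ> (\<lambda>s. sqrt ((z p)\<^sup>2 + 2 * y i * s + s\<^sup>2)) has_vector_derivative (y i / z p) *\<^sub>R pderiv_c p u z) (at 0)"
      by (rule vector_diff_chain_at[OF q d])
    then show ?thesis using w[OF zD] zp by (simp add: o_def)
  next
    case True
    then have "(\<Sum>s\<in>Bl. (y s)^2) = 0" using rho_p_square[of y] by (simp add: z_def)
    then have yi: "y i = 0" using i by (subst (asm) sum_nonneg_eq_0_iff) auto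
    have d: "((\<lambda>s. u (z(p := z p + s))) has_vector_derivative 0) (at 0)"
      using Cinf_has_pd[OF uC p zD] Od_zero[OF Ev_pderiv_p[OF u] zD True] by (simp add: has_pd_def)
    have "((\<lambda>s. u (z(p := \<bar>s\<bar>))) has_vector_derivative 0) (at 0)"
    proof (rule has_vector_derivative_transform_within_open[OF d open_line[OF D zD p]])
      show "0 \<in> {s. z(p := z p + s) \<in> D}" using zD by simp
      fix s assume s: "s \<in> {s. z(p := z p + s) \<in> D}"
      show "u (z(p := z p + s)) = u (z(p := \<bar>s\<bar>))"
      proof (cases "s \<ge> 0")
        case False
        then have "z(p := \<bar>s\<bar>) = rf p (z(p := z p + s))" using True by (auto simp: rf_def)
        then show ?thesis using u s by (simp add: Ev_def)
      qed (use True in simp)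
    qed
    then show ?thesis using True yi by simp
  qed
  then show ?thesis by (simp add: has_pd_def F z_def)
qed

text \<open>Derivatives of a pullback are again pullbacks of even functions: of
  \<open>Lop p u\<close>, with a factor \<open>y i\<close>, inside the block and of another partial
  derivative outside. This closes the induction.\<close>

lemma Ck_pull:
  fixes u :: "(nat \<Rightarrow> real) \<Rightarrow> 'a::banach"
  assumes "Ev u" shows "Ck k n' D' (\<lambda>y. u (rho y))"
  using assms
proof (induction k arbitrary: u)
  have cont: "continuous_on D' (\<lambda>y. u (rho y))" if "Ev u" for u :: "(nat \<Rightarrow> real) \<Rightarrow> 'a"
    by (rule continuous_on_compose2[OF Cinf_continuous[of n D u] continuous_on_rho]) (use that in \<open>auto simp: Ev_def D'_def\<close>)
  {
    case 0
    then show ?case using cont by simp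
  next
    case (Suc k)
    define g where "g i y = (if i \<in> Bl then y i *\<^sub>R Lop p u (rho y) else pderiv_c (kap i) u (rho y))" for i y
    show ?case
    proof (rule Ck_SucI[OF opn_D' cont[OF Suc.prems], where g = g])
      fix i y assume i: "i < n'" and y: "y \<in> D'"
      show "has_pd i (\<lambda>y. u (rho y)) (g i y) y"
      proof (cases "i \<in> Bl")
        case True
        have "pderiv_c p u y = y p *\<^sub>R Lop p u y" if "y \<in> D" for y
          using Od_eq_Dv[OF Ev_pderiv_p[OF Suc.prems] that] by (simp add: Lop_def)
        from has_pd_pull_block[OF Suc.prems this y True] show ?thesis using True by (simp add: g_def)
      next
        case False
        have "has_pd (kap i) u (pderiv_c (kap i) u (rho y)) (rho y)"
          by (rule Cinf_has_pd[of n D]) (use Suc.prems kap_range[OF i False] rho_D[OF y] in \<open>auto simp: Ev_def\<close>)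
        from has_pd_pull_other[OF this i False] show ?thesis using False unfolding g_def by auto
      qed
    next
      fix i assume i: "i < n'"
      show "Ck k n' D' (g i)"
      proof (cases "i \<in> Bl")
        case True
        then have "g i = (\<lambda>y. y i *\<^sub>R Lop p u (rho y))" by (auto simp: g_def)
        then show ?thesis using Ck_scaleR[OF opn_D' Ck_coord Suc.IH[OF Ev_Lop[OF Suc.prems]]] by simp
      next
        case False
        then have "g i = (\<lambda>y. pderiv_c (kap i) u (rho y))" by (auto simp: g_def)
        then show ?thesis using Suc.IH[OF Ev_pderiv[OF Suc.prems]] kap_range[OF i False] by simp
      qed
    qed
  }
qed

lemma Cinf_pull: "Ev u \<Longrightarrow> Cinf n' D' (\<lambda>y. u (rho y))"
  using Ck_pull[of u] by (simp add: Cinf_def)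

text \<open>The chain equation does not compare \<open>y\<close> with its reflection when the two
  are not joined inside \<open>D\<close>, while pulling back along \<open>rho\<close> needs
  evenness.\<close>

definition evchain :: "(nat \<Rightarrow> (nat \<Rightarrow> real) \<Rightarrow> 'a::banach) \<Rightarrow> bool" where
  "evchain u \<longleftrightarrow> chain u \<and> (\<forall>k. Ev (u k))"

lemma evchain_Lop: "Ev u \<Longrightarrow> evchain (\<lambda>k. (Lop p ^^ k) u)"
  by (simp add: evchain_def chain_Lop Ev_Lop_funpow)

lemma evchain_linear_sum:
  assumes "\<And>K. K \<in> S \<Longrightarrow> evchain (u K)" "\<And>K. K \<in> S \<Longrightarrow> bounded_linear (L K)"
  shows "evchain (\<lambda>k y. \<Sum>K\<in>S. L K (u K k y))"
  unfolding evchain_def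
proof (intro conjI allI)
  show c: "chain (\<lambda>k y. \<Sum>K\<in>S. L K (u K k y))"
    by (rule chain_sum, rule chain_linear) (use assms in \<open>auto simp: evchain_def\<close>)
  show "Ev (\<lambda>y. \<Sum>K\<in>S. L K (u K k y))" for k
    using chainD(1)[OF c, of k] assms by (auto simp: evchain_def Ev_def intro!: sum.cong)
qed

lemma has_pd_pull_chain_block:
  "evchain u \<Longrightarrow> y \<in> D' \<Longrightarrow> i \<in> Bl \<Longrightarrow> has_pd i (\<lambda>y. u k (rho y)) (y i *\<^sub>R u (Suc k) (rho y)) y"
  by (rule has_pd_pull_block) (auto simp: evchain_def chainD)

lemma has_pd_pull_chain_other:
  assumes "Ev u" "y \<in> D'" "i < n'" "i \<notin> Bl"
  shows "has_pd i (\<lambda>y. u (rho y)) (pderiv_c (kap i) u (rho y)) y"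
  by (rule has_pd_pull_other[OF Cinf_has_pd[of n D] assms(3,4)])
     (use assms kap_range[OF assms(3,4)] rho_D[OF assms(2)] in \<open>auto simp: Ev_def\<close>)

lemma pderiv2I:
  assumes "i < n'" "y \<in> D'" "\<And>z. z \<in> D' \<Longrightarrow> has_pd i f (g z) z" "has_pd i g d y"
  shows "pderiv_c i (pderiv_c i f) y = d"
proof -
  have "pderiv_c i (pderiv_c i f) y = pderiv_c i g y"
    by (rule pderiv_c_cong[OF opn_D' assms(2,1)]) (rule has_pd_imp_pderiv[OF assms(3)])
  then show ?thesis using has_pd_imp_pderiv[OF assms(4)] by simp
qed

lemma sum_split_block: "(\<Sum>i<n'. h i) = (\<Sum>i\<in>{..<n'} - Bl. h i) + (\<Sum>i\<in>Bl. h i)"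
  using tau by (subst sum.subset_diff[of Bl]) (auto simp: n'_iff)

lemma sum_kap: "(\<Sum>i\<in>{..<n'} - Bl. h (kap i)) = (\<Sum>j\<in>{..<n} - {p}. h j)"
  by (rule sum.reindex_bij_betw[OF kap_bij])

lemma pull_pderiv2_other:
  assumes u: "Ev u" and y: "y \<in> D'" and i: "i < n'" "i \<notin> Bl"
  shows "pderiv_c i (pderiv_c i (\<lambda>y. u (rho y))) y = pderiv_c (kap i) (pderiv_c (kap i) u) (rho y)"
  by (rule pderiv2I[OF i(1) y has_pd_pull_chain_other[OF u _ i] has_pd_pull_chain_other[OF Ev_pderiv[OF u] y i]])
     (use kap_range[OF i] in auto)

text \<open>A block coordinate contributes \<open>u (Suc k)\<close> plus
  \<open>(y i)\<^sup>2\<close> times \<open>u (Suc (Suc k))\<close>; there are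
  \<open>Suc t1 - p\<close> of them, and the squares add up to the squared norm.\<close>

lemma laplacian_pull:
  fixes u :: "nat \<Rightarrow> (nat \<Rightarrow> real) \<Rightarrow> 'a::banach"
  assumes u: "evchain u" and y: "y \<in> D'"
  shows "(\<Sum>i<n'. pderiv_c i (pderiv_c i (\<lambda>y. u k (rho y))) y) =
    (\<Sum>j\<in>{..<n} - {p}. pderiv_c j (pderiv_c j (u k)) (rho y)) + real (Suc t1 - p) *\<^sub>R u (Suc k) (rho y)
    + (rho y p)\<^sup>2 *\<^sub>R u (Suc (Suc k)) (rho y)"
proof -
  have E: "Ev (u k)" for k using u by (simp add: evchain_def)
  have bl: "pderiv_c i (pderiv_c i (\<lambda>y. u k (rho y))) y = u (Suc k) (rho y) + (y i)\<^sup>2 *\<^sub>R u (Suc (Suc k)) (rho y)" if i: "i \<in> Bl" for i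
  proof (rule pderiv2I[OF _ y has_pd_pull_chain_block[OF u _ i]])
    show "i < n'" using i tau by (simp add: n'_iff)
    show "has_pd i (\<lambda>y. y i *\<^sub>R u (Suc k) (rho y)) (u (Suc k) (rho y) + (y i)\<^sup>2 *\<^sub>R u (Suc (Suc k)) (rho y)) y"
      using has_pd_scaleR[OF has_pd_coord[of i i y] has_pd_pull_chain_block[OF u y i, of "Suc k"]]
      by (simp add: power2_eq_square add.commute)
  qed
  have "(\<Sum>i\<in>Bl. pderiv_c i (pderiv_c i (\<lambda>y. u k (rho y))) y) =
     real (Suc t1 - p) *\<^sub>R u (Suc k) (rho y) + (rho y p)\<^sup>2 *\<^sub>R u (Suc (Suc k)) (rho y)"
    unfolding rho_p_square using bl by (simp add: sum.distrib scaleR_sum_left sum_constant_scaleR del: sum_constant)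
  moreover have "(\<Sum>i\<in>{..<n'} - Bl. pderiv_c i (pderiv_c i (\<lambda>y. u k (rho y))) y) =
     (\<Sum>i\<in>{..<n'} - Bl. pderiv_c (kap i) (pderiv_c (kap i) (u k)) (rho y))"
    by (intro sum.cong refl pull_pderiv2_other[OF E y]) auto
  ultimately show ?thesis
    using sum_kap[of "\<lambda>j. pderiv_c j (pderiv_c j (u k)) (rho y)"] by (simp add: sum_split_block add.assoc)
qed

end

section \<open>Functions with the block vector as a factor\<close>

locale pulled_alg = pulled n p D t1 \<tau> n' for n p D t1 \<tau> n' +
  fixes v :: "nat \<Rightarrow> 'a::{real_algebra_1,euclidean_space}"
begin

definition X :: "(nat \<Rightarrow> real) \<Rightarrow> 'a" where "X y = (\<Sum>s\<in>Bl. y s *\<^sub>R v s)"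

lemma X_mult: "X y * a = (\<Sum>s\<in>Bl. y s *\<^sub>R (v s * a))" by (simp add: X_def sum_distrib_right)

lemma has_pd_X_mult:
  assumes "has_pd i g d y"
  shows "has_pd i (\<lambda>y. X y * g y) (X y * d + (if i \<in> Bl then v i * g y else 0)) y"
proof -
  have "has_pd i (\<lambda>y. \<Sum>s\<in>Bl. y s *\<^sub>R (v s * g y)) (\<Sum>s\<in>Bl. y s *\<^sub>R (v s * d) + (if s = i then 1 else 0) *\<^sub>R (v s * g y)) y"
    by (intro has_pd_sum has_pd_scaleR has_pd_coord has_pd_linear[OF bounded_linear_mult_left_fin] assms)
  moreover have "(\<Sum>s\<in>Bl. (if s = i then 1 else 0) *\<^sub>R (v s * g y)) = (if i \<in> Bl then v i * g y else 0)"
    by (simp add: if_distrib[of "\<lambda>r. r *\<^sub>R _"] sum.delta cong: if_cong)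
  ultimately show ?thesis by (simp add: X_mult sum.distrib)
qed

lemma has_pd_X_mult_other:
  assumes "has_pd i g d y" "i \<notin> Bl" shows "has_pd i (\<lambda>y. X y * g y) (X y * d) y"
  using has_pd_X_mult[OF assms(1)] unfolding if_not_P[OF assms(2)] by simp

lemma Cinf_X_mult: "Cinf n' D' g \<Longrightarrow> Cinf n' D' (\<lambda>y. X y * g y)"
  unfolding X_mult by (intro Cinf_sum[OF opn_D'] Cinf_scaleR[OF opn_D'] Cinf_coord Cinf_linear[OF opn_D' bounded_linear_mult_left_fin])

text \<open>\<open>X\<close> is linear, so only mixed terms are new: they are
  \<open>(2 * y i) *\<^sub>R (v i * u (Suc k))\<close> and sum to
  \<open>2 *\<^sub>R (X y * u (Suc k))\<close>, which raises the dimension coefficient by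
  two.\<close>

lemma laplacian_X_pull:
  fixes u :: "nat \<Rightarrow> (nat \<Rightarrow> real) \<Rightarrow> 'a"
  assumes u: "evchain u" and y: "y \<in> D'"
  shows "(\<Sum>i<n'. pderiv_c i (pderiv_c i (\<lambda>y. X y * u k (rho y))) y) =
    X y * ((\<Sum>j\<in>{..<n} - {p}. pderiv_c j (pderiv_c j (u k)) (rho y)) + (real (Suc t1 - p) + 2) *\<^sub>R u (Suc k) (rho y)
    + (rho y p)\<^sup>2 *\<^sub>R u (Suc (Suc k)) (rho y))"
proof -
  have E: "Ev (u k)" for k using u by (simp add: evchain_def)
  have bl: "pderiv_c i (pderiv_c i (\<lambda>y. X y * u k (rho y))) y =
      X y * u (Suc k) (rho y) + (2 * y i) *\<^sub>R (v i * u (Suc k) (rho y)) + (y i)\<^sup>2 *\<^sub>R (X y * u (Suc (Suc k)) (rho y))" if i: "i \<in> Bl" for i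
  proof (rule pderiv2I[OF _ y, where g = "\<lambda>y. y i *\<^sub>R (X y * u (Suc k) (rho y)) + v i * u k (rho y)"])
    show "i < n'" using i tau by (simp add: n'_iff)
    show "has_pd i (\<lambda>y. X y * u k (rho y)) (z i *\<^sub>R (X z * u (Suc k) (rho z)) + v i * u k (rho z)) z" if "z \<in> D'" for z
      using has_pd_X_mult[OF has_pd_pull_chain_block[OF u that i, of k]] i by simp
    have "has_pd i (\<lambda>y. y i *\<^sub>R (X y * u (Suc k) (rho y)) + v i * u k (rho y))
       ((y i *\<^sub>R (X y * (y i *\<^sub>R u (Suc (Suc k)) (rho y)) + (if i \<in> Bl then v i * u (Suc k) (rho y) else 0))
         + (if i = i then 1 else 0) *\<^sub>R (X y * u (Suc k) (rho y))) + v i * (y i *\<^sub>R u (Suc k) (rho y))) y"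
      by (intro has_pd_add has_pd_scaleR has_pd_coord has_pd_X_mult has_pd_pull_chain_block[OF u y i]
            has_pd_linear[OF bounded_linear_mult_left_fin])
    moreover have "(y i *\<^sub>R (X y * (y i *\<^sub>R u (Suc (Suc k)) (rho y)) + (if i \<in> Bl then v i * u (Suc k) (rho y) else 0))
         + (if i = i then 1 else 0) *\<^sub>R (X y * u (Suc k) (rho y))) + v i * (y i *\<^sub>R u (Suc k) (rho y)) =
       X y * u (Suc k) (rho y) + (2 * y i) *\<^sub>R (v i * u (Suc k) (rho y)) + (y i)\<^sup>2 *\<^sub>R (X y * u (Suc (Suc k)) (rho y))"
    proof -
      have "(2 * y i) *\<^sub>R (v i * u (Suc k) (rho y)) = y i *\<^sub>R (v i * u (Suc k) (rho y)) + y i *\<^sub>R (v i * u (Suc k) (rho y))"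
        by (simp flip: scaleR_add_left)
      then show ?thesis using i by (simp add: scaleR_add_right power2_eq_square)
    qed
    ultimately show "has_pd i (\<lambda>y. y i *\<^sub>R (X y * u (Suc k) (rho y)) + v i * u k (rho y))
       (X y * u (Suc k) (rho y) + (2 * y i) *\<^sub>R (v i * u (Suc k) (rho y)) + (y i)\<^sup>2 *\<^sub>R (X y * u (Suc (Suc k)) (rho y))) y"
      by (simp only:)
  qed
  have "(\<Sum>i\<in>Bl. pderiv_c i (pderiv_c i (\<lambda>y. X y * u k (rho y))) y) =
     real (Suc t1 - p) *\<^sub>R (X y * u (Suc k) (rho y)) + 2 *\<^sub>R (X y * u (Suc k) (rho y)) + (rho y p)\<^sup>2 *\<^sub>R (X y * u (Suc (Suc k)) (rho y))"
  proof -
    have "(\<Sum>i\<in>Bl. (2 * y i) *\<^sub>R (v i * u (Suc k) (rho y))) = 2 *\<^sub>R (X y * u (Suc k) (rho y))"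
      by (simp add: X_mult scaleR_sum_right)
    then show ?thesis unfolding rho_p_square using bl by (simp add: sum.distrib scaleR_sum_left sum_constant_scaleR del: sum_constant)
  qed
  moreover have "(\<Sum>i\<in>{..<n'} - Bl. pderiv_c i (pderiv_c i (\<lambda>y. X y * u k (rho y))) y) =
     X y * (\<Sum>j\<in>{..<n} - {p}. pderiv_c j (pderiv_c j (u k)) (rho y))"
  proof -
    have "(\<Sum>i\<in>{..<n'} - Bl. pderiv_c i (pderiv_c i (\<lambda>y. X y * u k (rho y))) y) =
       (\<Sum>i\<in>{..<n'} - Bl. X y * pderiv_c (kap i) (pderiv_c (kap i) (u k)) (rho y))"
    proof (intro sum.cong refl)
      fix i assume "i \<in> {..<n'} - Bl"
      then have i: "i < n'" "i \<notin> Bl" by auto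
      show "pderiv_c i (pderiv_c i (\<lambda>y. X y * u k (rho y))) y = X y * pderiv_c (kap i) (pderiv_c (kap i) (u k)) (rho y)"
      proof (rule pderiv2I[OF i(1) y, where g = "\<lambda>y. X y * pderiv_c (kap i) (u k) (rho y)"])
        show "has_pd i (\<lambda>y. X y * u k (rho y)) (X z * pderiv_c (kap i) (u k) (rho z)) z" if "z \<in> D'" for z
          by (rule has_pd_X_mult_other[OF has_pd_pull_chain_other[OF E that i] i(2)])
        show "has_pd i (\<lambda>y. X y * pderiv_c (kap i) (u k) (rho y)) (X y * pderiv_c (kap i) (pderiv_c (kap i) (u k)) (rho y)) y"
          by (rule has_pd_X_mult_other[OF has_pd_pull_chain_other[OF Ev_pderiv[OF E] y i] i(2)]) (use kap_range[OF i] in auto)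
      qed
    qed
    then show ?thesis by (simp add: sum_distrib_left sum_kap[of "\<lambda>j. X y * pderiv_c j (pderiv_c j (u k)) (rho y)"])
  qed
  ultimately show ?thesis by (simp add: sum_split_block distrib_left scaleR_add_left add.assoc)
qed

text \<open>The sign \<open>\<sigma>\<close> compensates for moving the block vector past a product
  of the remaining imaginary units; see \<open>ext_sum\<close>.\<close>

definition ext :: "real \<Rightarrow> ((nat \<Rightarrow> real) \<Rightarrow> 'a) \<Rightarrow> ((nat \<Rightarrow> real) \<Rightarrow> 'a) \<Rightarrow> (nat \<Rightarrow> real) \<Rightarrow> 'a" where
  "ext \<sigma> a b y = a (rho y) + \<sigma> *\<^sub>R (X y * b (rho y))"

lemma Cinf_ext: "Ev a \<Longrightarrow> Ev b \<Longrightarrow> Cinf n' D' (ext \<sigma> a b)"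
  unfolding ext_def[abs_def]
  by (rule Cinf_add[OF opn_D' Cinf_pull[of a] Cinf_linear[OF opn_D' bounded_linear_scaleR_right Cinf_X_mult[OF Cinf_pull[of b]]]])

lemma laplacian_pull_radial:
  fixes a :: "nat \<Rightarrow> (nat \<Rightarrow> real) \<Rightarrow> 'a"
  assumes a: "evchain a"
    and ha: "\<And>y. y \<in> D \<Longrightarrow> (\<Sum>j\<in>{..<n} - {p}. pderiv_c j (pderiv_c j (a k)) y) + (1 + 2 * real k) *\<^sub>R a (Suc k) y
       + (y p)\<^sup>2 *\<^sub>R a (Suc (Suc k)) y = 0"
    and y: "y \<in> D'"
  shows "(\<Sum>i<n'. pderiv_c i (pderiv_c i (\<lambda>y. a k (rho y))) y) = (real (Suc t1 - p) - 1 - 2 * real k) *\<^sub>R a (Suc k) (rho y)"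
proof -
  let ?S = "\<Sum>j\<in>{..<n} - {p}. pderiv_c j (pderiv_c j (a k)) (rho y)"
  let ?m = "real (Suc t1 - p)"
  have "?S + ?m *\<^sub>R a (Suc k) (rho y) + (rho y p)\<^sup>2 *\<^sub>R a (Suc (Suc k)) (rho y) =
      (?S + (1 + 2 * real k) *\<^sub>R a (Suc k) (rho y) + (rho y p)\<^sup>2 *\<^sub>R a (Suc (Suc k)) (rho y))
      + (?m - 1 - 2 * real k) *\<^sub>R a (Suc k) (rho y)"
    by (simp add: scaleR_diff_left scaleR_add_left)
  also have "\<dots> = (?m - 1 - 2 * real k) *\<^sub>R a (Suc k) (rho y)" using ha[OF rho_D[OF y]] by simp
  finally show ?thesis using laplacian_pull[OF a y, of k] by simp
qed

lemma laplacian_X_pull_radial: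
  fixes b :: "nat \<Rightarrow> (nat \<Rightarrow> real) \<Rightarrow> 'a"
  assumes b: "evchain b"
    and hb: "\<And>y. y \<in> D \<Longrightarrow> (\<Sum>j\<in>{..<n} - {p}. pderiv_c j (pderiv_c j (b k)) y) + (3 + 2 * real k) *\<^sub>R b (Suc k) y
       + (y p)\<^sup>2 *\<^sub>R b (Suc (Suc k)) y = 0"
    and y: "y \<in> D'"
  shows "(\<Sum>i<n'. pderiv_c i (pderiv_c i (\<lambda>y. X y * b k (rho y))) y) = (real (Suc t1 - p) - 1 - 2 * real k) *\<^sub>R (X y * b (Suc k) (rho y))"
proof -
  let ?S = "\<Sum>j\<in>{..<n} - {p}. pderiv_c j (pderiv_c j (b k)) (rho y)"
  let ?m = "real (Suc t1 - p)"
  have "?S + (?m + 2) *\<^sub>R b (Suc k) (rho y) + (rho y p)\<^sup>2 *\<^sub>R b (Suc (Suc k)) (rho y) =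
      (?S + (3 + 2 * real k) *\<^sub>R b (Suc k) (rho y) + (rho y p)\<^sup>2 *\<^sub>R b (Suc (Suc k)) (rho y))
      + (?m + 2 - (3 + 2 * real k)) *\<^sub>R b (Suc k) (rho y)"
    by (simp only: scaleR_diff_left) simp
  also have "\<dots> = (?m - 1 - 2 * real k) *\<^sub>R b (Suc k) (rho y)" using hb[OF rho_D[OF y]] by simp
  finally show ?thesis using laplacian_X_pull[OF b y, of k] by simp
qed

text \<open>Write \<open>m\<close> for the block size. For \<open>a\<close> the coefficient
  \<open>m\<close> is compared with \<open>1 + 2 * k\<close>, for \<open>b\<close> the coefficient
  \<open>m + 2\<close> with \<open>3 + 2 * k\<close>. Both differences are
  \<open>m - 1 - 2 * k\<close>, and this coincidence keeps the pair in the form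
  \<open>ext\<close>.\<close>

lemma laplacian_ext:
  fixes a b :: "nat \<Rightarrow> (nat \<Rightarrow> real) \<Rightarrow> 'a"
  assumes a: "evchain a" and b: "evchain b"
    and ha: "\<And>y. y \<in> D \<Longrightarrow> (\<Sum>j\<in>{..<n} - {p}. pderiv_c j (pderiv_c j (a k)) y) + (1 + 2 * real k) *\<^sub>R a (Suc k) y
       + (y p)\<^sup>2 *\<^sub>R a (Suc (Suc k)) y = 0"
    and hb: "\<And>y. y \<in> D \<Longrightarrow> (\<Sum>j\<in>{..<n} - {p}. pderiv_c j (pderiv_c j (b k)) y) + (3 + 2 * real k) *\<^sub>R b (Suc k) y
       + (y p)\<^sup>2 *\<^sub>R b (Suc (Suc k)) y = 0"
    and y: "y \<in> D'"
  shows "(\<Sum>i<n'. pderiv_c i (pderiv_c i (ext \<sigma> (a k) (b k))) y) =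
     (real (Suc t1 - p) - 1 - 2 * real k) *\<^sub>R ext \<sigma> (a (Suc k)) (b (Suc k)) y"
proof -
  define P where "P = (\<lambda>y. a k (rho y))"
  define Q where "Q = (\<lambda>y. X y * b k (rho y))"
  have E: "Ev (a k)" "Ev (b k)" using a b by (simp_all add: evchain_def)
  have Ca: "Cinf n' D' P" unfolding P_def by (rule Cinf_pull[OF E(1)])
  have Cb: "Cinf n' D' Q" unfolding Q_def by (rule Cinf_X_mult[OF Cinf_pull[OF E(2)]])
  have ePQ: "ext \<sigma> (a k) (b k) = (\<lambda>y. P y + \<sigma> *\<^sub>R Q y)" by (simp add: ext_def[abs_def] P_def Q_def)
  have "pderiv_c i (pderiv_c i (\<lambda>y. P y + \<sigma> *\<^sub>R Q y)) y = pderiv_c i (pderiv_c i P) y + \<sigma> *\<^sub>R pderiv_c i (pderiv_c i Q) y"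
    if i: "i < n'" for i
  proof (rule pderiv2I[OF i y, where g = "\<lambda>z. pderiv_c i P z + \<sigma> *\<^sub>R pderiv_c i Q z"])
    show "has_pd i (\<lambda>y. P y + \<sigma> *\<^sub>R Q y) (pderiv_c i P z + \<sigma> *\<^sub>R pderiv_c i Q z) z" if "z \<in> D'" for z
      by (rule has_pd_add[OF Cinf_has_pd[OF Ca i that] has_pd_linear[OF bounded_linear_scaleR_right Cinf_has_pd[OF Cb i that]]])
    show "has_pd i (\<lambda>z. pderiv_c i P z + \<sigma> *\<^sub>R pderiv_c i Q z) (pderiv_c i (pderiv_c i P) y + \<sigma> *\<^sub>R pderiv_c i (pderiv_c i Q) y) y"
      by (rule has_pd_add[OF Cinf_has_pd[OF Cinf_pderiv[OF Ca i] i y]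
            has_pd_linear[OF bounded_linear_scaleR_right Cinf_has_pd[OF Cinf_pderiv[OF Cb i] i y]]])
  qed
  then have "(\<Sum>i<n'. pderiv_c i (pderiv_c i (ext \<sigma> (a k) (b k))) y) =
     (\<Sum>i<n'. pderiv_c i (pderiv_c i P) y) + \<sigma> *\<^sub>R (\<Sum>i<n'. pderiv_c i (pderiv_c i Q) y)"
    by (simp add: ePQ sum.distrib scaleR_sum_right)
  also have "\<dots> = (real (Suc t1 - p) - 1 - 2 * real k) *\<^sub>R ext \<sigma> (a (Suc k)) (b (Suc k)) y"
    using laplacian_pull_radial[OF a ha y] laplacian_X_pull_radial[OF b hb y]
    by (simp add: P_def Q_def ext_def scaleR_add_right mult.commute)
  finally show ?thesis .
qed

end

section \<open>The first-order system and its iterates\<close>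

lemma sum_and_difference_zero:
  fixes A B :: "'a::real_vector"
  assumes "A + B = 0" "A - B = 0" shows "A = 0" "B = 0"
proof -
  have "A = B" using assms(2) by simp
  then have "2 *\<^sub>R B = 0" using assms(1) by (simp add: scaleR_2)
  then show "B = 0" "A = 0" using \<open>A = B\<close> by simp_all
qed

context reflected begin

text \<open>\<open>E1\<close> and \<open>E2\<close> express regularity in one radial dimension, the
  right side of \<open>E1\<close> being the \<open>p\<close>-derivative of
  \<open>y p *\<^sub>R b 0\<close>. Applying \<open>L\<close> repeatedly keeps the form of
  \<open>E2\<close> and adds \<open>2 * real k\<close> in \<open>E1\<close>, by
  \<open>chain_radius_square\<close>.\<close>

lemma first_order_chain:
  fixes a b :: "nat \<Rightarrow> (nat \<Rightarrow> real) \<Rightarrow> 'a::{real_algebra_1,euclidean_space}"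
  assumes a: "chain a" and b: "chain b"
    and E1: "\<And>y. y \<in> D \<Longrightarrow> (\<Sum>j\<in>{..<n} - {p}. e j * pderiv_c j (a 0) y) = b 0 y + (y p)\<^sup>2 *\<^sub>R b 1 y"
    and E2: "\<And>y. y \<in> D \<Longrightarrow> a 1 y + (\<Sum>j\<in>{..<n} - {p}. ec j * pderiv_c j (b 0) y) = 0"
    and y: "y \<in> D"
  shows "(\<Sum>j\<in>{..<n} - {p}. e j * pderiv_c j (a k) y) = (1 + 2 * real k) *\<^sub>R b k y + (y p)\<^sup>2 *\<^sub>R b (Suc k) y"
    and "a (Suc k) y + (\<Sum>j\<in>{..<n} - {p}. ec j * pderiv_c j (b k) y) = 0"
proof -
  have ch: "chain (\<lambda>k y. \<Sum>j\<in>{..<n} - {p}. c j * pderiv_c j (u k) y)" if "chain u"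
    for c :: "nat \<Rightarrow> 'a" and u :: "nat \<Rightarrow> (nat \<Rightarrow> real) \<Rightarrow> 'a"
    by (rule chain_sum, rule chain_linear[OF bounded_linear_mult_left_fin chain_pderiv[OF that]]) auto
  define w where "w k y = (\<Sum>j\<in>{..<n} - {p}. e j * pderiv_c j (a k) y)
     + ((- 1) *\<^sub>R b k y + (- 1) *\<^sub>R ((2 * real k) *\<^sub>R b k y + (y p)\<^sup>2 *\<^sub>R b (Suc k) y))" for k y
  have "chain w" unfolding w_def
    by (rule chain_add[OF ch[OF a] chain_add[OF chain_linear[OF bounded_linear_scaleR_right b]
          chain_linear[OF bounded_linear_scaleR_right chain_radius_square[OF b]]]])
  then have "w k y = 0" by (rule chain_zero[OF _ _ y]) (use E1 in \<open>simp add: w_def\<close>)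
  then show "(\<Sum>j\<in>{..<n} - {p}. e j * pderiv_c j (a k) y) = (1 + 2 * real k) *\<^sub>R b k y + (y p)\<^sup>2 *\<^sub>R b (Suc k) y"
    by (simp add: w_def algebra_simps)
  have "chain (\<lambda>k y. a (Suc k) y + (\<Sum>j\<in>{..<n} - {p}. ec j * pderiv_c j (b k) y))"
    by (rule chain_add[OF chain_Suc[OF a] ch[OF b]])
  then show "a (Suc k) y + (\<Sum>j\<in>{..<n} - {p}. ec j * pderiv_c j (b k) y) = 0"
    by (rule chain_zero[OF _ _ y]) (use E2 in simp)
qed

text \<open>The slices along \<open>J\<close> and \<open>- J\<close> share \<open>a\<close> and
  \<open>b\<close>, so the sum and the difference of their equations separate the terms with a
  factor \<open>J\<close> from those without. \<open>ec\<close> records what becomes of the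
  coefficients when \<open>J\<close> is moved to the left past them.\<close>

lemma regular_split:
  fixes a b :: "nat \<Rightarrow> (nat \<Rightarrow> real) \<Rightarrow> 'a::{real_algebra_1,euclidean_space}"
  assumes a: "chain a" and b: "chain b" and J: "J * J = - 1"
    and comm: "\<And>j. j < n \<Longrightarrow> j \<noteq> p \<Longrightarrow> e j * J = J * ec j"
    and reg: "\<And>\<sigma> y. \<sigma> \<in> {1, - 1} \<Longrightarrow> y \<in> D \<Longrightarrow>
      (\<Sum>j\<in>{..<n} - {p}. e j * pderiv_c j (\<lambda>y. a 0 y + \<sigma> *\<^sub>R (J * (y p *\<^sub>R b 0 y))) y)
      + (\<sigma> *\<^sub>R J) * pderiv_c p (\<lambda>y. a 0 y + \<sigma> *\<^sub>R (J * (y p *\<^sub>R b 0 y))) y = 0"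
    and y: "y \<in> D"
  shows "(\<Sum>j\<in>{..<n} - {p}. e j * pderiv_c j (a 0) y) = b 0 y + (y p)\<^sup>2 *\<^sub>R b 1 y"
    and "a 1 y + (\<Sum>j\<in>{..<n} - {p}. ec j * pderiv_c j (b 0) y) = 0"
proof -
  let ?S = "\<lambda>y. \<Sum>j\<in>{..<n} - {p}. e j * pderiv_c j (a 0) y"
  let ?T = "\<lambda>y. \<Sum>j\<in>{..<n} - {p}. ec j * pderiv_c j (b 0) y"
  have main: "?S y - (b 0 y + (y p)\<^sup>2 *\<^sub>R b 1 y) + \<sigma> *\<^sub>R (J * (y p *\<^sub>R (a 1 y + ?T y))) = 0"
    if \<sigma>: "\<sigma> \<in> {1, - 1}" and y: "y \<in> D" for \<sigma> y
  proof -
    let ?G = "\<lambda>y. a 0 y + \<sigma> *\<^sub>R (J * (y p *\<^sub>R b 0 y))"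
    have dj: "pderiv_c j ?G y = pderiv_c j (a 0) y + \<sigma> *\<^sub>R (J * (y p *\<^sub>R pderiv_c j (b 0) y))" if j: "j < n" "j \<noteq> p" for j
    proof (rule has_pd_imp_pderiv, rule has_pd_add)
      show "has_pd j (a 0) (pderiv_c j (a 0) y) y" by (rule Cinf_has_pd[OF chainD(1)[OF a] j(1) y])
      have "has_pd j (\<lambda>y. y p *\<^sub>R b 0 y) (y p *\<^sub>R pderiv_c j (b 0) y) y"
        using has_pd_scaleR[OF has_pd_coord[of j p y] Cinf_has_pd[OF chainD(1)[OF b] j(1) y, of 0]] j by simp
      then show "has_pd j (\<lambda>y. \<sigma> *\<^sub>R (J * (y p *\<^sub>R b 0 y))) (\<sigma> *\<^sub>R (J * (y p *\<^sub>R pderiv_c j (b 0) y))) y"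
        by (rule has_pd_linear[OF bounded_linear_scaleR_right has_pd_linear[OF bounded_linear_mult_left_fin]])
    qed
    have dp: "pderiv_c p ?G y = y p *\<^sub>R a 1 y + \<sigma> *\<^sub>R (J * (b 0 y + (y p)\<^sup>2 *\<^sub>R b 1 y))"
    proof (rule has_pd_imp_pderiv, rule has_pd_add)
      show "has_pd p (a 0) (y p *\<^sub>R a 1 y) y" using chain_has_pd[OF a y, of 0] by simp
      have "has_pd p (\<lambda>y. y p *\<^sub>R b 0 y) (b 0 y + (y p)\<^sup>2 *\<^sub>R b 1 y) y"
        using has_pd_scaleR[OF has_pd_coord[of p p y] chain_has_pd[OF b y, of 0]] by (simp add: power2_eq_square add.commute)
      then show "has_pd p (\<lambda>y. \<sigma> *\<^sub>R (J * (y p *\<^sub>R b 0 y))) (\<sigma> *\<^sub>R (J * (b 0 y + (y p)\<^sup>2 *\<^sub>R b 1 y))) y"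
        by (rule has_pd_linear[OF bounded_linear_scaleR_right has_pd_linear[OF bounded_linear_mult_left_fin]])
    qed
    have A: "(\<Sum>j\<in>{..<n} - {p}. e j * pderiv_c j ?G y) = ?S y + \<sigma> *\<^sub>R (J * (y p *\<^sub>R ?T y))"
    proof -
      have "e j * pderiv_c j ?G y = e j * pderiv_c j (a 0) y + \<sigma> *\<^sub>R (J * (y p *\<^sub>R (ec j * pderiv_c j (b 0) y)))"
        if "j \<in> {..<n} - {p}" for j
      proof -
        have "e j * (J * (y p *\<^sub>R pderiv_c j (b 0) y)) = J * (y p *\<^sub>R (ec j * pderiv_c j (b 0) y))"
          using comm[of j] that by (simp add: mult.assoc[symmetric])
        then show ?thesis using dj[of j] that by (auto simp: distrib_left)
      qed
      then show ?thesis by (simp add: sum.distrib scaleR_sum_right sum_distrib_left)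
    qed
    have B: "(\<sigma> *\<^sub>R J) * pderiv_c p ?G y = \<sigma> *\<^sub>R (J * (y p *\<^sub>R a 1 y)) - (b 0 y + (y p)\<^sup>2 *\<^sub>R b 1 y)"
    proof -
      have "J * (J * c) = - c" for c using J by (simp add: mult.assoc[symmetric])
      then show ?thesis unfolding dp using \<sigma> by (auto simp: distrib_left)
    qed
    have "?S y - (b 0 y + (y p)\<^sup>2 *\<^sub>R b 1 y) + \<sigma> *\<^sub>R (J * (y p *\<^sub>R (a 1 y + ?T y))) =
       (?S y + \<sigma> *\<^sub>R (J * (y p *\<^sub>R ?T y))) + (\<sigma> *\<^sub>R (J * (y p *\<^sub>R a 1 y)) - (b 0 y + (y p)\<^sup>2 *\<^sub>R b 1 y))"
      by (simp add: distrib_left scaleR_add_right)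
    also have "\<dots> = 0" unfolding A[symmetric] B[symmetric] by (rule reg[OF \<sigma> y])
    finally show ?thesis .
  qed
  have 1: "?S y = b 0 y + (y p)\<^sup>2 *\<^sub>R b 1 y" and 2: "J * (y p *\<^sub>R (a 1 y + ?T y)) = 0" if y: "y \<in> D" for y
  proof -
    let ?A = "?S y - (b 0 y + (y p)\<^sup>2 *\<^sub>R b 1 y)" and ?B = "J * (y p *\<^sub>R (a 1 y + ?T y))"
    have m: "?A + ?B = 0" "?A - ?B = 0" using main[of 1 y] main[of "-1" y] y by simp_all
    show "?S y = b 0 y + (y p)\<^sup>2 *\<^sub>R b 1 y" using sum_and_difference_zero(1)[OF m] by simp
    show "?B = 0" by (rule sum_and_difference_zero(2)[OF m])
  qed
  show "?S y = b 0 y + (y p)\<^sup>2 *\<^sub>R b 1 y" by (rule 1[OF y])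
  show "a 1 y + ?T y = 0"
  proof (rule eq_if_coord_multiples_eq[OF D p _ continuous_on_const _ y])
    have "Cinf n D (\<lambda>y. a 1 y + ?T y)"
      by (intro Cinf_add[OF D chainD(1)[OF a]] Cinf_sum[OF D] Cinf_linear[OF D bounded_linear_mult_left_fin] Cinf_pderiv chainD(1)[OF b]) auto
    then show "continuous_on D (\<lambda>y. a 1 y + ?T y)" by (rule Cinf_continuous)
    fix y assume y: "y \<in> D"
    have "J * (J * (y p *\<^sub>R (a 1 y + ?T y))) = 0" unfolding 2[OF y] by simp
    moreover have "J * (J * c) = - c" for c using J by (simp add: mult.assoc[symmetric])
    ultimately have "- (y p *\<^sub>R (a 1 y + ?T y)) = 0" by (simp only:)
    then show "y p *\<^sub>R (a 1 y + ?T y) = y p *\<^sub>R 0" by (simp only: neg_equal_0_iff_equal scaleR_zero_right)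
  qed
qed

end

context pulled_alg begin

lemma X_square:
  assumes sq: "\<And>s. s \<in> Bl \<Longrightarrow> v s * v s = - 1" and anti: "\<And>s u. s \<in> Bl \<Longrightarrow> u \<in> Bl \<Longrightarrow> s \<noteq> u \<Longrightarrow> v s * v u = - (v u * v s)"
  shows "X y * X y = - ((rho y p)\<^sup>2 *\<^sub>R 1)"
proof -
  have "(\<Sum>s\<in>Bl. (- v s) * (\<Sum>u\<in>Bl. v u * (y s * y u) *\<^sub>R 1)) = (\<Sum>s\<in>Bl. (y s * y s) *\<^sub>R 1)"
  proof (rule clifford_trace)
    show "- v s * v u + - v u * v s = 0" if "s \<in> Bl" "u \<in> Bl" "s \<noteq> u" for s u using anti[OF that] by simp
  qed (use sq in \<open>auto simp: mult.commute\<close>)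
  also have "(\<Sum>s\<in>Bl. (- v s) * (\<Sum>u\<in>Bl. v u * (y s * y u) *\<^sub>R 1)) = - (X y * X y)"
    by (simp add: X_def sum_distrib_left sum_distrib_right sum_negf scaleR_sum_right) (subst sum.swap, simp add: mult.commute)
  also have "(\<Sum>s\<in>Bl. (y s * y s) *\<^sub>R (1::'a)) = (rho y p)\<^sup>2 *\<^sub>R 1"
    unfolding rho_p_square by (simp add: scaleR_sum_left power2_eq_square)
  finally show ?thesis by (metis minus_minus)
qed

text \<open>Off the block, \<open>E1\<close> and \<open>E2\<close> replace the derivatives. On the
  block, \<open>v i * (v i * b k) = - b k\<close> occurs once per coordinate, and the square of
  \<open>X\<close> is minus the squared norm. What remains is \<open>1 + 2 * k\<close> minus the
  block size, times \<open>b k\<close>; the size required in \<open>m\<close> is exactly the one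
  that makes it vanish.\<close>

lemma regular_ext:
  fixes a b :: "nat \<Rightarrow> (nat \<Rightarrow> real) \<Rightarrow> 'a"
  assumes a: "evchain a" and b: "evchain b"
    and sq: "\<And>s. s \<in> Bl \<Longrightarrow> v s * v s = - 1" and anti: "\<And>s u. s \<in> Bl \<Longrightarrow> u \<in> Bl \<Longrightarrow> s \<noteq> u \<Longrightarrow> v s * v u = - (v u * v s)"
    and e'B: "\<And>s. s \<in> Bl \<Longrightarrow> e' s = v s" and e'e: "\<And>i. i < n' \<Longrightarrow> i \<notin> Bl \<Longrightarrow> e' i = e (kap i)"
    and comm: "\<And>j s. j < n \<Longrightarrow> j \<noteq> p \<Longrightarrow> s \<in> Bl \<Longrightarrow> e j * v s = v s * ec j"
    and E1: "\<And>y. y \<in> D \<Longrightarrow> (\<Sum>j\<in>{..<n} - {p}. e j * pderiv_c j (a k) y) = (1 + 2 * real k) *\<^sub>R b k y + (y p)\<^sup>2 *\<^sub>R b (Suc k) y"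
    and E2: "\<And>y. y \<in> D \<Longrightarrow> a (Suc k) y + (\<Sum>j\<in>{..<n} - {p}. ec j * pderiv_c j (b k) y) = 0"
    and m: "Suc t1 - p = 2 * k + 1" and y: "y \<in> D'"
  shows "(\<Sum>i<n'. e' i * pderiv_c i (ext 1 (a k) (b k)) y) = 0"
proof -
  have E: "Ev (a k)" "Ev (b k)" using a b by (simp_all add: evchain_def)
  let ?z = "rho y"
  have zD: "?z \<in> D" by (rule rho_D[OF y])
  have ext1: "ext 1 (a k) (b k) = (\<lambda>y. a k (rho y) + X y * b k (rho y))" by (simp add: ext_def[abs_def])
  have oth: "e' i * pderiv_c i (ext 1 (a k) (b k)) y =
      e (kap i) * pderiv_c (kap i) (a k) ?z + X y * (ec (kap i) * pderiv_c (kap i) (b k) ?z)" if i: "i < n'" "i \<notin> Bl" for i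
  proof -
    have "pderiv_c i (ext 1 (a k) (b k)) y = pderiv_c (kap i) (a k) ?z + X y * pderiv_c (kap i) (b k) ?z"
      unfolding ext1
      by (rule has_pd_imp_pderiv[OF has_pd_add[OF has_pd_pull_chain_other[OF E(1) y i]
            has_pd_X_mult_other[OF has_pd_pull_chain_other[OF E(2) y i] i(2)]]])
    moreover have "e (kap i) * (X y * c) = X y * (ec (kap i) * c)" for c
    proof -
      have "e (kap i) * X y = X y * ec (kap i)"
        using comm kap_range[OF i] by (simp add: X_def sum_distrib_left sum_distrib_right)
      then show ?thesis by (simp add: mult.assoc[symmetric])
    qed
    ultimately show ?thesis using e'e[OF i] by (simp add: distrib_left)
  qed
  have bl: "e' i * pderiv_c i (ext 1 (a k) (b k)) y =
      y i *\<^sub>R (v i * a (Suc k) ?z) + y i *\<^sub>R (v i * (X y * b (Suc k) ?z)) - b k ?z" if i: "i \<in> Bl" for i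
  proof -
    have "pderiv_c i (ext 1 (a k) (b k)) y = y i *\<^sub>R a (Suc k) ?z + (X y * (y i *\<^sub>R b (Suc k) ?z) + (if i \<in> Bl then v i * b k ?z else 0))"
      unfolding ext1
      by (rule has_pd_imp_pderiv[OF has_pd_add[OF has_pd_pull_chain_block[OF a y i] has_pd_X_mult[OF has_pd_pull_chain_block[OF b y i]]]])
    moreover have "v i * (v i * b k ?z) = - b k ?z" using sq[OF i] by (simp add: mult.assoc[symmetric])
    ultimately show ?thesis unfolding e'B[OF i] using i by (simp add: distrib_left)
  qed
  have "(\<Sum>i\<in>{..<n'} - Bl. e' i * pderiv_c i (ext 1 (a k) (b k)) y) =
     (\<Sum>i\<in>{..<n'} - Bl. e (kap i) * pderiv_c (kap i) (a k) ?z + X y * (ec (kap i) * pderiv_c (kap i) (b k) ?z))"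
    by (rule sum.cong[OF refl oth]) auto
  also have "\<dots> = (\<Sum>j\<in>{..<n} - {p}. e j * pderiv_c j (a k) ?z + X y * (ec j * pderiv_c j (b k) ?z))"
    by (rule sum_kap)
  also have "\<dots> = (1 + 2 * real k) *\<^sub>R b k ?z + (?z p)\<^sup>2 *\<^sub>R b (Suc k) ?z + X y * (\<Sum>j\<in>{..<n} - {p}. ec j * pderiv_c j (b k) ?z)"
    by (simp add: sum.distrib E1[OF zD] sum_distrib_left)
  finally have 1: "(\<Sum>i\<in>{..<n'} - Bl. e' i * pderiv_c i (ext 1 (a k) (b k)) y) = \<dots>" .
  have "(\<Sum>i\<in>Bl. e' i * pderiv_c i (ext 1 (a k) (b k)) y) =
     (\<Sum>i\<in>Bl. y i *\<^sub>R (v i * a (Suc k) ?z) + y i *\<^sub>R (v i * (X y * b (Suc k) ?z)) - b k ?z)"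
    by (rule sum.cong[OF refl bl])
  also have "\<dots> = X y * a (Suc k) ?z + X y * (X y * b (Suc k) ?z) - real (Suc t1 - p) *\<^sub>R b k ?z"
    by (simp add: X_mult[of y "a (Suc k) ?z"] X_mult[of y "X y * b (Suc k) ?z"] sum.distrib sum_subtractf sum_constant_scaleR del: sum_constant)
  also have "X y * (X y * b (Suc k) ?z) = - ((?z p)\<^sup>2 *\<^sub>R b (Suc k) ?z)"
    using X_square[OF sq anti, of y] by (simp add: mult.assoc[symmetric])
  finally have 2: "(\<Sum>i\<in>Bl. e' i * pderiv_c i (ext 1 (a k) (b k)) y) =
     X y * a (Suc k) ?z + - ((?z p)\<^sup>2 *\<^sub>R b (Suc k) ?z) - real (Suc t1 - p) *\<^sub>R b k ?z" .
  have 3: "X y * (\<Sum>j\<in>{..<n} - {p}. ec j * pderiv_c j (b k) ?z) = - (X y * a (Suc k) ?z)"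
  proof -
    have "(\<Sum>j\<in>{..<n} - {p}. ec j * pderiv_c j (b k) ?z) = - a (Suc k) ?z"
      using E2[OF zD] by (simp add: eq_neg_iff_add_eq_0 add.commute)
    then show ?thesis by simp
  qed
  have mm: "real (Suc t1 - p) = 1 + 2 * real k" using m by simp
  show ?thesis unfolding sum_split_block 1 2 3 mm by simp
qed

end

section \<open>Stem functions\<close>

text \<open>Differentiating the equation along each \<open>a\<close>, multiplying by
  \<open>cconj e a\<close> and summing gives the Laplacian by \<open>clifford_trace\<close>, the
  Hessian being symmetric. The second derivatives exist by
  \<open>cregular_imp_analytic\<close>.\<close>

lemma cregular_harmonic:
  fixes e :: "nat \<Rightarrow> 'a::{real_algebra_1,euclidean_space}"
  assumes e: "clifford_sys n e" and D: "opn n D" and F: "cregular n e D F" and y: "y \<in> D"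
  shows "(\<Sum>i<n. pderiv_c i (pderiv_c i F) y) = 0"
proof -
  have C: "Cinf n D F" by (rule cregular_imp_analytic[OF e D F])
  have "(\<Sum>a<n. cconj e a * (\<Sum>b<n. e b * pderiv_c a (pderiv_c b F) y)) = (\<Sum>a<n. pderiv_c a (pderiv_c a F) y)"
    by (rule clifford_trace) (use cconj_mult[OF e] cconj_anti[OF e] Cinf_pderiv_commute[OF D C y] in auto)
  moreover have "(\<Sum>b<n. e b * pderiv_c a (pderiv_c b F) y) = 0" if a: "a < n" for a
  proof -
    have "has_pd a (\<lambda>y. \<Sum>b<n. e b * pderiv_c b F y) (\<Sum>b<n. e b * pderiv_c a (pderiv_c b F) y) y"
      by (rule has_pd_sum, rule has_pd_linear[OF bounded_linear_mult_left_fin], rule Cinf_has_pd[OF Cinf_pderiv[OF C] a y]) simp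
    then have "(\<Sum>b<n. e b * pderiv_c a (pderiv_c b F) y) = pderiv_c a (\<lambda>y. \<Sum>b<n. e b * pderiv_c b F y) y"
      by (rule has_pd_imp_pderiv[symmetric])
    also have "\<dots> = pderiv_c a (\<lambda>y. 0) y"
      by (rule pderiv_c_cong[OF D y a]) (use F in \<open>simp add: cregular_def\<close>)
    also have "\<dots> = 0" by (rule has_pd_imp_pderiv[OF has_pd_const])
    finally show ?thesis .
  qed
  ultimately show ?thesis by simp
qed

lemma real_analyticE:
  assumes F: "real_analytic_c n D F" and y: "y \<in> D"
  obtains r c where "r > 0" "\<forall>z\<in>Ecoord n. (\<forall>i<n. \<bar>z i - y i\<bar> < r) \<longrightarrow> z \<in> D"
    "\<forall>z\<in>Ecoord n. (\<forall>i<n. \<bar>z i - y i\<bar> < r) \<longrightarrow>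
      ((\<lambda>m. (\<Prod>i<n. (z i - y i) ^ m i) *\<^sub>R c m) has_sum F z) {m. \<forall>i\<ge>n. m i = 0}"
proof -
  obtain r c where "r > 0" "\<forall>z\<in>Ecoord n. (\<forall>i<n. \<bar>z i - y i\<bar> < r) \<longrightarrow> z \<in> D \<and>
      ((\<lambda>m. (\<Prod>i<n. (z i - y i) ^ m i) *\<^sub>R c m) has_sum F z) {m. \<forall>i\<ge>n. m i = 0}"
    using bspec[OF F[unfolded real_analytic_c_def] y] by (elim exE conjE)
  then show thesis by (intro that[of r c]) simp_all
qed

lemma real_analyticI:
  assumes "\<And>y. y \<in> D \<Longrightarrow> \<exists>r c. r > 0 \<and> (\<forall>z\<in>Ecoord n. (\<forall>i<n. \<bar>z i - y i\<bar> < r) \<longrightarrow> z \<in> D) \<and>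
     (\<forall>z\<in>Ecoord n. (\<forall>i<n. \<bar>z i - y i\<bar> < r) \<longrightarrow>
       ((\<lambda>m. (\<Prod>i<n. (z i - y i) ^ m i) *\<^sub>R c m) has_sum F z) {m. \<forall>i\<ge>n. m i = 0})"
  shows "real_analytic_c n D F"
  unfolding real_analytic_c_def
proof
  fix y assume "y \<in> D"
  from assms[OF this] obtain r c where rc: "r > 0" "\<forall>z\<in>Ecoord n. (\<forall>i<n. \<bar>z i - y i\<bar> < r) \<longrightarrow> z \<in> D"
     "\<forall>z\<in>Ecoord n. (\<forall>i<n. \<bar>z i - y i\<bar> < r) \<longrightarrow>
       ((\<lambda>m. (\<Prod>i<n. (z i - y i) ^ m i) *\<^sub>R c m) has_sum F z) {m. \<forall>i\<ge>n. m i = 0}"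
    by (elim exE conjE)
  show "\<exists>r>0. \<exists>c. \<forall>z\<in>Ecoord n. (\<forall>i<n. \<bar>z i - y i\<bar> < r) \<longrightarrow> z \<in> D \<and>
     ((\<lambda>m. (\<Prod>i<n. (z i - y i) ^ m i) *\<^sub>R c m) has_sum F z) {m. \<forall>i\<ge>n. m i = 0}"
    by (rule exI[of _ r], rule conjI[OF rc(1)], rule exI[of _ c]) (use rc(2,3) in simp)
qed

lemma real_analytic_cong:
  assumes F: "real_analytic_c n D F" and eq: "\<And>y. y \<in> D \<Longrightarrow> F y = G y"
  shows "real_analytic_c n D G"
proof (rule real_analyticI)
  fix y assume y: "y \<in> D"
  obtain r c where rc: "r > 0" "\<forall>z\<in>Ecoord n. (\<forall>i<n. \<bar>z i - y i\<bar> < r) \<longrightarrow> z \<in> D"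
    "\<forall>z\<in>Ecoord n. (\<forall>i<n. \<bar>z i - y i\<bar> < r) \<longrightarrow>
      ((\<lambda>m. (\<Prod>i<n. (z i - y i) ^ m i) *\<^sub>R c m) has_sum F z) {m. \<forall>i\<ge>n. m i = 0}"
    by (rule real_analyticE[OF F y])
  show "\<exists>r c. r > 0 \<and> (\<forall>z\<in>Ecoord n. (\<forall>i<n. \<bar>z i - y i\<bar> < r) \<longrightarrow> z \<in> D) \<and>
     (\<forall>z\<in>Ecoord n. (\<forall>i<n. \<bar>z i - y i\<bar> < r) \<longrightarrow>
       ((\<lambda>m. (\<Prod>i<n. (z i - y i) ^ m i) *\<^sub>R c m) has_sum G z) {m. \<forall>i\<ge>n. m i = 0})"
    by (rule exI[of _ r], rule exI[of _ c]) (use rc in \<open>simp add: eq[symmetric]\<close>)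
qed

lemma real_analytic_linear:
  assumes L: "bounded_linear L" and F: "real_analytic_c n D F"
  shows "real_analytic_c n D (\<lambda>y. L (F y))"
proof (rule real_analyticI)
  fix y assume y: "y \<in> D"
  obtain r c where rc: "r > 0" "\<forall>z\<in>Ecoord n. (\<forall>i<n. \<bar>z i - y i\<bar> < r) \<longrightarrow> z \<in> D"
    "\<forall>z\<in>Ecoord n. (\<forall>i<n. \<bar>z i - y i\<bar> < r) \<longrightarrow>
      ((\<lambda>m. (\<Prod>i<n. (z i - y i) ^ m i) *\<^sub>R c m) has_sum F z) {m. \<forall>i\<ge>n. m i = 0}"
    by (rule real_analyticE[OF F y])
  have "((\<lambda>m. (\<Prod>i<n. (z i - y i) ^ m i) *\<^sub>R L (c m)) has_sum L (F z)) {m. \<forall>i\<ge>n. m i = 0}"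
    if "z \<in> Ecoord n" "\<forall>i<n. \<bar>z i - y i\<bar> < r" for z
    using has_sum_bounded_linear[OF L rc(3)[rule_format, OF that(1)]] that(2) L by (simp add: linear_simps)
  then show "\<exists>r c. r > 0 \<and> (\<forall>z\<in>Ecoord n. (\<forall>i<n. \<bar>z i - y i\<bar> < r) \<longrightarrow> z \<in> D) \<and>
     (\<forall>z\<in>Ecoord n. (\<forall>i<n. \<bar>z i - y i\<bar> < r) \<longrightarrow>
       ((\<lambda>m. (\<Prod>i<n. (z i - y i) ^ m i) *\<^sub>R c m) has_sum L (F z)) {m. \<forall>i\<ge>n. m i = 0})"
    by (intro exI[of _ r] exI[of _ "\<lambda>m. L (c m)"]) (use rc(1,2) in simp)
qed

lemma real_analytic_add:
  fixes F G :: "(nat \<Rightarrow> real) \<Rightarrow> 'a::real_normed_vector"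
  assumes F: "real_analytic_c n D F" and G: "real_analytic_c n D G"
  shows "real_analytic_c n D (\<lambda>y. F y + G y)"
proof (rule real_analyticI)
  fix y assume y: "y \<in> D"
  obtain r1 c1 where r1: "r1 > 0" "\<forall>z\<in>Ecoord n. (\<forall>i<n. \<bar>z i - y i\<bar> < r1) \<longrightarrow> z \<in> D"
    "\<forall>z\<in>Ecoord n. (\<forall>i<n. \<bar>z i - y i\<bar> < r1) \<longrightarrow>
      ((\<lambda>m. (\<Prod>i<n. (z i - y i) ^ m i) *\<^sub>R c1 m) has_sum F z) {m. \<forall>i\<ge>n. m i = 0}"
    by (rule real_analyticE[OF F y])
  obtain r2 c2 where r2: "r2 > 0" "\<forall>z\<in>Ecoord n. (\<forall>i<n. \<bar>z i - y i\<bar> < r2) \<longrightarrow> z \<in> D"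
    "\<forall>z\<in>Ecoord n. (\<forall>i<n. \<bar>z i - y i\<bar> < r2) \<longrightarrow>
      ((\<lambda>m. (\<Prod>i<n. (z i - y i) ^ m i) *\<^sub>R c2 m) has_sum G z) {m. \<forall>i\<ge>n. m i = 0}"
    by (rule real_analyticE[OF G y])
  have "((\<lambda>m. (\<Prod>i<n. (z i - y i) ^ m i) *\<^sub>R (c1 m + c2 m)) has_sum (F z + G z)) {m. \<forall>i\<ge>n. m i = 0}"
    if z: "z \<in> Ecoord n" "\<forall>i<n. \<bar>z i - y i\<bar> < min r1 r2" for z
    unfolding scaleR_add_right
    by (rule has_sum_add[OF r1(3)[rule_format] r2(3)[rule_format]]) (use z in simp_all)
  then show "\<exists>r c. r > 0 \<and> (\<forall>z\<in>Ecoord n. (\<forall>i<n. \<bar>z i - y i\<bar> < r) \<longrightarrow> z \<in> D) \<and>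
     (\<forall>z\<in>Ecoord n. (\<forall>i<n. \<bar>z i - y i\<bar> < r) \<longrightarrow>
       ((\<lambda>m. (\<Prod>i<n. (z i - y i) ^ m i) *\<^sub>R c m) has_sum (F z + G z)) {m. \<forall>i\<ge>n. m i = 0})"
    by (intro exI[of _ "min r1 r2"] exI[of _ "\<lambda>m. c1 m + c2 m"]) (use r1(1,2) r2(1) in simp)
qed

lemma real_analytic_zero:
  assumes D: "opn n D" shows "real_analytic_c n D (\<lambda>y. 0 :: 'a::real_normed_vector)"
proof (rule real_analyticI)
  fix y assume "y \<in> D"
  then obtain \<epsilon> where "\<epsilon> > 0" "ocube n y \<epsilon> \<subseteq> D" using opn_imp_ocube[OF D] by blast
  then show "\<exists>r c. r > 0 \<and> (\<forall>z\<in>Ecoord n. (\<forall>i<n. \<bar>z i - y i\<bar> < r) \<longrightarrow> z \<in> D) \<and>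
     (\<forall>z\<in>Ecoord n. (\<forall>i<n. \<bar>z i - y i\<bar> < r) \<longrightarrow>
       ((\<lambda>m. (\<Prod>i<n. (z i - y i) ^ m i) *\<^sub>R c m) has_sum (0::'a)) {m. \<forall>i\<ge>n. m i = 0})"
    by (intro exI[of _ \<epsilon>] exI[of _ "\<lambda>m. 0"]) (auto simp: ocube_def has_sum_0)
qed

lemma real_analytic_sum:
  fixes F :: "'i \<Rightarrow> (nat \<Rightarrow> real) \<Rightarrow> 'a::real_normed_vector"
  assumes D: "opn n D"
  shows "finite A \<Longrightarrow> (\<And>j. j \<in> A \<Longrightarrow> real_analytic_c n D (F j)) \<Longrightarrow> real_analytic_c n D (\<lambda>y. \<Sum>j\<in>A. F j y)"
proof (induction A rule: finite_induct)
  case (insert j A)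
  then show ?case using real_analytic_add[of n D "F j" "\<lambda>y. \<Sum>j\<in>A. F j y"] by simp
qed (simp add: real_analytic_zero[OF D])

section \<open>Sign characters and products of imaginary units\<close>

definition psign :: "nat set \<Rightarrow> nat set \<Rightarrow> real" where
  "psign K S = (\<Prod>h\<in>S. if h \<in> K then - 1 else 1)"

lemma psign_square: "psign K S * psign K S = 1"
proof -
  have "psign K S * psign K S = (\<Prod>h\<in>S. 1)" unfolding psign_def prod.distrib[symmetric] by (rule prod.cong) auto
  then show ?thesis by simp
qed

lemma psign_insert: "finite S \<Longrightarrow> h \<notin> S \<Longrightarrow> psign K (insert h S) = (if h \<in> K then - psign K S else psign K S)"
  by (simp add: psign_def)

text \<open>\<open>psign K\<close> is a character of the group of sign changes. The sum over all
  \<open>S\<close> is the expansion of the product of the \<open>c h + 1\<close>, and one factor is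
  zero as soon as \<open>K\<close> and \<open>L\<close> differ.\<close>

lemma psign_orthogonal:
  assumes A: "finite A" and K: "K \<subseteq> A" and L: "L \<subseteq> A"
  shows "(\<Sum>S\<in>Pow A. psign K S * psign L S) = (if K = L then 2 ^ card A else 0)"
proof -
  define c :: "nat \<Rightarrow> real" where "c h = (if (h \<in> K) = (h \<in> L) then 1 else - 1)" for h
  have "psign K S * psign L S = (\<Prod>h\<in>S. c h)" for S
    unfolding psign_def prod.distrib[symmetric] by (rule prod.cong) (auto simp: c_def)
  then have "(\<Sum>S\<in>Pow A. psign K S * psign L S) = (\<Sum>S\<in>Pow A. (\<Prod>h\<in>S. c h) * (\<Prod>h\<in>A - S. 1))" by simp
  also have "\<dots> = (\<Prod>h\<in>A. c h + 1)" by (rule prod_add[OF A, symmetric])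
  also have "\<dots> = (if K = L then 2 ^ card A else 0)"
  proof (cases "K = L")
    case True
    then show ?thesis by (simp add: c_def)
  next
    case False
    then obtain h where "h \<in> A" "(h \<in> K) \<noteq> (h \<in> L)" using K L by blast
    then have "c h + 1 = 0" by (simp add: c_def)
    then show ?thesis using \<open>h \<in> A\<close> A False by (auto simp: prod_zero_iff intro!: bexI[of _ h])
  qed
  finally show ?thesis .
qed

definition Jflip :: "(nat \<Rightarrow> 'a::uminus) \<Rightarrow> nat set \<Rightarrow> nat \<Rightarrow> 'a" where
  "Jflip J S h = (if h \<in> S then - J h else J h)"

text \<open>The list form of \<open>Jprod\<close>, for inductions over the factors.\<close>

definition lprod :: "(nat \<Rightarrow> 'a::monoid_mult) \<Rightarrow> nat list \<Rightarrow> 'a" where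
  "lprod J ks = foldr (\<lambda>k a. J k * a) ks 1"

lemma lprod_simps [simp]: "lprod J [] = 1" "lprod J (k # ks) = J k * lprod J ks"
  by (simp_all add: lprod_def)

lemma Jprod_lprod: "Jprod J K = lprod J (sorted_list_of_set K)" by (simp add: Jprod_def lprod_def)

lemma lprod_Jflip:
  fixes J :: "nat \<Rightarrow> 'a::real_algebra_1"
  shows "distinct ks \<Longrightarrow> lprod (Jflip J S) ks = psign S (set ks) *\<^sub>R lprod J ks"
  by (induction ks) (auto simp: psign_insert Jflip_def psign_def[of _ "{}"])

lemma psign_commute:
  assumes "finite K" "finite S" shows "psign K S = psign S K"
proof -
  have "psign K S = (\<Prod>h\<in>S \<inter> K. - 1)" if "finite S" for K S
    unfolding psign_def using that by (subst prod.inter_restrict[symmetric]) (auto intro!: prod.cong simp: prod.If_cases)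
  then show ?thesis using assms by (metis Int_commute)
qed

lemma Jprod_Jflip:
  fixes J :: "nat \<Rightarrow> 'a::real_algebra_1"
  shows "finite K \<Longrightarrow> finite S \<Longrightarrow> Jprod (Jflip J S) K = psign K S *\<^sub>R Jprod J K"
  unfolding Jprod_lprod by (simp add: lprod_Jflip psign_commute)

lemma Jprod_cong: "finite K \<Longrightarrow> (\<And>k. k \<in> K \<Longrightarrow> J k = J' k) \<Longrightarrow> Jprod J K = Jprod J' K"
proof -
  assume a: "finite K" "\<And>k. k \<in> K \<Longrightarrow> J k = J' k"
  have "(\<forall>k\<in>set ks. J k = J' k) \<longrightarrow> lprod J ks = lprod J' ks" for ks by (induction ks) auto
  then show ?thesis unfolding Jprod_lprod using a by simp
qed

lemma Jprod_insert_min: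
  assumes "finite K" "\<And>j. j \<in> K \<Longrightarrow> k < j" shows "Jprod J (insert k K) = J k * Jprod J K"
proof -
  have "sorted_list_of_set (insert k K) = insort k (sorted_list_of_set K)"
    using assms by (subst sorted_list_of_set_insert) auto
  also have "\<dots> = k # sorted_list_of_set K"
    using assms by (intro insort_is_Cons) (auto intro: less_imp_le)
  finally show ?thesis by (simp add: Jprod_lprod)
qed

lemma Jprod_Suc: "finite K \<Longrightarrow> Jprod J (Suc ` K) = Jprod (\<lambda>h. J (Suc h)) K"
proof -
  assume K: "finite K"
  have "sorted_list_of_set (Suc ` K) = map Suc (sorted_list_of_set K)"
    by (rule sorted_distinct_set_unique)
       (use K in \<open>auto simp: distinct_map sorted_map intro: sorted_wrt_mono_rel[OF _ sorted_sorted_list_of_set]\<close>)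
  moreover have "lprod J (map Suc ks) = lprod (\<lambda>h. J (Suc h)) ks" for ks by (induction ks) auto
  ultimately show ?thesis by (simp add: Jprod_lprod)
qed

lemma Jprod_commute:
  fixes J :: "nat \<Rightarrow> 'a::real_algebra_1"
  assumes "finite K" "\<And>k. k \<in> K \<Longrightarrow> x * J k = - (J k * x)"
  shows "x * Jprod J K = (- 1) ^ card K *\<^sub>R (Jprod J K * x)"
proof -
  have "(\<forall>k\<in>set ks. x * J k = - (J k * x)) \<longrightarrow> x * lprod J ks = (- 1) ^ length ks *\<^sub>R (lprod J ks * x)" for ks
  proof (induction ks)
    case (Cons k ks)
    show ?case
    proof
      assume a: "\<forall>j\<in>set (k # ks). x * J j = - (J j * x)"
      then have "x * (J k * lprod J ks) = - (J k * (x * lprod J ks))" by (simp add: mult.assoc[symmetric])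
      then show "x * lprod J (k # ks) = (- 1) ^ length (k # ks) *\<^sub>R (lprod J (k # ks) * x)"
        using Cons a by (simp add: mult.assoc)
    qed
  qed simp
  then show ?thesis unfolding Jprod_lprod using assms by simp
qed

text \<open>Each \<open>- J k\<close> inverts \<open>J k\<close>. \<open>stem_extraction\<close>
  uses the left inverse to remove the product in front of a stem component.\<close>

lemma Jprod_left_inverse:
  fixes J :: "nat \<Rightarrow> 'a::real_algebra_1"
  assumes "finite K" "\<And>k. k \<in> K \<Longrightarrow> J k * J k = - 1"
  obtains c where "c * Jprod J K = 1"
proof -
  have "(\<forall>k\<in>set ks. J k * J k = - 1) \<longrightarrow> (\<exists>c. c * lprod J ks = 1)" for ks
  proof (induction ks)
    case (Cons k ks)
    show ?case
    proof
      assume a: "\<forall>j\<in>set (k # ks). J j * J j = - 1"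
      then obtain c where c: "c * lprod J ks = 1" using Cons by auto
      have "- J k * (J k * lprod J ks) = lprod J ks" using a by (simp add: mult.assoc[symmetric])
      then have "(c * (- J k)) * lprod J (k # ks) = 1" using c by (simp only: lprod_simps mult.assoc)
      then show "\<exists>c. c * lprod J (k # ks) = 1" by blast
    qed
  qed auto
  then show thesis using assms that unfolding Jprod_lprod by (metis set_sorted_list_of_set)
qed

section \<open>Hypercomplex bases and tori\<close>

locale hypercomplex =
  fixes v :: "nat \<Rightarrow> 'a::{real_algebra_1,euclidean_space}" and N :: nat
  assumes v0: "v 0 = 1" and vsq: "\<And>s. s \<in> {1..N} \<Longrightarrow> v s * v s = - 1"
    and vanti: "\<And>s u. s \<in> {1..N} \<Longrightarrow> u \<in> {1..N} \<Longrightarrow> s \<noteq> u \<Longrightarrow> v s * v u = - (v u * v s)"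
    and vindep: "independent (v ` {0..N})" and vinj: "inj_on v {0..N}"
begin

lemma lincomb_square:
  assumes A: "A \<subseteq> {1..N}"
  shows "(\<Sum>s\<in>A. c s *\<^sub>R v s) * (\<Sum>s\<in>A. c s *\<^sub>R v s) = - ((\<Sum>s\<in>A. (c s)\<^sup>2) *\<^sub>R 1)"
proof -
  have fA: "finite A" using A finite_subset by blast
  have "(\<Sum>s\<in>A. (- v s) * (\<Sum>u\<in>A. v u * (c s * c u) *\<^sub>R 1)) = (\<Sum>s\<in>A. (c s * c s) *\<^sub>R 1)"
  proof (rule clifford_trace[OF fA])
    show "- v s * v u + - v u * v s = 0" if "s \<in> A" "u \<in> A" "s \<noteq> u" for s u
    proof -
      have "s \<in> {1..N}" "u \<in> {1..N}" using that A by auto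
      then show ?thesis using vanti[of s u] that(3) by simp
    qed
    show "- v s * v s = 1" if "s \<in> A" for s using vsq[of s] that A by auto
  qed (simp add: mult.commute)
  also have "(\<Sum>s\<in>A. (- v s) * (\<Sum>u\<in>A. v u * (c s * c u) *\<^sub>R 1)) = - ((\<Sum>s\<in>A. c s *\<^sub>R v s) * (\<Sum>s\<in>A. c s *\<^sub>R v s))"
    by (simp add: sum_distrib_left sum_distrib_right sum_negf scaleR_sum_right) (subst sum.swap, simp add: mult.commute)
  also have "(\<Sum>s\<in>A. (c s * c s) *\<^sub>R (1::'a)) = (\<Sum>s\<in>A. (c s)\<^sup>2) *\<^sub>R 1"
    by (simp add: scaleR_sum_left power2_eq_square)
  finally show ?thesis by (metis minus_minus)
qed

lemma lincomb_anticommute: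
  assumes A: "A \<subseteq> {1..N}" and B: "B \<subseteq> {1..N}" and AB: "A \<inter> B = {}"
  shows "(\<Sum>s\<in>A. c s *\<^sub>R v s) * (\<Sum>u\<in>B. d u *\<^sub>R v u) = - ((\<Sum>u\<in>B. d u *\<^sub>R v u) * (\<Sum>s\<in>A. c s *\<^sub>R v s))"
proof -
  have "(\<Sum>s\<in>A. c s *\<^sub>R v s) * (\<Sum>u\<in>B. d u *\<^sub>R v u) = (\<Sum>s\<in>A. \<Sum>u\<in>B. (c s * d u) *\<^sub>R (v s * v u))"
    by (simp add: sum_product mult.commute)
  also have "\<dots> = (\<Sum>s\<in>A. \<Sum>u\<in>B. (c s * d u) *\<^sub>R (- (v u * v s)))"
  proof (intro sum.cong refl)
    fix s u assume "s \<in> A" "u \<in> B"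
    then have "v s * v u = - (v u * v s)" using A B AB by (intro vanti) auto
    then show "(c s * d u) *\<^sub>R (v s * v u) = (c s * d u) *\<^sub>R (- (v u * v s))" by simp
  qed
  also have "\<dots> = - (\<Sum>u\<in>B. \<Sum>s\<in>A. (d u * c s) *\<^sub>R (v u * v s))"
    by (subst sum.swap) (simp add: sum_negf mult.commute)
  also have "(\<Sum>u\<in>B. \<Sum>s\<in>A. (d u * c s) *\<^sub>R (v u * v s)) = (\<Sum>u\<in>B. d u *\<^sub>R v u) * (\<Sum>s\<in>A. c s *\<^sub>R v s)"
    by (simp add: sum_product mult.commute)
  finally show ?thesis .
qed

lemma usph_square: "J \<in> usph v l m \<Longrightarrow> 1 \<le> l \<Longrightarrow> m \<le> N \<Longrightarrow> J * J = - 1"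
  using lincomb_square[of "{l..m}"] by (auto simp: usph_def)

lemma usph_anticommute:
  assumes "J \<in> usph v l m" "J' \<in> usph v l' m'" "1 \<le> l" "m < l'" "m' \<le> N" "m \<le> N"
  shows "J * J' = - (J' * J)"
  using assms lincomb_anticommute[of "{l..m}" "{l'..m'}"] by (fastforce simp: usph_def)

lemma usph_v: assumes "l \<le> m" shows "v l \<in> usph v l m"
proof -
  have "(\<Sum>s=l..m. (if s = l then 1 else 0) *\<^sub>R v s) = v l"
    using assms by (simp add: if_distrib[of "\<lambda>r. r *\<^sub>R _"] sum.delta cong: if_cong)
  moreover have "(\<Sum>s=l..m. (if s = l then 1 else 0 :: real)\<^sup>2) = 1"
    using assms by (simp add: if_distrib[of "\<lambda>r. r\<^sup>2"] sum.delta cong: if_cong)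
  ultimately show ?thesis unfolding usph_def by (intro CollectI exI[of _ "\<lambda>s. if s = l then 1 else 0"]) auto
qed

lemma usph_uminus: assumes "J \<in> usph v l m" shows "- J \<in> usph v l m"
proof -
  obtain c where c: "J = (\<Sum>s=l..m. c s *\<^sub>R v s)" "(\<Sum>s=l..m. (c s)\<^sup>2) = 1" using assms by (auto simp: usph_def)
  then show ?thesis unfolding usph_def by (intro CollectI exI[of _ "\<lambda>s. - c s"]) (auto simp: sum_negf)
qed

end

locale hyper_steps = hypercomplex v N for v :: "nat \<Rightarrow> 'a::{real_algebra_1,euclidean_space}" and N +
  fixes t :: "nat \<Rightarrow> nat" and \<tau> :: nat
  assumes steps: "steps t \<tau> N"
begin

abbreviation "nn \<equiv> t 0 + 1 + \<tau>"

lemma t_mono: "h < k \<Longrightarrow> k \<le> \<tau> \<Longrightarrow> t h < t k"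
  using steps by (auto simp: steps_def strict_mono_on_def)

lemma t_mono_le: "h \<le> k \<Longrightarrow> k \<le> \<tau> \<Longrightarrow> t h \<le> t k"
  using t_mono[of h k] by (cases "h = k") auto

lemma t_le_N: "h \<le> \<tau> \<Longrightarrow> t h \<le> N"
  using t_mono_le[of h \<tau>] steps by (simp add: steps_def)

lemma torusD: "J \<in> torus v t \<tau> \<Longrightarrow> h \<in> {1..\<tau>} \<Longrightarrow> J h \<in> usph v (t (h - 1) + 1) (t h)"
  by (simp add: torus_def)

lemma torus_square: "J \<in> torus v t \<tau> \<Longrightarrow> h \<in> {1..\<tau>} \<Longrightarrow> J h * J h = - 1"
  using usph_square[OF torusD] t_le_N by auto

lemma torus_anticommute_less:
  assumes J: "J \<in> torus v t \<tau>" and hk: "h \<in> {1..\<tau>}" "k \<in> {1..\<tau>}" "h < k"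
  shows "J h * J k = - (J k * J h)"
proof (rule usph_anticommute[OF torusD[OF J hk(1)] torusD[OF J hk(2)]])
  have "t h \<le> t (k - 1)" by (rule t_mono_le) (use hk in auto)
  then show "t h < t (k - 1) + 1" by simp
qed (use hk t_le_N in auto)

lemma torus_anticommute:
  assumes J: "J \<in> torus v t \<tau>" and hk: "h \<in> {1..\<tau>}" "k \<in> {1..\<tau>}" "h \<noteq> k"
  shows "J h * J k = - (J k * J h)"
  using torus_anticommute_less[OF J hk(1,2)] torus_anticommute_less[OF J hk(2,1)] hk(3)
  by (cases "h < k") auto

lemma usph_anticommute_v:
  assumes J: "J \<in> usph v l m" and "1 \<le> l" "m \<le> N" and s: "1 \<le> s" "s < l"
  shows "v s * J = - (J * v s)"
proof -
  have "v s \<in> usph v s s" by (rule usph_v) simp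
  moreover have "s \<le> N" if "l \<le> m" using that assms by simp
  moreover have "l \<le> m" using J by (auto simp: usph_def intro: ccontr)
  ultimately show ?thesis using usph_anticommute[OF _ J, of "v s" s s] assms by simp
qed

lemma torus_anticommute_v:
  assumes J: "J \<in> torus v t \<tau>" and h: "h \<in> {1..\<tau>}" and s: "1 \<le> s" "s \<le> t (h - 1)"
  shows "v s * J h = - (J h * v s)"
  by (rule usph_anticommute_v[OF torusD[OF J h]]) (use s t_le_N[of h] h in auto)

text \<open>The coefficients of the regularity operator along \<open>J\<close> as one sequence,
  indexed like the coordinates of \<open>D\<close>; \<open>clifford_esys\<close> makes the theory of
  \<open>cregular\<close> functions applicable to slices.\<close>

definition esys :: "(nat \<Rightarrow> 'a) \<Rightarrow> nat \<Rightarrow> 'a" where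
  "esys J i = (if i \<le> t 0 then v i else J (i - t 0))"

lemma clifford_esys:
  assumes J: "J \<in> torus v t \<tau>" shows "clifford_sys nn (esys J)"
  unfolding clifford_sys_def
proof (intro conjI ballI impI)
  show "esys J 0 = 1" by (simp add: esys_def v0)
  have t0: "t 0 \<le> N" by (rule t_le_N) simp
  fix i assume i: "i \<in> {1..<nn}"
  show "esys J i * esys J i = - 1"
  proof (cases "i \<le> t 0")
    case True
    then show ?thesis using i vsq[of i] t0 by (simp add: esys_def)
  next
    case False
    then have "i - t 0 \<in> {1..\<tau>}" using i by auto
    then show ?thesis using False torus_square[OF J] by (simp add: esys_def)
  qed
  fix j assume j: "j \<in> {1..<nn}" and ij: "i \<noteq> j"
  have vJ: "v s * J h = - (J h * v s)" if "1 \<le> s" "s \<le> t 0" "h \<in> {1..\<tau>}" for s h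
  proof (rule torus_anticommute_v[OF J that(3,1)])
    have "t 0 \<le> t (h - 1)" by (rule t_mono_le) (use that in auto)
    then show "s \<le> t (h - 1)" using that by simp
  qed
  have mem: "k - t 0 \<in> {1..\<tau>}" if "k \<in> {1..<nn}" "\<not> k \<le> t 0" for k using that by auto
  show "esys J i * esys J j = - (esys J j * esys J i)"
  proof (cases "i \<le> t 0"; cases "j \<le> t 0")
    assume "i \<le> t 0" "j \<le> t 0"
    then show ?thesis using vanti[of i j] i j ij t0 by (simp add: esys_def)
  next
    assume a: "i \<le> t 0" "\<not> j \<le> t 0"
    then show ?thesis using vJ[OF _ _ mem[OF j a(2)], of i] i by (simp add: esys_def)
  next
    assume a: "\<not> i \<le> t 0" "j \<le> t 0"
    then show ?thesis using vJ[OF _ _ mem[OF i a(1)], of j] j by (simp add: esys_def)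
  next
    assume a: "\<not> i \<le> t 0" "\<not> j \<le> t 0"
    then have "i - t 0 \<noteq> j - t 0" using ij by simp
    then show ?thesis using a torus_anticommute[OF J mem[OF i a(1)] mem[OF j a(2)]] by (simp add: esys_def)
  qed
qed

lemma torus_Jflip: "J \<in> torus v t \<tau> \<Longrightarrow> Jflip J S \<in> torus v t \<tau>"
  by (auto simp: torus_def Jflip_def usph_uminus)

lemma torus_nonempty: obtains J where "J \<in> torus v t \<tau>" "\<And>h. h \<in> {1..\<tau>} \<Longrightarrow> J h = v (t (h - 1) + 1)"
proof (rule that[of "\<lambda>h. if h \<in> {1..\<tau>} then v (t (h - 1) + 1) else 0"])
  have "v (t (h - 1) + 1) \<in> usph v (t (h - 1) + 1) (t h)" if "h \<in> {1..\<tau>}" for h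
    by (rule usph_v) (use t_mono[of "h - 1" h] that in auto)
  then show "(\<lambda>h. if h \<in> {1..\<tau>} then v (t (h - 1) + 1) else 0) \<in> torus v t \<tau>" by (auto simp: torus_def)
qed auto

text \<open>The values at all sign changes of \<open>J\<close> are the transform of the components
  by the characters \<open>psign\<close>; orthogonality isolates \<open>Jprod J K * F K y\<close>,
  and a left inverse removes the product. The coefficients \<open>c S\<close> are chosen before
  \<open>f\<close>, \<open>F\<close>, \<open>D\<close> and \<open>y\<close>, so they behave as
  constants under differentiation.\<close>

lemma stem_extraction:
  assumes J: "J \<in> torus v t \<tau>" and K: "K \<subseteq> {1..\<tau>}"
  obtains c where "\<And>f F D y. represents v t \<tau> D f F \<Longrightarrow> y \<in> D \<Longrightarrow>
     F K y = (\<Sum>S\<in>Pow {1..\<tau>}. c S * f (pt v t \<tau> (Jflip J S) y))"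
proof -
  have fK: "finite K" using K finite_subset by blast
  obtain c0 where c0: "c0 * Jprod J K = 1"
    using Jprod_left_inverse[OF fK, of J] torus_square[OF J] K by blast
  show thesis
  proof (rule that[of "\<lambda>S. (psign K S / 2 ^ \<tau>) *\<^sub>R c0"])
    fix f and F :: "nat set \<Rightarrow> (nat \<Rightarrow> real) \<Rightarrow> 'a" and D y
    assume rep: "represents v t \<tau> D f F" and y: "y \<in> D"
    have f: "f (pt v t \<tau> (Jflip J S) y) = (\<Sum>L\<in>Pow {1..\<tau>}. psign L S *\<^sub>R (Jprod J L * F L y))" if "S \<in> Pow {1..\<tau>}" for S
    proof -
      have "finite S" using that finite_subset by blast
      moreover have "finite L" if "L \<in> Pow {1..\<tau>}" for L using that finite_subset by blast
      ultimately show ?thesis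
        using rep y torus_Jflip[OF J, of S] by (simp add: represents_def Jprod_Jflip)
    qed
    have "(\<Sum>S\<in>Pow {1..\<tau>}. ((psign K S / 2 ^ \<tau>) *\<^sub>R c0) * f (pt v t \<tau> (Jflip J S) y))
       = (\<Sum>S\<in>Pow {1..\<tau>}. \<Sum>L\<in>Pow {1..\<tau>}. (psign K S * psign L S / 2 ^ \<tau>) *\<^sub>R (c0 * (Jprod J L * F L y)))"
      by (intro sum.cong refl) (simp add: f sum_distrib_left scaleR_sum_right mult.commute)
    also have "\<dots> = (\<Sum>L\<in>Pow {1..\<tau>}. ((\<Sum>S\<in>Pow {1..\<tau>}. psign K S * psign L S) / 2 ^ \<tau>) *\<^sub>R (c0 * (Jprod J L * F L y)))"
      by (subst sum.swap) (simp add: scaleR_sum_left sum_divide_distrib)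
    also have "\<dots> = (\<Sum>L\<in>Pow {1..\<tau>}. (if L = K then c0 * (Jprod J L * F L y) else 0))"
      by (intro sum.cong refl) (use K in \<open>auto simp: psign_orthogonal[OF finite_atLeastAtMost]\<close>)
    also have "\<dots> = c0 * (Jprod J K * F K y)" using K by (simp add: sum.delta)
    also have "\<dots> = F K y" using c0 by (simp add: mult.assoc[symmetric])
    finally show "F K y = (\<Sum>S\<in>Pow {1..\<tau>}. ((psign K S / 2 ^ \<tau>) *\<^sub>R c0) * f (pt v t \<tau> (Jflip J S) y))" by simp
  qed
qed

text \<open>Injectivity of the passage from stem functions to functions; the definite description in
  \<open>lapT\<close> depends on it.\<close>

lemma represents_unique:
  assumes "represents v t \<tau> D f F" "represents v t \<tau> D f F'" "K \<subseteq> {1..\<tau>}" "y \<in> D"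
  shows "F K y = F' K y"
proof -
  obtain J where J: "J \<in> torus v t \<tau>" using torus_nonempty by blast
  obtain c where c: "\<And>f F D y. represents v t \<tau> D f F \<Longrightarrow> y \<in> D \<Longrightarrow>
     F K y = (\<Sum>S\<in>Pow {1..\<tau>}. c S * f (pt v t \<tau> (Jflip J S) y))" using stem_extraction[OF J assms(3)] by blast
  show ?thesis using c[OF assms(1,4)] c[OF assms(2,4)] by simp
qed

lemma v_independent:
  assumes "(\<Sum>s\<le>N. \<gamma> s *\<^sub>R v s) = 0" "s \<le> N" shows "\<gamma> s = 0"
proof -
  have A: "{..N} = {0..N}" by auto
  have "(\<Sum>x\<in>v ` {0..N}. \<gamma> (the_inv_into {0..N} v x) *\<^sub>R x) = (\<Sum>s\<in>{0..N}. \<gamma> s *\<^sub>R v s)"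
    by (subst sum.reindex[OF vinj]) (auto intro!: sum.cong simp: the_inv_into_f_f[OF vinj])
  then have "(\<Sum>x\<in>v ` {0..N}. \<gamma> (the_inv_into {0..N} v x) *\<^sub>R x) = 0" using assms(1) A by simp
  then have "\<gamma> (the_inv_into {0..N} v (v s)) = 0"
    using independentD[OF vindep _ _ _, of "v ` {0..N}" "\<lambda>x. \<gamma> (the_inv_into {0..N} v x)" "v s"] assms(2) by auto
  then show ?thesis using the_inv_into_f_f[OF vinj] assms(2) by simp
qed

definition block :: "nat \<Rightarrow> nat set" where "block h = {t (h - 1) + 1..t h}"

lemma block_disjoint: "h \<in> {1..\<tau>} \<Longrightarrow> k \<in> {1..\<tau>} \<Longrightarrow> s \<in> block h \<Longrightarrow> s \<in> block k \<Longrightarrow> h = k"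
proof (rule ccontr)
  assume a: "h \<in> {1..\<tau>}" "k \<in> {1..\<tau>}" "s \<in> block h" "s \<in> block k" "h \<noteq> k"
  consider "h < k" | "k < h" using a by linarith
  then show False
  proof cases
    case 1
    then have "t h \<le> t (k - 1)" using a by (intro t_mono_le) auto
    then show False using a by (auto simp: block_def)
  next
    case 2
    then have "t k \<le> t (h - 1)" using a by (intro t_mono_le) auto
    then show False using a by (auto simp: block_def)
  qed
qed

lemma blocks_independent:
  assumes eq: "(\<Sum>s\<le>t 0. \<alpha> s *\<^sub>R v s) + (\<Sum>h=1..\<tau>. \<Sum>s\<in>block h. \<gamma> h s *\<^sub>R v s) = 0"
  shows "\<And>s. s \<le> t 0 \<Longrightarrow> \<alpha> s = 0" "\<And>h s. h \<in> {1..\<tau>} \<Longrightarrow> s \<in> block h \<Longrightarrow> \<gamma> h s = 0"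
proof -
  define \<kappa> where "\<kappa> s = (if s \<le> t 0 then \<alpha> s else 0) + (\<Sum>h=1..\<tau>. if s \<in> block h then \<gamma> h s else 0)" for s
  have t0: "t 0 \<le> N" by (rule t_le_N) simp
  have blN: "block h \<subseteq> {..N}" if "h \<in> {1..\<tau>}" for h using t_le_N[of h] that by (auto simp: block_def)
  have "(\<Sum>s\<le>t 0. \<alpha> s *\<^sub>R v s) = (\<Sum>s\<le>N. (if s \<le> t 0 then \<alpha> s else 0) *\<^sub>R v s)"
    by (rule sum.mono_neutral_cong_left) (use t0 in auto)
  moreover have "(\<Sum>h=1..\<tau>. \<Sum>s\<in>block h. \<gamma> h s *\<^sub>R v s) = (\<Sum>s\<le>N. (\<Sum>h=1..\<tau>. if s \<in> block h then \<gamma> h s else 0) *\<^sub>R v s)"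
  proof -
    have "(\<Sum>s\<in>block h. \<gamma> h s *\<^sub>R v s) = (\<Sum>s\<le>N. (if s \<in> block h then \<gamma> h s else 0) *\<^sub>R v s)" if "h \<in> {1..\<tau>}" for h
      by (rule sum.mono_neutral_cong_left) (use blN[OF that] in auto)
    then show ?thesis by (simp add: scaleR_sum_left) (rule sum.swap)
  qed
  ultimately have "(\<Sum>s\<le>N. \<kappa> s *\<^sub>R v s) = 0" using eq by (simp add: \<kappa>_def scaleR_add_left sum.distrib)
  then have \<kappa>: "\<kappa> s = 0" if "s \<le> N" for s using v_independent that by blast
  have nb: "s \<notin> block h" if "s \<le> t 0" "h \<in> {1..\<tau>}" for s h
  proof -
    have "t 0 \<le> t (h - 1)" by (rule t_mono_le) (use that in auto)
    then show ?thesis using that by (auto simp: block_def)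
  qed
  show "\<alpha> s = 0" if s: "s \<le> t 0" for s
  proof -
    have "(\<Sum>h=1..\<tau>. if s \<in> block h then \<gamma> h s else 0) = 0" by (rule sum.neutral) (use nb[OF s] in auto)
    then show ?thesis using \<kappa>[of s] s t0 by (simp add: \<kappa>_def)
  qed
  show "\<gamma> h s = 0" if h: "h \<in> {1..\<tau>}" and s: "s \<in> block h" for h s
  proof -
    have "(\<Sum>k=1..\<tau>. if s \<in> block k then \<gamma> k s else 0) = (\<Sum>k=1..\<tau>. if k = h then \<gamma> k s else 0)"
    proof (rule sum.cong[OF refl])
      fix k assume k: "k \<in> {1..\<tau>}"
      show "(if s \<in> block k then \<gamma> k s else 0) = (if k = h then \<gamma> k s else 0)"
      proof (cases "k = h")
        case False
        then have "s \<notin> block k" using block_disjoint[OF k h _ s] by blast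
        then show ?thesis using False by simp
      qed (use s in simp)
    qed
    also have "\<dots> = \<gamma> h s" using h by (simp add: sum.delta)
    finally have "\<kappa> s = \<gamma> h s" using nb[of s h] h s by (auto simp: \<kappa>_def)
    then show ?thesis using \<kappa>[of s] blN[OF h] s by auto
  qed
qed

lemma pt_eq:
  assumes J: "J \<in> torus v t \<tau>" and J': "J' \<in> torus v t \<tau>" and eq: "pt v t \<tau> J y = pt v t \<tau> J' y'"
  shows "\<And>s. s \<le> t 0 \<Longrightarrow> y s = y' s"
    and "\<And>h. h \<in> {1..\<tau>} \<Longrightarrow> y (t 0 + h) *\<^sub>R J h = y' (t 0 + h) *\<^sub>R J' h"
proof -
  have ex: "\<exists>c. \<forall>h\<in>{1..\<tau>}. J h = (\<Sum>s\<in>block h. c h s *\<^sub>R v s)" if J: "J \<in> torus v t \<tau>" for J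
  proof -
    have "\<forall>h\<in>{1..\<tau>}. \<exists>c. J h = (\<Sum>s\<in>block h. c s *\<^sub>R v s)"
      using torusD[OF J] by (fastforce simp: usph_def block_def)
    then show ?thesis by (rule bchoice)
  qed
  obtain c where c: "\<And>h. h \<in> {1..\<tau>} \<Longrightarrow> J h = (\<Sum>s\<in>block h. c h s *\<^sub>R v s)" using ex[OF J] by blast
  obtain c' where c': "\<And>h. h \<in> {1..\<tau>} \<Longrightarrow> J' h = (\<Sum>s\<in>block h. c' h s *\<^sub>R v s)" using ex[OF J'] by blast
  have yJ: "(\<Sum>h=1..\<tau>. y (t 0 + h) *\<^sub>R J h) = (\<Sum>h=1..\<tau>. \<Sum>s\<in>block h. (y (t 0 + h) * c h s) *\<^sub>R v s)"
    by (intro sum.cong refl) (simp add: c scaleR_sum_right)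
  have yJ': "(\<Sum>h=1..\<tau>. y' (t 0 + h) *\<^sub>R J' h) = (\<Sum>h=1..\<tau>. \<Sum>s\<in>block h. (y' (t 0 + h) * c' h s) *\<^sub>R v s)"
    by (intro sum.cong refl) (simp add: c' scaleR_sum_right)
  have "pt v t \<tau> J y - pt v t \<tau> J' y' = (\<Sum>s\<le>t 0. (y s - y' s) *\<^sub>R v s)
      + (\<Sum>h=1..\<tau>. \<Sum>s\<in>block h. (y (t 0 + h) * c h s - y' (t 0 + h) * c' h s) *\<^sub>R v s)"
    unfolding pt_def yJ yJ' by (simp add: scaleR_diff_left sum_subtractf)
  then have 0: "(\<Sum>s\<le>t 0. (y s - y' s) *\<^sub>R v s)
      + (\<Sum>h=1..\<tau>. \<Sum>s\<in>block h. (y (t 0 + h) * c h s - y' (t 0 + h) * c' h s) *\<^sub>R v s) = 0" using eq by simp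
  show "y s = y' s" if "s \<le> t 0" for s using blocks_independent(1)[OF 0 that] by simp
  show "y (t 0 + h) *\<^sub>R J h = y' (t 0 + h) *\<^sub>R J' h" if h: "h \<in> {1..\<tau>}" for h
    unfolding c[OF h] c'[OF h] scaleR_sum_right
    by (rule sum.cong[OF refl]) (use blocks_independent(2)[OF 0 h] in simp)
qed

definition flipset :: "nat set \<Rightarrow> (nat \<Rightarrow> real) \<Rightarrow> nat \<Rightarrow> real" where
  "flipset S y i = (if i > t 0 \<and> i - t 0 \<in> S then - y i else y i)"

lemma flipset_insert: "h > 0 \<Longrightarrow> h \<notin> S \<Longrightarrow> flipset (insert h S) y = flip t h (flipset S y)"
  by (rule ext) (auto simp: flipset_def flip_def)

lemma flipset_in:
  assumes inv: "\<And>y h. y \<in> D \<Longrightarrow> h \<in> {1..\<tau>} \<Longrightarrow> flip t h y \<in> D" and y: "y \<in> D" and S: "S \<subseteq> {1..\<tau>}"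
  shows "flipset S y \<in> D"
proof -
  have "finite S" using S finite_subset by blast
  then show ?thesis using S
  proof (induction S rule: finite_induct)
    case empty
    have "flipset {} y = y" by (rule ext) (simp add: flipset_def)
    then show ?case using y by simp
  next
    case (insert h S)
    then show ?case using inv[of "flipset S y" h] flipset_insert[of h S y] by auto
  qed
qed

lemma stem_flipset:
  fixes F :: "nat set \<Rightarrow> (nat \<Rightarrow> real) \<Rightarrow> 'a"
  assumes inv: "\<And>y h. y \<in> D \<Longrightarrow> h \<in> {1..\<tau>} \<Longrightarrow> flip t h y \<in> D" and F: "stem t \<tau> D F"
    and K: "K \<subseteq> {1..\<tau>}" and y: "y \<in> D" and S: "S \<subseteq> {1..\<tau>}"
  shows "F K (flipset S y) = psign K S *\<^sub>R F K y"
proof -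
  have "finite S" using S finite_subset by blast
  then show ?thesis using S
  proof (induction S rule: finite_induct)
    case empty
    have "flipset {} y = y" by (rule ext) (simp add: flipset_def)
    then show ?case by (simp add: psign_def)
  next
    case (insert h S)
    have "flipset S y \<in> D" by (rule flipset_in[OF inv y]) (use insert in auto)
    then have "F K (flip t h (flipset S y)) = (if h \<in> K then - F K (flipset S y) else F K (flipset S y))"
      using F K insert.prems unfolding stem_def by auto
    then show ?case using insert flipset_insert[of h S y] by (auto simp: psign_insert)
  qed
qed

text \<open>The spans of different blocks are independent, so equal points have equal vectors
  \<open>y (t 0 + h) *\<^sub>R J h\<close>; squaring them determines the coordinates up to sign.
  Where a coordinate is zero, \<open>J h\<close> remains undetermined, hence the alternative in the
  last conclusion.\<close>

lemma pt_eq_flipset: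
  assumes J: "J \<in> torus v t \<tau>" and J': "J' \<in> torus v t \<tau>" and eq: "pt v t \<tau> J y = pt v t \<tau> J' y'"
    and y: "y \<in> Ecoord nn" "y' \<in> Ecoord nn"
  obtains S where "S \<subseteq> {1..\<tau>}" "y = flipset S y'"
    "\<And>h. h \<in> {1..\<tau>} \<Longrightarrow> y' (t 0 + h) = 0 \<or> J h = Jflip J' S h"
proof -
  define S where "S = {h \<in> {1..\<tau>}. y (t 0 + h) \<noteq> y' (t 0 + h)}"
  have pm: "y (t 0 + h) = y' (t 0 + h) \<or> y (t 0 + h) = - y' (t 0 + h)" if h: "h \<in> {1..\<tau>}" for h
  proof -
    let ?a = "y (t 0 + h)" and ?b = "y' (t 0 + h)"
    have "(?a *\<^sub>R J h) * (?a *\<^sub>R J h) = (?b *\<^sub>R J' h) * (?b *\<^sub>R J' h)" using pt_eq(2)[OF J J' eq h] by simp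
    then have "(?a * ?a) *\<^sub>R (1::'a) = (?b * ?b) *\<^sub>R 1" using torus_square[OF J h] torus_square[OF J' h] by simp
    then have "?a * ?a = ?b * ?b" by simp
    then show ?thesis by (simp add: square_eq_iff)
  qed
  show thesis
  proof (rule that[of S])
    show "S \<subseteq> {1..\<tau>}" by (auto simp: S_def)
    show "y = flipset S y'"
    proof
      fix i
      consider "i \<le> t 0" | "i > t 0" "i - t 0 \<in> {1..\<tau>}" | "i \<ge> nn" by force
      then show "y i = flipset S y' i"
      proof cases
        case 1
        then show ?thesis using pt_eq(1)[OF J J' eq] by (simp add: flipset_def)
      next
        case 2
        then show ?thesis using pm[OF 2(2)] by (auto simp: flipset_def S_def)
      next
        case 3
        then show ?thesis using y by (auto simp: flipset_def S_def Ecoord_def)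
      qed
    qed
    fix h assume h: "h \<in> {1..\<tau>}"
    show "y' (t 0 + h) = 0 \<or> J h = Jflip J' S h"
    proof (cases "y' (t 0 + h) = 0")
      case False
      have e: "y (t 0 + h) *\<^sub>R J h = y' (t 0 + h) *\<^sub>R J' h" by (rule pt_eq(2)[OF J J' eq h])
      show ?thesis
      proof (cases "h \<in> S")
        case True
        then have "y (t 0 + h) = - y' (t 0 + h)" using pm[OF h] by (auto simp: S_def)
        then have "y' (t 0 + h) *\<^sub>R (- J h) = y' (t 0 + h) *\<^sub>R J' h" using e by simp
        then have "- J h = J' h" using False by (simp only: scaleR_cancel_left) simp
        then have "J h = - J' h" by (metis minus_minus)
        then show ?thesis using True by (simp add: Jflip_def)
      next
        case nS: False
        then have "y (t 0 + h) = y' (t 0 + h)" using h by (auto simp: S_def)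
        then show ?thesis using e False nS by (simp add: Jflip_def)
      qed
    qed simp
  qed
qed

end

lemma pderiv_linear_sum:
  assumes D: "opn n D" and u: "\<And>S. S \<in> A \<Longrightarrow> Cinf n D (u S)" and L: "\<And>S. S \<in> A \<Longrightarrow> bounded_linear (L S)"
    and F: "\<And>y. y \<in> D \<Longrightarrow> F y = (\<Sum>S\<in>A. L S (u S y))" and y: "y \<in> D" and i: "i < n"
  shows "pderiv_c i F y = (\<Sum>S\<in>A. L S (pderiv_c i (u S) y))"
proof -
  have "has_pd i (\<lambda>y. \<Sum>S\<in>A. L S (u S y)) (\<Sum>S\<in>A. L S (pderiv_c i (u S) y)) y"
    by (rule has_pd_sum, rule has_pd_linear[OF L Cinf_has_pd[OF u i y]])
  then show ?thesis using pderiv_c_cong[OF D y i, of F "\<lambda>y. \<Sum>S\<in>A. L S (u S y)"] F has_pd_imp_pderiv by metis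
qed

lemma laplacian_linear_sum:
  assumes D: "opn n D" and u: "\<And>S. S \<in> A \<Longrightarrow> Cinf n D (u S)" and L: "\<And>S. S \<in> A \<Longrightarrow> bounded_linear (L S)"
    and F: "\<And>y. y \<in> D \<Longrightarrow> F y = (\<Sum>S\<in>A. L S (u S y))" and y: "y \<in> D"
  shows "(\<Sum>i<n. pderiv_c i (pderiv_c i F) y) = (\<Sum>S\<in>A. L S (\<Sum>i<n. pderiv_c i (pderiv_c i (u S)) y))"
proof -
  have "pderiv_c i (pderiv_c i F) y = (\<Sum>S\<in>A. L S (pderiv_c i (pderiv_c i (u S)) y))" if i: "i < n" for i
    by (rule pderiv_linear_sum[OF D Cinf_pderiv[OF u i] L pderiv_linear_sum[OF D u L F _ i] y i])
  then have "(\<Sum>i<n. pderiv_c i (pderiv_c i F) y) = (\<Sum>S\<in>A. \<Sum>i<n. L S (pderiv_c i (pderiv_c i (u S)) y))"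
    by (simp, subst sum.swap) simp
  also have "\<dots> = (\<Sum>S\<in>A. L S (\<Sum>i<n. pderiv_c i (pderiv_c i (u S)) y))"
    by (rule sum.cong[OF refl]) (simp add: linear_sum[OF bounded_linear.linear[OF L]])
  finally show ?thesis .
qed

text \<open>\<open>\<iota>\<close> embeds the smaller coordinate space up to signs. Coordinates
  outside \<open>C\<close> are zero on its image, so only the multi-indices supported in
  \<open>C\<close> survive in the power series of \<open>G\<close>, and these correspond to the
  multi-indices of the smaller space.\<close>

lemma real_analytic_restrict:
  fixes G :: "(nat \<Rightarrow> real) \<Rightarrow> 'a::real_normed_vector"
  assumes G: "real_analytic_c n' D' G" and D: "opn n D" and C: "C \<subseteq> {..<n'}" and \<kappa>: "bij_betw \<kappa> C {..<n}"
    and \<epsilon>: "\<And>j. \<bar>\<epsilon> j\<bar> = 1"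
    and \<iota>: "\<And>y. \<iota> y = (\<lambda>j. if j \<in> C then \<epsilon> j * y (\<kappa> j) else 0)" and \<iota>D: "\<And>y. y \<in> D \<Longrightarrow> \<iota> y \<in> D'"
  shows "real_analytic_c n D (\<lambda>y. G (\<iota> y))"
proof (rule real_analyticI)
  fix y assume y: "y \<in> D"
  \<comment> \<open>\<open>real_analytic_c\<close> also asks that nearby points lie in
    \<open>D\<close>; a radius for this is read off from the zero function, which is analytic on the
    open set \<open>D\<close>.\<close>
  obtain r0 where r0: "r0 > 0" "\<forall>z\<in>Ecoord n. (\<forall>i<n. \<bar>z i - y i\<bar> < r0) \<longrightarrow> z \<in> D"
    by (rule real_analyticE[OF real_analytic_zero[OF D, where ?'a = real] y])
  obtain r c where rc: "r > 0" "\<forall>z\<in>Ecoord n'. (\<forall>i<n'. \<bar>z i - \<iota> y i\<bar> < r) \<longrightarrow> z \<in> D'"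
    "\<forall>z\<in>Ecoord n'. (\<forall>i<n'. \<bar>z i - \<iota> y i\<bar> < r) \<longrightarrow>
      ((\<lambda>m. (\<Prod>i<n'. (z i - \<iota> y i) ^ m i) *\<^sub>R c m) has_sum G z) {m. \<forall>i\<ge>n'. m i = 0}"
    by (rule real_analyticE[OF G \<iota>D[OF y]])
  define lift :: "(nat \<Rightarrow> nat) \<Rightarrow> nat \<Rightarrow> nat" where "lift m = (\<lambda>j. if j \<in> C then m (\<kappa> j) else 0)" for m
  let ?M = "{m::nat \<Rightarrow> nat. \<forall>i\<ge>n. m i = 0}" and ?M' = "{m::nat \<Rightarrow> nat. \<forall>i\<ge>n'. m i = 0}"
  define d where "d m = (\<Prod>j\<in>C. \<epsilon> j ^ m (\<kappa> j)) *\<^sub>R c (lift m)" for m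
  have fC: "finite C" using C finite_subset by blast
  have \<kappa>lt: "\<kappa> j < n" if "j \<in> C" for j using \<kappa> that by (auto simp: bij_betw_def)
  have inj: "inj_on lift ?M"
  proof (rule inj_onI, rule HOL.ext)
    fix m m' i assume m: "m \<in> ?M" "m' \<in> ?M" and eq: "lift m = lift m'"
    show "m i = m' i"
    proof (cases "i < n")
      case True
      then obtain j where "j \<in> C" "\<kappa> j = i" using \<kappa> by (metis bij_betw_imp_surj_on imageE lessThan_iff)
      then show ?thesis using fun_cong[OF eq, of j] by (simp add: lift_def)
    qed (use m in auto)
  qed
  have img: "m \<in> lift ` ?M" if m: "\<forall>j. j \<notin> C \<longrightarrow> m j = 0" for m
  proof (rule image_eqI[of _ _ "\<lambda>i. if i < n then m (inv_into C \<kappa> i) else 0"])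
    show "m = lift (\<lambda>i. if i < n then m (inv_into C \<kappa> i) else 0)"
      using m \<kappa>lt \<kappa> by (auto simp: lift_def fun_eq_iff inv_into_f_f bij_betw_def)
  qed auto
  have hs: "((\<lambda>m. (\<Prod>i<n. (z i - y i) ^ m i) *\<^sub>R d m) has_sum G (\<iota> z)) ?M"
    if z: "z \<in> Ecoord n" "\<forall>i<n. \<bar>z i - y i\<bar> < min r0 r" for z
  proof -
    have zE: "\<iota> z \<in> Ecoord n'" using C by (auto simp: \<iota> Ecoord_def)
    have "\<bar>\<iota> z i - \<iota> y i\<bar> < r" if "i < n'" for i
    proof (cases "i \<in> C")
      case True
      have "\<iota> z i - \<iota> y i = \<epsilon> i * (z (\<kappa> i) - y (\<kappa> i))" using True by (simp add: \<iota> algebra_simps)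
      then show ?thesis using z(2) \<kappa>lt[OF True] \<epsilon>[of i] by (simp add: abs_mult)
    qed (simp add: \<iota> rc(1))
    then have "((\<lambda>m. (\<Prod>i<n'. (\<iota> z i - \<iota> y i) ^ m i) *\<^sub>R c m) has_sum G (\<iota> z)) ?M'" using rc(3) zE by blast
    moreover have "((\<lambda>m. (\<Prod>i<n'. (\<iota> z i - \<iota> y i) ^ m i) *\<^sub>R c m) has_sum G (\<iota> z)) ?M' \<longleftrightarrow>
       ((\<lambda>m. (\<Prod>i<n'. (\<iota> z i - \<iota> y i) ^ m i) *\<^sub>R c m) has_sum G (\<iota> z)) (lift ` ?M)"
    proof (rule has_sum_cong_neutral)
      fix m assume "m \<in> ?M' - lift ` ?M"
      then obtain j where j: "j \<notin> C" "m j \<noteq> 0" "j < n'" using img[of m] not_le by blast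
      then have "(\<iota> z j - \<iota> y j) ^ m j = 0" by (simp add: \<iota>)
      then have "(\<Prod>i<n'. (\<iota> z i - \<iota> y i) ^ m i) = 0" using j(3) by (intro prod_zero) auto
      then show "(\<Prod>i<n'. (\<iota> z i - \<iota> y i) ^ m i) *\<^sub>R c m = 0" by simp
    next
      fix m assume m: "m \<in> lift ` ?M - ?M'"
      have "m \<in> ?M'" using m C by (auto simp: lift_def)
      then show "(\<Prod>i<n'. (\<iota> z i - \<iota> y i) ^ m i) *\<^sub>R c m = 0" using m by simp
    qed simp
    ultimately have "(((\<lambda>m. (\<Prod>i<n'. (\<iota> z i - \<iota> y i) ^ m i) *\<^sub>R c m) \<circ> lift) has_sum G (\<iota> z)) ?M"
      by (simp only: has_sum_reindex[OF inj])
    moreover have "((\<lambda>m. (\<Prod>i<n'. (\<iota> z i - \<iota> y i) ^ m i) *\<^sub>R c m) \<circ> lift) = (\<lambda>m. (\<Prod>i<n. (z i - y i) ^ m i) *\<^sub>R d m)"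
    proof (rule HOL.ext)
      fix m
      have "(\<Prod>i<n'. (\<iota> z i - \<iota> y i) ^ lift m i) = (\<Prod>j\<in>C. (\<epsilon> j * (z (\<kappa> j) - y (\<kappa> j))) ^ m (\<kappa> j))"
        by (rule prod.mono_neutral_cong_right) (use C in \<open>auto simp: lift_def \<iota> right_diff_distrib\<close>)
      also have "\<dots> = (\<Prod>j\<in>C. \<epsilon> j ^ m (\<kappa> j)) * (\<Prod>j\<in>C. (z (\<kappa> j) - y (\<kappa> j)) ^ m (\<kappa> j))"
        by (simp add: power_mult_distrib prod.distrib)
      also have "(\<Prod>j\<in>C. (z (\<kappa> j) - y (\<kappa> j)) ^ m (\<kappa> j)) = (\<Prod>i<n. (z i - y i) ^ m i)"
        by (rule prod.reindex_bij_betw[OF \<kappa>])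
      finally show "((\<lambda>m. (\<Prod>i<n'. (\<iota> z i - \<iota> y i) ^ m i) *\<^sub>R c m) \<circ> lift) m = (\<Prod>i<n. (z i - y i) ^ m i) *\<^sub>R d m"
        by (simp add: d_def mult.commute)
    qed
    ultimately show ?thesis by (simp only:)
  qed
  show "\<exists>r c. r > 0 \<and> (\<forall>z\<in>Ecoord n. (\<forall>i<n. \<bar>z i - y i\<bar> < r) \<longrightarrow> z \<in> D) \<and>
     (\<forall>z\<in>Ecoord n. (\<forall>i<n. \<bar>z i - y i\<bar> < r) \<longrightarrow>
       ((\<lambda>m. (\<Prod>i<n. (z i - y i) ^ m i) *\<^sub>R c m) has_sum G (\<iota> z)) {m. \<forall>i\<ge>n. m i = 0})"
    by (rule exI[of _ "min r0 r"], rule exI[of _ d]) (use r0 rc(1) hs in simp)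
qed

section \<open>Slices, well-definedness and the Laplacian of stem functions\<close>

context hyper_steps begin

lemma sum_esys:
  "(\<Sum>i<nn. esys J i * \<phi> i) = (\<Sum>s\<le>t 0. v s * \<phi> s) + (\<Sum>u=1..\<tau>. J u * \<phi> (t 0 + u))"
proof -
  have "{..<nn} = {..t 0} \<union> (\<lambda>u. t 0 + u) ` {1..\<tau>}"
  proof (intro equalityI subsetI)
    fix i assume "i \<in> {..<nn}"
    then show "i \<in> {..t 0} \<union> (\<lambda>u. t 0 + u) ` {1..\<tau>}"
      by (cases "i \<le> t 0") (auto intro: image_eqI[of _ _ "i - t 0"])
  qed auto
  then have "(\<Sum>i<nn. esys J i * \<phi> i) = (\<Sum>i\<le>t 0. esys J i * \<phi> i) + (\<Sum>i\<in>(\<lambda>u. t 0 + u) ` {1..\<tau>}. esys J i * \<phi> i)"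
    by (simp only:) (rule sum.union_disjoint, auto)
  also have "(\<Sum>i\<in>(\<lambda>u. t 0 + u) ` {1..\<tau>}. esys J i * \<phi> i) = (\<Sum>u=1..\<tau>. J u * \<phi> (t 0 + u))"
    by (subst sum.reindex) (auto simp: esys_def)
  also have "(\<Sum>i\<le>t 0. esys J i * \<phi> i) = (\<Sum>s\<le>t 0. v s * \<phi> s)" by (simp add: esys_def)
  finally show ?thesis .
qed

context
  fixes D
  assumes D: "opn nn D" and Dinv: "\<And>y h. y \<in> D \<Longrightarrow> h \<in> {1..\<tau>} \<Longrightarrow> flip t h y \<in> D"
begin

text \<open>A point of the slice may come from another torus element; the two descriptions then
  differ by sign changes, under which \<open>D\<close> is invariant.\<close>

lemma slice_domain:
  assumes J: "J \<in> torus v t \<tau>" shows "{c \<in> Ecoord nn. pt v t \<tau> J c \<in> Omega v t \<tau> D} = D"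
proof (intro equalityI subsetI)
  fix y assume "y \<in> {c \<in> Ecoord nn. pt v t \<tau> J c \<in> Omega v t \<tau> D}"
  then obtain J' y' where y: "y \<in> Ecoord nn" and y': "y' \<in> D" and J': "J' \<in> torus v t \<tau>"
    and eq: "pt v t \<tau> J y = pt v t \<tau> J' y'" by (auto simp: Omega_def)
  obtain S where "S \<subseteq> {1..\<tau>}" "y = flipset S y'"
    using pt_eq_flipset[OF J J' eq y opn_imp_Ecoord[OF D y']] by blast
  then show "y \<in> D" using flipset_in[OF Dinv y'] by simp
qed (use J opn_imp_Ecoord[OF D] in \<open>auto simp: Omega_def\<close>)

lemma Tregular_iff_cregular:
  "Tregular v t \<tau> (Omega v t \<tau> D) f \<longleftrightarrow> (\<forall>J\<in>torus v t \<tau>. cregular nn (esys J) D (\<lambda>y. f (pt v t \<tau> J y)))"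
  unfolding Tregular_def cregular_def sum_esys comp_def
  by (rule ball_cong[OF refl]) (simp only: slice_domain)

text \<open>Two descriptions of a point differ by a sign change \<open>S\<close>. Both
  \<open>F K\<close> and \<open>Jprod J K\<close> pick up \<open>psign K S\<close>, so the signs
  cancel. If a coordinate with index in \<open>K\<close> is zero, \<open>F K\<close> vanishes by
  oddness, and the undetermined \<open>J h\<close> does no harm.\<close>

lemma represents_exists:
  fixes F :: "nat set \<Rightarrow> (nat \<Rightarrow> real) \<Rightarrow> 'a"
  assumes F: "stem t \<tau> D F"
  obtains g where "represents v t \<tau> D g F" "\<And>x. x \<notin> Omega v t \<tau> D \<Longrightarrow> g x = 0"
proof -
  have wd: "(\<Sum>K\<in>Pow {1..\<tau>}. Jprod J K * F K y) = (\<Sum>K\<in>Pow {1..\<tau>}. Jprod J' K * F K y')"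
    if J: "J \<in> torus v t \<tau>" and J': "J' \<in> torus v t \<tau>" and y: "y \<in> D" "y' \<in> D"
      and eq: "pt v t \<tau> J y = pt v t \<tau> J' y'" for J J' y y'
  proof (rule sum.cong[OF refl])
    fix K assume "K \<in> Pow {1..\<tau>}"
    then have K: "K \<subseteq> {1..\<tau>}" by simp
    have fK: "finite K" using K finite_subset by blast
    obtain S where S: "S \<subseteq> {1..\<tau>}" "y = flipset S y'"
      "\<And>h. h \<in> {1..\<tau>} \<Longrightarrow> y' (t 0 + h) = 0 \<or> J h = Jflip J' S h"
      using pt_eq_flipset[OF J J' eq] opn_imp_Ecoord[OF D] y by blast
    have fS: "finite S" using S(1) finite_subset by blast
    have FK: "F K y = psign K S *\<^sub>R F K y'" unfolding S(2) by (rule stem_flipset[OF Dinv F K y(2) S(1)])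
    show "Jprod J K * F K y = Jprod J' K * F K y'"
    proof (cases "\<exists>h\<in>K. y' (t 0 + h) = 0")
      case True
      then obtain h where h: "h \<in> K" "y' (t 0 + h) = 0" by blast
      have "h \<in> {1..\<tau>}" using h K by blast
      then have "F K (flip t h y') = - F K y'" using F K h y(2) unfolding stem_def by simp
      moreover have "flip t h y' = y'" using h by (auto simp: flip_def fun_eq_iff)
      ultimately have "2 *\<^sub>R F K y' = 0" by (metis add.right_inverse scaleR_2)
      then show ?thesis by (simp add: FK)
    next
      case False
      then have "Jprod J K = Jprod (Jflip J' S) K" by (intro Jprod_cong[OF fK]) (use S(3) K in blast)
      also have "\<dots> = psign K S *\<^sub>R Jprod J' K" by (rule Jprod_Jflip[OF fK fS])
      finally show ?thesis by (simp add: FK psign_square)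
    qed
  qed
  define P where "P x q \<longleftrightarrow> snd q \<in> D \<and> fst q \<in> torus v t \<tau> \<and> x = pt v t \<tau> (fst q) (snd q)" for x q
  define g where "g x = (if x \<in> Omega v t \<tau> D then \<Sum>K\<in>Pow {1..\<tau>}. Jprod (fst (Eps (P x))) K * F K (snd (Eps (P x))) else 0)" for x
  show thesis
  proof (rule that)
    show "represents v t \<tau> D g F" unfolding represents_def
    proof (intro ballI)
      fix y J assume y: "y \<in> D" and J: "J \<in> torus v t \<tau>"
      let ?x = "pt v t \<tau> J y"
      have "P ?x (J, y)" using y J by (simp add: P_def)
      then have "P ?x (Eps (P ?x))" by (rule someI)
      then have "(\<Sum>K\<in>Pow {1..\<tau>}. Jprod (fst (Eps (P ?x))) K * F K (snd (Eps (P ?x)))) = (\<Sum>K\<in>Pow {1..\<tau>}. Jprod J K * F K y)"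
        unfolding P_def by (intro wd) (use y J in auto)
      moreover have "?x \<in> Omega v t \<tau> D" using y J by (auto simp: Omega_def)
      ultimately show "g ?x = (\<Sum>K\<in>Pow {1..\<tau>}. Jprod J K * F K y)" by (simp add: g_def)
    qed
  qed (simp add: g_def)
qed

text \<open>By \<open>stem_extraction\<close> a component is a fixed combination of restrictions of
  \<open>f\<close> to slices. Each restriction is regular for a Clifford system of its own, but
  analyticity and harmonicity do not refer to the system and survive the combination.\<close>

lemma SR_stem:
  assumes f: "SR v t \<tau> D f" and F: "represents v t \<tau> D f F" and K: "K \<subseteq> {1..\<tau>}"
  shows "Cinf nn D (F K)" "real_analytic_c nn D (F K)"
    "\<And>y. y \<in> D \<Longrightarrow> (\<Sum>i<nn. pderiv_c i (pderiv_c i (F K)) y) = 0"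
proof -
  obtain J where J: "J \<in> torus v t \<tau>" using torus_nonempty by blast
  obtain c where c: "\<And>f F D y. represents v t \<tau> D f F \<Longrightarrow> y \<in> D \<Longrightarrow>
     F K y = (\<Sum>S\<in>Pow {1..\<tau>}. c S * f (pt v t \<tau> (Jflip J S) y))" using stem_extraction[OF J K] by blast
  define u where "u S y = f (pt v t \<tau> (Jflip J S) y)" for S y
  have cl: "clifford_sys nn (esys (Jflip J S))" for S by (rule clifford_esys[OF torus_Jflip[OF J]])
  have reg: "cregular nn (esys (Jflip J S)) D (u S)" for S
    using f torus_Jflip[OF J] unfolding SR_def Tregular_iff_cregular u_def by blast
  have u: "Cinf nn D (u S)" "real_analytic_c nn D (u S)" for S by (rule cregular_imp_analytic[OF cl D reg])+
  have Fu: "F K y = (\<Sum>S\<in>Pow {1..\<tau>}. c S * u S y)" if "y \<in> D" for y using c[OF F that] by (simp add: u_def)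
  have L: "bounded_linear (\<lambda>x. c S * x)" for S by (rule bounded_linear_mult_left_fin)
  have "Cinf nn D (\<lambda>y. \<Sum>S\<in>Pow {1..\<tau>}. c S * u S y)" by (rule Cinf_sum[OF D], rule Cinf_linear[OF D L u(1)])
  then show "Cinf nn D (F K)" by (rule Cinf_cong[OF D, rotated]) (simp add: Fu)
  have "real_analytic_c nn D (\<lambda>y. \<Sum>S\<in>Pow {1..\<tau>}. c S * u S y)"
    by (rule real_analytic_sum[OF D]) (simp, rule real_analytic_linear[OF L u(2)])
  then show "real_analytic_c nn D (F K)" by (rule real_analytic_cong) (simp add: Fu)
  fix y assume y: "y \<in> D"
  have "(\<Sum>i<nn. pderiv_c i (pderiv_c i (F K)) y) = (\<Sum>S\<in>Pow {1..\<tau>}. c S * (\<Sum>i<nn. pderiv_c i (pderiv_c i (u S)) y))"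
    by (rule laplacian_linear_sum[OF D u(1) L Fu y])
  also have "\<dots> = 0" by (rule sum.neutral) (simp only: cregular_harmonic[OF cl D reg y], simp)
  finally show "(\<Sum>i<nn. pderiv_c i (pderiv_c i (F K)) y) = 0" .
qed

lemma represents_cong:
  assumes "represents v t \<tau> D f F" "\<And>K y. K \<subseteq> {1..\<tau>} \<Longrightarrow> y \<in> D \<Longrightarrow> F K y = F' K y"
  shows "represents v t \<tau> D f F'"
  unfolding represents_def
proof (intro ballI)
  fix y J assume y: "y \<in> D" and J: "J \<in> torus v t \<tau>"
  have "(\<Sum>K\<in>Pow {1..\<tau>}. Jprod J K * F K y) = (\<Sum>K\<in>Pow {1..\<tau>}. Jprod J K * F' K y)"
    by (rule sum.cong[OF refl]) (use assms(2)[OF _ y] in auto)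
  then show "f (pt v t \<tau> J y) = (\<Sum>K\<in>Pow {1..\<tau>}. Jprod J K * F' K y)"
    using assms(1) y J by (simp add: represents_def)
qed

text \<open>Evaluates the definite description: \<open>represents_exists\<close> provides a function
  that fits, \<open>represents_unique\<close> excludes any other. \<open>H\<close> has to agree with
  the Laplacian only on \<open>D\<close>, which allows closed formulas.\<close>

lemma lapT_represents:
  fixes G H :: "nat set \<Rightarrow> (nat \<Rightarrow> real) \<Rightarrow> 'a"
  assumes G: "stem t \<tau> D G" "\<And>K. K \<subseteq> {1..\<tau>} \<Longrightarrow> Cinf nn D (G K)" "represents v t \<tau> D f G"
    and H: "stem t \<tau> D H" "\<And>K y. K \<subseteq> {1..\<tau>} \<Longrightarrow> y \<in> D \<Longrightarrow> H K y = (\<Sum>i<nn. pderiv_c i (pderiv_c i (G K)) y)"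
  shows "represents v t \<tau> D (lapT v t \<tau> D f) H"
proof -
  obtain g where g: "represents v t \<tau> D g H" "\<And>x. x \<notin> Omega v t \<tau> D \<Longrightarrow> g x = 0"
    using represents_exists[OF H(1)] by blast
  have "lapT v t \<tau> D f = g" unfolding lapT_def
  proof (rule the_equality)
    have "represents v t \<tau> D g (lap_stem nn G)"
      by (rule represents_cong[OF g(1)]) (simp add: H(2) lap_stem_def)
    then show "(\<forall>x. x \<notin> Omega v t \<tau> D \<longrightarrow> g x = 0) \<and>
        (\<exists>G. stem t \<tau> D G \<and> (\<forall>K. K \<subseteq> {1..\<tau>} \<longrightarrow> Cinf nn D (G K)) \<and>
             represents v t \<tau> D f G \<and> represents v t \<tau> D g (lap_stem nn G))"
      using g(2) G by blast
    fix g' assume g': "(\<forall>x. x \<notin> Omega v t \<tau> D \<longrightarrow> g' x = 0) \<and>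
        (\<exists>G. stem t \<tau> D G \<and> (\<forall>K. K \<subseteq> {1..\<tau>} \<longrightarrow> Cinf nn D (G K)) \<and>
             represents v t \<tau> D f G \<and> represents v t \<tau> D g' (lap_stem nn G))"
    then obtain G' where G': "represents v t \<tau> D f G'" "represents v t \<tau> D g' (lap_stem nn G')" by blast
    have GG: "G' K z = G K z" if "K \<subseteq> {1..\<tau>}" "z \<in> D" for K z by (rule represents_unique[OF G'(1) G(3) that])
    have d1: "pderiv_c i (G' K) z = pderiv_c i (G K) z" if "K \<subseteq> {1..\<tau>}" "z \<in> D" "i < nn" for K z i
      by (rule pderiv_c_cong[OF D that(2,3)]) (rule GG[OF that(1)])
    have d2: "pderiv_c i (pderiv_c i (G' K)) z = pderiv_c i (pderiv_c i (G K)) z" if "K \<subseteq> {1..\<tau>}" "z \<in> D" "i < nn" for K z i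
      by (rule pderiv_c_cong[OF D that(2,3)]) (rule d1[OF that(1) _ that(3)])
    have H': "represents v t \<tau> D g' H"
      by (rule represents_cong[OF G'(2)]) (simp add: H(2) lap_stem_def d2)
    show "g' = g"
    proof
      fix x show "g' x = g x"
      proof (cases "x \<in> Omega v t \<tau> D")
        case True
        then obtain J y where "x = pt v t \<tau> J y" "y \<in> D" "J \<in> torus v t \<tau>" by (auto simp: Omega_def)
        then show ?thesis using H' g(1) by (simp add: represents_def)
      qed (use g' g(2) in simp)
    qed
  qed
  then show ?thesis using g(1) by simp
qed

end

end

section \<open>The first Fueter transform\<close>

context reflected begin

lemma Dv_reflect:
  fixes h :: "(nat \<Rightarrow> real) \<Rightarrow> 'a::banach"
  assumes h: "Cinf n D h" and sym: "\<And>y. y \<in> D \<Longrightarrow> h (rf q y) = \<sigma> *\<^sub>R h y" and q: "q \<noteq> p" and y: "y \<in> D"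
  shows "Dv p h (rf q y) = \<sigma> *\<^sub>R Dv p h y"
proof -
  have "(rf q y) p = y p" using q by (simp add: rf_def)
  then show ?thesis using pderiv_c_reflect[OF D h sym y p] sym[OF y] q by (auto simp: Dv_def)
qed

lemma Lop_funpow_reflect:
  fixes u :: "(nat \<Rightarrow> real) \<Rightarrow> 'a::banach"
  assumes u: "Ev u" and sym: "\<And>y. y \<in> D \<Longrightarrow> u (rf q y) = \<sigma> *\<^sub>R u y" and q: "q \<noteq> p" and y: "y \<in> D"
  shows "(Lop p ^^ k) u (rf q y) = \<sigma> *\<^sub>R (Lop p ^^ k) u y"
  using y
proof (induction k arbitrary: y)
  case (Suc k)
  let ?u = "(Lop p ^^ k) u"
  have C: "Cinf n D ?u" using Ev_Lop_funpow[OF u] by (simp add: Ev_def)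
  have "pderiv_c p ?u (rf q z) = \<sigma> *\<^sub>R pderiv_c p ?u z" if "z \<in> D" for z
    using pderiv_c_reflect[OF D C Suc.IH that p] q by simp
  then show ?case using Dv_reflect[OF Cinf_pderiv[OF C p] _ q Suc.prems, of \<sigma>]
    by (simp add: Lop_def[of p "(Lop p ^^ k) u"])
qed (use sym in simp)

end

lemma sum_Pow_split_first:
  assumes "1 \<le> (\<tau>::nat)"
  shows "(\<Sum>L\<in>Pow {1..\<tau>}. \<phi> L) = (\<Sum>K\<in>Pow {1..\<tau> - 1}. \<phi> (Suc ` K) + \<phi> (insert 1 (Suc ` K)))"
proof -
  let ?A = "Suc ` {1..\<tau> - 1}"
  have A: "{1..\<tau>} = insert 1 ?A" using assms by (auto simp: image_Suc_atLeastAtMost)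
  have P: "Pow ?A = image Suc ` Pow {1..\<tau> - 1}" by (rule image_Pow_surj[OF refl, symmetric])
  have fin: "finite (Pow ?A)" by simp
  have n1: "1 \<notin> L" if "L \<in> Pow ?A" for L using that by auto
  have "(\<Sum>L\<in>Pow {1..\<tau>}. \<phi> L) = (\<Sum>L\<in>Pow ?A. \<phi> L) + (\<Sum>L\<in>insert 1 ` Pow ?A. \<phi> L)"
    unfolding A Pow_insert by (rule sum.union_disjoint) (use n1 in auto)
  also have "(\<Sum>L\<in>insert 1 ` Pow ?A. \<phi> L) = (\<Sum>L\<in>Pow ?A. \<phi> (insert 1 L))"
  proof (subst sum.reindex)
    show "inj_on (insert 1) (Pow ?A)" by (rule inj_onI) (metis n1 insert_ident)
  qed simp
  also have "(\<Sum>L\<in>Pow ?A. \<phi> L) + (\<Sum>L\<in>Pow ?A. \<phi> (insert 1 L)) = (\<Sum>L\<in>Pow ?A. \<phi> L + \<phi> (insert 1 L))"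
    by (rule sum.distrib[symmetric])
  also have "\<dots> = (\<Sum>K\<in>Pow {1..\<tau> - 1}. \<phi> (Suc ` K) + \<phi> (insert 1 (Suc ` K)))"
    unfolding P by (subst sum.reindex) (auto simp: inj_on_def)
  finally show ?thesis .
qed

text \<open>Coordinate \<open>t 0 + 1\<close> of \<open>D\<close> is the first of the
  \<open>\<beta>\<close> variables, hence the value of \<open>p\<close>; the block from
  \<open>p\<close> to \<open>t1\<close> then consists of the basis indices of the first
  sphere.\<close>

locale fueter_step = pulled_alg n p D t1 \<tau> n' v + hyper_steps v N t \<tau>
  for n p D t1 \<tau> n' and v :: "nat \<Rightarrow> 'a::{real_algebra_1,euclidean_space}" and N t +
  assumes p_t0: "p = Suc (t 0)" and t1_t: "t1 = t 1"
    and Dinv: "\<And>y h. y \<in> D \<Longrightarrow> h \<in> {1..\<tau>} \<Longrightarrow> flip t h y \<in> D"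
begin

lemma nn: "t 0 + 1 + \<tau> = n" using n p_t0 by simp

lemma nn': "tshift t 0 + 1 + (\<tau> - 1) = n'" using n' t1_t tau by (simp add: tshift_def)

sublocale T': hyper_steps v N "tshift t" "\<tau> - 1"
proof
  have "strict_mono_on {0..\<tau> - 1} (tshift t)"
    using t_mono tau by (auto simp: strict_mono_on_def tshift_def)
  then show "steps (tshift t) (\<tau> - 1) N" using steps tau by (auto simp: steps_def tshift_def)
qed

lemma opn_nn: "opn (t 0 + 1 + \<tau>) D" using D nn by simp

lemma opn_nn': "opn (tshift t 0 + 1 + (\<tau> - 1)) D'" using opn_D' nn' by simp

lemma flip_rf: "flip t (Suc h) y = rf (p + h) y" by (simp add: flip_def rf_def p_t0)

lemma flip'_rf: "flip (tshift t) h y = rf (t1 + h) y" by (simp add: flip_def rf_def tshift_def t1_t)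

lemma rho_flip':
  assumes h: "h \<in> {1..\<tau> - 1}" shows "rho (rf (t1 + h) y) = rf (p + h) (rho y)"
proof -
  have i: "t1 + h < n'" "t1 + h \<notin> Bl" using h tau by (auto simp: n'_iff)
  have "kap (t1 + h) = p + h" using pt1 by (simp add: kap_def)
  then show ?thesis using rho_upd_other[OF i, of y] rho_kap[OF i, of y] by (simp add: rf_def)
qed

lemma rf_D: "h \<in> {1..\<tau> - 1} \<Longrightarrow> y \<in> D \<Longrightarrow> rf (p + h) y \<in> D"
  using Dinv[of y "Suc h"] tau by (auto simp: flip_rf)

lemma D'inv:
  assumes "y \<in> D'" "h \<in> {1..\<tau> - 1}" shows "flip (tshift t) h y \<in> D'"
proof -
  have "rf (t1 + h) y \<in> Ecoord n'" using assms by (auto simp: D'_def Ecoord_def rf_def)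
  then show ?thesis using rho_flip'[OF assms(2)] rf_D[OF assms(2) rho_D[OF assms(1)]] by (simp add: flip'_rf D'_def)
qed

text \<open>Torus elements vanish outside their index range, so index \<open>0\<close> is reset; a
  plain shift would place \<open>J 1\<close> there.\<close>

definition Jtl :: "(nat \<Rightarrow> 'a) \<Rightarrow> nat \<Rightarrow> 'a" where "Jtl J h = (if h = 0 then 0 else J (Suc h))"

lemma Jtl_torus: "J \<in> torus v t \<tau> \<Longrightarrow> Jtl J \<in> torus v (tshift t) (\<tau> - 1)"
proof -
  assume J: "J \<in> torus v t \<tau>"
  have "Jtl J h \<in> usph v (tshift t (h - 1) + 1) (tshift t h)" if "h \<in> {1..\<tau> - 1}" for h
    using torusD[OF J, of "Suc h"] that by (cases h) (auto simp: Jtl_def tshift_def)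
  moreover have "Jtl J h = 0" if "h \<notin> {1..\<tau> - 1}" for h
    using J that by (auto simp: Jtl_def torus_def)
  ultimately show ?thesis unfolding torus_def by blast
qed

lemma torus_cons:
  assumes J': "J' \<in> torus v (tshift t) (\<tau> - 1)" and u: "u \<in> usph v p t1"
  obtains J where "J \<in> torus v t \<tau>" "J 1 = u" "Jtl J = J'"
proof (rule that[of "\<lambda>h. if h = 1 then u else J' (h - 1)"])
  let ?J = "\<lambda>h. if h = 1 then u else J' (h - 1)"
  have J'0: "J' h = 0" if "h \<notin> {1..\<tau> - 1}" for h using J' that by (simp add: torus_def)
  have "?J h \<in> usph v (t (h - 1) + 1) (t h)" if h: "h \<in> {1..\<tau>}" for h
  proof (cases "h = 1")
    case True
    then show ?thesis using u by (simp add: p_t0 t1_t)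
  next
    case False
    then have "J' (h - 1) \<in> usph v (tshift t (h - 1 - 1) + 1) (tshift t (h - 1))" using h by (intro T'.torusD[OF J']) auto
    moreover have "Suc (h - 1 - 1) = h - 1" "Suc (h - 1) = h" using h False by auto
    ultimately show ?thesis using False by (simp only: tshift_def if_False)
  qed
  moreover have "?J h = 0" if "h \<notin> {1..\<tau>}" for h
  proof -
    have "h \<noteq> 1" "h - 1 \<notin> {1..\<tau> - 1}" using that tau by auto
    then show ?thesis using J'0 by simp
  qed
  ultimately show "?J \<in> torus v t \<tau>" unfolding torus_def by blast
  show "Jtl ?J = J'"
  proof (rule HOL.ext)
    fix h show "Jtl ?J h = J' h" using J'0[of 0] by (cases h) (simp_all add: Jtl_def)
  qed
qed simp

text \<open>A \<open>T\<close>-stem function has components \<open>A K\<close> at the index set \<open>Suc ` K\<close> and, being odd in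
  the first \<open>\<beta>\<close>-variable, \<open>y p *\<^sub>R B K\<close> at \<open>insert 1 (Suc ` K)\<close>; the same function has the stem components
  \<open>ext ((- 1) ^ card K) (A K) (B K)\<close> for the shifted list of steps.\<close>

definition join :: "(nat set \<Rightarrow> (nat \<Rightarrow> real) \<Rightarrow> 'a) \<Rightarrow> (nat set \<Rightarrow> (nat \<Rightarrow> real) \<Rightarrow> 'a) \<Rightarrow> nat set \<Rightarrow> (nat \<Rightarrow> real) \<Rightarrow> 'a" where
  "join A B L y = (if 1 \<in> L then y p *\<^sub>R B {h. 1 \<le> h \<and> Suc h \<in> L} y else A {h. 1 \<le> h \<and> Suc h \<in> L} y)"

lemma join_simps:
  assumes "K \<subseteq> {1..\<tau> - 1}"
  shows "join A B (Suc ` K) y = A K y" "join A B (insert 1 (Suc ` K)) y = y p *\<^sub>R B K y"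
proof -
  have 1: "{h. 1 \<le> h \<and> Suc h \<in> Suc ` K} = K" "{h. 1 \<le> h \<and> Suc h \<in> insert 1 (Suc ` K)} = K" using assms by auto
  have "1 \<notin> Suc ` K" using assms by auto
  then show "join A B (Suc ` K) y = A K y" "join A B (insert 1 (Suc ` K)) y = y p *\<^sub>R B K y"
    unfolding join_def 1 by simp_all
qed

text \<open>Since \<open>1\<close> is the least index, \<open>J 1\<close> is the leftmost factor of
  each product that contains it and can be taken out of the sum.\<close>

lemma join_sum:
  "(\<Sum>L\<in>Pow {1..\<tau>}. Jprod J L * join A B L y) = (\<Sum>K\<in>Pow {1..\<tau> - 1}. Jprod (Jtl J) K * A K y)
     + J 1 * (y p *\<^sub>R (\<Sum>K\<in>Pow {1..\<tau> - 1}. Jprod (Jtl J) K * B K y))"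
proof -
  have eq: "Jprod J (Suc ` K) * join A B (Suc ` K) y + Jprod J (insert 1 (Suc ` K)) * join A B (insert 1 (Suc ` K)) y
     = Jprod (Jtl J) K * A K y + J 1 * (y p *\<^sub>R (Jprod (Jtl J) K * B K y))" if "K \<in> Pow {1..\<tau> - 1}" for K
  proof -
    have K: "K \<subseteq> {1..\<tau> - 1}" using that by simp
    have fK: "finite K" using K finite_subset by blast
    have 1: "Jprod J (Suc ` K) = Jprod (Jtl J) K"
      unfolding Jprod_Suc[OF fK] by (rule Jprod_cong[OF fK]) (use K in \<open>auto simp: Jtl_def\<close>)
    have 2: "Jprod J (insert 1 (Suc ` K)) = J 1 * Jprod J (Suc ` K)"
      by (rule Jprod_insert_min) (use K fK in auto)
    show ?thesis unfolding join_simps[OF K] 2 1 by (simp add: mult.assoc)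
  qed
  show ?thesis
    unfolding sum_Pow_split_first[OF tau] scaleR_sum_right sum_distrib_left sum.distrib[symmetric]
    by (rule sum.cong[OF refl], rule eq)
qed

lemma X_torus_anticommute:
  assumes J': "J' \<in> torus v (tshift t) (\<tau> - 1)" and h: "h \<in> {1..\<tau> - 1}"
  shows "X y * J' h = - (J' h * X y)"
proof -
  have "v s * J' h = - (J' h * v s)" if s: "s \<in> Bl" for s
  proof (rule T'.torus_anticommute_v[OF J' h])
    have "t 1 \<le> t h" by (rule t_mono_le) (use h in auto)
    then show "s \<le> tshift t (h - 1)" using s h by (simp add: t1_t tshift_def)
  qed (use s p_t0 in auto)
  then show ?thesis by (simp add: X_def sum_distrib_left sum_distrib_right sum_negf)
qed

text \<open>\<open>X y\<close> anticommutes with each \<open>J' h\<close>, so moving it to the left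
  past \<open>Jprod J' K\<close> costs \<open>(- 1) ^ card K\<close>. The sign in \<open>ext\<close>
  compensates, and one may sum over \<open>K\<close> before extending.\<close>

lemma ext_sum:
  assumes J': "J' \<in> torus v (tshift t) (\<tau> - 1)"
  shows "(\<Sum>K\<in>Pow {1..\<tau> - 1}. Jprod J' K * ext ((- 1) ^ card K) (A K) (B K) y)
     = ext 1 (\<lambda>y. \<Sum>K\<in>Pow {1..\<tau> - 1}. Jprod J' K * A K y) (\<lambda>y. \<Sum>K\<in>Pow {1..\<tau> - 1}. Jprod J' K * B K y) y"
proof -
  have "Jprod J' K * ext ((- 1) ^ card K) (A K) (B K) y = Jprod J' K * A K (rho y) + X y * (Jprod J' K * B K (rho y))"
    if "K \<in> Pow {1..\<tau> - 1}" for K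
  proof -
    have K: "K \<subseteq> {1..\<tau> - 1}" using that by simp
    have fK: "finite K" using K finite_subset by blast
    have "X y * Jprod J' K = (- 1) ^ card K *\<^sub>R (Jprod J' K * X y)"
      by (rule Jprod_commute[OF fK]) (use X_torus_anticommute[OF J'] K in blast)
    then show ?thesis by (simp add: ext_def distrib_left mult.assoc[symmetric])
  qed
  then show ?thesis by (simp add: ext_def sum.distrib sum_distrib_left)
qed

lemma pt_split:
  "pt v t \<tau> J y = (\<Sum>s<p. y s *\<^sub>R v s) + y p *\<^sub>R J 1 + (\<Sum>h=1..\<tau> - 1. y (p + h) *\<^sub>R Jtl J h)"
proof -
  have "(\<Sum>h=1..\<tau>. y (t 0 + h) *\<^sub>R J h) = y (t 0 + 1) *\<^sub>R J 1 + (\<Sum>h=2..\<tau>. y (t 0 + h) *\<^sub>R J h)"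
    using tau by (subst sum.atLeast_Suc_atMost) (auto simp: numeral_2_eq_2)
  also have "(\<Sum>h=2..\<tau>. y (t 0 + h) *\<^sub>R J h) = (\<Sum>h=1..\<tau> - 1. y (p + h) *\<^sub>R Jtl J h)"
    by (rule sum.reindex_bij_witness[of _ Suc "\<lambda>h. h - 1"]) (auto simp: Jtl_def p_t0)
  finally show ?thesis by (simp add: pt_def p_t0 lessThan_Suc_atMost)
qed

lemma pt'_split:
  "pt v (tshift t) (\<tau> - 1) J' y = (\<Sum>s<p. y s *\<^sub>R v s) + X y + (\<Sum>h=1..\<tau> - 1. y (t1 + h) *\<^sub>R J' h)"
proof -
  have "{..t1} = {..<p} \<union> Bl" using pt1 by auto
  then have "(\<Sum>s\<le>t1. y s *\<^sub>R v s) = (\<Sum>s<p. y s *\<^sub>R v s) + X y"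
    unfolding X_def by (simp only:) (rule sum.union_disjoint, auto)
  then show ?thesis by (simp add: pt_def tshift_def t1_t)
qed

text \<open>A section of \<open>rho\<close> up to sign: the block vector is laid along the vector
  with coefficients \<open>c\<close>. For a unit vector and \<open>y p < 0\<close>,
  \<open>rho\<close> returns the reflected point, which even functions do not distinguish.\<close>

definition lft :: "(nat \<Rightarrow> real) \<Rightarrow> (nat \<Rightarrow> real) \<Rightarrow> nat \<Rightarrow> real" where
  "lft c y i = (if i < p then y i else if i \<le> t1 then y p * c i else if i < n' then y (p + (i - t1)) else 0)"

lemma rho_lft:
  assumes c: "(\<Sum>s\<in>Bl. (c s)\<^sup>2) = 1" and y: "y \<in> Ecoord n"
  shows "rho (lft c y) = y \<or> rho (lft c y) = rf p y"
proof -
  have "(\<Sum>s\<in>Bl. (lft c y s)\<^sup>2) = (\<Sum>s\<in>Bl. (y p)\<^sup>2 * (c s)\<^sup>2)"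
    by (rule sum.cong[OF refl]) (simp add: lft_def power_mult_distrib)
  also have "\<dots> = (y p)\<^sup>2" unfolding sum_distrib_left[symmetric] by (simp add: c)
  finally have "rho (lft c y) p = \<bar>y p\<bar>" by (simp add: rho_p)
  moreover have "rho (lft c y) i = y i" if "i \<noteq> p" for i
    using that y pt1 by (auto simp: rho_def lft_def Ecoord_def n_iff n'_iff)
  ultimately have "rho (lft c y) = y(p := \<bar>y p\<bar>)" by (auto simp: fun_eq_iff)
  then show ?thesis by (cases "y p \<ge> 0") (auto simp: rf_def)
qed

lemma lft_D': assumes "(\<Sum>s\<in>Bl. (c s)\<^sup>2) = 1" "y \<in> D" shows "lft c y \<in> D'"
proof -
  have "lft c y \<in> Ecoord n'" using pt1 tau by (auto simp: Ecoord_def lft_def n'_iff)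
  then show ?thesis using rho_lft[OF assms(1) opn_imp_Ecoord[OF D assms(2)]] assms(2) rfD by (auto simp: D'_def)
qed

lemma Ev_lft: assumes "(\<Sum>s\<in>Bl. (c s)\<^sup>2) = 1" "y \<in> D" "Ev u" shows "u (rho (lft c y)) = u y"
  using rho_lft[OF assms(1) opn_imp_Ecoord[OF D assms(2)]] assms by (auto simp: Ev_def)

lemma X_lft: "X (lft c y) = y p *\<^sub>R (\<Sum>s\<in>Bl. c s *\<^sub>R v s)"
  by (simp add: X_def lft_def scaleR_sum_right)

text \<open>Both lists describe the same points. A block vector is its norm times a unit vector,
  which is taken as \<open>J 1\<close>; conversely the coefficients of \<open>J 1\<close> times
  \<open>y p\<close> fill the block. By \<open>join_sum\<close> and \<open>ext_sum\<close> the two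
  representation sums then agree.\<close>

lemma represents_ext:
  assumes A: "\<And>K. K \<subseteq> {1..\<tau> - 1} \<Longrightarrow> Ev (A K)" and B: "\<And>K. K \<subseteq> {1..\<tau> - 1} \<Longrightarrow> Ev (B K)"
  shows "represents v t \<tau> D f (join A B) \<longleftrightarrow>
    represents v (tshift t) (\<tau> - 1) D' f (\<lambda>K. ext ((- 1) ^ card K) (A K) (B K))"
proof
  assume rep: "represents v t \<tau> D f (join A B)"
  show "represents v (tshift t) (\<tau> - 1) D' f (\<lambda>K. ext ((- 1) ^ card K) (A K) (B K))"
    unfolding represents_def
  proof (intro ballI)
    fix y J' assume y: "y \<in> D'" and J': "J' \<in> torus v (tshift t) (\<tau> - 1)"
    \<comment> \<open>If the block vector is zero, any unit vector serves.\<close>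
    obtain u where u: "u \<in> usph v p t1" "X y = rho y p *\<^sub>R u"
    proof (cases "rho y p = 0")
      case True
      then have "(\<Sum>s\<in>Bl. (y s)\<^sup>2) = 0" using rho_p_square[of y] by simp
      then have "\<forall>s\<in>Bl. (y s)\<^sup>2 = 0" by (subst (asm) sum_nonneg_eq_0_iff) auto
      then have "X y = 0" by (simp add: X_def)
      then show thesis using that[of "v p"] usph_v[OF pt1] True by simp
    next
      case False
      define c where "c s = y s / rho y p" for s
      have "(\<Sum>s\<in>Bl. (c s)\<^sup>2) = (\<Sum>s\<in>Bl. (y s)\<^sup>2) / (rho y p)\<^sup>2"
        unfolding c_def power_divide sum_divide_distrib ..
      also have "\<dots> = 1" unfolding rho_p_square[symmetric] using False by simp
      finally have "(\<Sum>s\<in>Bl. c s *\<^sub>R v s) \<in> usph v p t1" unfolding usph_def by blast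
      moreover have "X y = rho y p *\<^sub>R (\<Sum>s\<in>Bl. c s *\<^sub>R v s)" using False by (simp add: X_def c_def scaleR_sum_right)
      ultimately show thesis by (rule that)
    qed
    obtain J where J: "J \<in> torus v t \<tau>" "J 1 = u" "Jtl J = J'" by (rule torus_cons[OF J' u(1)])
    have pt_eq: "pt v (tshift t) (\<tau> - 1) J' y = pt v t \<tau> J (rho y)"
    proof -
      have "rho y s = y s" if "s < p" for s using that by (simp add: rho_def)
      moreover have "rho y (p + h) = y (t1 + h)" if "h \<in> {1..\<tau> - 1}" for h using that by (auto simp: rho_def)
      ultimately show ?thesis unfolding pt_split pt'_split by (simp add: J(2)[unfolded One_nat_def] J(3) u)
    qed
    have "f (pt v (tshift t) (\<tau> - 1) J' y) = (\<Sum>L\<in>Pow {1..\<tau>}. Jprod J L * join A B L (rho y))"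
      unfolding pt_eq using rep J(1) rho_D[OF y] by (simp add: represents_def)
    also have "\<dots> = (\<Sum>K\<in>Pow {1..\<tau> - 1}. Jprod J' K * ext ((- 1) ^ card K) (A K) (B K) y)"
      unfolding join_sum ext_sum[OF J'] by (simp add: J(2)[unfolded One_nat_def] J(3) u ext_def)
    finally show "f (pt v (tshift t) (\<tau> - 1) J' y) = (\<Sum>K\<in>Pow {1..\<tau> - 1}. Jprod J' K * ext ((- 1) ^ card K) (A K) (B K) y)" .
  qed
next
  assume rep: "represents v (tshift t) (\<tau> - 1) D' f (\<lambda>K. ext ((- 1) ^ card K) (A K) (B K))"
  show "represents v t \<tau> D f (join A B)"
    unfolding represents_def
  proof (intro ballI)
    fix y J assume y: "y \<in> D" and J: "J \<in> torus v t \<tau>"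
    have "J 1 \<in> usph v p t1" using torusD[OF J, of 1] tau by (simp add: p_t0 t1_t)
    then obtain c where c: "J 1 = (\<Sum>s\<in>Bl. c s *\<^sub>R v s)" "(\<Sum>s\<in>Bl. (c s)\<^sup>2) = 1" by (auto simp: usph_def)
    let ?y = "lft c y"
    have J': "Jtl J \<in> torus v (tshift t) (\<tau> - 1)" by (rule Jtl_torus[OF J])
    have X: "X ?y = y p *\<^sub>R J 1" by (simp only: X_lft c(1))
    have "pt v t \<tau> J y = pt v (tshift t) (\<tau> - 1) (Jtl J) ?y"
    proof -
      have "?y s = y s" if "s < p" for s using that by (simp add: lft_def)
      moreover have "?y (t1 + h) = y (p + h)" if "h \<in> {1..\<tau> - 1}" for h
        using that pt1 by (auto simp: lft_def n'_iff)
      ultimately show ?thesis unfolding pt_split pt'_split by (simp add: X)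
    qed
    then have "f (pt v t \<tau> J y) = (\<Sum>K\<in>Pow {1..\<tau> - 1}. Jprod (Jtl J) K * ext ((- 1) ^ card K) (A K) (B K) ?y)"
      using rep J' lft_D'[OF c(2) y] by (simp add: represents_def)
    also have "\<dots> = (\<Sum>L\<in>Pow {1..\<tau>}. Jprod J L * join A B L y)"
      unfolding join_sum ext_sum[OF J'] unfolding ext_def X using Ev_lft[OF c(2) y A] Ev_lft[OF c(2) y B]
      by simp
    finally show "f (pt v t \<tau> J y) = (\<Sum>L\<in>Pow {1..\<tau>}. Jprod J L * join A B L y)" .
  qed
qed

text \<open>The parities in the coordinates behind \<open>p\<close>, with evenness in
  \<open>p\<close> itself: what two families need for both \<open>join\<close> and
  \<open>ext\<close> of them to be stem functions.\<close>

definition par :: "(nat set \<Rightarrow> (nat \<Rightarrow> real) \<Rightarrow> 'a) \<Rightarrow> bool" where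
  "par A \<longleftrightarrow> (\<forall>K. K \<subseteq> {1..\<tau> - 1} \<longrightarrow> Ev (A K) \<and>
     (\<forall>h\<in>{1..\<tau> - 1}. \<forall>y\<in>D. A K (rf (p + h) y) = (if h \<in> K then - 1 else 1) *\<^sub>R A K y))"

lemma parD: "par A \<Longrightarrow> K \<subseteq> {1..\<tau> - 1} \<Longrightarrow> Ev (A K)"
  "par A \<Longrightarrow> K \<subseteq> {1..\<tau> - 1} \<Longrightarrow> h \<in> {1..\<tau> - 1} \<Longrightarrow> y \<in> D \<Longrightarrow> A K (rf (p + h) y) = (if h \<in> K then - 1 else 1) *\<^sub>R A K y"
  by (simp_all add: par_def)

lemma par_Lop: assumes A: "par A" shows "par (\<lambda>K. (Lop p ^^ k) (A K))"
  unfolding par_def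
proof (intro allI impI conjI ballI)
  fix K h y assume K: "K \<subseteq> {1..\<tau> - 1}"
  show "Ev ((Lop p ^^ k) (A K))" by (rule Ev_Lop_funpow[OF parD(1)[OF A K]])
  assume h: "h \<in> {1..\<tau> - 1}" and y: "y \<in> D"
  show "(Lop p ^^ k) (A K) (rf (p + h) y) = (if h \<in> K then - 1 else 1) *\<^sub>R (Lop p ^^ k) (A K) y"
    by (rule Lop_funpow_reflect[OF parD(1)[OF A K] parD(2)[OF A K h] _ y]) (use h in auto)
qed

lemma par_scaleR: assumes A: "par A" shows "par (\<lambda>K y. c *\<^sub>R A K y)"
  unfolding par_def
proof (intro allI impI conjI ballI)
  fix K h y assume K: "K \<subseteq> {1..\<tau> - 1}"
  show "Ev (\<lambda>y. c *\<^sub>R A K y)"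
    using parD(1)[OF A K] Cinf_linear[OF D bounded_linear_scaleR_right, of "A K" c] by (auto simp: Ev_def)
  assume h: "h \<in> {1..\<tau> - 1}" and y: "y \<in> D"
  show "c *\<^sub>R A K (rf (p + h) y) = (if h \<in> K then - 1 else 1) *\<^sub>R (c *\<^sub>R A K y)"
    using parD(2)[OF A K h y] by simp
qed

lemma stem_join: assumes A: "par A" and B: "par B" shows "stem t \<tau> D (join A B)"
  unfolding stem_def
proof (intro allI impI ballI)
  fix L h y assume L: "L \<subseteq> {1..\<tau>}" and h: "h \<in> {1..\<tau>}" and y: "y \<in> D"
  let ?K = "{h. 1 \<le> h \<and> Suc h \<in> L}"
  have K: "?K \<subseteq> {1..\<tau> - 1}" using L by auto
  show "join A B L (flip t h y) = (if h \<in> L then - join A B L y else join A B L y)"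
  proof (cases "h = 1")
    case True
    have "flip t h y = rf p y" using True by (simp add: flip_def rf_def p_t0)
    then show ?thesis using parD(1)[OF A K] parD(1)[OF B K] y True by (auto simp: join_def Ev_def rf_def)
  next
    case False
    then obtain h' where h': "h = Suc h'" "h' \<in> {1..\<tau> - 1}" using h by (cases h) auto
    have "(rf (p + h') y) p = y p" using h' by (simp add: rf_def)
    then show ?thesis using parD(2)[OF A K h'(2) y] parD(2)[OF B K h'(2) y] h' by (auto simp: join_def flip_rf)
  qed
qed

lemma stem_ext:
  assumes A: "par A" and B: "par B" shows "stem (tshift t) (\<tau> - 1) D' (\<lambda>K. ext ((- 1) ^ card K) (A K) (B K))"
  unfolding stem_def
proof (intro allI impI ballI)
  fix K h y assume K: "K \<subseteq> {1..\<tau> - 1}" and h: "h \<in> {1..\<tau> - 1}" and y: "y \<in> D'"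
  have "X (rf (t1 + h) y) = X y" using h unfolding X_def by (intro sum.cong) (auto simp: rf_def)
  then show "ext ((- 1) ^ card K) (A K) (B K) (flip (tshift t) h y)
     = (if h \<in> K then - ext ((- 1) ^ card K) (A K) (B K) y else ext ((- 1) ^ card K) (A K) (B K) y)"
    using parD(2)[OF A K h rho_D[OF y]] parD(2)[OF B K h rho_D[OF y]]
    by (auto simp: flip'_rf ext_def rho_flip'[OF h])
qed

end

section \<open>Iterated components and powers of the Laplacian\<close>

context fueter_step begin

definition Ak :: "(nat set \<Rightarrow> (nat \<Rightarrow> real) \<Rightarrow> 'a) \<Rightarrow> nat \<Rightarrow> nat set \<Rightarrow> (nat \<Rightarrow> real) \<Rightarrow> 'a" where
  "Ak F k K = (Lop p ^^ k) (F (Suc ` K))"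

definition Bk :: "(nat set \<Rightarrow> (nat \<Rightarrow> real) \<Rightarrow> 'a) \<Rightarrow> nat \<Rightarrow> nat set \<Rightarrow> (nat \<Rightarrow> real) \<Rightarrow> 'a" where
  "Bk F k K = (Lop p ^^ k) (Dv p (F (insert 1 (Suc ` K))))"

lemma ext_scaleR: "ext \<sigma> (\<lambda>y. c *\<^sub>R a y) (\<lambda>y. c *\<^sub>R b y) y = c *\<^sub>R ext \<sigma> a b y"
  by (simp add: ext_def scaleR_add_right mult.commute)

context
  fixes f F
  assumes f: "SR v t \<tau> D f" and F: "stem t \<tau> D F" and rep: "represents v t \<tau> D f F"
begin

lemma F_Cinf: "L \<subseteq> {1..\<tau>} \<Longrightarrow> Cinf n D (F L)"
  using SR_stem(1)[OF opn_nn Dinv f rep, of L] nn by simp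

lemma F_harmonic: "L \<subseteq> {1..\<tau>} \<Longrightarrow> y \<in> D \<Longrightarrow> (\<Sum>i<n. pderiv_c i (pderiv_c i (F L)) y) = 0"
  using SR_stem(3)[OF opn_nn Dinv f rep, of L y] unfolding nn by blast

lemma F_flip: "L \<subseteq> {1..\<tau>} \<Longrightarrow> y \<in> D \<Longrightarrow> h \<in> {1..\<tau>} \<Longrightarrow> F L (flip t h y) = (if h \<in> L then - F L y else F L y)"
  using F unfolding stem_def by blast

lemma Suc_subset:
  assumes "K \<subseteq> {1..\<tau> - 1}" shows "Suc ` K \<subseteq> {1..\<tau>}" "insert 1 (Suc ` K) \<subseteq> {1..\<tau>}" "1 \<notin> Suc ` K"
proof -
  have "Suc h \<in> {1..\<tau>}" "h \<noteq> 0" if "h \<in> K" for h using assms that tau by force+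
  then show "Suc ` K \<subseteq> {1..\<tau>}" "insert 1 (Suc ` K) \<subseteq> {1..\<tau>}" "1 \<notin> Suc ` K" using tau by auto
qed

lemma flip_1: "flip t 1 y = rf p y" by (simp add: flip_def rf_def p_t0)

lemma Od_F: assumes K: "K \<subseteq> {1..\<tau> - 1}" shows "Od (F (insert 1 (Suc ` K)))"
  using F_Cinf[OF Suc_subset(2)[OF K]] F_flip[OF Suc_subset(2)[OF K], of _ 1] tau
  unfolding Od_def flip_1 by auto

lemma Ev_F: assumes K: "K \<subseteq> {1..\<tau> - 1}" shows "Ev (F (Suc ` K))"
  using F_Cinf[OF Suc_subset(1)[OF K]] F_flip[OF Suc_subset(1)[OF K], of _ 1] Suc_subset(3)[OF K] tau
  unfolding Ev_def flip_1 by auto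

lemma F_rf:
  assumes K: "K \<subseteq> {1..\<tau> - 1}" and h: "h \<in> {1..\<tau> - 1}" and y: "y \<in> D"
  shows "F (Suc ` K) (rf (p + h) y) = (if h \<in> K then - 1 else 1) *\<^sub>R F (Suc ` K) y"
    "F (insert 1 (Suc ` K)) (rf (p + h) y) = (if h \<in> K then - 1 else 1) *\<^sub>R F (insert 1 (Suc ` K)) y"
proof -
  have h': "Suc h \<in> {1..\<tau>}" "Suc h \<in> Suc ` K \<longleftrightarrow> h \<in> K" "Suc h \<in> insert 1 (Suc ` K) \<longleftrightarrow> h \<in> K" using h by auto
  show "F (Suc ` K) (rf (p + h) y) = (if h \<in> K then - 1 else 1) *\<^sub>R F (Suc ` K) y"
    using F_flip[OF Suc_subset(1)[OF K] y h'(1)] unfolding flip_rf h'(2) by simp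
  show "F (insert 1 (Suc ` K)) (rf (p + h) y) = (if h \<in> K then - 1 else 1) *\<^sub>R F (insert 1 (Suc ` K)) y"
    using F_flip[OF Suc_subset(2)[OF K] y h'(1)] unfolding flip_rf h'(3) by simp
qed

lemma par_Ak: "par (Ak F k)"
proof -
  have "par (\<lambda>K. F (Suc ` K))" unfolding par_def using Ev_F F_rf(1) by blast
  then show ?thesis unfolding Ak_def[abs_def] by (rule par_Lop)
qed

lemma par_Bk: "par (Bk F k)"
proof -
  have "par (\<lambda>K. Dv p (F (insert 1 (Suc ` K))))" unfolding par_def
  proof (intro allI impI conjI ballI)
    fix K h y assume K: "K \<subseteq> {1..\<tau> - 1}"
    show "Ev (Dv p (F (insert 1 (Suc ` K))))" by (rule Ev_Dv[OF Od_F[OF K]])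
    assume h: "h \<in> {1..\<tau> - 1}" and y: "y \<in> D"
    show "Dv p (F (insert 1 (Suc ` K))) (rf (p + h) y) = (if h \<in> K then - 1 else 1) *\<^sub>R Dv p (F (insert 1 (Suc ` K))) y"
      by (rule Dv_reflect[OF F_Cinf[OF Suc_subset(2)[OF K]] F_rf(2)[OF K h] _ y]) (use h in auto)
  qed
  then show ?thesis unfolding Bk_def[abs_def] by (rule par_Lop)
qed

lemma F_join: assumes L: "L \<subseteq> {1..\<tau>}" and y: "y \<in> D" shows "F L y = join (Ak F 0) (Bk F 0) L y"
proof -
  let ?K = "{h. 1 \<le> h \<and> Suc h \<in> L}"
  have K: "?K \<subseteq> {1..\<tau> - 1}" using L by auto
  have SK: "Suc ` ?K = L - {1}"
  proof (intro equalityI subsetI)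
    fix h assume h: "h \<in> L - {1}"
    then have "h = Suc (h - 1)" "1 \<le> h - 1" using L by force+
    then show "h \<in> Suc ` ?K" using h by (intro image_eqI[of _ _ "h - 1"]) auto
  qed auto
  show ?thesis
  proof (cases "1 \<in> L")
    case True
    then have "insert 1 (Suc ` ?K) = L" using SK by blast
    then show ?thesis using join_simps(2)[OF K, of "Ak F 0" "Bk F 0" y] Od_eq_Dv[OF Od_F[OF K] y] by (simp add: Bk_def)
  next
    case False
    then have "Suc ` ?K = L" using SK by blast
    then show ?thesis using join_simps(1)[OF K, of "Ak F 0" "Bk F 0" y] by (simp add: Ak_def)
  qed
qed

lemma rep_join: "represents v t \<tau> D f (join (Ak F 0) (Bk F 0))"
  by (rule represents_cong[OF opn_nn Dinv rep F_join])

lemma evchain_Ak: "K \<subseteq> {1..\<tau> - 1} \<Longrightarrow> evchain (\<lambda>k. Ak F k K)"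
  unfolding Ak_def by (rule evchain_Lop[OF Ev_F])

lemma evchain_Bk: "K \<subseteq> {1..\<tau> - 1} \<Longrightarrow> evchain (\<lambda>k. Bk F k K)"
  unfolding Bk_def by (rule evchain_Lop[OF Ev_Dv[OF Od_F]])

lemma Ak_equation:
  assumes K: "K \<subseteq> {1..\<tau> - 1}" and y: "y \<in> D"
  shows "(\<Sum>j\<in>{..<n} - {p}. pderiv_c j (pderiv_c j (Ak F k K)) y) + (1 + 2 * real k) *\<^sub>R Ak F (Suc k) K y
       + (y p)\<^sup>2 *\<^sub>R Ak F (Suc (Suc k)) K y = 0"
proof -
  have c: "chain (\<lambda>k. Ak F k K)" using evchain_Ak[OF K] by (simp add: evchain_def)
  have h: "(\<Sum>j<n. pderiv_c j (pderiv_c j (Ak F 0 K)) z) = 0" if "z \<in> D" for z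
    using F_harmonic[OF Suc_subset(1)[OF K] that] by (simp add: Ak_def)
  show ?thesis using chain_radial_equation[OF c chain_harmonic_base[OF c _ h] y, of k] by simp
qed

lemma Bk_equation:
  assumes K: "K \<subseteq> {1..\<tau> - 1}" and y: "y \<in> D"
  shows "(\<Sum>j\<in>{..<n} - {p}. pderiv_c j (pderiv_c j (Bk F k K)) y) + (3 + 2 * real k) *\<^sub>R Bk F (Suc k) K y
       + (y p)\<^sup>2 *\<^sub>R Bk F (Suc (Suc k)) K y = 0"
proof -
  have c: "chain (\<lambda>k. Bk F k K)" using evchain_Bk[OF K] by (simp add: evchain_def)
  have FB: "F (insert 1 (Suc ` K)) z = z p *\<^sub>R Bk F 0 K z" if "z \<in> D" for z
    using Od_eq_Dv[OF Od_F[OF K] that] by (simp add: Bk_def)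
  show ?thesis
    using chain_radial_equation[OF c chain_odd_harmonic_base[OF c FB F_harmonic[OF Suc_subset(2)[OF K]]] y, of k] by simp
qed

text \<open>The scalar collects the factors \<open>m - 1 - 2 * i\<close> with
  \<open>m = 2 * n1 + 1\<close>. It is kept inside the components, so that \<open>stem_ext\<close>
  and \<open>lapT_represents\<close> apply unchanged at each step.\<close>

lemma laplacian_power:
  assumes m: "Suc t1 - p = 2 * n1 + 1"
  defines "c \<equiv> \<lambda>k. \<Prod>i<k. real (2 * n1) - 2 * real i"
  shows "represents v (tshift t) (\<tau> - 1) D' ((lapT v (tshift t) (\<tau> - 1) D' ^^ k) f)
    (\<lambda>K. ext ((- 1) ^ card K) (\<lambda>y. c k *\<^sub>R Ak F k K y) (\<lambda>y. c k *\<^sub>R Bk F k K y))"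
proof (induction k)
  case 0
  have "represents v (tshift t) (\<tau> - 1) D' f (\<lambda>K. ext ((- 1) ^ card K) (Ak F 0 K) (Bk F 0 K))"
    by (rule represents_ext[THEN iffD1, OF parD(1)[OF par_Ak] parD(1)[OF par_Bk] rep_join])
  then show ?case by (simp add: c_def)
next
  case (Suc k)
  let ?G = "\<lambda>k K. ext ((- 1) ^ card K) (\<lambda>y. c k *\<^sub>R Ak F k K y) (\<lambda>y. c k *\<^sub>R Bk F k K y)"
  have pA: "par (\<lambda>K y. c k *\<^sub>R Ak F k K y)" and pB: "par (\<lambda>K y. c k *\<^sub>R Bk F k K y)" for k
    by (rule par_scaleR[OF par_Ak], rule par_scaleR[OF par_Bk])
  have "represents v (tshift t) (\<tau> - 1) D' (lapT v (tshift t) (\<tau> - 1) D' ((lapT v (tshift t) (\<tau> - 1) D' ^^ k) f)) (?G (Suc k))"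
  proof (rule T'.lapT_represents[OF opn_nn' D'inv stem_ext[OF pA pB] _ Suc.IH stem_ext[OF pA pB]])
    fix K assume K: "K \<subseteq> {1..\<tau> - 1}"
    show "Cinf (tshift t 0 + 1 + (\<tau> - 1)) D' (?G k K)"
      unfolding nn' by (rule Cinf_ext[OF parD(1)[OF pA K] parD(1)[OF pB K]])
    fix y assume y: "y \<in> D'"
    let ?E = "\<lambda>k. ext ((- 1) ^ card K) (Ak F k K) (Bk F k K)"
    \<comment> \<open>A sum over a singleton lets \<open>laplacian_linear_sum\<close> serve for a
      scalar multiple.\<close>
    have "(\<Sum>i<n'. pderiv_c i (pderiv_c i (?G k K)) y) = (\<Sum>S\<in>{0::nat}. c k *\<^sub>R (\<Sum>i<n'. pderiv_c i (pderiv_c i (?E k)) y))"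
      by (rule laplacian_linear_sum[OF opn_D' Cinf_ext[OF parD(1)[OF par_Ak K] parD(1)[OF par_Bk K]] bounded_linear_scaleR_right _ y])
         (simp add: ext_scaleR)
    also have "(\<Sum>i<n'. pderiv_c i (pderiv_c i (?E k)) y) = (real (Suc t1 - p) - 1 - 2 * real k) *\<^sub>R ?E (Suc k) y"
      by (rule laplacian_ext[OF evchain_Ak[OF K] evchain_Bk[OF K] Ak_equation[OF K] Bk_equation[OF K] y])
    finally have "(\<Sum>i<n'. pderiv_c i (pderiv_c i (?G k K)) y) = c (Suc k) *\<^sub>R ?E (Suc k) y"
      unfolding m by (simp add: c_def algebra_simps)
    then show "?G (Suc k) K y = (\<Sum>i<tshift t 0 + 1 + (\<tau> - 1). pderiv_c i (pderiv_c i (?G k K)) y)"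
      unfolding nn' ext_scaleR by (rule sym)
  qed
  then show ?case by simp
qed

text \<open>For a fixed \<open>J'\<close> the components combine into one pair \<open>a\<close>,
  \<open>b\<close> of chains. The first-order system is derived for this pair from two slices of
  \<open>f\<close>, iterated \<open>n1\<close> times and read in the block of size
  \<open>2 * n1 + 1\<close>. The factor \<open>C\<close> is there for the scalar of
  \<open>laplacian_power\<close>.\<close>

lemma regular_final:
  assumes m: "Suc t1 - p = 2 * n1 + 1" and J': "J' \<in> torus v (tshift t) (\<tau> - 1)"
  shows "cregular n' (T'.esys J') D' (\<lambda>y. C *\<^sub>R ext 1 (\<lambda>y. \<Sum>K\<in>Pow {1..\<tau> - 1}. Jprod J' K * Ak F n1 K y)
     (\<lambda>y. \<Sum>K\<in>Pow {1..\<tau> - 1}. Jprod J' K * Bk F n1 K y) y)"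
proof -
  define a where "a k y = (\<Sum>K\<in>Pow {1..\<tau> - 1}. Jprod J' K * Ak F k K y)" for k y
  define b where "b k y = (\<Sum>K\<in>Pow {1..\<tau> - 1}. Jprod J' K * Bk F k K y)" for k y
  define e where "e j = (if j < p then v j else J' (j - p))" for j
  \<comment> \<open>What becomes of \<open>e j\<close> when some \<open>v s\<close> of the block is
    moved to the left past it: the unit commutes, all others anticommute.\<close>
  define ec where "ec j = (if j = 0 then e j else - e j)" for j
  have a: "evchain a" unfolding a_def[abs_def]
    by (rule evchain_linear_sum[where u = "\<lambda>K k. Ak F k K" and L = "\<lambda>K x. Jprod J' K * x"])
       (simp_all add: evchain_Ak bounded_linear_mult_left_fin)
  have b: "evchain b" unfolding b_def[abs_def]
    by (rule evchain_linear_sum[where u = "\<lambda>K k. Bk F k K" and L = "\<lambda>K x. Jprod J' K * x"])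
       (simp_all add: evchain_Bk bounded_linear_mult_left_fin)
  have ca: "chain a" and cb: "chain b" using a b by (simp_all add: evchain_def)
  have t1N: "t1 \<le> N" unfolding t1_t by (rule t_le_N[OF tau])
  have BlN: "s \<in> {1..N}" if "s \<in> Bl" for s using that t1N p_t0 by auto
  have comm: "e j * v s = v s * ec j" if j: "j < n" "j \<noteq> p" and s: "s \<in> Bl" for j s
  proof (cases "j < p")
    case True
    show ?thesis
    proof (cases "j = 0")
      case False
      have "v j * v s = - (v s * v j)" by (rule vanti) (use False True s BlN[OF s] in auto)
      then show ?thesis using False True by (simp add: e_def ec_def)
    qed (use p_t0 in \<open>simp add: e_def ec_def v0\<close>)
  next
    case False
    then have h: "j - p \<in> {1..\<tau> - 1}" using j by (auto simp: n_iff)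
    have "v s * J' (j - p) = - (J' (j - p) * v s)"
    proof (rule T'.torus_anticommute_v[OF J' h])
      have "t 1 \<le> t (j - p)" by (rule t_mono_le) (use h in auto)
      moreover have "Suc (j - p - 1) = j - p" using h by auto
      ultimately show "s \<le> tshift t (j - p - 1)" using s unfolding t1_t tshift_def by auto
    qed (use BlN[OF s] in auto)
    then show ?thesis using False p_t0 by (simp add: e_def ec_def)
  qed
  have pBl: "p \<in> Bl" using pt1 by simp
  have reg: "(\<Sum>j\<in>{..<n} - {p}. e j * pderiv_c j (\<lambda>y. a 0 y + \<sigma> *\<^sub>R (v p * (y p *\<^sub>R b 0 y))) y)
      + (\<sigma> *\<^sub>R v p) * pderiv_c p (\<lambda>y. a 0 y + \<sigma> *\<^sub>R (v p * (y p *\<^sub>R b 0 y))) y = 0"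
    if \<sigma>: "\<sigma> \<in> {1, - 1}" and y: "y \<in> D" for \<sigma> :: real and y
  proof -
    let ?w = "\<lambda>y. a 0 y + \<sigma> *\<^sub>R (v p * (y p *\<^sub>R b 0 y))"
    \<comment> \<open>The two signs give two torus elements with opposite first component and the
      same tail \<open>J'\<close>; \<open>regular_split\<close> compares the corresponding slices of
      \<open>f\<close>.\<close>
    have "\<sigma> *\<^sub>R v p \<in> usph v p t1" using \<sigma> usph_v[OF pt1] usph_uminus[OF usph_v[OF pt1]] by auto
    then obtain J where J: "J \<in> torus v t \<tau>" "J 1 = \<sigma> *\<^sub>R v p" "Jtl J = J'" by (rule torus_cons[OF J'])
    have w: "f (pt v t \<tau> J z) = ?w z" if z: "z \<in> D" for z
    proof -
      have "f (pt v t \<tau> J z) = (\<Sum>L\<in>Pow {1..\<tau>}. Jprod J L * join (Ak F 0) (Bk F 0) L z)"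
        using rep_join z J(1) unfolding represents_def by blast
      also have "\<dots> = ?w z" unfolding join_sum J(2,3) a_def b_def by simp
      finally show ?thesis .
    qed
    have "cregular n (esys J) D (\<lambda>y. f (pt v t \<tau> J y))"
    proof -
      have "Tregular v t \<tau> (Omega v t \<tau> D) f \<longleftrightarrow> (\<forall>J\<in>torus v t \<tau>. cregular (t 0 + 1 + \<tau>) (esys J) D (\<lambda>y. f (pt v t \<tau> J y)))"
        by (rule Tregular_iff_cregular[OF opn_nn Dinv])
      then show ?thesis using f J(1) unfolding SR_def nn by blast
    qed
    then have "(\<Sum>i<n. esys J i * pderiv_c i (\<lambda>y. f (pt v t \<tau> J y)) y) = 0" using y unfolding cregular_def by blast
    also have "(\<Sum>i<n. esys J i * pderiv_c i (\<lambda>y. f (pt v t \<tau> J y)) y) = (\<Sum>i<n. esys J i * pderiv_c i ?w y)"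
      by (rule sum.cong[OF refl]) (use pderiv_c_cong[OF D y _ w] in simp)
    also have "\<dots> = esys J p * pderiv_c p ?w y + (\<Sum>i\<in>{..<n} - {p}. esys J i * pderiv_c i ?w y)"
      by (rule sum.remove) (use p in auto)
    also have "esys J p = \<sigma> *\<^sub>R v p" using J(2) by (simp add: esys_def p_t0)
    also have "(\<Sum>i\<in>{..<n} - {p}. esys J i * pderiv_c i ?w y) = (\<Sum>i\<in>{..<n} - {p}. e i * pderiv_c i ?w y)"
    proof (rule sum.cong[OF refl])
      fix i assume i: "i \<in> {..<n} - {p}"
      have "esys J i = e i"
      proof (cases "i < p")
        case False
        then have "i - t 0 = Suc (i - p)" "i - p \<noteq> 0" using i p_t0 by auto
        then have "J (i - t 0) = J' (i - p)" unfolding J(3)[symmetric] by (simp add: Jtl_def)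
        then show ?thesis using False p_t0 by (simp add: esys_def e_def)
      qed (use p_t0 in \<open>simp add: esys_def e_def\<close>)
      then show "esys J i * pderiv_c i ?w y = e i * pderiv_c i ?w y" by simp
    qed
    finally show ?thesis by (simp only: add.commute)
  qed
  have vp: "v p * v p = - 1" by (rule vsq[OF BlN[OF pBl]])
  note E0 = regular_split[OF ca cb vp comm[OF _ _ pBl] reg]
  note Ek = first_order_chain[OF ca cb E0]
  have 0: "(\<Sum>i<n'. T'.esys J' i * pderiv_c i (ext 1 (a n1) (b n1)) y) = 0" if y: "y \<in> D'" for y
  proof (rule regular_ext[OF a b vsq[OF BlN] vanti[OF BlN BlN] _ _ comm Ek m y])
    have t1': "tshift t 0 = t1" by (simp add: tshift_def t1_t)
    show "T'.esys J' s = v s" if "s \<in> Bl" for s unfolding T'.esys_def t1' using that by simp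
    fix i assume i: "i < n'" "i \<notin> Bl"
    show "T'.esys J' i = e (kap i)"
      unfolding T'.esys_def t1' using i pt1 by (auto simp: e_def kap_def)
  qed
  have C: "Cinf n' D' (ext 1 (a n1) (b n1))" by (rule Cinf_ext) (use a b in \<open>simp_all add: evchain_def\<close>)
  have "Cinf n' D' (\<lambda>y. C *\<^sub>R ext 1 (a n1) (b n1) y)" by (rule Cinf_linear[OF opn_D' bounded_linear_scaleR_right C])
  moreover have "(\<Sum>i<n'. T'.esys J' i * pderiv_c i (\<lambda>y. C *\<^sub>R ext 1 (a n1) (b n1) y) y) = 0" if y: "y \<in> D'" for y
  proof -
    have "pderiv_c i (\<lambda>y. C *\<^sub>R ext 1 (a n1) (b n1) y) y = C *\<^sub>R pderiv_c i (ext 1 (a n1) (b n1)) y" if i: "i < n'" for i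
      using has_pd_imp_pderiv[OF has_pd_linear[OF bounded_linear_scaleR_right Cinf_has_pd[OF C i y]]] .
    then have "(\<Sum>i<n'. T'.esys J' i * pderiv_c i (\<lambda>y. C *\<^sub>R ext 1 (a n1) (b n1) y) y)
       = C *\<^sub>R (\<Sum>i<n'. T'.esys J' i * pderiv_c i (ext 1 (a n1) (b n1)) y)"
      by (simp add: scaleR_sum_right)
    then show ?thesis using 0[OF y] by simp
  qed
  ultimately show ?thesis unfolding cregular_def a_def b_def Cinf_def by blast
qed

end

end

section \<open>Analyticity for the original list and the conclusion\<close>

context fueter_step begin

lemma kap_bij_insert: "bij_betw kap (({..<n'} - Bl) \<union> {p}) {..<n}"
proof -
  \<comment> \<open>At \<open>p\<close> the second branch of \<open>kap\<close> gives
    \<open>p + (p - t1)\<close>, and truncated subtraction makes this \<open>p\<close>.\<close>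
  have "kap p = p" using pt1 by (simp add: kap_def)
  then have "bij_betw kap {p} {p}" by (simp add: bij_betw_def)
  then have "bij_betw kap (({..<n'} - Bl) \<union> {p}) (({..<n} - {p}) \<union> {p})"
    by (rule bij_betw_combine[OF kap_bij]) simp
  moreover have "({..<n} - {p}) \<union> {p} = {..<n}" using p by auto
  ultimately show ?thesis by simp
qed

text \<open>The chosen coefficients describe the unit vector \<open>\<sigma> *\<^sub>R v p\<close>.
  The block is thereby restricted to the line through \<open>v p\<close>, where \<open>lft\<close>
  only relabels coordinates up to sign, as \<open>real_analytic_restrict\<close> requires.\<close>

lemma real_analytic_lft:
  assumes G: "real_analytic_c n' D' G" and \<sigma>: "\<sigma> \<in> {1, - 1}"
  shows "real_analytic_c n D (\<lambda>y. G (lft (\<lambda>s. if s = p then \<sigma> else 0) y))"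
proof (rule real_analytic_restrict[OF G D _ kap_bij_insert, where \<epsilon> = "\<lambda>j. if j = p then \<sigma> else 1"])
  let ?c = "\<lambda>s. if s = p then \<sigma> else 0"
  have "p < n'" using pt1 tau by (simp add: n'_iff)
  then show "({..<n'} - Bl) \<union> {p} \<subseteq> {..<n'}" by auto
  show "\<bar>if j = p then \<sigma> else 1\<bar> = 1" for j using \<sigma> by auto
  show "lft ?c y = (\<lambda>j. if j \<in> ({..<n'} - Bl) \<union> {p} then (if j = p then \<sigma> else 1) * y (kap j) else 0)" for y
    using pt1 tau by (auto simp: lft_def kap_def fun_eq_iff n'_iff)
  have "(\<Sum>s\<in>Bl. (?c s)\<^sup>2) = (\<Sum>s\<in>Bl. if s = p then 1 else 0)" by (rule sum.cong[OF refl]) (use \<sigma> in auto)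
  then show "lft ?c y \<in> D'" if "y \<in> D" for y using that pt1 by (intro lft_D') auto
qed

text \<open>On block vectors along \<open>v p\<close>, \<open>ext\<close> is \<open>A\<close> plus a
  multiple of \<open>v p * B\<close> that changes sign with \<open>\<sigma>\<close>. The mean over
  both signs is \<open>A\<close>, and the odd part, freed of \<open>v p\<close>, is
  \<open>y p *\<^sub>R B\<close>. Analyticity thus returns to the original list without a statement
  on quotients by \<open>y p\<close>.\<close>

lemma real_analytic_join:
  assumes A: "\<And>K. K \<subseteq> {1..\<tau> - 1} \<Longrightarrow> Ev (A K)" and B: "\<And>K. K \<subseteq> {1..\<tau> - 1} \<Longrightarrow> Ev (B K)"
    and G: "\<And>K. K \<subseteq> {1..\<tau> - 1} \<Longrightarrow> real_analytic_c n' D' (ext ((- 1) ^ card K) (A K) (B K))"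
    and L: "L \<subseteq> {1..\<tau>}"
  shows "real_analytic_c n D (join A B L)"
proof -
  define K where "K = {h. 1 \<le> h \<and> Suc h \<in> L}"
  have K: "K \<subseteq> {1..\<tau> - 1}" using L by (auto simp: K_def)
  define g where "g \<sigma> y = ext ((- 1) ^ card K) (A K) (B K) (lft (\<lambda>s. if s = p then \<sigma> else 0) y)" for \<sigma> y
  have an: "real_analytic_c n D (\<lambda>y. \<Sum>\<sigma>\<in>{1, - 1 :: real}. M \<sigma> * g \<sigma> y)" for M
  proof (rule real_analytic_sum[OF D])
    fix \<sigma> :: real assume "\<sigma> \<in> {1, - 1}"
    then show "real_analytic_c n D (\<lambda>y. M \<sigma> * g \<sigma> y)" unfolding g_def
      by (intro real_analytic_linear[OF bounded_linear_mult_left_fin] real_analytic_lft[OF G[OF K]])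
  qed simp
  have g: "g \<sigma> y = A K y + ((- 1) ^ card K * y p * \<sigma>) *\<^sub>R (v p * B K y)" if \<sigma>: "\<sigma> \<in> {1, - 1}" and y: "y \<in> D" for \<sigma> y
  proof -
    let ?c = "\<lambda>s. if s = p then \<sigma> else 0"
    have "(\<Sum>s\<in>Bl. (?c s)\<^sup>2) = (\<Sum>s\<in>Bl. if s = p then 1 else 0)" by (rule sum.cong[OF refl]) (use \<sigma> in auto)
    then have c: "(\<Sum>s\<in>Bl. (?c s)\<^sup>2) = 1" using pt1 by simp
    have "(\<Sum>s\<in>Bl. ?c s *\<^sub>R v s) = (\<Sum>s\<in>Bl. if s = p then \<sigma> *\<^sub>R v s else 0)" by (rule sum.cong[OF refl]) auto
    then have "X (lft ?c y) = (y p * \<sigma>) *\<^sub>R v p" using pt1 by (simp add: X_lft)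
    then show ?thesis unfolding g_def ext_def Ev_lft[OF c y A[OF K]] Ev_lft[OF c y B[OF K]] by simp
  qed
  have vp: "v p * v p = - 1" by (rule vsq) (use p_t0 pt1 t1_t t_le_N[OF tau] in auto)
  show ?thesis
  proof (cases "1 \<in> L")
    case True
    \<comment> \<open>\<open>- v p\<close> is the inverse of \<open>v p\<close>, and the scalar
      extracts the part that is odd in \<open>\<sigma>\<close> while cancelling the sign in
      \<open>ext\<close>.\<close>
    define M where "M \<sigma> = (- (\<sigma> * (- 1) ^ card K) / 2) *\<^sub>R v p" for \<sigma> :: real
    show ?thesis
    proof (rule real_analytic_cong[OF an[of M]])
      fix y assume y: "y \<in> D"
      have sq: "((- 1) ^ card K * (- 1) ^ card K :: real) = 1" by (simp flip: power_mult_distrib)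
      have vv: "v p * (v p * x) = - x" for x using vp by (simp add: mult.assoc[symmetric])
      have "M \<sigma> * g \<sigma> y = (- (\<sigma> * (- 1) ^ card K) / 2) *\<^sub>R (v p * A K y) + (y p / 2) *\<^sub>R B K y"
        if s: "\<sigma> \<in> {1, - 1}" for \<sigma>
      proof -
        have s2: "\<sigma> * \<sigma> = 1" using s by auto
        have "M \<sigma> * g \<sigma> y = (- (\<sigma> * (- 1) ^ card K) / 2) *\<^sub>R (v p * A K y)
            + ((\<sigma> * \<sigma>) * ((- 1) ^ card K * (- 1) ^ card K) * y p / 2) *\<^sub>R B K y"
          unfolding M_def g[OF s y] by (simp add: distrib_left vv scaleR_add_right mult_ac)
        then show ?thesis unfolding s2 sq by simp
      qed
      then have "(\<Sum>\<sigma>\<in>{1, - 1}. M \<sigma> * g \<sigma> y) = (y p / 2) *\<^sub>R B K y + (y p / 2) *\<^sub>R B K y" by simp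
      also have "\<dots> = y p *\<^sub>R B K y" by (simp flip: scaleR_add_left)
      finally show "(\<Sum>\<sigma>\<in>{1, - 1}. M \<sigma> * g \<sigma> y) = join A B L y" using True by (simp add: join_def K_def)
    qed
  next
    case False
    show ?thesis
    proof (rule real_analytic_cong[OF an[of "\<lambda>\<sigma>. (1 / 2) *\<^sub>R 1"]])
      fix y assume y: "y \<in> D"
      have "(\<Sum>\<sigma>\<in>{1, - 1 :: real}. ((1 / 2) *\<^sub>R 1) * g \<sigma> y) = (1 / 2) *\<^sub>R A K y + (1 / 2) *\<^sub>R A K y"
        using g[of 1 y] g[of "- 1" y] y by (simp add: scaleR_add_right scaleR_diff_right)
      also have "\<dots> = A K y" by (simp flip: scaleR_add_left)
      finally show "(\<Sum>\<sigma>\<in>{1, - 1 :: real}. ((1 / 2) *\<^sub>R 1) * g \<sigma> y) = join A B L y" using False by (simp add: join_def K_def)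
    qed
  qed
qed

theorem first_fueter_transform:
  assumes f: "SR v t \<tau> D f" and m: "Suc t1 - p = 2 * n1 + 1"
  defines "g \<equiv> (lapT v (tshift t) (\<tau> - 1) D' ^^ n1) f"
  shows "SR v (tshift t) (\<tau> - 1) D' g" and "Tfun_omega v t \<tau> D g"
proof -
  obtain F where F: "stem t \<tau> D F" and rep: "represents v t \<tau> D f F" using f by (auto simp: SR_def Tfun_def)
  define c :: real where "c = (\<Prod>i<n1. real (2 * n1) - 2 * real i)"
  let ?A = "\<lambda>K y. c *\<^sub>R Ak F n1 K y" and ?B = "\<lambda>K y. c *\<^sub>R Bk F n1 K y"
  let ?G = "\<lambda>K. ext ((- 1) ^ card K) (?A K) (?B K)"
  have pA: "par ?A" and pB: "par ?B"
    by (rule par_scaleR[OF par_Ak[OF f F rep]], rule par_scaleR[OF par_Bk[OF f F rep]])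
  have repG: "represents v (tshift t) (\<tau> - 1) D' g ?G"
    unfolding g_def c_def by (rule laplacian_power[OF f F rep m])
  have iff: "Tregular v (tshift t) (\<tau> - 1) (Omega v (tshift t) (\<tau> - 1) D') g \<longleftrightarrow>
    (\<forall>J\<in>torus v (tshift t) (\<tau> - 1). cregular (tshift t 0 + 1 + (\<tau> - 1)) (T'.esys J) D' (\<lambda>y. g (pt v (tshift t) (\<tau> - 1) J y)))"
    by (rule T'.Tregular_iff_cregular[OF opn_nn' D'inv])
  have "cregular n' (T'.esys J) D' (\<lambda>y. g (pt v (tshift t) (\<tau> - 1) J y))" if J: "J \<in> torus v (tshift t) (\<tau> - 1)" for J
  proof -
    let ?h = "\<lambda>y. c *\<^sub>R ext 1 (\<lambda>y. \<Sum>K\<in>Pow {1..\<tau> - 1}. Jprod J K * Ak F n1 K y)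
       (\<lambda>y. \<Sum>K\<in>Pow {1..\<tau> - 1}. Jprod J K * Bk F n1 K y) y"
    have "g (pt v (tshift t) (\<tau> - 1) J y) = ?h y" if y: "y \<in> D'" for y
    proof -
      have "g (pt v (tshift t) (\<tau> - 1) J y) = (\<Sum>K\<in>Pow {1..\<tau> - 1}. Jprod J K * ?G K y)"
        using repG y J unfolding represents_def by blast
      also have "\<dots> = c *\<^sub>R (\<Sum>K\<in>Pow {1..\<tau> - 1}. Jprod J K * ext ((- 1) ^ card K) (Ak F n1 K) (Bk F n1 K) y)"
        unfolding ext_scaleR scaleR_sum_right by simp
      also have "\<dots> = ?h y" unfolding ext_sum[OF J] ..
      finally show ?thesis .
    qed
    note eq = this
    have reg: "cregular n' (T'.esys J) D' ?h" by (rule regular_final[OF f F rep m J])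
    have "Ck 1 n' D' (\<lambda>y. g (pt v (tshift t) (\<tau> - 1) J y))"
      by (rule Ck_cong[OF opn_D', of ?h]) (use reg eq in \<open>simp_all add: cregular_def del: Ck.simps One_nat_def\<close>)
    moreover have "(\<Sum>i<n'. T'.esys J i * pderiv_c i (\<lambda>y. g (pt v (tshift t) (\<tau> - 1) J y)) y) = 0" if y: "y \<in> D'" for y
    proof -
      have "(\<Sum>i<n'. T'.esys J i * pderiv_c i (\<lambda>y. g (pt v (tshift t) (\<tau> - 1) J y)) y) = (\<Sum>i<n'. T'.esys J i * pderiv_c i ?h y)"
      proof (rule sum.cong[OF refl])
        fix i assume "i \<in> {..<n'}"
        then have i: "i < n'" by simp
        show "T'.esys J i * pderiv_c i (\<lambda>y. g (pt v (tshift t) (\<tau> - 1) J y)) y = T'.esys J i * pderiv_c i ?h y"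
          by (simp only: pderiv_c_cong[OF opn_D' y i eq])
      qed
      also have "\<dots> = 0" using reg y unfolding cregular_def by blast
      finally show ?thesis .
    qed
    ultimately show ?thesis unfolding cregular_def by blast
  qed
  then have "Tregular v (tshift t) (\<tau> - 1) (Omega v (tshift t) (\<tau> - 1) D') g" unfolding iff nn' by blast
  then show SR': "SR v (tshift t) (\<tau> - 1) D' g"
    using stem_ext[OF pA pB] repG unfolding SR_def Tfun_def by blast
  \<comment> \<open>\<open>g\<close> is by now strongly regular for the shifted list, so
    \<open>SR_stem\<close> applies to it as it did to \<open>f\<close>.\<close>
  have an: "real_analytic_c n' D' (?G K)" if "K \<subseteq> {1..\<tau> - 1}" for K
    using T'.SR_stem(2)[OF opn_nn' D'inv SR' repG that] unfolding nn' by blast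
  have "represents v t \<tau> D g (join ?A ?B)"
    by (rule represents_ext[THEN iffD2, OF parD(1)[OF pA] parD(1)[OF pB] repG])
  moreover have "real_analytic_c n D (join ?A ?B L)" if "L \<subseteq> {1..\<tau>}" for L
    by (rule real_analytic_join[OF parD(1)[OF pA] parD(1)[OF pB] an that])
  ultimately show "Tfun_omega v t \<tau> D g"
    using stem_join[OF pA pB] unfolding Tfun_omega_def nn by blast
qed

end

theorem theorem7p2:
  fixes cj :: "'a::{real_algebra_1,euclidean_space} \<Rightarrow> 'a"
    and v :: "nat \<Rightarrow> 'a"
    and N :: nat and t :: "nat \<Rightarrow> nat" and \<tau> :: nat and n1 :: nat
    and D :: "(nat \<Rightarrow> real) set" and f :: "'a \<Rightarrow> 'a"
  assumes inv_lin: "linear cj"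
    and inv_invol: "\<And>x. cj (cj x) = x"
    and inv_anti: "\<And>x y. cj (x * y) = cj y * cj x"
    and N_ge: "N \<ge> 1"
    and v0: "v 0 = 1"
    and vS: "\<And>s. s \<in> {1..N} \<Longrightarrow> v s \<in> SA cj"
    and v_anti: "\<And>s u. s \<in> {1..N} \<Longrightarrow> u \<in> {1..N} \<Longrightarrow> s \<noteq> u \<Longrightarrow> v s * v u = - (v u * v s)"
    and v_indep: "independent (v ` {0..N})"
    and v_inj: "inj_on v {0..N}"
    and V_slices: "span (v ` {0..N}) \<subseteq> (\<Union>J\<in>SA cj. {a *\<^sub>R 1 + b *\<^sub>R J | a b. True})"
    and tau_ge: "\<tau> \<ge> 1"
    and T_steps: "steps t \<tau> N"
    and D_sub: "D \<subseteq> Ecoord (t 0 + 1 + \<tau>)"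
    and D_open: "openin (top_of_set (Ecoord (t 0 + 1 + \<tau>))) D"
    and D_inv: "\<And>y h. y \<in> D \<Longrightarrow> h \<in> {1..\<tau>} \<Longrightarrow> flip t h y \<in> D"
    and Omega_open: "openin (top_of_set (span (v ` {0..N}))) (Omega v t \<tau> D)"
    and Omega_conn: "connected (Omega v t \<tau> D)"
    and odd_gap: "t 1 - t 0 = 2 * n1 + 1"
    and f_SR: "SR v t \<tau> D f"
  shows "SR v (tshift t) (\<tau> - 1) (Dtilde t \<tau> D) ((lapT v (tshift t) (\<tau> - 1) (Dtilde t \<tau> D) ^^ n1) f)
       \<and> Tfun_omega v t \<tau> D ((lapT v (tshift t) (\<tau> - 1) (Dtilde t \<tau> D) ^^ n1) f)"
proof -
  have st: "t h < t k" if "h < k" "k \<le> \<tau>" for h k using T_steps that by (auto simp: steps_def strict_mono_on_def)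
  have t01: "t 0 < t 1" using st[of 0 1] tau_ge by simp
  have vsq: "v s * v s = - 1" if "s \<in> {1..N}" for s
  proof -
    have "cj (v s) = - v s" "v s * cj (v s) = 1" using vS[OF that] by (auto simp: SA_def add_eq_0_iff)
    then have "- (v s * v s) = 1" by simp
    then show ?thesis by (metis minus_minus)
  qed
  interpret fueter_step "t 0 + 1 + \<tau>" "Suc (t 0)" D "t 1" \<tau> "t 1 + \<tau>" v N t
  proof
    show "rf (Suc (t 0)) y \<in> D" if "y \<in> D" for y using D_inv[OF that, of 1] tau_ge by (simp add: rf_def flip_def)
  qed (fact | (rule vsq v_anti D_inv; assumption) | (use t01 tau_ge in simp; fail))+
  \<comment> \<open>With \<open>p = Suc (t 0)\<close> the bounds \<open>\<le> t 0\<close> and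
    \<open>\<le> t 0 + \<tau>\<close> of \<open>Dtilde\<close> become the strict bounds of
    \<open>rho\<close>.\<close>
  have eq: "Dtilde t \<tau> D = D'"
  proof -
    have "(\<lambda>i. if i \<le> t 0 then y i else if i = t 0 + 1 then sqrt (\<Sum>s=t 0 + 1..t 1. (y s)^2)
           else if i \<le> t 0 + \<tau> then y (t 1 + (i - t 0 - 1)) else 0) = rho y" for y
      unfolding rho_def by (rule HOL.ext) (simp add: less_Suc_eq_le)
    then show ?thesis by (simp only: Dtilde_def D'_def)
  qed
  have m: "Suc (t 1) - Suc (t 0) = 2 * n1 + 1" using odd_gap by simp
  show ?thesis unfolding eq using first_fueter_transform[OF f_SR m] by blast
qed

end
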